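(* Let $N\geq2$, $D,d,R,\mu,\nu,\rho>0$ and let $g$ satisfy (KPP$_g$) and (sKPP$_g$). Consider problem (M). For every non-negative, bounded, continuous initial datum $(u_0,v_0)\not\equiv(0,0)$, the solution converges as $t\to+\infty$ (locally uniformly in each domain) to a positive steady state of (M) if and only if $\frac{g'(0)}{D}>\beta_0^2$; otherwise the solution converges to $(0,0)$ uniformly in each domain. Moreover, if $\frac{g'(0)}{D}>\beta_0^2$, and assuming in addition $N\leq 5$ in case $D<d$, there exists an asymptotic speed of propagation $c^*_m>0$ in the $x$ direction, i.e. for every such initial datum with compact support: for all $c>c^*_m$, $\sup_{|x|\geq ct}(u,v)\to(0,0)$ uniformly in $y$, and for all $0<c<c^*_m$, $\sup_{|x|\leq ct}|(u,v)-(U,V)|\to 0$ locally uniformly in $y$, where $(U,V)$ is the positive limiting steady state.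
   Context: Points of $\mathbb{R}^N$ are written $(x,y)$, $x\in\mathbb{R}$, $y\in\mathbb{R}^{N-1}$; $\Omega:=\mathbb{R}\times B_R(0)$, $B_R(0)$ the ball of radius $R$ in $\mathbb{R}^{N-1}$; $\partial_n$ the outward normal derivative to $\Omega$. Problem (M): $u_t-D\Delta u=g(u)$ in $\Omega\times(0,\infty)$, $v_t-d\Delta v=-\rho v$ in $(\mathbb{R}^N\setminus\overline\Omega)\times(0,\infty)$, $D\partial_nu=\nu v-\mu u$, $-d\partial_nv=\mu u-\nu v$ on $\partial\Omega\times(0,\infty)$. (KPP$_g$): $g$ locally Lipschitz, differentiable at $0$, $g(0)=g(1)=0$, $0<g(s)\leq g'(0)s$ on $(0,1)$, $g(s)<0$ for $s>1$; (sKPP$_g$): $g(s)/s$ decreasing on $(0,\infty)$. Let $\tau=(N-3)/2$, $K_\tau$ the modified Bessel function of the second kind, and $\kappa:=\frac{\mu\sqrt{d\rho}K_{\tau+1}(\sqrt{\rho/d}R)}{\nu K_\tau(\sqrt{\rho/d}R)+\sqrt{d\rho}K_{\tau+1}(\sqrt{\rho/d}R)}>0$. $\beta_0^2$ denotes the principal eigenvalue of $-\Delta_y\phi=\beta_0^2\phi$ in $B_R(0)\subset\mathbb{R}^{N-1}$, $D\partial_n\phi+\kappa\phi=0$ on $\partial B_R(0)$. *)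

theory Defs
  imports "HOL-Analysis.Analysis"
begin

text \<open>Points of R^N are pairs (x,y) with x real and y :: real^'m, so N = CARD('m) + 1.\<close>

type_synonym 'm pt = "real \<times> (real ^ 'm)"

definition OmegaC :: "real \<Rightarrow> 'm::finite pt set" where
  "OmegaC R = {p. norm (snd p) \<le> R}"
definition OmegaI :: "real \<Rightarrow> 'm::finite pt set" where
  "OmegaI R = {p. norm (snd p) < R}"
definition ExtC :: "real \<Rightarrow> 'm::finite pt set" where
  "ExtC R = {p. norm (snd p) \<ge> R}"
definition ExtI :: "real \<Rightarrow> 'm::finite pt set" where
  "ExtI R = {p. norm (snd p) > R}"

definition nrm :: "real \<Rightarrow> 'm::finite pt \<Rightarrow> 'm pt" where
  "nrm R p = (0, (1 / R) *\<^sub>R snd p)"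

definition C2_on :: "'a::euclidean_space set \<Rightarrow> ('a \<Rightarrow> real) \<Rightarrow> bool" where
  "C2_on S f \<longleftrightarrow> (\<exists>f' f''.
      (\<forall>p\<in>S. (f has_derivative f' p) (at p)) \<and>
      (\<forall>p\<in>S. \<forall>h. ((\<lambda>q. f' q h) has_derivative f'' p h) (at p)) \<and>
      (\<forall>h k. continuous_on S (\<lambda>p. f'' p h k)))"

definition laplacian :: "('a::euclidean_space \<Rightarrow> real) \<Rightarrow> 'a \<Rightarrow> real" where
  "laplacian f p = (\<Sum>b\<in>Basis. deriv (\<lambda>s. deriv (\<lambda>r. f (p + r *\<^sub>R b)) s) 0)"

text \<open>Modified Bessel function of the second kind (integral representation, z > 0).\<close>
definition BesselK :: "real \<Rightarrow> real \<Rightarrow> real" where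
  "BesselK \<nu>' z = integral {0..} (\<lambda>t. exp (- z * cosh t) * cosh (\<nu>' * t))"

definition kappa :: "'m::finite itself \<Rightarrow> real \<Rightarrow> real \<Rightarrow> real \<Rightarrow> real \<Rightarrow> real \<Rightarrow> real" where
  "kappa _ d R \<mu> \<nu> \<rho> =
     (let \<tau> = (real (CARD('m) + 1) - 3) / 2; z = sqrt (\<rho> / d) * R in
      \<mu> * sqrt (d * \<rho>) * BesselK (\<tau> + 1) z /
      (\<nu> * BesselK \<tau> z + sqrt (d * \<rho>) * BesselK (\<tau> + 1) z))"

definition principal_eig :: "'m::finite itself \<Rightarrow> real \<Rightarrow> real \<Rightarrow> real \<Rightarrow> real \<Rightarrow> bool" where
  "principal_eig _ D k R lam \<longleftrightarrow> (\<exists>\<phi> :: real ^ 'm \<Rightarrow> real.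
      continuous_on (cball 0 R) \<phi> \<and> C2_on (ball 0 R) \<phi> \<and>
      (\<forall>y\<in>ball 0 R. \<phi> y > 0 \<and> - laplacian \<phi> y = lam * \<phi> y) \<and>
      (\<forall>y. norm y = R \<longrightarrow> (\<exists>d\<phi>. ((\<lambda>s. \<phi> (y + s *\<^sub>R ((1 / R) *\<^sub>R y))) has_real_derivative d\<phi>) (at_left 0)
                                 \<and> D * d\<phi> + k * \<phi> y = 0)))"

definition beta0sq :: "'m::finite itself \<Rightarrow> real \<Rightarrow> real \<Rightarrow> real \<Rightarrow> real \<Rightarrow> real \<Rightarrow> real \<Rightarrow> real" where
  "beta0sq M D d R \<mu> \<nu> \<rho> = (THE lam. principal_eig M D (kappa M d R \<mu> \<nu> \<rho>) R lam)"

definition admissible_data :: "real \<Rightarrow> ('m::finite pt \<Rightarrow> real) \<Rightarrow> ('m pt \<Rightarrow> real) \<Rightarrow> bool" where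
  "admissible_data R u0 v0 \<longleftrightarrow>
     continuous_on (OmegaC R) u0 \<and> continuous_on (ExtC R) v0 \<and>
     bounded (u0 ` OmegaC R) \<and> bounded (v0 ` ExtC R) \<and>
     (\<forall>p\<in>OmegaC R. u0 p \<ge> 0) \<and> (\<forall>p\<in>ExtC R. v0 p \<ge> 0) \<and>
     \<not> ((\<forall>p\<in>OmegaC R. u0 p = 0) \<and> (\<forall>p\<in>ExtC R. v0 p = 0))"

definition compact_support :: "real \<Rightarrow> ('m::finite pt \<Rightarrow> real) \<Rightarrow> ('m pt \<Rightarrow> real) \<Rightarrow> bool" where
  "compact_support R u0 v0 \<longleftrightarrow> (\<exists>r. (\<forall>p\<in>OmegaC R. norm p \<ge> r \<longrightarrow> u0 p = 0) \<and>
                                      (\<forall>p\<in>ExtC R. norm p \<ge> r \<longrightarrow> v0 p = 0))"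

definition is_solution ::
  "real \<Rightarrow> real \<Rightarrow> real \<Rightarrow> real \<Rightarrow> real \<Rightarrow> real \<Rightarrow> (real \<Rightarrow> real) \<Rightarrow>
   ('m::finite pt \<Rightarrow> real) \<Rightarrow> ('m pt \<Rightarrow> real) \<Rightarrow>
   ('m pt \<Rightarrow> real \<Rightarrow> real) \<Rightarrow> ('m pt \<Rightarrow> real \<Rightarrow> real) \<Rightarrow> bool" where
  "is_solution D d R \<mu> \<nu> \<rho> g u0 v0 u v \<longleftrightarrow>
     continuous_on (OmegaC R \<times> {0..}) (\<lambda>(p,t). u p t) \<and>
     continuous_on (ExtC R \<times> {0..}) (\<lambda>(p,t). v p t) \<and>
     (\<forall>T. bounded ((\<lambda>(p,t). u p t) ` (OmegaC R \<times> {0..T}))) \<and>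
     (\<forall>T. bounded ((\<lambda>(p,t). v p t) ` (ExtC R \<times> {0..T}))) \<and>
     (\<forall>p\<in>OmegaC R. u p 0 = u0 p) \<and> (\<forall>p\<in>ExtC R. v p 0 = v0 p) \<and>
     (\<forall>t>0. C2_on (OmegaI R) (\<lambda>p. u p t) \<and> C2_on (ExtI R) (\<lambda>p. v p t)) \<and>
     (\<forall>t>0. \<forall>p\<in>OmegaI R. (\<lambda>s. u p s) differentiable (at t) \<and>
         deriv (\<lambda>s. u p s) t - D * laplacian (\<lambda>q. u q t) p = g (u p t)) \<and>
     (\<forall>t>0. \<forall>p\<in>ExtI R. (\<lambda>s. v p s) differentiable (at t) \<and>
         deriv (\<lambda>s. v p s) t - d * laplacian (\<lambda>q. v q t) p = - \<rho> * v p t) \<and>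
     (\<forall>t>0. \<forall>p. norm (snd p) = R \<longrightarrow> (\<exists>du dv.
         ((\<lambda>s. u (p + s *\<^sub>R nrm R p) t) has_real_derivative du) (at_left 0) \<and>
         ((\<lambda>s. v (p + s *\<^sub>R nrm R p) t) has_real_derivative dv) (at_right 0) \<and>
         D * du = \<nu> * v p t - \<mu> * u p t \<and> - d * dv = \<mu> * u p t - \<nu> * v p t))"

definition pos_steady ::
  "real \<Rightarrow> real \<Rightarrow> real \<Rightarrow> real \<Rightarrow> real \<Rightarrow> real \<Rightarrow> (real \<Rightarrow> real) \<Rightarrow>
   ('m::finite pt \<Rightarrow> real) \<Rightarrow> ('m pt \<Rightarrow> real) \<Rightarrow> bool" where
  "pos_steady D d R \<mu> \<nu> \<rho> g U V \<longleftrightarrow>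
     continuous_on (OmegaC R) U \<and> continuous_on (ExtC R) V \<and>
     C2_on (OmegaI R) U \<and> C2_on (ExtI R) V \<and>
     (\<forall>p\<in>OmegaI R. U p > 0 \<and> - D * laplacian U p = g (U p)) \<and>
     (\<forall>p\<in>ExtI R. V p > 0 \<and> - d * laplacian V p = - \<rho> * V p) \<and>
     (\<forall>p. norm (snd p) = R \<longrightarrow> (\<exists>dU dV.
         ((\<lambda>s. U (p + s *\<^sub>R nrm R p)) has_real_derivative dU) (at_left 0) \<and>
         ((\<lambda>s. V (p + s *\<^sub>R nrm R p)) has_real_derivative dV) (at_right 0) \<and>
         D * dU = \<nu> * V p - \<mu> * U p \<and> - d * dV = \<mu> * U p - \<nu> * V p))"

definition conv_loc :: "real \<Rightarrow> ('m::finite pt \<Rightarrow> real \<Rightarrow> real) \<Rightarrow> ('m pt \<Rightarrow> real \<Rightarrow> real) \<Rightarrow>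
   ('m pt \<Rightarrow> real) \<Rightarrow> ('m pt \<Rightarrow> real) \<Rightarrow> bool" where
  "conv_loc R u v U V \<longleftrightarrow>
     (\<forall>K. compact K \<and> K \<subseteq> OmegaC R \<longrightarrow>
        (\<forall>e>0. \<forall>\<^sub>F t in at_top. \<forall>p\<in>K. \<bar>u p t - U p\<bar> < e)) \<and>
     (\<forall>K. compact K \<and> K \<subseteq> ExtC R \<longrightarrow>
        (\<forall>e>0. \<forall>\<^sub>F t in at_top. \<forall>p\<in>K. \<bar>v p t - V p\<bar> < e))"

definition conv_zero :: "real \<Rightarrow> ('m::finite pt \<Rightarrow> real \<Rightarrow> real) \<Rightarrow> ('m pt \<Rightarrow> real \<Rightarrow> real) \<Rightarrow> bool" where
  "conv_zero R u v \<longleftrightarrow>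
     (\<forall>e>0. \<forall>\<^sub>F t in at_top. (\<forall>p\<in>OmegaC R. \<bar>u p t\<bar> < e) \<and> (\<forall>p\<in>ExtC R. \<bar>v p t\<bar> < e))"

definition spread_out :: "real \<Rightarrow> real \<Rightarrow> ('m::finite pt \<Rightarrow> real \<Rightarrow> real) \<Rightarrow> ('m pt \<Rightarrow> real \<Rightarrow> real) \<Rightarrow> bool" where
  "spread_out R c u v \<longleftrightarrow>
     (\<forall>e>0. \<forall>\<^sub>F t in at_top.
        (\<forall>p\<in>OmegaC R. \<bar>fst p\<bar> \<ge> c * t \<longrightarrow> \<bar>u p t\<bar> < e) \<and>
        (\<forall>p\<in>ExtC R. \<bar>fst p\<bar> \<ge> c * t \<longrightarrow> \<bar>v p t\<bar> < e))"

definition spread_in :: "real \<Rightarrow> real \<Rightarrow> ('m::finite pt \<Rightarrow> real \<Rightarrow> real) \<Rightarrow> ('m pt \<Rightarrow> real \<Rightarrow> real) \<Rightarrow>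
   ('m pt \<Rightarrow> real) \<Rightarrow> ('m pt \<Rightarrow> real) \<Rightarrow> bool" where
  "spread_in R c u v U V \<longleftrightarrow>
     (\<forall>r. \<forall>e>0. \<forall>\<^sub>F t in at_top.
        (\<forall>p\<in>OmegaC R. \<bar>fst p\<bar> \<le> c * t \<longrightarrow> \<bar>u p t - U p\<bar> < e) \<and>
        (\<forall>p\<in>ExtC R. \<bar>fst p\<bar> \<le> c * t \<and> norm (snd p) \<le> r \<longrightarrow> \<bar>v p t - V p\<bar> < e))"

end

theory Submission
  imports Defs "HOL-Complex_Analysis.Complex_Analysis" "HOL-Real_Asymp.Real_Asymp"
begin
text \<open>
Comparison is available in the strong form that a subsolution has to satisfy its inequalities only where it is
positive; touching arguments with the barriers \<open>hu\<close>, \<open>hv\<close> replace growth conditions at infinity.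
Supersolutions \<open>A \<Phi> + h\<close> built on the radial Robin profile push every solution below \<open>0\<close> or below the steady state
\<open>U\<close>, which comes from shooting for the radial equation in \<open>\<Omega>\<close>; the exterior component is a multiple of
\<open>r^{-\<tau>} K_\<tau>\<close>, whose logarithmic derivative at \<open>R\<close> is what \<open>\<kappa>\<close> encodes.
From below, moving balls give positivity everywhere, and the bumps \<open>A(t) cos(\<delta> x) (U + k(R^2 - r^2))\<close>, with a slightly
steeper exterior decay, rise to \<open>(1 - \<epsilon>) U\<close>.
The speed is the least \<open>c\<close> for which the linearisation at \<open>0\<close> has an exponential solution \<open>exp(-\<alpha> (x - c t))\<close> times a nonnegative
radial profile. Below it, truncation of the exterior at a large radius makes the least speed a double
root; Hurwitz' theorem turns it into complex roots \<open>\<alpha>\<close> at smaller speeds, whose real parts are compactly supported moving subsolutions.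
\<close>

text \<open>In the lemmas \<open>N\<close> is \<open>CARD('m) - 1\<close>, so the radial Laplacian
  reads f'' + (N/r) f'. Solutions are known only through \<open>is_solution\<close>: classical in
  the open domains, continuous up to the interface, bounded on finite time intervals. Compactness of
  orbits is not at hand, so all convergence comes from squeezing between explicit functions, each
  tested against the two equations and the two flux conditions. The obstacle for the speed is the
  unbounded exterior, where decay is not a closed condition on the parameters. The exterior part of
  a mode is therefore solved outwards from \<open>R\<close>, its value and slope being dictated by
  the flux conditions, and only nonnegativity on \<open>[R, R2]\<close> is asked. That passes to
  limits, and decay is regained by comparison with \<open>psi\<close>. For subsolutions the reaction
  slope is lowered from \<open>g0\<close> to some \<open>G < g0\<close>, which the nonlinearity
  beats at small values; \<open>R2\<close> and \<open>G\<close> are removed together by one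
  compactness argument. Power series in the spectral parameter over any Banach field serve real and
  complex modes alike and provide the holomorphy for Hurwitz' theorem.\<close>

abbreviation HD (infix "HD" 50) where "f HD c == ((f::real => real) has_real_derivative c)"
abbreviation "con == continuous_on"
abbreviation "nr p == norm (snd p)"
notation scaleR (infixr "*R" 75)
lemmas ci = continuous_intros and dei = derivative_eq_intros and asi = algebra_simps

text \<open>The derivative \<open>h\<close> is required on a neighbourhood of \<open>x\<close>, not
  just at \<open>x\<close>. This rules out the default values that nested \<open>deriv\<close> takes
  where a derivative fails to exist, and makes the relation stable under sums and under local
  modification of \<open>f\<close>.\<close>

definition has_d2 :: "(real => real) => real => real => bool" where
 "has_d2 f x c \<longleftrightarrow> (EX h. (\<forall>\<^sub>F s in nhds x. (f HD h s) (at s)) &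
   (h HD c) (at x))"

text \<open>Only pure second derivatives along the basis lines are asked for. A comparison function
  with kinks can therefore be used as long as it is regular at the points where it is
  tested.\<close>

definition has_lap :: "('a::euclidean_space => real) => 'a => real => bool" where
 "has_lap f p L \<longleftrightarrow> (EX A. (ALL b:Basis. has_d2 (%r. f (p + r *R b)) 0 (A b)) & L = (\<Sum>b\<in>Basis. A b))"

lemma has_d2_cong:
 assumes "has_d2 f x c" "\<forall>\<^sub>F s in nhds x. f s = g s"
 shows "has_d2 g x c"
proof -
 obtain h where h: "\<forall>\<^sub>F s in nhds x. (f HD h s) (at s)" "(h HD c) (at x)" using assms(1) by (auto simp: has_d2_def)
 have "\<forall>\<^sub>F s in nhds x. \<forall>\<^sub>F r in nhds s. f r = g r" using assms(2) by (simp add: eventually_eventually)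
 with h(1) have "\<forall>\<^sub>F s in nhds x. (g HD h s) (at s)"
 proof eventually_elim
  case (elim s)
  thus ?case using DERIV_cong_ev[of s s f g "h s" "h s"] by simp
 qed
 with h(2) show ?thesis by (auto simp: has_d2_def)
qed

lemma has_d2_const: "has_d2 (%_. k) x 0" unfolding has_d2_def by (rule exI[of _ "%_. 0"]) auto

lemma has_d2_add:
 assumes "has_d2 f x c" "has_d2 g x e"
 shows "has_d2 (%s. f s + g s) x (c + e)"
proof -
 obtain h k where h: "\<forall>\<^sub>F s in nhds x. (f HD h s) (at s)" "(h HD c) (at x)"
  and k: "\<forall>\<^sub>F s in nhds x. (g HD k s) (at s)" "(k HD e) (at x)" using assms by (auto simp: has_d2_def)
 from h(1) k(1) have "\<forall>\<^sub>F s in nhds x. ((%s. f s + g s) HD (h s + k s)) (at s)" by eventually_elim (rule DERIV_add)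
 moreover have "((%s. h s + k s) HD (c + e)) (at x)" using h(2) k(2) by (rule DERIV_add)
 ultimately show ?thesis unfolding has_d2_def by (intro exI[of _ "%s. h s + k s"]) auto
qed

lemma has_d2_cmult:
 assumes "has_d2 f x c"
 shows "has_d2 (%s. k*f s) x (k*c)"
proof -
 obtain h where h: "\<forall>\<^sub>F s in nhds x. (f HD h s) (at s)" "(h HD c) (at x)" using assms by (auto simp: has_d2_def)
 from h(1) have "\<forall>\<^sub>F s in nhds x. ((%s. k*f s) HD (k*h s)) (at s)" by eventually_elim (rule DERIV_cmult)
 moreover have "((%s. k*h s) HD (k*c)) (at x)" using h(2) by (rule DERIV_cmult)
 ultimately show ?thesis unfolding has_d2_def by (intro exI[of _ "%s. k*h s"]) auto
qed

lemma has_d2_I: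
 assumes "!!s. (f HD h s) (at s)" "(h HD c) (at x)"
 shows "has_d2 f x c" unfolding has_d2_def by (intro exI[of _ h] conjI always_eventually allI assms)

lemma has_d2_shift:
 assumes "has_d2 f x c"
 shows "has_d2 (%r. f (x + r)) 0 c"
proof -
 obtain h where h: "\<forall>\<^sub>F s in nhds x. (f HD h s) (at s)" "(h HD c) (at x)" using assms by (auto simp: has_d2_def)
 have "((%r. x + r) \<longlongrightarrow> x + 0) (nhds (0::real))" by (intro tendsto_intros filterlim_ident)
 hence "filterlim (%r. x + r) (nhds x) (nhds (0::real))" by simp
 with h(1) have "\<forall>\<^sub>F r in nhds 0. (f HD h (x + r)) (at (x + r))" by (rule eventually_compose_filterlim)
 hence "\<forall>\<^sub>F r in nhds 0. ((%r. f (x + r)) HD h (x + r)) (at r)" by eventually_elim (simp add: DERIV_at_within_shift_lemma add.commute DERIV_shift)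
 moreover have "((%r. h (x + r)) HD c) (at 0)" using h(2) by (simp add: add.commute[of x] flip: DERIV_shift)
 ultimately show ?thesis unfolding has_d2_def by (intro exI[of _ "%r. h (x + r)"]) auto
qed

text \<open>At a local maximum \<open>h x = 0\<close>; if \<open>c\<close> were positive,
  \<open>h\<close> would be positive just to the right of \<open>x\<close>, and the mean value
  theorem would produce a larger value of \<open>f\<close>.\<close>

lemma has_d2_local_max:
 assumes "has_d2 f x c" "\<forall>\<^sub>F s in nhds x. f s <= f x"
 shows "c <= 0"
proof (rule ccontr)
 assume c: "~ c <= 0"
 obtain h where h: "\<forall>\<^sub>F s in nhds x. (f HD h s) (at s)" "(h HD c) (at x)" using assms by (auto simp: has_d2_def)
 from h(1) assms(2) have "\<forall>\<^sub>F s in nhds x. (f HD h s) (at s) & f s <= f x" by eventually_elim simp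
 then obtain e where e: "e > 0" "!!s. dist s x < e ==> (f HD h s) (at s) & f s <= f x" by (auto simp: eventually_nhds_metric)
 have hx: "h x = 0" using e by (intro DERIV_local_max[of f "h x" x e]) (auto simp: dist_real_def abs_minus_commute)
 obtain d where d: "d > 0" "!!k. 0 < k ==> k < d ==> h x < h (x + k)" using DERIV_pos_inc_right[OF h(2)] c by auto
 define k where "k = min d e/2"
 have k: "0 < k" "k < d" "k < e" using d(1) e(1) by (auto simp: k_def)
 have "EX z>x. z < x + k & f (x + k) - f x = (x + k - x)*h z" by (rule MVT2) (use k e in \<open>auto simp: dist_real_def\<close>)
 then obtain z where z: "x < z" "z < x + k" "f (x + k) - f x = k*h z" by auto
 have "h z > 0" using d(2)[of "z - x"] z k hx by auto
 hence "f (x + k) > f x" using z(3) mult_pos_pos[OF k(1) \<open>h z > 0\<close>] by linarith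
 with e(2)[of "x + k"] k show False by (auto simp: dist_real_def)
qed

lemma has_d2_deriv2:
 assumes "has_d2 f x c"
 shows "deriv (%s. deriv f s) x = c"
proof -
 obtain h where h: "\<forall>\<^sub>F s in nhds x. (f HD h s) (at s)" "(h HD c) (at x)" using assms by (auto simp: has_d2_def)
 from h(1) have "\<forall>\<^sub>F s in nhds x. deriv f s = h s" by eventually_elim (rule DERIV_imp_deriv)
 hence "((%s. deriv f s) HD c) (at x)" using h(2) DERIV_cong_ev[of x x "%s. deriv f s" h c c] by simp
 thus ?thesis by (rule DERIV_imp_deriv)
qed

lemma filterlim_line: "filterlim (%r. p + r *R b) (nhds p) (nhds (0::real))"
 for p :: "'a::real_normed_vector"
proof -
 have "((%r. p + r *R b) \<longlongrightarrow> p + 0 *R b) (nhds (0::real))" by (intro tendsto_intros filterlim_ident)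
 thus ?thesis by simp
qed

lemma eventually_line:
 fixes p :: "'a::real_normed_vector"
 shows "eventually P (nhds p) ==> \<forall>\<^sub>F s in nhds 0. P (p + s *R b)" by (rule eventually_compose_filterlim[OF _ filterlim_line])

lemma has_lap_local_max:
 assumes "has_lap f p L" "\<forall>\<^sub>F q in nhds p. f q <= f p"
 shows "L <= 0"
proof -
 obtain A where A: "!!b. b:Basis ==> has_d2 (%r. f (p + r *R b)) 0 (A b)" "L = (\<Sum>b\<in>Basis. A b)" using assms(1) by (auto simp: has_lap_def)
 have "A b <= 0" if "b:Basis" for b
 proof (rule has_d2_local_max[OF A(1)[OF that]])
  show "\<forall>\<^sub>F s in nhds 0. f (p + s *R b) <= f (p + 0 *R b)" using eventually_line[OF assms(2), of b] by simp
 qed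
 thus ?thesis using A(2) by (simp add: sum_nonpos)
qed

lemma has_lap_cong:
 assumes "has_lap f p L" "\<forall>\<^sub>F q in nhds p. f q = g q"
 shows "has_lap g p L"
proof -
 have "\<forall>\<^sub>F s in nhds 0. f (p + s *R b) = g (p + s *R b)" for b using eventually_line[OF assms(2), of b] by simp
 thus ?thesis using assms(1) has_d2_cong unfolding has_lap_def by metis
qed

lemma has_lap_add:
 assumes "has_lap f p L" "has_lap g p M"
 shows "has_lap (%q. f q + g q) p (L + M)"
proof -
 obtain A B where "ALL b:Basis. has_d2 (%r. f (p + r *R b)) 0 (A b)" "L = (\<Sum>b\<in>Basis. A b)"
  "ALL b:Basis. has_d2 (%r. g (p + r *R b)) 0 (B b)" "M = (\<Sum>b\<in>Basis. B b)" using assms by (auto simp: has_lap_def)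
 thus ?thesis unfolding has_lap_def by (intro exI[of _ "%b. A b + B b"]) (auto simp: sum.distrib intro!: has_d2_add)
qed

lemma has_lap_cmult:
 assumes "has_lap f p L"
 shows "has_lap (%q. k*f q) p (k*L)"
proof -
 obtain A where "ALL b:Basis. has_d2 (%r. f (p + r *R b)) 0 (A b)" "L = (\<Sum>b\<in>Basis. A b)" using assms by (auto simp: has_lap_def)
 thus ?thesis unfolding has_lap_def by (intro exI[of _ "%b. k*A b"]) (auto simp: sum_distrib_left intro!: has_d2_cmult)
qed

lemma has_lap_const: "has_lap (%_. k) p 0" unfolding has_lap_def by (intro exI[of _ "%_. 0"]) (auto intro!: has_d2_const)

lemma has_lap_diff:
 assumes "has_lap f p L" "has_lap g p M"
 shows "has_lap (%q. f q - g q) p (L - M)" using has_lap_add[OF assms(1) has_lap_cmult[OF assms(2), of "-1"]] by simp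

lemma has_lap_laplacian: "has_lap f p L ==> laplacian f p = L"
proof -
 assume "has_lap f p L"
 then obtain A where A: "!!b. b:Basis ==> has_d2 (%r. f (p + r *R b)) 0 (A b)" "L = (\<Sum>b\<in>Basis. A b)" by (auto simp: has_lap_def)
 show ?thesis unfolding laplacian_def A(2) by (intro sum.cong refl has_d2_deriv2 A(1))
qed

text \<open>The basis of the product consists of the axis vector and of the vectors of the second
  factor; along the former only \<open>X\<close> varies, along the latter only
  \<open>F\<close>.\<close>

lemma has_lap_prod:
 fixes F :: "'a::euclidean_space => real"
 assumes "has_d2 X (fst p) c" "has_lap F (snd p) L"
 shows "has_lap (%q. X (fst q)*F (snd q)) p (c*F (snd p) + X (fst p)*L)"
proof -
 obtain A where A: "!!b. b:Basis ==> has_d2 (%r. F (snd p + r *R b)) 0 (A b)" "L = (\<Sum>b\<in>Basis. A b)" using assms by (auto simp: has_lap_def)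
 define C where "C = (%b::real \<times> 'a. if fst b = 0 then X (fst p)*A (snd b) else c*F (snd p))"
 have sp: "(\<Sum>b\<in>Basis. C b) = C (1, 0) + (\<Sum>b\<in>Basis. C (0, b))" unfolding Basis_prod_def by (subst sum.union_disjoint) (auto simp: sum.reindex inj_on_def)
 have "has_d2 (%r. X (fst (p + r *R b))*F (snd (p + r *R b))) 0 (C b)" if b: "b:Basis" for b
 proof -
  from b consider (1) "b = (1, 0)" | (2) e where "b = (0, e)" "e:Basis" unfolding Basis_prod_def by auto
  thus ?thesis
  proof cases
   case 1
   have "has_d2 (%s. F (snd p)*X (fst p + s)) 0 (F (snd p)*c)" by (rule has_d2_cmult[OF has_d2_shift[OF assms(1)]])
   thus ?thesis using 1 by (simp add: C_def mult.commute)
  next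
   case 2
   have "has_d2 (%s. X (fst p)*F (snd p + s *R e)) 0 (X (fst p)*A e)" by (rule has_d2_cmult[OF A(1)[OF 2(2)]])
   thus ?thesis using 2 by (simp add: C_def)
  qed
 qed
 moreover have "c*F (snd p) + X (fst p)*L = (\<Sum>b\<in>Basis. C b)" unfolding sp by (simp add: C_def A(2) sum_distrib_left)
 ultimately show ?thesis unfolding has_lap_def by blast
qed

lemma has_lap_snd:
 fixes F :: "'a::euclidean_space => real"
 assumes "has_lap F (snd p) L"
 shows "has_lap (%q::real \<times> 'a. F (snd q)) p L" using has_lap_prod[OF has_d2_const[of 1] assms] by simp

lemma C2_on_has_lap:
 assumes "open S" "p:S"
  and f': "!!p. p:S ==> (f has_derivative f' p) (at p)"
  and f'': "!!p h. p:S ==> ((%q. f' q h) has_derivative f'' p h) (at p)"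
 shows "has_lap f p (\<Sum>b\<in>Basis. f'' p b b)"
proof -
 have "has_d2 (%r. f (p + r *R b)) 0 (f'' p b b)" for b
 proof -
  have line: "((%r. p + r *R b) has_derivative (%r. r *R b)) (at s)" for s by (auto intro!: dei)
  have ev: "\<forall>\<^sub>F s in nhds 0. p + s *R b:S" using eventually_line[OF eventually_nhds_in_open[OF assms(1,2)], of b] by simp
  have D1: "((%r. f (p + r *R b)) HD f' (p + s *R b) b) (at s)"
   if "p + s *R b:S" for s
  proof -
   have "linear (f' (p + s *R b))" using f'[OF that] by (rule has_derivative_linear)
   hence "(%r. f' (p + s *R b) (r *R b)) = (%r. f' (p + s *R b) b*r)" by (intro ext) (simp add: linear_cmul)
   thus ?thesis using has_derivative_compose[OF line f'[OF that]] by (simp only: has_field_derivative_def)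
  qed
  have "linear (f'' p b)" using f''[OF assms(2)] by (rule has_derivative_linear)
  hence eq: "(%r. f'' p b (r *R b)) = (%r. f'' p b b*r)" by (intro ext) (simp add: linear_cmul)
  have "((%q. f' q b) has_derivative f'' p b) (at (p + 0 *R b))" using f''[OF assms(2)] by simp
  from has_derivative_compose[OF line this]
  have D2: "((%r. f' (p + r *R b) b) HD f'' p b b) (at 0)" by (simp only: has_field_derivative_def eq)
  have "\<forall>\<^sub>F s in nhds 0. ((%r. f (p + r *R b)) HD f' (p + s *R b) b) (at s)" using ev by eventually_elim (rule D1)
  with D2 show ?thesis unfolding has_d2_def by (intro exI[of _ "%s. f' (p + s *R b) b"] conjI)
 qed
 thus ?thesis unfolding has_lap_def by (intro exI[of _ "%b. f'' p b b"]) auto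
qed

text \<open>The bridge from the Frechet derivatives in \<open>is_solution\<close> to the relational
  Laplacian, with the value that \<open>laplacian\<close> computes.\<close>

lemma C2_on_imp_has_lap:
 assumes "C2_on S f" "open S" "p:S"
 shows "has_lap f p (laplacian f p)"
proof -
 obtain f' f'' where "!!p. p:S ==> (f has_derivative f' p) (at p)"
  "!!p h. p:S ==> ((%q. f' q h) has_derivative f'' p h) (at p)" using assms(1) unfolding C2_on_def by blast
 from C2_on_has_lap[OF assms(2,3) this] show ?thesis using has_lap_laplacian by metis
qed

text \<open>The Hessian of a radial function is \<open>B\<close> times the identity, where
  \<open>B r = w1 r / r\<close>, plus a rank-one part with factor \<open>w2 - B\<close>. At the
  origin the rank-one part disappears because \<open>w1 r / r\<close> and \<open>w2\<close> share
  the limit \<open>q\<close>; this makes the second derivative continuous there.\<close>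

lemma radial_C2:
 fixes S :: "'a::euclidean_space set" and w w1 w2 :: "real => real"
 assumes S: "open S"
  and w1: "!!y. y:S ==> y ~= 0 ==> (w HD w1 (norm y)) (at (norm y))"
  and w2: "!!y. y:S ==> y ~= 0 ==> (w1 HD w2 (norm y)) (at (norm y))"
  and w2c: "!!y. y:S ==> y ~= 0 ==> isCont w2 (norm y)"
  and z: "0:S ==> ((%r. w1 r/r) \<longlongrightarrow> q) (at_right 0)"
  and z2: "0:S ==> (w2 \<longlongrightarrow> q) (at_right 0)"
  and z0: "0:S ==> (w HD 0) (at_right 0)"
 shows "C2_on S (%y. w (norm y))"
  and "y:S ==> y ~= 0 ==> has_lap (%y. w (norm y)) y (w2 (norm y) + (real DIM('a) - 1)/norm y*w1 (norm y))"
  and "0:S ==> has_lap (%y. w (norm y)) (0::'a) (real DIM('a)*q)"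
proof -
 define B where "B = (%r. w1 r/r)"
 define f' where "f' = (%(y::'a) h. B (norm y)*(y \<bullet> h))"
 define f'' where "f'' = (%(y::'a) h k. if y = 0 then q*(h \<bullet> k) else
  B (norm y)*(h \<bullet> k) + (w2 (norm y) - B (norm y))/(norm y)^2*((y \<bullet> h)*(y \<bullet> k)))"
 have nz: "filterlim norm (at_right 0) (at (0::'a))" by (auto simp: filterlim_at intro!: tendsto_eq_intros eventually_at_filter[THEN iffD2])
 have nd: "(norm has_derivative (%k. (y \<bullet> k)/norm y)) (at y)" if "y ~= 0" for y :: 'a using has_derivative_norm[OF that] by (simp add: sgn_div_norm field_simps inner_commute)
 have d1: "((%y. w (norm y)) has_derivative f' y) (at y)" if y: "y:S" for y
 proof (cases "y = 0")
  case False
  have "(%k. w1 (norm y)*((y \<bullet> k)/norm y)) = f' y" by (intro ext) (simp add: f'_def B_def)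
  thus ?thesis using has_derivative_compose[OF nd[OF False] w1[OF y False, unfolded has_field_derivative_def]] by simp
 next
  case True
  hence 0: "0:S" using y by simp
  have "((%r. (w r - w 0)/(r - 0)) \<longlongrightarrow> 0) (at_right 0)" using z0[OF 0] by (simp add: has_field_derivative_iff)
  from filterlim_compose[OF this nz]
  have "((%y::'a. (w (norm y) - w 0)/norm y) \<longlongrightarrow> 0) (at 0)" by simp
  hence "((%y::'a. norm (w (norm y) - w 0)/norm y) \<longlongrightarrow> 0) (at 0)" by (simp add: tendsto_norm_zero_iff[symmetric, of "%y. (w (norm y) - w 0)/norm y"])
  thus ?thesis unfolding True by (simp add: has_derivative_iff_norm f'_def)
 qed
 have d2: "((%q. f' q h) has_derivative f'' y h) (at y)" if y: "y:S" for y h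
 proof (cases "y = 0")
  case False
  have r: "norm y ~= 0" using False by simp
  have "(B HD (w2 (norm y) - B (norm y))/norm y) (at (norm y))" unfolding B_def using r by (auto intro!: dei w2[OF y False] simp: field_simps power2_eq_square)
  from has_derivative_compose[OF nd[OF False], of B, OF this[unfolded has_field_derivative_def]]
  have "((%y. B (norm y)) has_derivative (%k. (w2 (norm y) - B (norm y))/norm y*((y \<bullet> k)/norm y))) (at y)" by (simp add: mult.commute)
  moreover have "((%y. y \<bullet> h) has_derivative (%k. k \<bullet> h)) (at y)" by (auto intro!: dei)
  ultimately have "((%y. B (norm y)*(y \<bullet> h)) has_derivative
   (%k. B (norm y)*(k \<bullet> h) + (w2 (norm y) - B (norm y))/norm y*((y \<bullet> k)/norm y)*(y \<bullet> h))) (at y)" by (rule has_derivative_mult)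
  thus ?thesis using False by (simp add: f'_def f''_def power2_eq_square inner_commute mult_ac)
 next
  case True
  hence 0: "0:S" using y by simp
  have "((%y::'a. B (norm y) - q) \<longlongrightarrow> 0) (at 0)" using filterlim_compose[OF z[OF 0] nz] unfolding B_def by (simp add: LIM_zero_iff)
  hence t: "((%y::'a. norm (B (norm y) - q)*norm h) \<longlongrightarrow> 0) (at 0)" by (intro tendsto_mult_left_zero tendsto_norm_zero)
  have "((%y. norm (f' y h - q*(h \<bullet> y))/norm y) \<longlongrightarrow> 0) (at 0)"
  proof (rule Lim_null_comparison[OF always_eventually t], rule allI)
   fix y :: 'a
   have "norm (f' y h - q*(h \<bullet> y)) = norm (B (norm y) - q)*\<bar>y \<bullet> h\<bar>" by (simp add: f'_def inner_commute left_diff_distrib[symmetric] abs_mult)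
   also have "\<dots> <= norm (B (norm y) - q)*(norm y*norm h)" by (intro mult_left_mono Cauchy_Schwarz_ineq2) auto
   finally show "norm (norm (f' y h - q*(h \<bullet> y))/norm y) <= norm (B (norm y) - q)*norm h" by (cases "y = 0") (auto simp: divide_simps mult_ac)
  qed
  moreover have "bounded_linear (%y. q*(h \<bullet> y))" by (intro bounded_linear_const_mult bounded_linear_inner_right)
  ultimately show ?thesis unfolding True by (simp add: has_derivative_iff_norm f''_def f'_def)
 qed
 have c: "con S (%p. f'' p h k)" for h k
 proof (rule continuous_at_imp_continuous_on, rule ballI)
  fix y assume y: "y:S"
  show "isCont (%p. f'' p h k) y"
  proof (cases "y = 0")
   case False
   have w1c: "isCont w1 (norm y)" using w2[OF y False] by (rule DERIV_isCont)
   have w1c': "isCont (%p. w1 (norm p)) y" and w2c': "isCont (%p. w2 (norm p)) y" using isCont_o2[where g=w1 and f=norm and a=y] isCont_o2[where g=w2 and f=norm and a=y] w1c w2c[OF y False] by auto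
   have ev: "\<forall>\<^sub>F p in nhds y. B (norm p)*(h \<bullet> k) + (w2 (norm p) - B (norm p))/(norm p)^2*((p \<bullet> h)*(p \<bullet> k)) = f'' p h k" using t1_space_nhds[OF False] by eventually_elim (simp add: f''_def)
   have "isCont (%p. B (norm p)*(h \<bullet> k) + (w2 (norm p) - B (norm p))/(norm p)^2*((p \<bullet> h)*(p \<bullet> k))) y" unfolding B_def using False by (intro ci w1c' w2c') auto
   with isCont_cong[OF ev] show ?thesis by simp
  next
   case True
   hence 0: "0:S" using y by simp
   have tB: "((%y::'a. B (norm y)) \<longlongrightarrow> q) (at 0)" using filterlim_compose[OF z[OF 0] nz] unfolding B_def by simp
   have t2: "((%y::'a. w2 (norm y)) \<longlongrightarrow> q) (at 0)" using filterlim_compose[OF z2[OF 0] nz] .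
   have t3: "((%y::'a. norm (w2 (norm y) - B (norm y))*(norm h*norm k)) \<longlongrightarrow> 0) (at 0)" using tendsto_diff[OF t2 tB] by (intro tendsto_mult_left_zero tendsto_norm_zero) simp
   have "((%y::'a. (w2 (norm y) - B (norm y))/(norm y)^2*((y \<bullet> h)*(y \<bullet> k))) \<longlongrightarrow> 0) (at 0)"
   proof (rule Lim_null_comparison[OF always_eventually t3], rule allI)
   fix y :: 'a
   have "\<bar>(y \<bullet> h)*(y \<bullet> k)\<bar> <= (norm y*norm h)*(norm y*norm k)" unfolding abs_mult by (intro mult_mono Cauchy_Schwarz_ineq2) auto
   hence *: "\<bar>(y \<bullet> h)*(y \<bullet> k)\<bar> <= (norm y)^2*(norm h*norm k)" by (simp add: power2_eq_square mult_ac)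
   have "norm ((w2 (norm y) - B (norm y))/(norm y)^2*((y \<bullet> h)*(y \<bullet> k)))
   = norm (w2 (norm y) - B (norm y))*(\<bar>(y \<bullet> h)*(y \<bullet> k)\<bar>/(norm y)^2)" by (simp add: abs_mult)
   also have "\<dots> <= norm (w2 (norm y) - B (norm y))*(norm h*norm k)" using * by (intro mult_left_mono) (cases "y = 0"; auto simp: divide_simps mult_ac)+
   finally show "norm ((w2 (norm y) - B (norm y))/(norm y)^2*((y \<bullet> h)*(y \<bullet> k))) <= norm (w2 (norm y) - B (norm y))*(norm h*norm k)" .
   qed
   from tendsto_add[OF tendsto_mult_right[OF tB, of "h \<bullet> k"] this]
   have "((%y. B (norm y)*(h \<bullet> k) + (w2 (norm y) - B (norm y))/(norm y)^2*((y \<bullet> h)*(y \<bullet> k))) \<longlongrightarrow> q*(h \<bullet> k)) (at 0)" by simp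
   hence "((%y. f'' y h k) \<longlongrightarrow> q*(h \<bullet> k)) (at 0)" by (rule Lim_transform_eventually) (auto simp: eventually_at_filter f''_def)
   thus ?thesis unfolding True by (simp add: isCont_def f''_def)
  qed
 qed
 show "C2_on S (%y. w (norm y))" unfolding C2_on_def using d1 d2 c by blast
 have lap: "has_lap (%y. w (norm y)) y (\<Sum>b\<in>Basis. f'' y b b)" if "y:S" for y by (rule C2_on_has_lap[OF S that d1 d2])
 show "has_lap (%y. w (norm y)) y (w2 (norm y) + (real DIM('a) - 1)/norm y*w1 (norm y))"
  if y: "y:S" "y ~= 0"
 proof -
  have s: "(\<Sum>b\<in>Basis. (y \<bullet> b)*(y \<bullet> b)) = (norm y)^2" unfolding power2_norm_eq_inner by (subst (3) euclidean_inner) simp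
  have "(\<Sum>b\<in>Basis. f'' y b b) = (\<Sum>b\<in>Basis. B (norm y) + (w2 (norm y) - B (norm y))/(norm y)^2*((y \<bullet> b)*(y \<bullet> b)))" using y by (intro sum.cong) (auto simp: f''_def)
  also have "\<dots> = DIM('a)*B (norm y) + (w2 (norm y) - B (norm y))/(norm y)^2*(\<Sum>b\<in>Basis. (y \<bullet> b)*(y \<bullet> b))" by (simp add: sum.distrib sum_distrib_left)
  also have "\<dots> = w2 (norm y) + (real DIM('a) - 1)/norm y*w1 (norm y)" unfolding s using y by (simp add: B_def field_simps)
  finally show ?thesis using lap[OF y(1)] by simp
 qed
 show "has_lap (%y. w (norm y)) (0::'a) (real DIM('a)*q)" if "0:S" using lap[OF that] by (simp add: f''_def)
qed

lemma norm_sq_line: "(norm (v + r *R b))^2 = (norm v)^2 + 2*r*(v \<bullet> b) + r^2"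
 if "b:Basis" for v b :: "'a::euclidean_space" using that unfolding power2_norm_eq_inner by (simp add: inner_add_left inner_add_right inner_commute power2_eq_square inner_Basis asi)

lemma has_lap_norm2:
 fixes p p0 :: "'a::euclidean_space"
 shows "has_lap (%q. (norm (q - p0))\<^sup>2) p (2*DIM('a))"
proof -
 have "has_d2 (%r. (norm (p + r *R b - p0))\<^sup>2) 0 2" if b: "b:Basis" for b
 proof -
  have "has_d2 (%r. (norm (p - p0))\<^sup>2 + 2*r*((p - p0) \<bullet> b) + r^2) 0 2" by (rule has_d2_I[where h="%r. 2*((p - p0) \<bullet> b) + 2*r"]) (auto intro!: dei)
  moreover have "p + r *R b - p0 = (p - p0) + r *R b" for r by simp
  ultimately show ?thesis by (simp only: norm_sq_line[OF b])
 qed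
 thus ?thesis unfolding has_lap_def by (intro exI[of _ "%_. 2"]) auto
qed

lemma has_lap_norm4:
 fixes p p0 :: "'a::euclidean_space"
 shows "has_lap (%q. ((norm (q - p0))^2)\<^sup>2) p ((8 + 4*DIM('a))*(norm (p - p0))^2)"
proof -
 define A where "A = (norm (p - p0))^2"
 have "has_d2 (%r. ((norm (p + r *R b - p0))^2)\<^sup>2) 0 (8*((p - p0) \<bullet> b)^2 + 4*A)" if b: "b:Basis" for b
 proof -
  define B where "B = (p - p0) \<bullet> b"
  have "has_d2 (%r. (A + 2*r*B + r^2)\<^sup>2) 0 (8*B^2 + 4*A)" by (rule has_d2_I[where h="%r. 2*(A + 2*r*B + r^2)*(2*B + 2*r)"])
   (auto intro!: dei simp: power2_eq_square)
  moreover have "(norm (p + r *R b - p0))^2 = A + 2*r*B + r^2" for r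
  proof -
   have "p + r *R b - p0 = (p - p0) + r *R b" by simp
   thus ?thesis by (simp only: norm_sq_line[OF b] A_def B_def)
  qed
  ultimately show ?thesis by (simp add: B_def)
 qed
 moreover have "(\<Sum>b\<in>Basis. ((p - p0) \<bullet> b)\<^sup>2) = A" unfolding A_def power2_norm_eq_inner by (subst (2) euclidean_inner) (simp add: power2_eq_square)
 hence "(\<Sum>b\<in>Basis. 8*((p - p0) \<bullet> b)^2 + 4*A) = (8 + 4*DIM('a))*A" by (simp add: sum.distrib asi flip: sum_distrib_left)
 ultimately show ?thesis unfolding has_lap_def A_def[symmetric] by (intro exI[of _ "%b. 8*((p - p0) \<bullet> b)^2 + 4*A"]) auto
qed

lemma has_lap_fst_sq:
 fixes p :: "real \<times> 'a::euclidean_space"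
 shows "has_lap (%q. (fst q)\<^sup>2) p 2"
proof -
 have "has_d2 (%x. x\<^sup>2) (fst p) 2" by (rule has_d2_I[where h="%r. 2*r"]) (auto intro!: dei)
 from has_lap_prod[OF this has_lap_const[of 1]] show ?thesis by simp
qed

lemma left_max_deriv_nonneg:
 assumes "(f HD x) (at_left a)" "\<forall>\<^sub>F s in at_left a. f s <= f a"
 shows "x >= 0"
proof -
 have t: "((%s. (f s - f a)/(s - a)) \<longlongrightarrow> x) (at_left a)" using assms(1) by (simp add: has_field_derivative_iff)
 have "\<forall>\<^sub>F s in at_left a. s < a" by (simp add: eventually_at_filter)
 with assms(2) have "\<forall>\<^sub>F s in at_left a. (f s - f a)/(s - a) >= 0" by eventually_elim (auto intro!: divide_nonpos_neg)
 with t show ?thesis by (intro tendsto_lowerbound[OF t]) auto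
qed

lemma right_max_deriv_nonpos:
 assumes "(f HD x) (at_right a)" "\<forall>\<^sub>F s in at_right a. f s <= f a"
 shows "x <= 0"
proof -
 have t: "((%s. (f s - f a)/(s - a)) \<longlongrightarrow> x) (at_right a)" using assms(1) by (simp add: has_field_derivative_iff)
 have "\<forall>\<^sub>F s in at_right a. s > a" by (simp add: eventually_at_filter)
 with assms(2) have "\<forall>\<^sub>F s in at_right a. (f s - f a)/(s - a) <= 0" by eventually_elim (auto intro!: divide_nonpos_pos)
 with t show ?thesis by (intro tendsto_upperbound[OF t]) auto
qed

subsection \<open>Comparison principle\<close>

definition has_par :: "('a::euclidean_space => real => real) => 'a => real => real => real => bool" where
 "has_par f p t ft l \<longleftrightarrow> ((%s. f p s) HD ft) (at t) & has_lap (%q. f q t) p l"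

text \<open>The derivative is taken along the ray through \<open>p\<close>, with the one-sided
  filter of the side on which the function lives, exactly as in \<open>is_solution\<close>. The
  exterior version keeps the same outward direction.\<close>

definition dn_in :: "real => ('m::finite pt => real) => 'm pt => real => bool" where
 "dn_in R f p x \<longleftrightarrow> ((%s. f (p + s *R nrm R p)) HD x) (at_left 0)"

definition dn_out :: "real => ('m::finite pt => real) => 'm pt => real => bool" where
 "dn_out R f p x \<longleftrightarrow> ((%s. f (p + s *R nrm R p)) HD x) (at_right 0)"

lemma has_par_diff:
 "has_par f p t a l ==> has_par g p t b m ==> has_par (%p t. f p t - g p t) p t (a - b) (l - m)" by (auto simp: has_par_def intro: DERIV_diff has_lap_diff)

lemma dn_in_diff: "dn_in R f p a ==> dn_in R g p b ==> dn_in R (%p. f p - g p) p (a - b)" by (auto simp: dn_in_def intro: DERIV_diff)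

lemma dn_out_diff: "dn_out R f p a ==> dn_out R g p b ==> dn_out R (%p. f p - g p) p (a - b)" by (auto simp: dn_out_def intro: DERIV_diff)

lemma open_OmegaI: "open (OmegaI R)" and open_ExtI: "open (ExtI R)"
 and closed_OmegaC: "closed (OmegaC R)" and closed_ExtC: "closed (ExtC R)" unfolding OmegaI_def ExtI_def OmegaC_def ExtC_def by (auto intro!: open_Collect_less closed_Collect_le ci)

lemma OmegaI_sub: "p:OmegaI R ==> p:OmegaC R" and ExtI_sub: "p:ExtI R ==> p:ExtC R" by (auto simp: OmegaI_def OmegaC_def ExtI_def ExtC_def)

lemma norm_snd_line:
 assumes "nr p = R" "R > 0" "s >= - R"
 shows "norm (snd (p + s *R nrm R p)) = R + s"
proof -
 have "snd (p + s *R nrm R p) = (1 + s/R) *R snd p" by (simp add: nrm_def asi)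
 hence "norm (snd (p + s *R nrm R p)) = \<bar>1 + s/R\<bar> * R" using assms by simp
 also have "\<bar>1 + s/R\<bar> = 1 + s/R" using assms by (simp add: field_simps)
 also have "(1 + s/R) * R = R + s" using assms by (simp add: field_simps)
 finally show ?thesis .
qed

lemma fst_line: "fst (p + s *R nrm R p) = fst p" by (simp add: nrm_def)

lemma eventually_line_left: "R > 0 ==> \<forall>\<^sub>F s in at_left (0::real). - R <= s & s < 0" using eventually_at_left[of "-1" "0::real"] by (auto intro!: exI[of _ "-R"] simp: eventually_at_left[of "-R" 0])

lemma eventually_line_right: "\<forall>\<^sub>F s in at_right (0::real). 0 < s" by (simp add: eventually_at_filter)

lemma first_touch_left:
 fixes f :: "real => real"
 assumes "con {ta..T} f" "ta < s" "s <= T" "!!t. ta <= t ==> t < s ==> f t < 0"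
 shows "f s <= 0"
proof (rule tendsto_upperbound)
 have "con {ta..s} f" using assms by (auto intro: continuous_on_subset)
 hence "(f \<longlongrightarrow> f s) (at s within {ta..s})" using assms by (auto simp: continuous_on_def)
 thus "(f \<longlongrightarrow> f s) (at_left s)" using assms(2) by (simp add: at_within_Icc_at_left)
 have "\<forall>\<^sub>F t in at_left s. ta < t & t < s" using assms(2) by (auto simp: eventually_at_left[OF assms(2)])
 thus "\<forall>\<^sub>F t in at_left s. f t <= 0" by eventually_elim (auto intro: less_imp_le assms(4))
qed simp

locale field_road =
 fixes D d R mq nq ro :: real
 assumes pos: "D > 0" "d > 0" "R > 0" "mq > 0" "nq > 0" "ro > 0"
begin
abbreviation "OC == OmegaC R" abbreviation "EC == ExtC R"
abbreviation "OI == OmegaI R" abbreviation "EI == ExtI R"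

text \<open>The constants make \<open>mq * hu = nq * hv\<close> on the interface, so the exchange
  terms cancel, while the outward slopes are \<open>2 * R / mq\<close> for \<open>hu\<close> and
  \<open>- 2 * R / nq\<close> for \<open>hv\<close>: both flux inequalities hold strictly. The
  quartic term lets \<open>hv\<close> grow at infinity although it starts with a negative
  slope.\<close>

definition hu :: "'m::finite pt => real" where
 "hu p = (2 + (fst p)^2 + (nr p)^2)/mq"
definition hv :: "'m::finite pt => real" where
 "hv p = (2 + R^2 + (fst p)^2 + ((nr p)^2 - R^2)^2 - ((nr p)^2 - R^2))/nq"

lemma norm_pt: "(norm p)^2 = (fst p)^2 + (nr p)^2" for p :: "'m::finite pt" by (cases p) (simp add: norm_Pair)

lemma hu_ge: "hu p >= (1 + (norm p)^2)/mq" unfolding hu_def norm_pt using pos by (intro divide_right_mono) auto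

lemma hv_ge: "hv p >= (1 + (norm p)^2)/nq"
proof -
 have "((nr p)^2 - R^2)^2 - ((nr p)^2 - R^2) + 1 >= (nr p)^2 - R^2" using zero_le_power2[of "((nr p)^2 - R^2) - 1"] by (simp add: power2_diff)
 thus ?thesis unfolding hv_def norm_pt using pos by (intro divide_right_mono) auto
qed

lemma hu_pos: "hu p > 0" and hv_pos: "hv p > 0"
proof -
 have "0 < (1 + (norm p)^2)/mq" using pos by (intro divide_pos_pos add_pos_nonneg) auto
 thus "hu p > 0" using hu_ge[of p] by linarith
 have "0 < (1 + (norm p)^2)/nq" using pos by (intro divide_pos_pos add_pos_nonneg) auto
 thus "hv p > 0" using hv_ge[of p] by linarith
qed

text \<open>One factor serves both barriers; \<open>8 + 4 * real CARD('m)\<close> comes from the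
  quartic term of \<open>hv\<close> and is generous for \<open>hu\<close>.\<close>

lemma hu_lap:
 fixes p :: "'m::finite pt"
 shows "EX l. has_lap hu p l & l <= (8 + 4*real CARD('m))*hu p"
proof (intro exI conjI)
 have "has_lap (%q::'m pt. (norm (snd q - 0))\<^sup>2) p (2*CARD('m))" using has_lap_snd[OF has_lap_norm2[of 0 "snd p"]] by simp
 hence "has_lap (%q::'m pt. inverse mq*(2 + (fst q)^2 + (norm (snd q))^2)) p (inverse mq*(0 + 2 + 2*real CARD('m)))" by (intro has_lap_add has_lap_cmult has_lap_const has_lap_fst_sq) auto
 thus "has_lap hu p (inverse mq*(2 + 2*real CARD('m)))" unfolding hu_def by (simp add: field_simps)
 have "2 + 2*real CARD('m) <= (8 + 4*real CARD('m))*(2 + (fst p)^2 + (nr p)^2)" by (rule order_trans[OF _ mult_left_mono[of 1 "2 + (fst p)^2 + (nr p)^2" "8 + 4*real CARD('m)"]]) auto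
 thus "inverse mq*(2 + 2*real CARD('m)) <= (8 + 4*real CARD('m))*hu p" unfolding hu_def using pos by (simp add: field_simps)
qed

lemma hv_lap:
 fixes p :: "'m::finite pt"
 shows "EX l. has_lap hv p l & l <= (8 + 4*real CARD('m))*hv p"
proof (intro exI conjI)
 let ?n = "real CARD('m)" and ?s = "(nr p)^2"
 have 1: "has_lap (%q::'m pt. (norm (snd q))\<^sup>2) p (2*?n)" using has_lap_snd[OF has_lap_norm2[of 0 "snd p"]] by simp
 have 2: "has_lap (%q::'m pt. ((norm (snd q))^2)\<^sup>2) p ((8 + 4*?n)*?s)" using has_lap_snd[OF has_lap_norm4[of 0 "snd p"]] by simp
 have "has_lap (%q::'m pt. inverse nq*((2 + 2 * R^2 + R^2 * R^2) + ((fst q)^2 + (((norm (snd q))^2)^2 + (- (2 * R^2 + 1))*(norm (snd q))^2)))) p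
  (inverse nq*(0 + (2 + ((8 + 4*?n)*?s + (- (2 * R^2 + 1))*(2*?n)))))" by (intro has_lap_add has_lap_cmult has_lap_const has_lap_fst_sq 1 2)
 moreover have "(%q::'m pt. inverse nq*((2 + 2 * R^2 + R^2 * R^2) + ((fst q)^2 + (((norm (snd q))^2)^2 + (- (2 * R^2 + 1))*(norm (snd q))^2)))) = hv" unfolding hv_def by (rule ext) (simp add: power2_eq_square asi divide_inverse)
 ultimately have "has_lap hv p (inverse nq*(0 + (2 + ((8 + 4*?n)*?s + (- (2 * R^2 + 1))*(2*?n)))))" by (simp only:)
 thus "has_lap hv p (inverse nq*(2 + (8 + 4*?n)*?s - (2 * R^2 + 1)*(2*?n)))" by (simp add: asi)
 have "2 + (8 + 4*?n)*?s - (2 * R^2 + 1)*(2*?n) <= (8 + 4*?n)*(1 + ?s)" by (simp add: asi)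
 also have "\<dots> <= (8 + 4*?n)*(1 + (norm p)^2)" by (simp add: norm_pt)
 finally have "2 + (8 + 4*?n)*?s - (2 * R^2 + 1)*(2*?n) <= (8 + 4*?n)*(1 + (norm p)^2)" .
 from mult_left_mono[OF this, of "inverse nq"]
 have "inverse nq*(2 + (8 + 4*?n)*?s - (2 * R^2 + 1)*(2*?n)) <= (8 + 4*?n)*((1 + (norm p)^2)/nq)" using pos by (simp add: divide_inverse mult_ac)
 also have "\<dots> <= (8 + 4*?n)*hv p" by (intro mult_left_mono hv_ge) auto
 finally show "inverse nq*(2 + (8 + 4*?n)*?s - (2 * R^2 + 1)*(2*?n)) <= (8 + 4*?n)*hv p" .
qed

lemma hu_hv_bdry: "nr p = R ==> mq*hu p = nq*hv p" unfolding hu_def hv_def using pos by simp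

lemma hu_dn: "nr p = R ==> dn_in R hu p (2 * R/mq)"
proof -
 assume p: "nr p = R"
 have "((%s. (2 + (fst p)^2 + (R + s)^2)/mq) HD 2 * R/mq) (at_left 0)" using pos by (auto intro!: dei)
 moreover have "\<forall>\<^sub>F s in at_left 0. (2 + (fst p)^2 + (R + s)^2)/mq = hu (p + s *R nrm R p)" using eventually_line_left[OF pos(3)]
 proof eventually_elim
  case (elim s)
  thus ?case unfolding hu_def fst_line using norm_snd_line[OF p pos(3), of s] by simp
 qed
 moreover have "(2 + (fst p)^2 + (R + 0)^2)/mq = hu (p + 0 *R nrm R p)" using p by (simp add: hu_def)
 ultimately show ?thesis unfolding dn_in_def by (rule has_field_derivative_cong_eventually[THEN iffD1, rotated -1])
qed

lemma hv_dn: "nr p = R ==> dn_out R hv p (- 2 * R/nq)"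
proof -
 assume p: "nr p = R"
 have "((%s. (2 + R^2 + (fst p)^2 + ((R + s)^2 - R^2)^2 - ((R + s)^2 - R^2))/nq) HD - 2 * R/nq) (at_right 0)" using pos by (auto intro!: dei)
 moreover have "\<forall>\<^sub>F s in at_right 0. (2 + R^2 + (fst p)^2 + ((R + s)^2 - R^2)^2 - ((R + s)^2 - R^2))/nq = hv (p + s *R nrm R p)" using eventually_line_right
 proof eventually_elim
  case (elim s)
  thus ?case unfolding hv_def fst_line using norm_snd_line[OF p pos(3), of s] pos by simp
 qed
 moreover have "(2 + R^2 + (fst p)^2 + ((R + 0)^2 - R^2)^2 - ((R + 0)^2 - R^2))/nq = hv (p + 0 *R nrm R p)" using p by (simp add: hv_def)
 ultimately show ?thesis unfolding dn_out_def by (rule has_field_derivative_cong_eventually[THEN iffD1, rotated -1])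
qed

lemma continuous_hu: "con A hu" and continuous_hv: "con A hv" unfolding hu_def hv_def by (intro ci; use pos in simp)+

text \<open>Touching points are confined to a ball because the barrier outgrows the bounded
  function; this supplies the compactness that the unbounded domains lack.\<close>

lemma touch_closed:
 fixes f :: "'m::finite pt => real => real"
 assumes S: "closed S" and c: "con (S \<times> {ta..T}) (%(p,t). f p t)"
  and b: "!!p t. p:S ==> t:{ta..T} ==> f p t >= 0 ==> norm p <= B"
 shows "compact {(p,t). p:S & t:{ta..T} & f p t >= 0}"
proof -
 have "closed ((S \<times> {ta..T}) \<inter> (%(p,t). f p t) -` {0..})" by (rule continuous_closed_preimage[OF c]) (auto intro: closed_Times S)
 moreover have "(S \<times> {ta..T}) \<inter> (%(p,t). f p t) -` {0..} = {(p,t). p:S & t:{ta..T} & f p t >= 0}" by auto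
 moreover have "bounded {(p,t). p:S & t:{ta..T} & f p t >= 0}"
 proof (rule bounded_subset[of "cball 0 B \<times> {ta..T}"])
  show "bounded (cball (0::'m pt) B \<times> {ta..T})" by (intro bounded_Times) auto
 qed (use b in auto)
 ultimately show ?thesis by (simp add: compact_eq_bounded_closed)
qed

text \<open>Consider the first time at which \<open>a\<close> or \<open>b\<close> reaches its
  barrier. Interior points are excluded by the growth rate \<open>k\<close>, interface points by the
  strict slopes of \<open>hu\<close> and \<open>hv\<close>. At a touching point the function has a
  positive value, so its differential inequality is available.\<close>

lemma max_principle_strict:
 fixes a b :: "'m::finite pt => real => real"
 assumes ca: "con (OC \<times> {ta..T}) (%(p,t). a p t)"
  and cb: "con (EC \<times> {ta..T}) (%(p,t). b p t)"
  and ba: "!!p t. p:OC ==> t:{ta..T} ==> a p t <= M"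
  and bb: "!!p t. p:EC ==> t:{ta..T} ==> b p t <= M"
  and ia: "!!p. p:OC ==> a p ta <= 0"
  and ib: "!!p. p:EC ==> b p ta <= 0"
  and L: "L >= 0"
  and pa: "!!p t. p:OI ==> ta < t ==> t <= T ==> a p t > 0 ==>
   EX ft l. has_par a p t ft l & ft <= D*l + L*a p t"
  and pb: "!!p t. p:EI ==> ta < t ==> t <= T ==> b p t > 0 ==>
   EX ft l. has_par b p t ft l & ft <= d*l + L*b p t"
  and da: "!!p t. nr p = R ==> ta < t ==> t <= T ==> a p t > 0 ==>
   EX x. dn_in R (%p. a p t) p x & D*x <= nq*b p t - mq*a p t"
  and db: "!!p t. nr p = R ==> ta < t ==> t <= T ==> b p t > 0 ==>
   EX x. dn_out R (%p. b p t) p x & - d*x <= mq*a p t - nq*b p t"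
  and e: "eps > 0" and kdef: "k = L + (D + d)*(8 + 4*real CARD('m)) + 1"
  and t: "t:{ta..T}"
 shows "(p:OC --> a p t < eps*exp (k*(t - ta))*hu p) & (p:EC --> b p t < eps*exp (k*(t - ta))*hv p)"
proof (rule ccontr)
 let ?C = "8 + 4*real CARD('m)"
 define E where "E = (%t. eps*exp (k*(t - ta)))"
 have E0: "E t > 0" for t using e by (simp add: E_def)
 have Eder: "(E HD k*E t) (at t)" for t unfolding E_def by (auto intro!: dei)
 have k0: "k > 0" using L pos by (simp add: kdef add_nonneg_pos)
 have Ege: "E t >= eps" if "t >= ta" for t using that e k0 by (simp add: E_def)
 define a' where "a' = (%p t. a p t - E t*hu p)"
 define b' where "b' = (%p t. b p t - E t*hv p)"
 assume neg: "~ ?thesis"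
 define Za where "Za = {(p,t). p:OC & t:{ta..T} & a' p t >= 0}"
 define Zb where "Zb = {(p,t). p:EC & t:{ta..T} & b' p t >= 0}"
 have cE: "con A E" for A unfolding E_def by (intro ci)
 have ca': "con (OC \<times> {ta..T}) (%(p,t). a' p t)"
 proof -
  have "con (OC \<times> {ta..T}) (%z. (%(p,t). a p t) z - E (snd z)*hu (fst z))" by (intro ci ca continuous_on_compose2[OF cE[of UNIV]] continuous_on_compose2[OF continuous_hu[of UNIV]]) auto
  thus ?thesis by (simp add: a'_def case_prod_beta)
 qed
 have cb': "con (EC \<times> {ta..T}) (%(p,t). b' p t)"
 proof -
  have "con (EC \<times> {ta..T}) (%z. (%(p,t). b p t) z - E (snd z)*hv (fst z))" by (intro ci cb continuous_on_compose2[OF cE[of UNIV]] continuous_on_compose2[OF continuous_hv[of UNIV]]) auto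
  thus ?thesis by (simp add: b'_def case_prod_beta)
 qed
 \<comment> \<open>Turns \<open>E t * h \<le> M\<close> and the quadratic lower bound of
   \<open>h\<close> into a bound for \<open>norm p\<close>; of the time factor only
   \<open>E t \<ge> eps\<close> is used.\<close>
 have bnd: "norm p <= \<bar>M\<bar>*c/eps + 1" if "E t*h <= M" "t >= ta" "h >= (1 + (norm p)^2)/c" "c > 0" for h t c and p :: "'m pt"
 proof -
  have "eps*((1 + (norm p)^2)/c) <= E t*h" using that e Ege[OF that(2)] by (intro mult_mono) auto
  hence "eps*(1 + (norm p)^2)/c <= \<bar>M\<bar>" using that by simp
  hence "eps*(1 + (norm p)^2) <= \<bar>M\<bar>*c" using that(4) by (simp add: pos_divide_le_eq)
  hence "eps*(norm p)^2 <= \<bar>M\<bar>*c" using e by (simp add: distrib_left)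
  hence "(norm p)^2 <= \<bar>M\<bar>*c/eps" using e by (simp add: pos_le_divide_eq mult.commute)
  moreover have "norm p <= (norm p)^2 + 1" using zero_le_power2[of "norm p - 1"] norm_ge_zero[of p] unfolding power2_diff power_one by linarith
  ultimately show ?thesis by linarith
 qed
 have Zac: "compact Za" unfolding Za_def
 proof (rule touch_closed[OF closed_OmegaC ca'])
  fix p t assume "p:OC" "t:{ta..T}" "0 <= a' p t"
  thus "norm p <= \<bar>M\<bar>*mq/eps + 1" using ba[of p t] pos hu_ge[of p] by (intro bnd[of t "hu p"]) (auto simp: a'_def)
 qed
 have Zbc: "compact Zb" unfolding Zb_def
 proof (rule touch_closed[OF closed_ExtC cb'])
  fix p t assume "p:EC" "t:{ta..T}" "0 <= b' p t"
  thus "norm p <= \<bar>M\<bar>*nq/eps + 1" using bb[of p t] pos hv_ge[of p] by (intro bnd[of t "hv p"]) (auto simp: b'_def)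
 qed
 have "(p, t):Za \<union> Zb" using neg t by (auto simp: Za_def Zb_def a'_def b'_def E_def)
 \<comment> \<open>The earliest touching time exists because the union of both touching sets is
   compact.\<close>
 hence "EX z:Za \<union> Zb. ALL z':Za \<union> Zb. snd z <= snd z'" using Zac Zbc by (intro continuous_attains_inf compact_Un ci) auto
 then obtain q s where qs: "(q, s):Za \<union> Zb" and min: "!!p t. (p, t):Za \<union> Zb ==> s <= t" by force
 have s: "ta <= s" "s <= T" using qs by (auto simp: Za_def Zb_def)
 have "a' p ta < 0" if "p:OC" for p using ia[OF that] mult_pos_pos[OF E0[of ta] hu_pos[of p]] by (simp add: a'_def)
 moreover have "b' p ta < 0" if "p:EC" for p using ib[OF that] mult_pos_pos[OF E0[of ta] hv_pos[of p]] by (simp add: b'_def)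
 ultimately have "s ~= ta" using qs by (fastforce simp: Za_def Zb_def)
 hence ts: "ta < s" using s by simp
 have befa: "a' p t < 0" if "p:OC" "ta <= t" "t < s" for p t using min[of p t] that s by (force simp: Za_def)
 have befb: "b' p t < 0" if "p:EC" "ta <= t" "t < s" for p t using min[of p t] that s by (force simp: Zb_def)
 have ata: "a' p s <= 0" if "p:OC" for p
 proof (rule first_touch_left[OF _ ts s(2) befa[OF that]])
  have "con {ta..T} (%t. (%(p,t). a' p t) (p, t))" by (rule continuous_on_compose2[OF ca']) (use that in \<open>auto intro!: ci\<close>)
  thus "con {ta..T} (a' p)" by simp
 qed
 have atb: "b' p s <= 0" if "p:EC" for p
 proof (rule first_touch_left[OF _ ts s(2) befb[OF that]])
  have "con {ta..T} (%t. (%(p,t). b' p t) (p, t))" by (rule continuous_on_compose2[OF cb']) (use that in \<open>auto intro!: ci\<close>)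
  thus "con {ta..T} (b' p)" by simp
 qed
 have time: "ft >= 0" if "(f HD ft) (at s)" "f s = 0" "!!t. ta <= t ==> t < s ==> f t < 0" for f ft
 proof (rule left_max_deriv_nonneg)
  show "(f HD ft) (at_left s)" using that(1) by (rule has_field_derivative_at_within)
  have "\<forall>\<^sub>F t in at_left s. ta < t & t < s" using ts by (auto simp: eventually_at_left[OF ts])
  thus "\<forall>\<^sub>F t in at_left s. f t <= f s" by eventually_elim (auto simp: that(2) intro!: less_imp_le that(3))
 qed
 \<comment> \<open>\<open>k\<close> exceeds the sum of the reaction rate \<open>L\<close> and the
   growth of the Laplacian for either diffusion coefficient, with 1 to spare for strictness.\<close>
 have kbig: "k*h > c*l + L*h" if "l <= ?C*h" "h > 0" "c = D | c = d" for c l h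
 proof -
  have "c*l <= (D + d)*(?C*h)"
  proof -
   have "c*l <= c*(?C*h)" using that pos by (intro mult_left_mono) auto
   also have "\<dots> <= (D + d)*(?C*h)" using that pos by (intro mult_right_mono) auto
   finally show ?thesis .
  qed
  thus ?thesis using that(2) by (simp add: kdef asi)
 qed
 consider (ai) "q:OI" "a' q s = 0" | (bi) "q:EI" "b' q s = 0"
  | (ab) "norm (snd q) = R" "a' q s = 0" | (bb) "norm (snd q) = R" "b' q s = 0" using qs ata[of q] atb[of q] by (fastforce simp: Za_def Zb_def OmegaC_def OmegaI_def ExtC_def ExtI_def)
 thus False
 proof cases
  case ai
  have as: "a q s = E s*hu q" using ai by (simp add: a'_def)
  hence "a q s > 0" using mult_pos_pos[OF E0 hu_pos] by simp
  from pa[OF ai(1) ts s(2) this] obtain ft l where p: "has_par a q s ft l" "ft <= D*l + L*a q s" by blast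
  obtain lh where lh: "has_lap hu q lh" "lh <= ?C*hu q" using hu_lap by blast
  have hp: "has_par (%p t. E t*hu p) q s (k*E s*hu q) (E s*lh)" unfolding has_par_def by (auto intro!: has_lap_cmult lh dei Eder)
  from has_par_diff[OF p(1) hp] have hp': "has_par a' q s (ft - k*E s*hu q) (l - E s*lh)" by (simp add: a'_def)
  have "ft - k*E s*hu q >= 0" by (rule time[of "a' q", OF _ ai(2) befa[OF OmegaI_sub[OF ai(1)]]]) (use hp' in \<open>auto simp: has_par_def\<close>)
  moreover have "l - E s*lh <= 0"
  proof (rule has_lap_local_max)
   show "has_lap (%p. a' p s) q (l - E s*lh)" using hp' by (simp add: has_par_def)
   show "\<forall>\<^sub>F p in nhds q. a' p s <= a' q s" using eventually_nhds_in_open[OF open_OmegaI ai(1)] by eventually_elim (simp add: ai(2) ata[OF OmegaI_sub])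
  qed
  hence "D*l <= D*(E s*lh)" using pos by (intro mult_left_mono) auto
  ultimately have "E s*(k*hu q) <= E s*(D*lh + L*hu q)" using p(2) as by (simp add: asi)
  hence "k*hu q <= D*lh + L*hu q" using E0 by simp
  thus False using kbig[OF lh(2) hu_pos, of D] by simp
 next
  case bi
  have as: "b q s = E s*hv q" using bi by (simp add: b'_def)
  hence "b q s > 0" using mult_pos_pos[OF E0 hv_pos] by simp
  from pb[OF bi(1) ts s(2) this] obtain ft l where p: "has_par b q s ft l" "ft <= d*l + L*b q s" by blast
  obtain lh where lh: "has_lap hv q lh" "lh <= ?C*hv q" using hv_lap by blast
  have hp: "has_par (%p t. E t*hv p) q s (k*E s*hv q) (E s*lh)" unfolding has_par_def by (auto intro!: has_lap_cmult lh dei Eder)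
  from has_par_diff[OF p(1) hp] have hp': "has_par b' q s (ft - k*E s*hv q) (l - E s*lh)" by (simp add: b'_def)
  have "ft - k*E s*hv q >= 0" by (rule time[of "b' q", OF _ bi(2) befb[OF ExtI_sub[OF bi(1)]]]) (use hp' in \<open>auto simp: has_par_def\<close>)
  moreover have "l - E s*lh <= 0"
  proof (rule has_lap_local_max)
   show "has_lap (%p. b' p s) q (l - E s*lh)" using hp' by (simp add: has_par_def)
   show "\<forall>\<^sub>F p in nhds q. b' p s <= b' q s" using eventually_nhds_in_open[OF open_ExtI bi(1)] by eventually_elim (simp add: bi(2) atb[OF ExtI_sub])
  qed
  hence "d*l <= d*(E s*lh)" using pos by (intro mult_left_mono) auto
  ultimately have "E s*(k*hv q) <= E s*(d*lh + L*hv q)" using p(2) as by (simp add: asi)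
  hence "k*hv q <= d*lh + L*hv q" using E0 by simp
  thus False using kbig[OF lh(2) hv_pos, of d] by simp
 next
  case ab
  have as: "a q s = E s*hu q" using ab by (simp add: a'_def)
  hence "a q s > 0" using mult_pos_pos[OF E0 hu_pos] by simp
  from da[OF ab(1) ts s(2) this] obtain x where x: "dn_in R (%p. a p s) q x" "D*x <= nq*b q s - mq*a q s" by blast
  have "dn_in R (%p. E s*hu p) q (E s*(2 * R/mq))" using hu_dn[OF ab(1)] unfolding dn_in_def by (rule DERIV_cmult)
  from dn_in_diff[OF x(1) this] have dx: "dn_in R (%p. a' p s) q (x - E s*(2 * R/mq))" by (simp add: a'_def)
  \<comment> \<open>Seen from inside, the difference is maximal on the interface, so the slope of
    \<open>a\<close> is at least the positive slope of the barrier. But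
    \<open>b q s \<le> E s * hv q\<close> makes the right-hand side of the flux condition
    nonpositive.\<close>
  have "x - E s*(2 * R/mq) >= 0"
  proof (rule left_max_deriv_nonneg[OF dx[unfolded dn_in_def]])
   show "\<forall>\<^sub>F h in at_left 0. a' (q + h *R nrm R q) s <= a' (q + 0 *R nrm R q) s" using eventually_line_left[OF pos(3)]
   proof eventually_elim
   case (elim h)
   hence "q + h *R nrm R q:OC" using norm_snd_line[OF ab(1) pos(3), of h] by (simp add: OmegaC_def)
   from ata[OF this] show ?case using ab by simp
   qed
  qed
  hence "x > 0" using E0[of s] pos by (smt (verit) divide_pos_pos mult_pos_pos)
  hence "D*x > 0" using pos by simp
  have "b q s <= E s*hv q" using atb[of q] ab by (simp add: b'_def ExtC_def)
  hence "nq*b q s <= E s*(nq*hv q)" using pos by (simp add: mult_left_mono asi)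
  moreover have "mq*a q s = E s*(nq*hv q)" unfolding as using hu_hv_bdry[OF ab(1)] by (metis mult.left_commute)
  ultimately have "nq*b q s <= mq*a q s" by linarith
  with \<open>D * x > 0\<close> show False using x(2) by linarith
 next
  case bb
  have as: "b q s = E s*hv q" using bb by (simp add: b'_def)
  hence "b q s > 0" using mult_pos_pos[OF E0 hv_pos] by simp
  from db[OF bb(1) ts s(2) this] obtain x where x: "dn_out R (%p. b p s) q x" "- d*x <= mq*a q s - nq*b q s" by blast
  have "dn_out R (%p. E s*hv p) q (E s*(- 2 * R/nq))" using hv_dn[OF bb(1)] unfolding dn_out_def by (rule DERIV_cmult)
  from dn_out_diff[OF x(1) this] have dx: "dn_out R (%p. b' p s) q (x + E s*(2 * R/nq))" by (simp add: b'_def)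
  have "x + E s*(2 * R/nq) <= 0"
  proof (rule right_max_deriv_nonpos[OF dx[unfolded dn_out_def]])
   show "\<forall>\<^sub>F h in at_right 0. b' (q + h *R nrm R q) s <= b' (q + 0 *R nrm R q) s" using eventually_line_right
   proof eventually_elim
   case (elim h)
   hence "q + h *R nrm R q:EC" using norm_snd_line[OF bb(1) pos(3), of h] pos by (simp add: ExtC_def)
   from atb[OF this] show ?case using bb by simp
   qed
  qed
  hence "x < 0" using E0[of s] pos by (smt (verit) divide_pos_pos mult_pos_pos)
  hence "- d*x > 0" using pos by (simp add: mult_pos_neg)
  have "a q s <= E s*hu q" using ata[of q] bb by (simp add: a'_def OmegaC_def)
  hence "mq*a q s <= E s*(mq*hu q)" using pos by (simp add: mult_left_mono asi)
  moreover have "nq*b q s = E s*(mq*hu q)" unfolding as using hu_hv_bdry[OF bb(1)] by (metis mult.left_commute)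
  ultimately have "mq*a q s <= nq*b q s" by linarith
  with \<open>- d * x > 0\<close> show False using x(2) by linarith
 qed
qed

text \<open>Let \<open>eps\<close> tend to 0 at a fixed point. Since the inequalities are tested at
  positive values only, \<open>L\<close> may be replaced by its positive part.\<close>

lemma max_principle:
 fixes a b :: "'m::finite pt => real => real"
 assumes ca: "con (OC \<times> {ta..T}) (%(p,t). a p t)"
  and cb: "con (EC \<times> {ta..T}) (%(p,t). b p t)"
  and ba: "!!p t. p:OC ==> t:{ta..T} ==> a p t <= M"
  and bb: "!!p t. p:EC ==> t:{ta..T} ==> b p t <= M"
  and ia: "!!p. p:OC ==> a p ta <= 0"
  and ib: "!!p. p:EC ==> b p ta <= 0"
  and pa: "!!p t. p:OI ==> ta < t ==> t <= T ==> a p t > 0 ==>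
   EX ft l. has_par a p t ft l & ft <= D*l + L*a p t"
  and pb: "!!p t. p:EI ==> ta < t ==> t <= T ==> b p t > 0 ==>
   EX ft l. has_par b p t ft l & ft <= d*l + L*b p t"
  and da: "!!p t. nr p = R ==> ta < t ==> t <= T ==> a p t > 0 ==>
   EX x. dn_in R (%p. a p t) p x & D*x <= nq*b p t - mq*a p t"
  and db: "!!p t. nr p = R ==> ta < t ==> t <= T ==> b p t > 0 ==>
   EX x. dn_out R (%p. b p t) p x & - d*x <= mq*a p t - nq*b p t"
  and t: "t:{ta..T}"
 shows "(p:OC --> a p t <= 0) & (p:EC --> b p t <= 0)"
proof -
 define L' where "L' = max L 0"
 define K where "K = exp ((L' + (D + d)*(8 + 4*real CARD('m)) + 1)*(t - ta))"
 have LL: "L*x <= L'*x" if "x > 0" for x using that by (simp add: L'_def mult_right_mono)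
 have K0: "K > 0" by (simp add: K_def)
 have pa': "EX ft l. has_par a p t ft l & ft <= D*l + L'*a p t"
  if "p:OI" "ta < t" "t <= T" "a p t > 0" for p t using pa[OF that] LL[OF that(4)] by (smt (verit))
 have pb': "EX ft l. has_par b p t ft l & ft <= d*l + L'*b p t"
  if "p:EI" "ta < t" "t <= T" "b p t > 0" for p t using pb[OF that] LL[OF that(4)] by (smt (verit))
 have m: "(p:OC --> a p t < e*(K*hu p)) & (p:EC --> b p t < e*(K*hv p))" if "e > 0" for e using max_principle_strict[OF ca cb ba bb ia ib _ pa' pb' da db that refl t, of p] by (simp add: K_def L'_def mult.assoc)
 have fin: "x <= 0" if "!!e. e > 0 ==> x < e*h" "h > 0" for x h :: real
 proof (rule ccontr)
  assume "~ x <= 0"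
  hence "x < (x/h)*h" using that by (intro that(1)) auto
  thus False using that(2) by simp
 qed
 have "K*hu p > 0" "K*hv p > 0" using K0 hu_pos[of p] hv_pos[of p] by simp_all
 thus ?thesis using m fin by meson
qed

end

locale kpp = field_road +
 fixes g :: "real => real" and g0 :: real
 assumes g_lip: "ALL z. EX e>0. EX L. ALL a:ball z e. ALL b:ball z e. \<bar>g a - g b\<bar> <= L*\<bar>a - b\<bar>"
  and g_diff: "(g HD g0) (at 0)"
  and g_0: "g 0 = 0" and g_1: "g 1 = 0"
  and g_kpp: "ALL s. 0 < s & s < 1 --> 0 < g s & g s <= g0 * s"
  and g_neg: "ALL s>1. g s < 0"
  and g_skpp: "ALL s t. 0 < s & s < t --> g t/t < g s/s"
begin

lemma g0_pos: "g0 > 0" using g_kpp[rule_format, of "1/2"] by linarith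

lemma isCont_g: "isCont g z"
proof -
 obtain e L where e: "e > 0" "ALL a:ball z e. ALL b:ball z e. \<bar>g a - g b\<bar> <= L*\<bar>a - b\<bar>" using g_lip by blast
 have "((%x. L*\<bar>x - z\<bar>) \<longlongrightarrow> L*\<bar>z - z\<bar>) (at z)" by (intro tendsto_intros)
 hence t: "((%x. L*\<bar>x - z\<bar>) \<longlongrightarrow> 0) (at z)" by simp
 have "\<forall>\<^sub>F x in at z. x:ball z e" using eventually_at_ball[OF e(1), of z UNIV] by (auto elim: eventually_mono)
 hence "\<forall>\<^sub>F x in at z. norm (g x - g z) <= L*\<bar>x - z\<bar>" by eventually_elim (use e in auto)
 from Lim_null_comparison[OF this t] show ?thesis by (simp add: isCont_def LIM_zero_iff)
qed

lemma continuous_g: "con A g" using isCont_g by (simp add: continuous_at_imp_continuous_on)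

lemma g_ratio: "0 < s ==> s <= t ==> g t/t <= g s/s" using g_skpp by (cases "s = t") (auto intro: less_imp_le)

lemma g_tendsto: "((%h. g h/h) \<longlongrightarrow> g0) (at 0)" using g_diff g_0 by (simp add: has_field_derivative_iff)

text \<open>The quotient \<open>g s / s\<close> decreases and tends to \<open>g0\<close> at 0, which
  extends the bound beyond \<open>s = 1\<close>.\<close>

lemma g_le: "s >= 0 ==> g s <= g0 * s"
proof (cases "s = 0")
 case False
 assume "s >= 0"
 hence s: "s > 0" using False by simp
 have t: "((%h. g h/h) \<longlongrightarrow> g0) (at_right 0)" using g_tendsto by (rule filterlim_mono) (auto simp: at_le)
 have "\<forall>\<^sub>F h in at_right 0. 0 < h & h < s" using s by (auto simp: eventually_at_right[OF s])
 hence "\<forall>\<^sub>F h in at_right 0. g s/s <= g h/h" by eventually_elim (rule g_ratio; simp)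
 hence "g s/s <= g0" by (intro tendsto_lowerbound[OF t]) auto
 thus ?thesis using s by (simp add: field_simps)
qed (simp add: g_0)

lemma g_lt: "s > 0 ==> g s < g0 * s"
proof -
 assume s: "s > 0"
 have "g s/s < g (s/2)/(s/2)" using g_skpp[rule_format, of "s/2" s] s by auto
 also have "\<dots> <= g0" using g_le[of "s/2"] s by (simp add: pos_divide_le_eq)
 finally show ?thesis using s by (simp add: pos_divide_less_eq)
qed

text \<open>From \<open>g u / u \<le> g w / w\<close> one gets
  \<open>g u - g w \<le> (u - w) * (g w / w)\<close>. The comparison theorems can thus take
  \<open>L = g0\<close> whatever the range of the functions, instead of a local Lipschitz
  constant.\<close>

lemma g_diff_le: "0 <= w ==> w <= u ==> g u - g w <= g0*(u - w)"
proof (cases "w = 0")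
 case False
 assume "0 <= w" "w <= u"
 hence w: "w > 0" "u > 0" "u - w >= 0" using False by auto
 have "g u <= u*(g w/w)" using g_ratio[OF w(1) \<open>w <= u\<close>] w by (simp add: pos_divide_le_eq mult.commute)
 also have "\<dots> = g w + (u - w)*(g w/w)" using w by (simp add: field_simps)
 finally have "g u - g w <= (u - w)*(g w/w)" by simp
 also have "\<dots> <= (u - w)*g0" using g_le[of w] w by (intro mult_left_mono) (auto simp: pos_divide_le_eq)
 finally show ?thesis by (simp add: mult.commute)
qed (use g_le g_0 in auto)

text \<open>Nothing is assumed about the sign of \<open>g\<close> below 0; differentiability at 0
  lets \<open>g u / u\<close> extend continuously, so it is bounded on compact intervals.\<close>

lemma g_neg_bound: "EX L. ALL u. - M <= u & u < 0 --> - g u <= L*(- u)"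
proof -
 define h where "h = (%u. if u = 0 then g0 else g u/u)"
 have hc: "isCont h u" for u
 proof (cases "u = 0")
  case True
  have "(h \<longlongrightarrow> g0) (at 0)" by (rule Lim_transform_eventually[OF g_tendsto]) (simp add: h_def eventually_at_filter)
  thus ?thesis using True by (simp add: isCont_def h_def)
 next
  case False
  have "isCont (%u. g u/u) u" using False isCont_g by (intro ci) auto
  moreover have "\<forall>\<^sub>F s in nhds u. g s/s = h s" using t1_space_nhds[OF False] by eventually_elim (simp add: h_def)
  ultimately show ?thesis using isCont_cong by fastforce
 qed
 have "compact (h ` {- M..0})" by (intro compact_continuous_image continuous_at_imp_continuous_on ballI hc) auto
 then obtain B where B: "!!u. u:{- M..0} ==> \<bar>h u\<bar> <= B" using compact_imp_bounded bounded_iff by (metis imageI real_norm_def)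
 have "- g u <= B*(- u)" if "- M <= u" "u < 0" for u
 proof -
  have "h u <= B" using B[of u] that by (force simp: abs_le_iff)
  hence "g u/u <= B" using that by (simp add: h_def)
  thus ?thesis using that by (simp add: neg_divide_le_eq)
 qed
 thus ?thesis by blast
qed

abbreviation sol where "sol u0 v0 u v == is_solution D d R mq nq ro g u0 v0 u v"

lemma sol_u:
 assumes "sol u0 v0 u v" "p:OI" "t > 0"
 shows "EX ft l. has_par u p t ft l & ft = D*l + g (u p t)"
proof -
 have "C2_on (OI) (%p. u p t)" "(%s. u p s) differentiable (at t)"
  "deriv (%s. u p s) t - D*laplacian (%q. u q t) p = g (u p t)" using assms unfolding is_solution_def by auto
 thus ?thesis unfolding has_par_def by (intro exI[of _ "deriv (%s. u p s) t"] exI[of _ "laplacian (%q. u q t) p"])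
   (auto simp: DERIV_deriv_iff_real_differentiable intro: C2_on_imp_has_lap open_OmegaI assms)
qed

lemma sol_v:
 assumes "sol u0 v0 u v" "p:EI" "t > 0"
 shows "EX ft l. has_par v p t ft l & ft = d*l - ro * v p t"
proof -
 have "C2_on (EI) (%p. v p t)" "(%s. v p s) differentiable (at t)"
  "deriv (%s. v p s) t - d*laplacian (%q. v q t) p = - ro * v p t" using assms unfolding is_solution_def by auto
 thus ?thesis unfolding has_par_def by (intro exI[of _ "deriv (%s. v p s) t"] exI[of _ "laplacian (%q. v q t) p"])
   (auto simp: DERIV_deriv_iff_real_differentiable intro: C2_on_imp_has_lap open_ExtI assms)
qed

lemma sol_b:
 assumes "sol u0 v0 u v" "nr p = R" "t > 0"
 obtains x y where "dn_in R (%p. u p t) p x" "dn_out R (%p. v p t) p y"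
  "D*x = nq * v p t - mq*u p t" "- d*y = mq*u p t - nq * v p t" using assms unfolding is_solution_def dn_in_def dn_out_def by blast

lemma sol_cont:
 assumes "sol u0 v0 u v" "0 <= ta"
 shows "con (OC \<times> {ta..T}) (%(p,t). u p t)" "con (EC \<times> {ta..T}) (%(p,t). v p t)" using assms unfolding is_solution_def by (auto elim!: continuous_on_subset)

lemma sol_cont_at:
 assumes "sol u0 v0 u v" "0 <= t"
 shows "con (OC) (%p. u p t)" "con (EC) (%p. v p t)"
proof -
 have "con (OC) (%p. (%(p,t). u p t) (p, t))" by (rule continuous_on_compose2[OF sol_cont(1)[OF assms, of t]]) (auto intro!: ci)
 thus "con (OC) (%p. u p t)" by simp
 have "con (EC) (%p. (%(p,t). v p t) (p, t))" by (rule continuous_on_compose2[OF sol_cont(2)[OF assms, of t]]) (auto intro!: ci)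
 thus "con (EC) (%p. v p t)" by simp
qed

lemma sol_bound:
 assumes "sol u0 v0 u v"
 obtains M where "M > 0" "!!p t. p:OC ==> t:{0..T} ==> \<bar>u p t\<bar> <= M"
  "!!p t. p:EC ==> t:{0..T} ==> \<bar>v p t\<bar> <= M"
proof -
 have "bounded ((%(p,t). u p t) ` (OC \<times> {0..T}))" "bounded ((%(p,t). v p t) ` (EC \<times> {0..T}))" using assms unfolding is_solution_def by auto
 then obtain A B where "ALL x:(%(p,t). u p t) ` (OC \<times> {0..T}). norm x <= A"
  "ALL x:(%(p,t). v p t) ` (EC \<times> {0..T}). norm x <= B" unfolding bounded_iff by blast
 thus ?thesis by (intro that[of "max 1 (max A B)"]) force+
qed

text \<open>The maximum principle is applied to \<open>- u\<close> and \<open>- v\<close>, with the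
  constant that \<open>g_neg_bound\<close> gives for the range of the solution up to time
  \<open>t\<close>.\<close>

lemma nonneg:
 fixes u v :: "'m::finite pt => real => real"
 assumes adm: "admissible_data R u0 v0" and S: "sol u0 v0 u v" and t: "t >= 0"
 shows "p:OC ==> u p t >= 0" "p:EC ==> v p t >= 0"
proof -
 obtain M where M: "!!p s. p:OC ==> s:{0..t} ==> \<bar>u p s\<bar> <= M"
  "!!p s. p:EC ==> s:{0..t} ==> \<bar>v p s\<bar> <= M" using sol_bound[OF S, of t] by metis
 obtain L where L: "!!u. - M <= u ==> u < 0 ==> - g u <= L*(- u)" using g_neg_bound by blast
 have neg_par: "has_par f p t ft l ==> has_par (%p t. - f p t) p t (- ft) (- l)" for f :: "'m pt => real => real" and p t ft l using has_lap_cmult[of "%q. f q t" p l "-1"] by (auto simp: has_par_def intro: DERIV_minus)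
 have "(p:OC --> - u p t <= 0) & (p:EC --> - v p t <= 0)" for p
 proof (rule max_principle[where a="%p t. - u p t" and b="%p t. - v p t" and ta=0 and T=t and L="max L 0"])
  show "con (OC \<times> {0..t}) (%(p, t). - u p t)" "con (EC \<times> {0..t}) (%(p, t). - v p t)" using sol_cont[OF S order_refl, of t] by (auto simp: case_prod_beta intro: ci)
  show "- u p s <= M" if "p:OC" "s:{0..t}" for p s using M(1)[OF that] by linarith
  show "- v p s <= M" if "p:EC" "s:{0..t}" for p s using M(2)[OF that] by linarith
  show "- u p 0 <= 0" if "p:OC" for p using that S adm by (simp add: is_solution_def admissible_data_def)
  show "- v p 0 <= 0" if "p:EC" for p using that S adm by (simp add: is_solution_def admissible_data_def)
 next
  fix p s assume a: "p:OI" "0 < s" "s <= t" "0 < - u p s"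
  obtain ft l where f: "has_par u p s ft l" "ft = D*l + g (u p s)" using sol_u[OF S a(1,2)] by blast
  have "- g (u p s) <= L*(- u p s)" using L[of "u p s"] M(1)[of p s] a OmegaI_sub[OF a(1)] by auto
  also have "\<dots> <= max L 0*(- u p s)" using a by (intro mult_right_mono) auto
  finally show "EX ft l. has_par (%p t. - u p t) p s ft l & ft <= D*l + max L 0*- u p s" using neg_par[OF f(1)] f(2) by (intro exI[of _ "-ft"] exI[of _ "-l"]) auto
 next
  fix p s assume a: "p:EI" "0 < s" "s <= t" "0 < - v p s"
  obtain ft l where f: "has_par v p s ft l" "ft = d*l - ro * v p s" using sol_v[OF S a(1,2)] by blast
  have "ro * v p s <= 0" "0 <= max L 0*- v p s" using a pos by (auto intro: mult_nonneg_nonpos)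
  thus "EX ft l. has_par (%p t. - v p t) p s ft l & ft <= d*l + max L 0*- v p s" using neg_par[OF f(1)] f(2) by (intro exI[of _ "-ft"] exI[of _ "-l"]) auto
 next
  fix p s assume a: "nr p = R" "0 < s" "s <= t" "0 < - u p s"
  obtain x where x: "dn_in R (%p. u p s) p x" "D*x = nq * v p s - mq*u p s" using sol_b[OF S a(1,2)] by metis
  thus "EX x. dn_in R (%p. - u p s) p x & D*x <= nq*- v p s - mq*- u p s" by (intro exI[of _ "-x"]) (auto simp: dn_in_def intro: DERIV_minus)
 next
  fix p s assume a: "nr p = R" "0 < s" "s <= t" "0 < - v p s"
  obtain x where x: "dn_out R (%p. v p s) p x" "- d*x = mq*u p s - nq * v p s" using sol_b[OF S a(1,2)] by metis
  thus "EX x. dn_out R (%p. - v p s) p x & - d*x <= mq*- u p s - nq*- v p s" by (intro exI[of _ "-x"]) (auto simp: dn_out_def intro: DERIV_minus)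
 qed (use t in auto)
 from this[of p] show "p:OC ==> u p t >= 0" "p:EC ==> v p t >= 0" by simp_all
qed

text \<open>Where \<open>w\<close> exceeds the nonnegative \<open>u\<close> it is positive, which is
  why inequalities at positive values suffice. The differences are bounded above by \<open>M\<close>
  for the same reason.\<close>

lemma sub_cmp:
 fixes u v w z :: "'m::finite pt => real => real"
 assumes adm: "admissible_data R u0 v0" and S: "sol u0 v0 u v" and ta: "0 <= ta"
  and cw: "con (OC \<times> {ta..T}) (%(p,t). w p t)"
  and cz: "con (EC \<times> {ta..T}) (%(p,t). z p t)"
  and bw: "!!p t. p:OC ==> t:{ta..T} ==> w p t <= M"
  and bz: "!!p t. p:EC ==> t:{ta..T} ==> z p t <= M"
  and iw: "!!p. p:OC ==> w p ta <= u p ta"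
  and iz: "!!p. p:EC ==> z p ta <= v p ta"
  and pw: "!!p t. p:OI ==> ta < t ==> t <= T ==> w p t > 0 ==>
   EX ft l. has_par w p t ft l & ft <= D*l + g (w p t)"
  and pz: "!!p t. p:EI ==> ta < t ==> t <= T ==> z p t > 0 ==>
   EX ft l. has_par z p t ft l & ft <= d*l - ro*z p t"
  and dw: "!!p t. nr p = R ==> ta < t ==> t <= T ==> w p t > 0 ==>
   EX x. dn_in R (%p. w p t) p x & D*x <= nq*z p t - mq*w p t"
  and dz: "!!p t. nr p = R ==> ta < t ==> t <= T ==> z p t > 0 ==>
   EX x. dn_out R (%p. z p t) p x & - d*x <= mq*w p t - nq*z p t"
  and t: "t:{ta..T}"
 shows "(p:OC --> w p t <= u p t) & (p:EC --> z p t <= v p t)"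
proof -
 note nn = nonneg[OF adm S]
 have "(p:OC --> w p t - u p t <= 0) & (p:EC --> z p t - v p t <= 0)" for p
 proof (rule max_principle[where a="%p t. w p t - u p t" and b="%p t. z p t - v p t" and ta=ta and T=T and L=g0 and M=M])
  show "con (OC \<times> {ta..T}) (%(p, t). w p t - u p t)" "con (EC \<times> {ta..T}) (%(p, t). z p t - v p t)" using sol_cont[OF S ta, of T] cw cz by (auto simp: case_prod_beta intro: ci)
  show "w p s - u p s <= M" if "p:OC" "s:{ta..T}" for p s using bw[OF that] nn(1)[of s p] that ta by auto
  show "z p s - v p s <= M" if "p:EC" "s:{ta..T}" for p s using bz[OF that] nn(2)[of s p] that ta by auto
 next
  fix p s assume a: "p:OI" "ta < s" "s <= T" "0 < w p s - u p s"
  have u0: "u p s >= 0" using nn(1)[of s p] a ta OmegaI_sub[OF a(1)] by auto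
  obtain ft l where f: "has_par u p s ft l" "ft = D*l + g (u p s)" using sol_u[OF S a(1), of s] a ta by auto
  obtain ft' l' where f': "has_par w p s ft' l'" "ft' <= D*l' + g (w p s)" using pw[OF a(1-3)] a u0 by auto
  have "ft' - ft <= D*(l' - l) + g0*(w p s - u p s)" using g_diff_le[OF u0, of "w p s"] a f f' by (simp add: asi)
  thus "EX ft l. has_par (%p t. w p t - u p t) p s ft l & ft <= D*l + g0*(w p s - u p s)" using has_par_diff[OF f'(1) f(1)] by blast
 next
  fix p s assume a: "p:EI" "ta < s" "s <= T" "0 < z p s - v p s"
  have u0: "v p s >= 0" using nn(2)[of s p] a ta ExtI_sub[OF a(1)] by auto
  obtain ft l where f: "has_par v p s ft l" "ft = d*l - ro * v p s" using sol_v[OF S a(1), of s] a ta by auto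
  obtain ft' l' where f': "has_par z p s ft' l'" "ft' <= d*l' - ro*z p s" using pz[OF a(1-3)] a u0 by auto
  have "0 <= ro*(z p s - v p s)" "0 <= g0*(z p s - v p s)" using a pos g0_pos by simp_all
  hence "ft' - ft <= d*(l' - l) + g0*(z p s - v p s)" using f f' by (simp add: asi)
  thus "EX ft l. has_par (%p t. z p t - v p t) p s ft l & ft <= d*l + g0*(z p s - v p s)" using has_par_diff[OF f'(1) f(1)] by blast
 next
  fix p s assume a: "nr p = R" "ta < s" "s <= T" "0 < w p s - u p s"
  have u0: "u p s >= 0" using nn(1)[of s p] a ta by (auto simp: OmegaC_def)
  obtain x where x: "dn_in R (%p. u p s) p x" "D*x = nq * v p s - mq*u p s" using sol_b[OF S a(1), of s] a ta by (metis order.strict_trans1)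
  obtain x' where x': "dn_in R (%p. w p s) p x'" "D*x' <= nq*z p s - mq*w p s" using dw[OF a(1-3)] a u0 by auto
  have "D*(x' - x) <= nq*(z p s - v p s) - mq*(w p s - u p s)" using x x' by (simp add: asi)
  thus "EX x. dn_in R (%p. w p s - u p s) p x & D*x <= nq*(z p s - v p s) - mq*(w p s - u p s)" using dn_in_diff[OF x'(1) x(1)] by blast
 next
  fix p s assume a: "nr p = R" "ta < s" "s <= T" "0 < z p s - v p s"
  have u0: "v p s >= 0" using nn(2)[of s p] a ta by (auto simp: ExtC_def)
  obtain x where x: "dn_out R (%p. v p s) p x" "- d*x = mq*u p s - nq * v p s" using sol_b[OF S a(1), of s] a ta by (metis order.strict_trans1)
  obtain x' where x': "dn_out R (%p. z p s) p x'" "- d*x' <= mq*w p s - nq*z p s" using dz[OF a(1-3)] a u0 by auto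
  have "- d*(x' - x) <= mq*(w p s - u p s) - nq*(z p s - v p s)" using x x' by (simp add: asi)
  thus "EX x. dn_out R (%p. z p s - v p s) p x & - d*x <= mq*(w p s - u p s) - nq*(z p s - v p s)" using dn_out_diff[OF x'(1) x(1)] by blast
 qed (use iw iz t in auto)
 from this[of p] show ?thesis by simp
qed

text \<open>Nonnegativity of \<open>w\<close> is what \<open>g_diff_le\<close> needs, and together
  with that of \<open>z\<close> it reduces the upper bound of the differences to the bound of the
  solution.\<close>

lemma super_cmp:
 fixes u v w z :: "'m::finite pt => real => real"
 assumes adm: "admissible_data R u0 v0" and S: "sol u0 v0 u v" and ta: "0 <= ta"
  and cw: "con (OC \<times> {ta..T}) (%(p,t). w p t)"
  and cz: "con (EC \<times> {ta..T}) (%(p,t). z p t)"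
  and bw: "!!p t. p:OC ==> t:{ta..T} ==> w p t >= 0"
  and bz: "!!p t. p:EC ==> t:{ta..T} ==> z p t >= 0"
  and iw: "!!p. p:OC ==> w p ta >= u p ta"
  and iz: "!!p. p:EC ==> z p ta >= v p ta"
  and pw: "!!p t. p:OI ==> ta < t ==> t <= T ==>
   EX ft l. has_par w p t ft l & ft >= D*l + g (w p t)"
  and pz: "!!p t. p:EI ==> ta < t ==> t <= T ==>
   EX ft l. has_par z p t ft l & ft >= d*l - ro*z p t"
  and dw: "!!p t. nr p = R ==> ta < t ==> t <= T ==>
   EX x. dn_in R (%p. w p t) p x & D*x >= nq*z p t - mq*w p t"
  and dz: "!!p t. nr p = R ==> ta < t ==> t <= T ==>
   EX x. dn_out R (%p. z p t) p x & - d*x >= mq*w p t - nq*z p t"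
  and t: "t:{ta..T}"
 shows "(p:OC --> u p t <= w p t) & (p:EC --> v p t <= z p t)"
proof -
 obtain M where M: "M > 0" "!!p s. p:OC ==> s:{0..T} ==> \<bar>u p s\<bar> <= M"
  "!!p s. p:EC ==> s:{0..T} ==> \<bar>v p s\<bar> <= M" using sol_bound[OF S, of T] by metis
 have "(p:OC --> u p t - w p t <= 0) & (p:EC --> v p t - z p t <= 0)" for p
 proof (rule max_principle[where a="%p t. u p t - w p t" and b="%p t. v p t - z p t" and ta=ta and T=T and L=g0 and M=M])
  show "con (OC \<times> {ta..T}) (%(p, t). u p t - w p t)" "con (EC \<times> {ta..T}) (%(p, t). v p t - z p t)" using sol_cont[OF S ta, of T] cw cz by (auto simp: case_prod_beta intro: ci)
  show "u p s - w p s <= M" if "p:OC" "s:{ta..T}" for p s using bw[OF that] M(2)[of p s] that ta by auto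
  show "v p s - z p s <= M" if "p:EC" "s:{ta..T}" for p s using bz[OF that] M(3)[of p s] that ta by auto
 next
  fix p s assume a: "p:OI" "ta < s" "s <= T" "0 < u p s - w p s"
  have w0: "w p s >= 0" using bw[of p s] a OmegaI_sub[OF a(1)] by auto
  obtain ft l where f: "has_par u p s ft l" "ft = D*l + g (u p s)" using sol_u[OF S a(1), of s] a ta by auto
  obtain ft' l' where f': "has_par w p s ft' l'" "ft' >= D*l' + g (w p s)" using pw[OF a(1-3)] by auto
  have "ft - ft' <= D*(l - l') + g0*(u p s - w p s)" using g_diff_le[OF w0, of "u p s"] a f f' by (simp add: asi)
  thus "EX ft l. has_par (%p t. u p t - w p t) p s ft l & ft <= D*l + g0*(u p s - w p s)" using has_par_diff[OF f(1) f'(1)] by blast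
 next
  fix p s assume a: "p:EI" "ta < s" "s <= T" "0 < v p s - z p s"
  obtain ft l where f: "has_par v p s ft l" "ft = d*l - ro * v p s" using sol_v[OF S a(1), of s] a ta by auto
  obtain ft' l' where f': "has_par z p s ft' l'" "ft' >= d*l' - ro*z p s" using pz[OF a(1-3)] by auto
  have "0 <= ro*(v p s - z p s)" "0 <= g0*(v p s - z p s)" using a pos g0_pos by simp_all
  hence "ft - ft' <= d*(l - l') + g0*(v p s - z p s)" using f f' by (simp add: asi)
  thus "EX ft l. has_par (%p t. v p t - z p t) p s ft l & ft <= d*l + g0*(v p s - z p s)" using has_par_diff[OF f(1) f'(1)] by blast
 next
  fix p s assume a: "nr p = R" "ta < s" "s <= T" "0 < u p s - w p s"
  obtain x where x: "dn_in R (%p. u p s) p x" "D*x = nq * v p s - mq*u p s" using sol_b[OF S a(1), of s] a ta by (metis order.strict_trans1)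
  obtain x' where x': "dn_in R (%p. w p s) p x'" "D*x' >= nq*z p s - mq*w p s" using dw[OF a(1-3)] by auto
  have "D*(x - x') <= nq*(v p s - z p s) - mq*(u p s - w p s)" using x x' by (simp add: asi)
  thus "EX x. dn_in R (%p. u p s - w p s) p x & D*x <= nq*(v p s - z p s) - mq*(u p s - w p s)" using dn_in_diff[OF x(1) x'(1)] by blast
 next
  fix p s assume a: "nr p = R" "ta < s" "s <= T" "0 < v p s - z p s"
  obtain x where x: "dn_out R (%p. v p s) p x" "- d*x = mq*u p s - nq * v p s" using sol_b[OF S a(1), of s] a ta by (metis order.strict_trans1)
  obtain x' where x': "dn_out R (%p. z p s) p x'" "- d*x' >= mq*w p s - nq*z p s" using dz[OF a(1-3)] by auto
  have "- d*(x - x') <= mq*(u p s - w p s) - nq*(v p s - z p s)" using x x' by (simp add: asi)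
  thus "EX x. dn_out R (%p. v p s - z p s) p x & - d*x <= mq*(u p s - w p s) - nq*(v p s - z p s)" using dn_out_diff[OF x(1) x'(1)] by blast
 qed (use iw iz t in auto)
 from this[of p] show ?thesis by simp
qed

end

subsection \<open>Radial linear equations\<close>

text \<open>Radial solutions are built as power series in the spectral parameter \<open>z\<close>
  with coefficients depending on the radius only, hence are entire in \<open>z\<close>.\<close>

definition pser :: "(nat => real => real) => 'z::{real_normed_field,banach} => real => 'z" where
 "pser e z r = (\<Sum>k. e k r *R z^k)"

lemma has_real_derivative_transform:
 assumes "(f HD f') (at x within S)" "x:S" "!!y. y:S ==> g y = f y"
 shows "(g HD f') (at x within S)" using assms(1) unfolding has_field_derivative_def by (rule has_derivative_transform[OF assms(2), rotated]) (rule assms(3))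

text \<open>The relations say that \<open>d k\<close> is the derivative of \<open>e k\<close> and
  that the operator f'' + (N/r) f' sends \<open>e (Suc k)\<close> to \<open>e k\<close> and
  \<open>e 0\<close> to 0. Hence it acts on \<open>pser e z\<close> as multiplication by
  \<open>z\<close>. The factorial bounds give convergence for every \<open>z\<close>.\<close>

locale vseq =
 fixes e d :: "nat => real => real" and N :: nat and a b M B :: real
 assumes ab: "a < b" "0 <= a"
  and de: "!!k r. r:{a..b} ==> (e k HD d k r) (at r within {a..b})"
  and dd: "!!k r. r:{a..b} ==> ((%r. r^N*d (Suc k) r) HD r^N*e k r) (at r within {a..b})"
  and d0: "!!r. r:{a..b} ==> ((%r. r^N*d 0 r) HD 0) (at r within {a..b})"
  and be: "!!k r. r:{a..b} ==> \<bar>e k r\<bar> <= M*B^k/fact k"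
  and bd: "!!k r. r:{a..b} ==> \<bar>d k r\<bar> <= M*B^k/fact k"
  and cd: "!!k. con {a..b} (d k)"
begin

lemma MB: "M >= 0" using be[of a 0] ab by auto

lemma summable_bound: "summable (%k. C*(M*B^k/fact k)*Z^k)" for C Z :: real
proof -
 have "summable (%k. (C*M)*((B*Z)^k /\<^sub>R fact k))" by (intro summable_mult summable_exp_generic)
 thus ?thesis by (simp add: power_mult_distrib field_simps)
qed

lemma bound_term:
 fixes z :: "'z::real_normed_field"
 assumes "\<bar>f\<bar> <= M*B^k/fact k" "norm z <= Z"
 shows "norm (f *R z^k) <= 1*(M*B^k/fact k)*Z^k"
proof -
 have "norm (f *R z^k) = \<bar>f\<bar>*norm z^k" by (simp add: norm_power)
 also have "\<dots> <= (M*B^k/fact k)*Z^k" using assms order_trans[OF abs_ge_zero assms(1)] by (intro mult_mono power_mono) auto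
 finally show ?thesis by simp
qed

lemma summable_gen:
 fixes z :: "'z::{real_normed_field,banach}"
 assumes "!!k. \<bar>f k\<bar> <= M*B^k/fact k"
 shows "summable (%k. f k *R z^k)" by (rule summable_comparison_test'[OF summable_bound[of 1 "norm z"] bound_term[OF assms order_refl]])

lemma summable_e: "r:{a..b} ==> summable (%k. e k r *R z^k)"
 and summable_d: "r:{a..b} ==> summable (%k. d k r *R z^k)"
 for z :: "'z::{real_normed_field,banach}" by (rule summable_gen[OF be] summable_gen[OF bd]; assumption)+

lemma series_deriv:
 fixes c :: "nat => real"
 assumes f: "!!k r. r:{a..b} ==> (f k HD f' k r) (at r within {a..b})"
  and bf': "!!k r. r:{a..b} ==> \<bar>f' k r*c k\<bar> <= C*(M*B^k/fact k)*Z^k"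
  and sf: "!!r. r:{a..b} ==> summable (%k. f k r*c k)"
  and r: "r:{a..b}"
 shows "((%r. \<Sum>k. f k r*c k) HD (\<Sum>k. f' k r*c k)) (at r within {a..b})"
proof -
 have fc: "((%r. f k r*c k) HD f' k r*c k) (at r within {a..b})" if "r:{a..b}" for k r by (rule DERIV_cmult_right[OF f[OF that]])
 have "uniform_limit {a..b} (%n r. \<Sum>k<n. f' k r*c k) (%r. \<Sum>k. f' k r*c k) sequentially" by (rule Weierstrass_m_test[OF _ summable_bound]) (use bf' in auto)
 hence "EX g. ALL r:{a..b}. (%k. f k r*c k) sums g r & (g HD (\<Sum>k. f' k r*c k)) (at r within {a..b})" using has_field_derivative_series[of "{a..b}" "%k r. f k r*c k" "%k r. f' k r*c k" "%r. \<Sum>k. f' k r*c k" a, OF _ fc _ _ sf]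
   ab by simp
 then obtain g where g: "!!r. r:{a..b} ==> (%k. f k r*c k) sums g r"
  "!!r. r:{a..b} ==> (g HD (\<Sum>k. f' k r*c k)) (at r within {a..b})" by blast
 show ?thesis by (rule has_real_derivative_transform[OF g(2)[OF r] r]) (use g(1) in \<open>auto simp: sums_iff\<close>)
qed

text \<open>\<open>HD\<close> concerns real functions only; \<open>l\<close> stands for the
  identity, the real part or the imaginary part, so each formula is proved once for all
  three.\<close>

context
 fixes l :: "'z::{real_normed_field,banach} => real"
 assumes l: "bounded_linear l"
begin

lemma l_pser_e: "r:{a..b} ==> l (pser e z r) = (\<Sum>k. e k r*l (z^k))"
 and l_pser_d: "r:{a..b} ==> l (pser d z r) = (\<Sum>k. d k r*l (z^k))"
 and summable_le: "r:{a..b} ==> summable (%k. e k r*l (z^k))"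
 and summable_ld: "r:{a..b} ==> summable (%k. d k r*l (z^k))" using bounded_linear.suminf[OF l summable_e[of r z]] bounded_linear.suminf[OF l summable_d[of r z]]
  bounded_linear.summable[OF l summable_e[of r z]] bounded_linear.summable[OF l summable_d[of r z]] by (simp_all add: pser_def linear_cmul[OF bounded_linear.linear[OF l]])

lemma bound_l: "EX C>=0. ALL k z. \<bar>l (z^k)\<bar> <= C*norm z^k" using bounded_linear.nonneg_bounded[OF l] by (metis norm_power mult.commute real_norm_def)

lemma pser_deriv_e:
 assumes r: "r:{a..b}"
 shows "((%r. l (pser e z r)) HD l (pser d z r)) (at r within {a..b})"
proof -
 obtain C where C: "C >= 0" "!!k. \<bar>l (z^k)\<bar> <= C*norm z^k" using bound_l by blast
 have "((%r. \<Sum>k. e k r*l (z^k)) HD (\<Sum>k. d k r*l (z^k))) (at r within {a..b})"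
 proof (rule series_deriv[OF de _ summable_le r])
  fix k r assume r: "r:{a..b}"
  show "\<bar>d k r*l (z^k)\<bar> <= C*(M*B^k/fact k)*norm z^k" using mult_mono[OF bd[OF r, of k] C(2)[of k]] bd[OF r, of k] by (simp add: abs_mult mult_ac)
 qed auto
 thus ?thesis unfolding l_pser_d[OF r] by (rule has_real_derivative_transform[OF _ r l_pser_e])
qed

lemma pser_deriv_d:
 assumes r: "r:{a..b}"
 shows "((%r. r^N*l (pser d z r)) HD r^N*l (z*pser e z r)) (at r within {a..b})"
proof -
 obtain C where C: "C >= 0" "!!k. \<bar>l (z^k)\<bar> <= C*norm z^k" using bound_l by blast
 define f where "f = (%k r. r^N*d k r)"
 define f' where "f' = (%k r. case k of 0 => 0 | Suc j => r^N*e j r)"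
 have b0: "0 <= b" using ab by simp
 \<comment> \<open>The term of index 0 is annihilated, so differentiation shifts the index by one
   and a factor \<open>z\<close> comes out.\<close>
 have "((%r. \<Sum>k. f (Suc k) r*l (z^Suc k)) HD (\<Sum>k. r^N*e k r*l (z^Suc k))) (at r within {a..b})"
 proof (rule series_deriv[OF _ _ _ r])
  fix k r assume r: "r:{a..b}"
  show "(f (Suc k) HD r^N*e k r) (at r within {a..b})" using dd[OF r] by (simp add: f_def)
  have "\<bar>r^N*e k r\<bar> <= b^N*(M*B^k/fact k)" unfolding abs_mult using r ab b0 be[OF r, of k] by (intro mult_mono) (auto simp: power_mono)
  hence "\<bar>r^N*e k r*l (z^Suc k)\<bar> <= (b^N*(M*B^k/fact k))*(C*norm z^Suc k)" unfolding abs_mult[of _ "l _"] by (intro mult_mono[OF _ C(2)] order_trans[OF abs_ge_zero] abs_ge_zero)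
  thus "\<bar>r^N*e k r*l (z^Suc k)\<bar> <= (b^N*C*norm z)*(M*B^k/fact k)*norm z^k" by (simp add: mult_ac)
 next
  fix r assume r: "r:{a..b}"
  show "summable (%k. f (Suc k) r*l (z^Suc k))" using summable_mult[OF summable_ld[OF r, of z], of "r^N"] unfolding f_def by (subst summable_Suc_iff[of "%k. r^N*d k r*l (z^k)"]) (simp add: mult_ac)
 qed
 moreover have "((%r. f 0 r*l 1) HD 0*l 1) (at r within {a..b})" unfolding f_def by (rule DERIV_cmult_right[OF d0[OF r]])
 ultimately have S: "((%r. (\<Sum>k. f (Suc k) r*l (z^Suc k)) + f 0 r*l 1) HD (\<Sum>k. r^N*e k r*l (z^Suc k)) + 0*l 1) (at r within {a..b})" by (rule DERIV_add)
 have eq1: "r^N*l (pser d z r) = (\<Sum>k. f (Suc k) r*l (z^Suc k)) + f 0 r*l 1" if r: "r:{a..b}" for r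
 proof -
  have "r^N*l (pser d z r) = (\<Sum>k. f k r*l (z^k))" unfolding l_pser_d[OF r] f_def by (simp add: suminf_mult[OF summable_ld[OF r], symmetric] mult.assoc)
  also have "\<dots> = (\<Sum>k. f (Suc k) r*l (z^Suc k)) + f 0 r*l (z^0)"
  proof -
   have "summable (%k. f k r*l (z^k))" using summable_mult[OF summable_ld[OF r, of z], of "r^N"] by (simp add: f_def mult_ac)
   from suminf_split_head[OF this] show ?thesis by simp
  qed
  finally show ?thesis by simp
 qed
 have eq2: "r^N*l (z*pser e z r) = (\<Sum>k. r^N*e k r*l (z^Suc k))"
 proof -
  have "bounded_linear (%w. l (z*w))" using bounded_linear_compose[OF l bounded_linear_mult_right[of z]] .
  from bounded_linear.suminf[OF this summable_e[OF r]] bounded_linear.summable[OF this summable_e[OF r]]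
  have *: "l (z*pser e z r) = (\<Sum>k. e k r*l (z^Suc k))" "summable (%k. e k r*l (z^Suc k))" by (simp_all add: pser_def linear_cmul[OF bounded_linear.linear[OF l]])
  show ?thesis unfolding * by (simp only: suminf_mult[OF *(2), symmetric] mult.assoc)
 qed
 show ?thesis unfolding eq2 by (rule has_real_derivative_transform[OF _ r eq1]) (use S in simp)
qed

end

lemma continuous_pser_gen:
 assumes "!!k. con {a..b} (f k)" "!!k r. r:{a..b} ==> \<bar>f k r\<bar> <= M*B^k/fact k"
 shows "con (cball (0::'z::{real_normed_field,banach}) Z \<times> {a..b}) (%(z,r). pser f z r)"
proof -
 let ?X = "cball (0::'z) Z \<times> {a..b}"
 have "uniform_limit ?X (%n (z,r). \<Sum>k<n. f k r *R z^k) (%(z,r). \<Sum>k. f k r *R z^k) sequentially" unfolding case_prod_beta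
 proof (rule Weierstrass_m_test[OF _ summable_bound[of 1 Z]])
  fix n x assume "x:?X"
  thus "norm (f n (snd x) *R fst x^n) <= 1*(M*B^n/fact n)*Z^n" using bound_term[OF assms(2)[of "snd x" n], of "fst x" Z] by auto
 qed
 moreover have "con ?X (%(z,r). \<Sum>k<n. f k r *R z^k)" for n unfolding case_prod_beta by (intro ci continuous_on_compose2[OF assms(1)]) auto
 ultimately show ?thesis unfolding pser_def by (intro uniform_limit_theorem[OF always_eventually]) auto
qed

lemma continuous_pser_e: "con (cball (0::'z::{real_normed_field,banach}) Z \<times> {a..b}) (%(z,r). pser e z r)" by (rule continuous_pser_gen[OF _ be]) (auto intro!: DERIV_continuous_on de)

lemma continuous_pser_d: "con (cball (0::'z::{real_normed_field,banach}) Z \<times> {a..b}) (%(z,r). pser d z r)" by (rule continuous_pser_gen[OF cd bd])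

lemma holomorphic_pser_e: "r:{a..b} ==> (%z. pser e z r) holomorphic_on A"
 and holomorphic_pser_d: "r:{a..b} ==> (%z. pser d z r) holomorphic_on A"
proof -
 have *: "(%z. pser f z r) holomorphic_on A" if "!!z::complex. summable (%k. f k r *R z^k)" for f
 proof -
  have "!!z::complex. summable (%k. of_real (f k r)*z^k)" using that by (simp add: scaleR_conv_of_real)
  from termdiffs_strong_converges_everywhere[OF this]
  show ?thesis unfolding pser_def scaleR_conv_of_real by (auto simp: holomorphic_on_def field_differentiable_def intro: has_field_derivative_at_within)
 qed
 show "r:{a..b} ==> (%z. pser e z r) holomorphic_on A" by (rule *[OF summable_e])
 show "r:{a..b} ==> (%z. pser d z r) holomorphic_on A" by (rule *[OF summable_d])
qed

lemma pser_ge: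
 assumes "r:{a..b}" "z >= (0::real)"
 shows "(!!k. e k r >= 0) ==> pser e z r >= e 0 r" "(!!k. d k r >= 0) ==> pser d z r >= d 0 r"
proof -
 have *: "(\<Sum>k. f k *R z^k) >= f 0" if "summable (%k. f k *R z^k)" "!!k. f k >= 0" for f using sum_le_suminf[OF that(1), of "{0}"] that(2) assms(2) by simp
 show "(!!k. e k r >= 0) ==> pser e z r >= e 0 r" "(!!k. d k r >= 0) ==> pser d z r >= d 0 r" unfolding pser_def by (rule *[OF summable_e[OF assms(1)]] *[OF summable_d[OF assms(1)]]; simp)+
qed

end

lemma pser_of_real: "(!!z::real. summable (%k. e k r *R z^k)) ==> pser e (complex_of_real z) r = complex_of_real (pser e z r)" unfolding pser_def by (subst bounded_linear.suminf[OF bounded_linear_of_real]) (auto simp: scaleR_conv_of_real)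

text \<open>In \<open>N + 1\<close> variables the Laplacian maps r^(2k+2) to (2k+2)(2k+1+N) r^(2k);
  the products of these factors are the denominators of a modified Bessel function of the first kind
  normalised to 1 at the origin.\<close>

fun cI :: "nat => nat => real" where
 "cI N 0 = 1"
| "cI N (Suc k) = cI N k*(2*(real k + 1)*(2*real k + 1 + real N))"

definition eI :: "nat => nat => real => real" where "eI N k r = r^(2*k)/cI N k"
definition dI :: "nat => nat => real => real" where "dI N k r = 2*real k*r^(2*k - 1)/cI N k"

lemma cI_ge: "cI N k >= fact k"
proof (induction k)
 case (Suc k)
 have "fact (Suc k) = fact k*(real k + 1)" by (simp add: asi)
 also have "\<dots> <= cI N k*(2*(real k + 1)*(2*real k + 1 + real N))"
 proof (intro mult_mono Suc.IH)
  show "real k + 1 <= 2*(real k + 1)*(2*real k + 1 + real N)" by (rule order_trans[OF _ mult_mono[of "real k + 1" "2*(real k + 1)" 1]]) auto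
  show "0 <= cI N k" using Suc.IH by (rule order_trans[rotated]) simp
 qed auto
 finally show ?case by simp
qed simp

lemma cI_pos: "cI N k > 0" using cI_ge[of k N] fact_gt_zero[of k] by (smt (verit))

lemma dI_Suc: "dI N (Suc k) r = r^(2*k + 1)/(cI N k*(2*real k + 1 + real N))"
proof -
 define q where "q = 2*(real k + 1)"
 have "dI N (Suc k) r = (q*r^(2*k + 1))/(q*(cI N k*(2*real k + 1 + real N)))" unfolding dI_def cI.simps q_def by (intro arg_cong2[of _ _ _ _ "(/)"]) (simp_all add: mult_ac)
 also have "\<dots> = r^(2*k + 1)/(cI N k*(2*real k + 1 + real N))" by (rule mult_divide_mult_cancel_left) (simp add: q_def)
 finally show ?thesis .
qed

lemma vseq_I: "b > 0 ==> vseq (eI N) (dI N) N 0 b 1 ((1 + b)^2)"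
proof
 fix k r assume b: "b > 0" and r: "r:{0..b}"
 show "(eI N k HD dI N k r) (at r within {0..b})" unfolding eI_def dI_def using cI_pos[of N k] by (auto intro!: dei)
 have c: "cI N k ~= 0" "2*real k + 1 + real N ~= 0" using cI_pos[of N k] by auto
 have "((%r. r^(N + 2*k + 1)/(cI N k*(2*real k + 1 + real N))) HD
  real (N + 2*k + 1)*r^(N + 2*k)/(cI N k*(2*real k + 1 + real N))) (at r within {0..b})" by (auto intro!: dei simp: c simp del: power_Suc)
 moreover have "real (N + 2*k + 1)*r^(N + 2*k)/(cI N k*(2*real k + 1 + real N)) = r^N*eI N k r"
 proof -
  define Q where "Q = 2*real k + 1 + real N"
  have "real (N + 2*k + 1) = Q" by (simp add: Q_def)
  thus ?thesis using c unfolding Q_def[symmetric] by (simp add: eI_def power_add)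
 qed
 moreover have "(%r. r^(N + 2*k + 1)/(cI N k*(2*real k + 1 + real N))) = (%r. r^N*dI N (Suc k) r)" unfolding dI_Suc by (simp add: power_add mult_ac)
 ultimately show "((%r. r^N*dI N (Suc k) r) HD r^N*eI N k r) (at r within {0..b})" by simp
 have pw: "r^m <= ((1 + b)^2)^k" "0 <= r^m" if "m <= 2*k" for m
 proof -
  have "r^m <= (1 + b)^m" using r b by (intro power_mono) auto
  also have "\<dots> <= (1 + b)^(2*k)" using b that by (intro power_increasing) auto
  finally show "r^m <= ((1 + b)^2)^k" by (simp add: power_mult)
  show "0 <= r^m" using r by simp
 qed
 have "r^(2*k)/cI N k <= ((1 + b)^2)^k/fact k" by (intro frac_le pw cI_ge order_refl) auto
 thus "\<bar>eI N k r\<bar> <= 1*((1 + b)^2)^k/fact k" using r cI_pos[of N k] by (simp add: eI_def)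
 show "\<bar>dI N k r\<bar> <= 1*((1 + b)^2)^k/fact k"
 proof (cases k)
  case (Suc j)
  have "fact k = fact j*(real j + 1)" unfolding Suc by (simp add: asi)
  also have "\<dots> <= cI N j*(2*real j + 1 + real N)" by (intro mult_mono cI_ge) (auto intro: less_imp_le cI_pos)
  finally have "r^(2*j + 1)/(cI N j*(2*real j + 1 + real N)) <= ((1 + b)^2)^k/fact k" by (intro frac_le pw) (auto simp: Suc)
  thus ?thesis unfolding Suc dI_Suc using r cI_pos[of N j] by (simp add: abs_mult)
 qed (simp add: dI_def)
next
 fix k assume "b > 0"
 show "con {0..b} (dI N k)" unfolding dI_def by (intro ci) (use cI_pos[of N k] in simp)
qed (auto simp: dI_def)

lemma eI_nonneg: "r >= 0 ==> eI N k r >= 0" and dI_nonneg: "r >= 0 ==> dI N k r >= 0" using cI_pos[of N k] by (auto simp: eI_def dI_def)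

lemma integral_nonneg_gen:
 fixes f :: "real => real"
 assumes "!!x. x:S ==> 0 <= f x"
 shows "0 <= integral S f" using assms integral_nonneg[of f S] not_integrable_integral[of f S] by (cases "f integrable_on S") auto

context
 fixes R :: real and N :: nat and f0 f1 :: "real => real"
begin

text \<open>Picard iterates for data given at \<open>R\<close>: starting from a function annihilated
  by the radial operator, each term is obtained from the previous one by inverting the operator with
  zero data at \<open>R\<close>.\<close>

fun eX dX :: "nat => real => real" where
 "eX 0 = f0"
| "dX 0 = f1"
| "dX (Suc k) = (%r. integral {R..r} (%s. s^N*eX k s)/r^N)"
| "eX (Suc k) = (%r. integral {R..r} (dX (Suc k)))"

lemma vseq_X:
 assumes R: "0 < R" "R < b"
  and f0: "!!r. r:{R..b} ==> (f0 HD f1 r) (at r within {R..b})"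
  and f1: "!!r. r:{R..b} ==> ((%r. r^N*f1 r) HD 0) (at r within {R..b})"
  and cf1: "con {R..b} f1"
  and M: "!!r. r:{R..b} ==> \<bar>f0 r\<bar> <= M & \<bar>f1 r\<bar> <= M"
 shows "vseq eX dX N R b M ((1 + (b - R))^2)"
proof -
 have M0: "M >= 0" using M[of R] R by auto
 let ?B = "1 + (b - R)"
 have cont: "con {R..b} (eX k)" for k
 proof (induction k)
  case 0
  have "con {R..b} f0" using f0 by (rule DERIV_continuous_on)
  thus ?case by simp
 next
  case (Suc k)
  have "con {R..b} (%r. integral {R..r} (%s. s^N*eX k s))" by (intro indefinite_integral_continuous_1 integrable_continuous_interval ci Suc.IH)
  hence "con {R..b} (dX (Suc k))" using R by (auto intro!: ci)
  thus ?case by (auto simp del: dX.simps intro!: indefinite_integral_continuous_1 integrable_continuous_interval)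
 qed
 have contd: "con {R..b} (dX k)" for k
 proof (cases k)
  case 0 thus ?thesis using cf1 by simp
 next
  case (Suc j)
  have "con {R..b} (%r. integral {R..r} (%s. s^N*eX j s))" by (intro indefinite_integral_continuous_1 integrable_continuous_interval ci cont)
  thus ?thesis unfolding Suc using R by (auto intro!: ci)
 qed
 have step: "\<bar>dX (Suc k) r\<bar> <= C*(r - R)^Suc k/fact (Suc k) & \<bar>eX (Suc k) r\<bar> <= ?B*C*(r - R)^Suc k/fact (Suc k)"
  if C: "!!s. s:{R..b} ==> \<bar>eX k s\<bar> <= C*(s - R)^k/fact k" and r: "r:{R..b}" for k C r
 proof -
  have d: "\<bar>dX (Suc k) r\<bar> <= C*(r - R)^Suc k/fact (Suc k)" if r: "r:{R..b}" for r
  proof -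
   have hi: "((%s. C*(s - R)^k/fact k) has_integral C*(r - R)^Suc k/fact (Suc k) - C*(R - R)^Suc k/fact (Suc k)) {R..r}"
   proof (rule fundamental_theorem_of_calculus)
   fix s
   have "((%s. C*(s - R)^Suc k/fact (Suc k)) HD C*(real (Suc k)*(s - R)^k)/fact (Suc k)) (at s within {R..r})" by (auto intro!: dei simp del: power_Suc fact_Suc of_nat_Suc)
   moreover have "C*(real (Suc k)*(s - R)^k)/fact (Suc k) = C*(s - R)^k/fact k" by (simp add: fact_Suc del: of_nat_Suc)
   ultimately show "((%s. C*(s - R)^Suc k/fact (Suc k)) has_vector_derivative C*(s - R)^k/fact k) (at s within {R..r})" by (simp only: has_real_derivative_iff_has_vector_derivative)
   qed (use r in auto)
   have c: "con {R..r} (%s. s^N*eX k s)" using r by (auto intro!: ci continuous_on_subset[OF cont])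
   have "norm (integral {R..r} (%s. s^N*eX k s)) <= integral {R..r} (%s. r^N*(C*(s - R)^k/fact k))"
   proof (rule integral_norm_bound_integral)
   show "(%s. s^N*eX k s) integrable_on {R..r}" by (rule integrable_continuous_interval[OF c])
   show "(%s. r^N*(C*(s - R)^k/fact k)) integrable_on {R..r}" using has_integral_mult_right[OF hi] by (rule has_integral_integrable)
   fix s assume s: "s:{R..r}"
   have "\<bar>s^N*eX k s\<bar> <= r^N*(C*(s - R)^k/fact k)" unfolding abs_mult using s r R C[of s] by (intro mult_mono) (auto intro: power_mono)
   thus "norm (s^N*eX k s) <= r^N*(C*(s - R)^k/fact k)" by simp
   qed
   also have "\<dots> = r^N*(C*(r - R)^Suc k/fact (Suc k))" using integral_unique[OF has_integral_mult_right[OF hi, of "r^N"]] by (simp del: power_Suc fact_Suc)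
   finally have *: "\<bar>integral {R..r} (%s. s^N*eX k s)\<bar> <= r^N*(C*(r - R)^Suc k/fact (Suc k))" by simp
   have "r^N > 0" using r R by simp
   thus ?thesis using * by (simp add: abs_div pos_divide_le_eq mult.commute del: power_Suc fact_Suc)
  qed
  have "\<bar>eX (Suc k) r\<bar> <= (C*(r - R)^Suc k/fact (Suc k))*(r - R)"
  proof -
   have mono: "C*(s - R)^Suc k/fact (Suc k) <= C*(r - R)^Suc k/fact (Suc k)" if "s:{R..r}" for s
   proof -
   have "C >= 0"
   proof -
   have "0 <= C*(b - R)^k/fact k" using C[of b] R by (smt (verit) atLeastAtMost_iff)
   moreover have "(b - R)^k/fact k > 0" using R by simp
   ultimately show ?thesis by (metis mult_le_cancel_right times_divide_eq_right mult_zero_left not_less)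
   qed
   thus ?thesis using that by (intro divide_right_mono mult_left_mono power_mono) auto
   qed
   have "norm (integral {R..r} (dX (Suc k))) <= (C*(r - R)^Suc k/fact (Suc k))*(r - R)"
   proof (rule integral_bound)
   show "con {R..r} (dX (Suc k))" using r by (intro continuous_on_subset[OF contd]) auto
   show "norm (dX (Suc k) s) <= C*(r - R)^Suc k/fact (Suc k)" if "s:{R..r}" for s using d[of s] mono[OF that] that r by (simp del: power_Suc fact_Suc dX.simps)
   qed (use r in auto)
   thus ?thesis by simp
  qed
  also have "\<dots> <= (C*(r - R)^Suc k/fact (Suc k))*?B" using d[OF r] r by (intro mult_left_mono) (auto simp del: power_Suc fact_Suc dX.simps)
  finally show ?thesis using d[OF r] by (simp add: mult_ac del: power_Suc fact_Suc dX.simps eX.simps)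
 qed
 have bnd: "\<bar>eX k r\<bar> <= (M*?B^k)*(r - R)^k/fact k" if "r:{R..b}" for k r using that
 proof (induction k arbitrary: r)
  case 0 thus ?case using M by simp
 next
  case (Suc k)
  from step[OF Suc.IH Suc.prems] show ?case by (simp add: mult_ac del: eX.simps dX.simps fact_Suc)
 qed
 have pw: "(M*?B^k)*(r - R)^k/fact k <= M*(?B^2)^k/fact k" if "r:{R..b}" for k r
 proof -
  have "(r - R)^k <= ?B^k" using that by (intro power_mono) auto
  hence "(M*?B^k)*(r - R)^k <= (M*?B^k)*?B^k" using M0 R by (intro mult_left_mono) auto
  also have "\<dots> = M*(?B^2)^k" by (simp add: power2_eq_square power_mult_distrib mult_ac)
  finally show ?thesis by (intro divide_right_mono) auto
 qed
 show ?thesis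
 proof
  fix k r assume r: "r:{R..b}"
  show "(eX k HD dX k r) (at r within {R..b})"
  proof (cases k)
   case 0 thus ?thesis using f0[OF r] by simp
  next
   case (Suc j) thus ?thesis using integral_has_real_derivative[OF contd r] by (simp del: dX.simps)
  qed
  have "((%r. integral {R..r} (%s. s^N*eX k s)) HD r^N*eX k r) (at r within {R..b})" by (rule integral_has_real_derivative[OF _ r]) (intro ci cont)
  moreover have "r'^N*dX (Suc k) r' = integral {R..r'} (%s. s^N*eX k s)" if "r':{R..b}" for r' using that R by simp
  ultimately show "((%r. r^N*dX (Suc k) r) HD r^N*eX k r) (at r within {R..b})" by (rule has_real_derivative_transform[OF _ r])
  show "\<bar>eX k r\<bar> <= M*(?B^2)^k/fact k" using bnd[OF r] pw[OF r] by (rule order_trans)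
  show "\<bar>dX k r\<bar> <= M*(?B^2)^k/fact k"
  proof (cases k)
   case 0 thus ?thesis using M[OF r] by simp
  next
   case (Suc j)
   have "\<bar>dX (Suc j) r\<bar> <= (M*?B^j)*(r - R)^Suc j/fact (Suc j)" using step[OF bnd r] by blast
   also have "\<dots> <= (M*?B^Suc j)*(r - R)^Suc j/fact (Suc j)" using M0 R r by (intro divide_right_mono mult_right_mono mult_left_mono power_increasing) auto
   also have "\<dots> <= M*(?B^2)^Suc j/fact (Suc j)" by (rule pw[OF r])
   finally show ?thesis unfolding Suc .
  qed
 next
  fix r assume r: "r:{R..b}"
  show "((%r. r^N*dX 0 r) HD 0) (at r within {R..b})" using f1[OF r] by simp
 qed (use R contd in auto)
qed

lemma eX_nonneg:
 assumes "0 < R" "!!r. r >= R ==> f0 r >= 0"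
 shows "r >= R ==> eX k r >= 0 & dX (Suc k) r >= 0"
proof (induction k arbitrary: r)
 case 0
 thus ?case using assms by (auto intro!: divide_nonneg_nonneg integral_nonneg_gen)
next
 case (Suc k)
 have "eX (Suc k) r >= 0" if "r >= R" for r unfolding eX.simps by (rule integral_nonneg_gen) (use Suc.IH in \<open>auto simp del: dX.simps\<close>)
 thus ?case using Suc.prems assms by (auto intro!: divide_nonneg_nonneg integral_nonneg_gen simp del: eX.simps)
qed

end

text \<open>The equation is given for the flux \<open>r^N * w1\<close>, which is regular at the
  centre. L'Hospital for the quotient of this flux and \<open>r^Suc N\<close> shows that
  \<open>w1 r / r\<close> tends to \<open>Q 0\<close> divided by the dimension, the common limit
  that \<open>radial_C2\<close> requires.\<close>

lemma radial_ode_C2: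
 fixes S :: "'a::euclidean_space set" and w w1 Q :: "real => real"
 assumes S: "open S" and N: "N + 1 = DIM('a)"
  and w: "!!y. y:S ==> y ~= 0 ==> (w HD w1 (norm y)) (at (norm y))"
  and w1: "!!y. y:S ==> y ~= 0 ==> ((%r. r^N*w1 r) HD norm y^N*Q (norm y)) (at (norm y))"
  and Q: "!!y. y:S ==> y ~= 0 ==> isCont Q (norm y)"
  and z0: "0:S ==> (Q \<longlongrightarrow> Q 0) (at_right 0) & ((%r. r^N*w1 r) \<longlongrightarrow> 0) (at_right 0) & (w HD 0) (at_right 0)"
 shows "C2_on S (%y. w (norm y))" and "y:S ==> has_lap (%y. w (norm y)) y (Q (norm y))"
proof -
 define w2 where "w2 = (%r. Q r - real N*(w1 r/r))"
 have w1d: "(w1 HD w2 (norm y)) (at (norm y))" if y: "y:S" "y ~= 0" for y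
 proof -
  let ?r = "norm y"
  have r: "?r ~= 0" using y by simp
  have "((%r. (r^N*w1 r)/r^N) HD
   (?r^N*Q ?r*?r^N - (?r^N*w1 ?r)*(real N*?r^(N - 1)))/(?r^N*?r^N)) (at ?r)" using r by (intro DERIV_divide w1 y) (auto intro!: dei)
  moreover have "(?r^N*Q ?r*?r^N - (?r^N*w1 ?r)*(real N*?r^(N - 1)))/(?r^N*?r^N) = w2 ?r"
  proof (cases N)
   case 0 thus ?thesis by (simp add: w2_def)
  next
   case (Suc k)
   thus ?thesis using r by (simp add: w2_def field_simps)
  qed
  moreover have "\<forall>\<^sub>F s in nhds ?r. (s^N*w1 s)/s^N = w1 s" using t1_space_nhds[OF r] by eventually_elim simp
  ultimately show ?thesis using DERIV_cong_ev[OF refl _ refl] by fastforce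
 qed
 have w2c: "isCont w2 (norm y)" if y: "y:S" "y ~= 0" for y unfolding w2_def using y by (intro ci Q DERIV_isCont[OF w1d]) auto
 have lim: "((%r. w1 r/r) \<longlongrightarrow> Q 0/DIM('a)) (at_right 0)" if 0: "0:S"
 proof -
  obtain e where e: "e > 0" "ball 0 e \<subseteq> S" using S 0 open_contains_ball by blast
  have ev: "\<forall>\<^sub>F r in at_right 0. 0 < r & r < e" using e by (auto simp: eventually_at_right[OF e(1)])
  obtain b :: 'a where b: "b:Basis" by (meson nonempty_Basis ex_in_conv)
  have inS: "r *R b:S & r *R b ~= 0 & norm (r *R b) = r" if "0 < r" "r < e" for r using that e(2) b nonzero_Basis[OF b] by (auto simp: subset_eq)
  have "((%r. (r^N*w1 r)/r^Suc N) \<longlongrightarrow> Q 0/DIM('a)) (at_right 0)"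
  proof (rule lhopital_right_0[where f' = "%r. r^N*Q r" and g' = "%r. real (Suc N)*r^N"])
   show "((%r. r^N*w1 r) \<longlongrightarrow> 0) (at_right 0)" using z0[OF 0] by simp
   have "((%r::real. r^Suc N) \<longlongrightarrow> 0^Suc N) (at_right 0)" by (intro tendsto_intros)
   thus "((%r::real. r^Suc N) \<longlongrightarrow> 0) (at_right 0)" by simp
   show "\<forall>\<^sub>F r in at_right 0. r^Suc N ~= (0::real)" using ev by eventually_elim simp
   show "\<forall>\<^sub>F r in at_right 0. real (Suc N)*r^N ~= 0" using ev by eventually_elim simp
   show "\<forall>\<^sub>F r in at_right 0. ((%r. r^N*w1 r) HD r^N*Q r) (at r)" using ev
   proof eventually_elim
   case (elim r) thus ?case using w1[of "r *R b"] inS[of r] by auto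
   qed
   show "\<forall>\<^sub>F r in at_right 0. ((%r. r^Suc N) HD real (Suc N)*r^N) (at r)" by (intro always_eventually allI) (auto intro!: dei simp del: power_Suc)
   have "((%r. Q r/DIM('a)) \<longlongrightarrow> Q 0/DIM('a)) (at_right 0)" using z0[OF 0] by (intro tendsto_intros) auto
   thus "((%r. r^N*Q r/(real (Suc N)*r^N)) \<longlongrightarrow> Q 0/DIM('a)) (at_right 0)"
   proof (rule Lim_transform_eventually)
   show "\<forall>\<^sub>F r in at_right 0. Q r/DIM('a) = r^N*Q r/(real (Suc N)*r^N)" using ev by eventually_elim (simp flip: N)
   qed
  qed
  thus ?thesis
  proof (rule Lim_transform_eventually)
   show "\<forall>\<^sub>F r in at_right 0. (r^N*w1 r)/r^Suc N = w1 r/r" using ev by eventually_elim simp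
  qed
 qed
 have lim2: "(w2 \<longlongrightarrow> Q 0/DIM('a)) (at_right 0)" if 0: "0:S"
 proof -
  have "(w2 \<longlongrightarrow> Q 0 - real N*(Q 0/DIM('a))) (at_right 0)" unfolding w2_def using z0[OF 0] by (intro tendsto_intros lim 0) auto
  also have "Q 0 - real N*(Q 0/DIM('a)) = Q 0/DIM('a)" by (simp add: field_simps flip: N)
  finally show ?thesis .
 qed
 have zz: "0:S ==> (w HD 0) (at_right 0)" using z0 by simp
 show "C2_on S (%y. w (norm y))" by (rule radial_C2(1)[OF S, of w w1 w2 "Q 0/DIM('a)"]) (auto intro: w w1d w2c lim lim2 zz)
 show "has_lap (%y. w (norm y)) y (Q (norm y))" if y: "y:S"
 proof (cases "y = 0")
  case True
  have "has_lap (%y. w (norm y)) (0::'a) (real DIM('a)*(Q 0/DIM('a)))" by (rule radial_C2(3)[OF S, of w w1 w2]) (use True y in \<open>auto intro: w w1d w2c lim lim2 zz\<close>)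
  thus ?thesis using True by simp
 next
  case False
  have "w2 (norm y) + (real DIM('a) - 1)/norm y*w1 (norm y) = Q (norm y)" by (simp add: w2_def flip: N)
  moreover have "has_lap (%y. w (norm y)) y (w2 (norm y) + (real DIM('a) - 1)/norm y*w1 (norm y))" by (rule radial_C2(2)[OF S, of w w1 w2 "Q 0/DIM('a)"]) (use False y in \<open>auto intro: w w1d w2c lim lim2 zz\<close>)
  ultimately show ?thesis by simp
 qed
qed

text \<open>The solution of f'' + (N/r) f' = z f with value 1 and slope 0 at the origin; for
  negative real \<open>z\<close> it is the oscillating Bessel profile.\<close>

definition phi :: "nat => 'z::{real_normed_field,banach} => real => 'z" where "phi N = pser (eI N)"
definition phi' :: "nat => 'z::{real_normed_field,banach} => real => 'z" where "phi' N = pser (dI N)"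

lemma at_within_Icc_inside: "a < r ==> r < b ==> at r within {a..b} = at r" for r :: real by (rule at_within_interior) simp

context
 fixes l :: "'z::{real_normed_field,banach} => real"
 assumes l: "bounded_linear l"
begin

lemma phi_deriv: "r > 0 ==> ((%r. l (phi N z r)) HD l (phi' N z r)) (at r)" using vseq.pser_deriv_e[OF vseq_I[of "r + 1"] l, where r=r and z=z] unfolding phi_def phi'_def by (auto simp: at_within_Icc_inside)

lemma phi'_deriv: "r > 0 ==> ((%r. r^N*l (phi' N z r)) HD r^N*l (z*phi N z r)) (at r)" using vseq.pser_deriv_d[OF vseq_I[of "r + 1"] l, where r=r and z=z] unfolding phi_def phi'_def by (auto simp: at_within_Icc_inside)

end

lemma phi'_0: "phi' N z 0 = 0"
proof -
 have "dI N k 0 = 0" for k by (cases k) (auto simp: dI_def)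
 thus ?thesis by (simp add: phi'_def pser_def)
qed

lemma phi_0: "phi N z 0 = 1"
proof -
 have "eI N k 0 *R z^k = (if k = 0 then 1 else 0)" for k by (cases k) (auto simp: eI_def)
 hence "(%k. eI N k 0 *R z^k) = (%k. if k = 0 then 1 else 0)" by (intro ext)
 thus ?thesis using suminf_finite[of "{0}" "%k. if k = 0 then 1 else (0::'a)"] by (simp add: phi_def pser_def)
qed

lemma phi_deriv0:
 assumes l: "bounded_linear l"
 shows "((%r. l (phi N z r)) HD 0) (at_right 0)"
proof -
 have "l (phi' N z 0) = 0" using linear_0[OF bounded_linear.linear[OF l]] by (simp add: phi'_0)
 thus ?thesis using vseq.pser_deriv_e[OF vseq_I[of 1 N] l, where r=0 and z=z] by (simp add: phi_def phi'_def at_within_Icc_at_right)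
qed

lemma phi_cont: "con (cball (0::'z::{real_normed_field,banach}) Z \<times> {0..b}) (%(z,r). phi N z r)" if "b > 0" unfolding phi_def by (rule vseq.continuous_pser_e[OF vseq_I[OF that]])

lemma phi'_cont: "con (cball (0::'z::{real_normed_field,banach}) Z \<times> {0..b}) (%(z,r). phi' N z r)" if "b > 0" unfolding phi'_def by (rule vseq.continuous_pser_d[OF vseq_I[OF that]])

lemma phi_cont_r: "con {0..b} (phi N z)" "con {0..b} (phi' N z)" if "b > 0"
proof -
 have "con {0..b} (%r. (%(z,r). phi N z r) (z, r))" by (rule continuous_on_compose2[OF phi_cont[OF that, of "norm z"]]) (auto intro!: ci)
 thus "con {0..b} (phi N z)" by simp
 have "con {0..b} (%r. (%(z,r). phi' N z r) (z, r))" by (rule continuous_on_compose2[OF phi'_cont[OF that, of "norm z"]]) (auto intro!: ci)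
 thus "con {0..b} (phi' N z)" by simp
qed

lemma phi_holo: "r >= 0 ==> (%z. phi N z r) holomorphic_on A" "r >= 0 ==> (%z. phi' N z r) holomorphic_on A" unfolding phi_def phi'_def
 using vseq.holomorphic_pser_e[OF vseq_I[of "r + 1"], of r] vseq.holomorphic_pser_d[OF vseq_I[of "r + 1"], of r] by auto

lemma phi_of_real: "r >= 0 ==> phi N (complex_of_real z) r = of_real (phi N z r)"
  "r >= 0 ==> phi' N (complex_of_real z) r = of_real (phi' N z r)" unfolding phi_def phi'_def using vseq.summable_e[OF vseq_I[of "r + 1"], of r] vseq.summable_d[OF vseq_I[of "r + 1"], of r] by (auto intro!: pser_of_real)

lemma phi_ge: "r >= 0 ==> z >= 0 ==> phi N z r >= (1::real)" "r >= 0 ==> z >= 0 ==> phi' N z r >= (0::real)" unfolding phi_def phi'_def using vseq.pser_ge[OF vseq_I[of "r + 1"], of r z] eI_nonneg dI_nonneg by (auto simp: eI_def dI_def)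

text \<open>The constant 1 and the primitive of r^(-N) span the kernel of the radial operator; they
  start the two series.\<close>

definition fX :: "real => nat => bool => real => real" where
 "fX R N i r = (if i then 1 else integral {R..r} (%s. 1/s^N))"
definition gX :: "nat => bool => real => real" where
 "gX N i r = (if i then 0 else 1/r^N)"
text \<open>At \<open>R\<close> the solution indexed by \<open>True\<close> has value 1 and slope 0, the other one value 0 and slope \<open>1 / R^N\<close>.\<close>

definition vx :: "real => nat => bool => 'z::{real_normed_field,banach} => real => 'z" where
 "vx R N i = pser (eX R N (fX R N i) (gX N i))"
definition vx' :: "real => nat => bool => 'z::{real_normed_field,banach} => real => 'z" where
 "vx' R N i = pser (dX R N (fX R N i) (gX N i))"

lemma vseq_vx:
 assumes R: "0 < R" "R < b"
 shows "EX M. vseq (eX R N (fX R N i) (gX N i)) (dX R N (fX R N i) (gX N i)) N R b M ((1 + (b - R))^2)"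
proof -
 have f0: "(fX R N i HD gX N i r) (at r within {R..b})" if r: "r:{R..b}" for r
 proof (cases i)
  case True
  hence "fX R N i = (%_. 1)" by (intro ext) (simp add: fX_def)
  thus ?thesis using True by (simp add: gX_def)
 next
  case False
  have "con {R..b} (%s. 1/s^N)" using R by (intro ci) auto
  moreover have "fX R N i = (%r. integral {R..r} (%s. 1/s^N))" using False by (intro ext) (simp add: fX_def)
  ultimately show ?thesis using integral_has_real_derivative[OF _ r] False by (simp add: gX_def)
 qed
 have f1: "((%r. r^N*gX N i r) HD 0) (at r within {R..b})" if r: "r:{R..b}" for r
 proof -
  have "((%r. if i then 0 else 1) HD 0) (at r within {R..b})" by simp
  thus ?thesis by (rule has_real_derivative_transform[OF _ r]) (use R in \<open>auto simp: gX_def\<close>)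
 qed
 have c1: "con {R..b} (gX N i)" unfolding gX_def using R by (cases i) (auto intro!: ci)
 have c0: "con {R..b} (fX R N i)" by (rule DERIV_continuous_on[OF f0])
 have "bounded (fX R N i ` {R..b})" "bounded (gX N i ` {R..b})" by (auto intro!: compact_imp_bounded compact_continuous_image c0 c1)
 then obtain A B where "!!x. x:{R..b} ==> \<bar>fX R N i x\<bar> <= A" "!!x. x:{R..b} ==> \<bar>gX N i x\<bar> <= B" unfolding bounded_iff by (metis imageI real_norm_def)
 hence "!!r. r:{R..b} ==> \<bar>fX R N i r\<bar> <= max A B & \<bar>gX N i r\<bar> <= max A B" by (meson max.coboundedI1 max.coboundedI2)
 from vseq_X[OF R f0 f1 c1 this] show ?thesis by blast
qed

context
 fixes R :: real
 assumes R: "R > 0"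
begin

lemma vx_deriv_within:
 assumes l: "bounded_linear l" and r: "r:{R..b}" "R < b"
 shows "((%r. l (vx R N i z r)) HD l (vx' R N i z r)) (at r within {R..b})"
  "((%r. r^N*l (vx' R N i z r)) HD r^N*l (z * vx R N i z r)) (at r within {R..b})" using vseq_vx[OF R r(2), of N i] vseq.pser_deriv_e[OF _ l r(1)] vseq.pser_deriv_d[OF _ l r(1)] unfolding vx_def vx'_def by blast+

lemma vx_deriv:
 assumes l: "bounded_linear l" and r: "r > R"
 shows "((%r. l (vx R N i z r)) HD l (vx' R N i z r)) (at r)"
  "((%r. r^N*l (vx' R N i z r)) HD r^N*l (z * vx R N i z r)) (at r)" using vx_deriv_within[OF l, of r "r + 1"] r by (simp_all add: at_within_Icc_inside)

lemma vx_deriv_R: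
 assumes l: "bounded_linear l"
 shows "((%r. l (vx R N i z r)) HD l (vx' R N i z R)) (at_right R)" using vx_deriv_within[OF l, of R "R + 1"] by (simp_all add: at_within_Icc_at_right)

lemma vx_cont:
 assumes "R < b"
 shows "con (cball (0::'z::{real_normed_field,banach}) Z \<times> {R..b}) (%(z,r). vx R N i z r)"
  "con (cball (0::'z::{real_normed_field,banach}) Z \<times> {R..b}) (%(z,r). vx' R N i z r)" using vseq_vx[OF R assms, of N i] vseq.continuous_pser_e vseq.continuous_pser_d unfolding vx_def vx'_def by blast+

lemma vx_holo: "r >= R ==> (%z. vx R N i z r) holomorphic_on A" "r >= R ==> (%z. vx' R N i z r) holomorphic_on A" unfolding vx_def vx'_def
 using vseq_vx[OF R, of "r + 1" N i] vseq.holomorphic_pser_e[of _ _ _ R "r + 1" _ _ r] vseq.holomorphic_pser_d[of _ _ _ R "r + 1" _ _ r] by fastforce+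

lemma vx_of_real: "r >= R ==> vx R N i (complex_of_real z) r = of_real (vx R N i z r)"
  "r >= R ==> vx' R N i (complex_of_real z) r = of_real (vx' R N i z r)" unfolding vx_def vx'_def using vseq_vx[OF R, of "r + 1" N i] vseq.summable_e[of _ _ _ R "r + 1" _ _ r] vseq.summable_d[of _ _ _ R "r + 1" _ _ r]
 by (auto intro!: pser_of_real simp del: real_scaleR_def)

lemma vx_R: "vx R N i z R = (if i then 1 else 0)" "vx' R N i z R = (if i then 0 else of_real (1/R^N))"
proof -
 have "eX R N (fX R N i) (gX N i) k R *R z^k = (if k = 0 then (if i then 1 else 0) else 0)" for k by (cases k) (auto simp: fX_def)
 hence "(%k. eX R N (fX R N i) (gX N i) k R *R z^k) = (%k. if k = 0 then (if i then 1 else 0) else 0)" by (intro ext)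
 thus "vx R N i z R = (if i then 1 else 0)" using suminf_finite[of "{0}" "%k. if k = 0 then (if i then 1 else 0) else (0::'a)"] by (simp add: vx_def pser_def)
 have "dX R N (fX R N i) (gX N i) k R *R z^k = (if k = 0 then (if i then 0 else of_real (1/R^N)) else 0)" for k by (cases k) (auto simp: gX_def scaleR_conv_of_real)
 hence "(%k. dX R N (fX R N i) (gX N i) k R *R z^k) = (%k. if k = 0 then (if i then 0 else of_real (1/R^N)) else 0)" by (intro ext)
 thus "vx' R N i z R = (if i then 0 else of_real (1/R^N))" using suminf_finite[of "{0}" "%k. if k = 0 then (if i then 0 else of_real (1/R^N)) else (0::'a)"] by (simp add: vx'_def pser_def)
qed

lemma vx_ge: "r >= R ==> z >= 0 ==> vx R N i z r >= (0::real)" "r >= R ==> z >= 0 ==> vx R N True z r >= (1::real)"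
proof -
 assume r: "r >= R" and z: "z >= 0"
 have f0: "fX R N i s >= 0" if "s >= R" for s i using that R by (auto simp: fX_def intro!: integral_nonneg_gen)
 have *: "vx R N i z r >= fX R N i r" for i
 proof -
  obtain M where M: "vseq (eX R N (fX R N i) (gX N i)) (dX R N (fX R N i) (gX N i)) N R (r + 1) M ((1 + (r + 1 - R))^2)" using vseq_vx[OF R, of "r + 1"] r by auto
  show ?thesis unfolding vx_def using vseq.pser_ge(1)[OF M, of r z] eX_nonneg[OF R f0 r] r z by auto
 qed
 show "vx R N i z r >= 0" using *[of i] f0[OF r, of i] by linarith
 show "vx R N True z r >= 1" using *[of True] by (simp add: fX_def)
qed

end

subsection \<open>The radial steady state\<close>

text \<open>\<open>rint2\<close> inverts the radial Laplacian among functions with value and slope 0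
  at the origin, and \<open>rint\<close> is its derivative. At \<open>r = 0\<close> the quotient
  evaluates to 0, which is also its limit for continuous \<open>w\<close>.\<close>

definition rint :: "nat => (real => real) => real => real" where
 "rint N w r = integral {0..r} (%s. s^N*w s)/r^N"
definition rint2 :: "nat => (real => real) => real => real" where
 "rint2 N w r = integral {0..r} (rint N w)"

context
 fixes N :: nat and b te :: real
 assumes b: "b > 0" and th: "te > 0"
begin

text \<open>In the norm weighted by \<open>exp (te * s)\<close> each integration costs a factor
  1/te, so a large \<open>te\<close> yields a contraction on an interval of any length.\<close>

lemma rint_bound:
 assumes w: "con {0..b} w" "!!s. s:{0..b} ==> \<bar>w s\<bar> <= C*exp (te * s)" and r: "r:{0..b}" and C: "C >= 0"
 shows "\<bar>rint N w r\<bar> <= C*exp (te*r)/te" "\<bar>rint N w r\<bar> <= C*exp (te*r)*r"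
proof -
 have c: "con {0..r} (%s. s^N*w s)" using r by (intro ci continuous_on_subset[OF w(1)]) auto
 have hi: "((%s. r^N*(C*exp (te * s))) has_integral r^N*(C*exp (te*r)/te - C*exp (te*0)/te)) {0..r}" using r th by (intro has_integral_mult_right fundamental_theorem_of_calculus)
   (auto intro!: dei simp: has_real_derivative_iff_has_vector_derivative[symmetric])
 have "norm (integral {0..r} (%s. s^N*w s)) <= integral {0..r} (%s. r^N*(C*exp (te * s)))"
 proof (rule integral_norm_bound_integral)
  fix s assume s: "s:{0..r}"
  have "\<bar>s^N*w s\<bar> <= r^N*(C*exp (te * s))" unfolding abs_mult using s r w(2)[of s] by (intro mult_mono) (auto intro: power_mono)
  thus "norm (s^N*w s) <= r^N*(C*exp (te * s))" by simp
 qed (use hi in \<open>auto intro: integrable_continuous_interval[OF c]\<close>)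
 also have "\<dots> = r^N*(C*exp (te*r)/te - C/te)" unfolding integral_unique[OF hi] by simp
 also have "\<dots> <= r^N*(C*exp (te*r)/te)" using r C th by (intro mult_left_mono) auto
 finally have 1: "\<bar>integral {0..r} (%s. s^N*w s)\<bar> <= r^N*(C*exp (te*r)/te)" by simp
 have "norm (integral {0..r} (%s. s^N*w s)) <= (r^N*(C*exp (te*r)))*(r - 0)"
 proof (rule integral_bound[OF _ c])
  fix s assume s: "s:{0..r}"
  have "C*exp (te * s) <= C*exp (te*r)" using s C th by (intro mult_left_mono) auto
  hence "\<bar>s^N*w s\<bar> <= r^N*(C*exp (te*r))" unfolding abs_mult using s r w(2)[of s] by (intro mult_mono) (auto intro: power_mono)
  thus "norm (s^N*w s) <= r^N*(C*exp (te*r))" by simp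
 qed (use r in auto)
 hence 2: "\<bar>integral {0..r} (%s. s^N*w s)\<bar> <= r^N*(C*exp (te*r)*r)" by (simp add: mult_ac)
 show "\<bar>rint N w r\<bar> <= C*exp (te*r)/te" "\<bar>rint N w r\<bar> <= C*exp (te*r)*r"
 proof -
  have z: "rint N w 0 = 0" by (simp add: rint_def)
  have p: "r^N > 0" if "r ~= 0" using r that by simp
  show "\<bar>rint N w r\<bar> <= C*exp (te*r)/te" using 1 p C th z by (cases "r = 0") (auto simp: rint_def abs_div pos_divide_le_eq mult.commute)
  show "\<bar>rint N w r\<bar> <= C*exp (te*r)*r" using 2 p C th z by (cases "r = 0") (auto simp: rint_def abs_div pos_divide_le_eq mult.commute)
 qed
qed

lemma rint_cont:
 assumes w: "con {0..b} w"
 shows "con {0..b} (rint N w)"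
proof -
 have "bounded (w ` {0..b})" using w by (intro compact_imp_bounded compact_continuous_image) auto
 then obtain C where C: "!!s. s:{0..b} ==> \<bar>w s\<bar> <= C" unfolding bounded_iff by (metis imageI real_norm_def)
 have C0: "C >= 0" using C[of 0] b by auto
 have C': "\<bar>w s\<bar> <= C*exp (te * s)" if "s:{0..b}" for s
 proof -
  have "C*1 <= C*exp (te * s)" using that C0 th by (intro mult_left_mono) auto
  thus ?thesis using C[OF that] by simp
 qed
 have cint: "con {0..b} (%r. integral {0..r} (%s. s^N*w s))" by (intro indefinite_integral_continuous_1 integrable_continuous_interval ci w)
 show ?thesis unfolding continuous_on_eq_continuous_within
 proof
  fix r assume r: "r:{0..b}"
  show "continuous (at r within {0..b}) (rint N w)"
  proof (cases "r = 0")
   case False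
   thus ?thesis unfolding rint_def using cint r by (intro ci) (auto simp: continuous_on_eq_continuous_within)
  next
   case True
   have "((%x. C*exp (te*x)*x) \<longlongrightarrow> C*exp (te*0)*0) (at 0 within {0..b})" by (intro tendsto_intros)
   hence t: "((%x. C*exp (te*x)*x) \<longlongrightarrow> 0) (at 0 within {0..b})" by simp
   have "(rint N w \<longlongrightarrow> 0) (at 0 within {0..b})" by (rule Lim_null_comparison[OF _ t])
   (use rint_bound(2)[OF w C' _ C0] in \<open>auto simp: eventually_at_filter\<close>)
   thus ?thesis unfolding True continuous_within by (simp add: rint_def)
  qed
 qed
qed

lemma rint2_bound:
 assumes w: "con {0..b} w" "!!s. s:{0..b} ==> \<bar>w s\<bar> <= C*exp (te * s)" and r: "r:{0..b}" and C: "C >= 0"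
 shows "\<bar>rint2 N w r\<bar> <= C*exp (te*r)/te^2"
proof -
 have hi: "((%s. C*exp (te * s)/te) has_integral (C*exp (te*r)/te^2 - C*exp (te*0)/te^2)) {0..r}" using r th by (intro fundamental_theorem_of_calculus)
   (auto intro!: dei simp: has_real_derivative_iff_has_vector_derivative[symmetric] power2_eq_square)
 have "norm (integral {0..r} (rint N w)) <= integral {0..r} (%s. C*exp (te * s)/te)"
 proof (rule integral_norm_bound_integral)
  show "rint N w integrable_on {0..r}" using r by (intro integrable_continuous_interval continuous_on_subset[OF rint_cont[OF w(1)]]) auto
  show "norm (rint N w s) <= C*exp (te * s)/te" if "s:{0..r}" for s using rint_bound(1)[OF w _ C, of s] that r by simp
 qed (use hi in auto)
 also have "\<dots> <= C*exp (te*r)/te^2" unfolding integral_unique[OF hi] using C by simp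
 finally show ?thesis by (simp add: rint2_def)
qed

lemma rint_diff:
 assumes "con {0..b} w" "con {0..b} v" "r:{0..b}"
 shows "rint N w r - rint N v r = rint N (%s. w s - v s) r" "rint2 N w r - rint2 N v r = rint2 N (%s. w s - v s) r"
proof -
 have *: "rint N w r - rint N v r = rint N (%s. w s - v s) r" if "r:{0..b}" for r
 proof -
  have "integral {0..r} (%s. s^N*w s) - integral {0..r} (%s. s^N * v s) = integral {0..r} (%s. s^N*w s - s^N * v s)" using that by (intro integral_diff[symmetric] integrable_continuous_interval ci)
   (auto intro: continuous_on_subset[OF assms(1)] continuous_on_subset[OF assms(2)])
  thus ?thesis by (simp add: rint_def diff_divide_distrib[symmetric] right_diff_distrib)
 qed
 show "rint N w r - rint N v r = rint N (%s. w s - v s) r" by (rule *[OF assms(3)])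
 have "rint2 N w r - rint2 N v r = integral {0..r} (%s. rint N w s - rint N v s)" unfolding rint2_def using assms(3) by (intro integral_diff[symmetric] integrable_continuous_interval)
   (auto intro: continuous_on_subset[OF rint_cont[OF assms(1)]] continuous_on_subset[OF rint_cont[OF assms(2)]])
 also have "\<dots> = rint2 N (%s. w s - v s) r" unfolding rint2_def by (rule integral_cong) (use * assms(3) in auto)
 finally show "rint2 N w r - rint2 N v r = rint2 N (%s. w s - v s) r" .
qed

end

text \<open>A fixed point iteration carried out for all central values \<open>a\<close>
  simultaneously: shooting needs continuous dependence on \<open>a\<close> of the solution and of
  its slope. That zeros of \<open>f\<close> give constant solutions provides one end of the shooting
  interval.\<close>

lemma radial_ivp:
 fixes f :: "real => real" and N :: nat
 assumes L: "!!x y. \<bar>f x - f y\<bar> <= L*\<bar>x - y\<bar>" "L > 0" and b: "b > 0"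
 obtains U U1 :: "real => real => real" and K where
  "!!a. U a 0 = a" "!!a. U1 a 0 = 0"
  "!!a r. r:{0..b} ==> (U a HD U1 a r) (at r within {0..b})"
  "!!a r. r:{0..b} ==> ((%r. r^N*U1 a r) HD - (r^N*f (U a r))) (at r within {0..b})"
  "!!a. con {0..b} (U1 a)"
  "!!a c r. r:{0..b} ==> \<bar>U a r - U c r\<bar> <= K*\<bar>a - c\<bar> & \<bar>U1 a r - U1 c r\<bar> <= K*\<bar>a - c\<bar>"
  "!!a r. f a = 0 ==> r:{0..b} ==> U a r = a & U1 a r = 0"
proof -
 \<comment> \<open>Two integrations then give the contraction factor
   \<open>L / te^2 = 1/2\<close>.\<close>
 define te where "te = sqrt (2*L)"
 have th: "te > 0" "te^2 = 2*L" using L by (auto simp: te_def)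
 have fc: "con A f" for A
 proof (rule continuous_at_imp_continuous_on, rule ballI)
  fix x
  have "((%y. L*\<bar>y - x\<bar>) \<longlongrightarrow> L*\<bar>x - x\<bar>) (at x)" by (intro tendsto_intros)
  hence t: "((%y. L*\<bar>y - x\<bar>) \<longlongrightarrow> 0) (at x)" by simp
  have "((%y. f y - f x) \<longlongrightarrow> 0) (at x)" by (rule Lim_null_comparison[OF _ t]) (use L(1) in auto)
  thus "isCont f x" by (simp add: isCont_def LIM_zero_iff)
 qed
 note bnd2 = rint2_bound[OF b th(1)] and bnd1 = rint_bound(1)[OF b th(1)] and rc = rint_cont[OF b th(1)]
  and rd = rint_diff[OF b th(1)]
 define u where "u = (%a k. ((%w r. a - rint2 N (%s. f (w s)) r) ^^ k) (%_. a))"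
 have u0: "u a 0 = (%_. a)" and uS: "u a (Suc k) = (%r. a - rint2 N (%s. f (u a k s)) r)" for a k by (auto simp: u_def)
 have r2c: "con {0..b} (rint2 N w)" if "con {0..b} w" for w unfolding rint2_def by (intro indefinite_integral_continuous_1 integrable_continuous_interval rc that)
 have uc: "con {0..b} (u a k)" for a k
 proof (induction k)
  case 0 thus ?case by (simp add: u0)
 next
  case (Suc k) thus ?case unfolding uS by (intro ci r2c continuous_on_compose2[OF fc[of UNIV]]) auto
 qed
 have fuc: "con {0..b} (%s. f (w s))" if "con {0..b} w" for w by (intro continuous_on_compose2[OF fc[of UNIV]] that) auto
 have contr: "\<bar>rint2 N (%s. f (w s)) r - rint2 N (%s. f (v s)) r\<bar> <= C/2*exp (te*r)
   & \<bar>rint N (%s. f (w s)) r - rint N (%s. f (v s)) r\<bar> <= L*C/te*exp (te*r)"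
  if w: "con {0..b} w" and v: "con {0..b} v"
   and C: "!!s. s:{0..b} ==> \<bar>w s - v s\<bar> <= C*exp (te * s)" and r: "r:{0..b}" and C0: "C >= 0" for w v C r
 proof -
  have *: "\<bar>f (w s) - f (v s)\<bar> <= (L*C)*exp (te * s)" if "s:{0..b}" for s using order_trans[OF L(1) mult_left_mono[OF C[OF that], of L]] L(2) by (simp add: mult_ac)
  have c: "con {0..b} (%s. f (w s) - f (v s))" by (intro ci fuc w v)
  have LC: "L*C >= 0" using L C0 by simp
  have eq: "(L*C)*exp (te*r)/te^2 = C/2*exp (te*r)" unfolding th(2) using L by simp
  show ?thesis using bnd2[OF c * r LC, unfolded eq] bnd1[OF c * r LC] unfolding rd[OF fuc[OF w] fuc[OF v] r] by simp
 qed
 have ucauchy: "EX C>=0. ALL k. ALL r:{0..b}. \<bar>u a (Suc k) r - u a k r\<bar> <= C*(1/2)^k*exp (te*r)" for a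
 proof (intro exI conjI allI ballI)
  show "\<bar>f a\<bar>/te^2 >= 0" by simp
  fix k r assume r: "r:{0..b}"
  show "\<bar>u a (Suc k) r - u a k r\<bar> <= \<bar>f a\<bar>/te^2*(1/2)^k*exp (te*r)" using r
  proof (induction k arbitrary: r)
   case 0
   have "\<bar>f a\<bar>*1 <= \<bar>f a\<bar>*exp (te * s)" if "s:{0..b}" for s using that th by (intro mult_left_mono) auto
   hence "\<bar>rint2 N (%s. f a) r\<bar> <= \<bar>f a\<bar>*exp (te*r)/te^2" using 0 by (intro bnd2) auto
   thus ?case by (simp add: u0 uS)
  next
   case (Suc k)
   have "\<bar>rint2 N (%s. f (u a (Suc k) s)) r - rint2 N (%s. f (u a k s)) r\<bar> <= (\<bar>f a\<bar>/te^2*(1/2)^k)/2*exp (te*r)" using contr[OF uc uc Suc.IH Suc.prems] by simp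
   thus ?case unfolding uS[of a "Suc k"] uS[of a k] by (simp add: abs_minus_commute uS)
  qed
 qed
 define U where "U = (%a r. lim (%k. u a k r))"
 have ulim: "uniform_limit {0..b} (u a) (U a) sequentially" for a
 proof -
  obtain C where C: "C >= 0" "!!k r. r:{0..b} ==> \<bar>u a (Suc k) r - u a k r\<bar> <= C*(1/2)^k*exp (te*r)" using ucauchy by meson
  have "uniformly_convergent_on {0..b} (%n r. \<Sum>k<n. u a (Suc k) r - u a k r)"
  proof (rule Weierstrass_m_test')
   show "summable (%k. C*exp (te*b)*(1/2::real)^k)" by (intro summable_mult summable_geometric) simp
   fix n r assume r: "r:{0..b}"
   have "C*(1/2)^n*exp (te*r) <= C*(1/2)^n*exp (te*b)" using r C th by (intro mult_left_mono) auto
   thus "norm (u a (Suc n) r - u a n r) <= C*exp (te*b)*(1/2)^n" using C(2)[OF r, of n] by (simp add: mult_ac)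
  qed
  then obtain l where l: "uniform_limit {0..b} (%n r. \<Sum>k<n. u a (Suc k) r - u a k r) l sequentially" by (auto simp: uniformly_convergent_on_def)
  have "(\<Sum>k<n. u a (Suc k) r - u a k r) = u a n r - a" for n r by (subst sum_lessThan_telescope) (simp add: u0)
  with l have "uniform_limit {0..b} (%n r. u a n r - a) l sequentially" by simp
  hence "uniform_limit {0..b} (%n r. (u a n r - a) + a) (%r. l r + a) sequentially" by (intro uniform_limit_intros)
  hence l2: "uniform_limit {0..b} (u a) (%r. l r + a) sequentially" by simp
  have "U a r = l r + a" if "r:{0..b}" for r using tendsto_uniform_limitI[OF l2 that] by (simp add: U_def limI)
  thus ?thesis using uniform_limit_cong'[of "{0..b}" "u a" "u a" "U a" "%r. l r + a"] l2 by simp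
 qed
 have Uc: "con {0..b} (U a)" for a by (rule uniform_limit_theorem[OF always_eventually ulim]) (auto intro: uc)
 have eq: "U a r = a - rint2 N (%s. f (U a s)) r" if r: "r:{0..b}" for a r
 proof -
  have "(%k. rint2 N (%s. f (u a k s)) r) \<longlonglongrightarrow> rint2 N (%s. f (U a s)) r"
  proof (rule tendstoI)
   fix e :: real assume e: "e > 0"
   have E: "exp (te*r) > 0" by simp
   have "\<forall>\<^sub>F k in sequentially. ALL s:{0..b}. dist (u a k s) (U a s) < e/exp (te*r)" using ulim[of a] e unfolding uniform_limit_iff by simp
   thus "\<forall>\<^sub>F k in sequentially. dist (rint2 N (%s. f (u a k s)) r) (rint2 N (%s. f (U a s)) r) < e"
   proof eventually_elim
   case (elim k)
   have "\<bar>u a k s - U a s\<bar> <= e/exp (te*r)*exp (te * s)" if "s:{0..b}" for s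
   proof -
   have "e/exp (te*r)*1 <= e/exp (te*r)*exp (te * s)" using that th e by (intro mult_left_mono) auto
   moreover have "\<bar>u a k s - U a s\<bar> < e/exp (te*r)" using elim that by (simp add: dist_real_def)
   ultimately show ?thesis by linarith
   qed
   from contr[OF uc Uc this r] show ?case using e by (simp add: dist_real_def)
   qed
  qed
  hence "(%k. u a (Suc k) r) \<longlonglongrightarrow> a - rint2 N (%s. f (U a s)) r" unfolding uS by (intro tendsto_intros)
  moreover have "(%k. u a (Suc k) r) \<longlonglongrightarrow> U a r" using tendsto_uniform_limitI[OF ulim r] by (rule LIMSEQ_Suc)
  ultimately show ?thesis by (rule LIMSEQ_unique[symmetric])
 qed
 define U1 where "U1 = (%a r. - rint N (%s. f (U a s)) r)"
 \<comment> \<open>The factor 1/2 makes this bound reproduce itself: the data contribute one \<bar>a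
   - c\<bar>, the previous iterate another.\<close>
 have lipu: "\<bar>u a k r - u c k r\<bar> <= 2*\<bar>a - c\<bar>*exp (te*r)" if "r:{0..b}" for a c k r using that
 proof (induction k arbitrary: r)
  case 0
  have "2*\<bar>a - c\<bar>*1 <= 2*\<bar>a - c\<bar>*exp (te*r)" using 0 th by (intro mult_left_mono) auto
  thus ?case by (simp add: u0)
 next
  case (Suc k)
  have "\<bar>rint2 N (%s. f (u a k s)) r - rint2 N (%s. f (u c k s)) r\<bar> <= \<bar>a - c\<bar>*exp (te*r)" using contr[OF uc uc Suc.IH Suc.prems] by simp
  moreover have "\<bar>a - c\<bar>*1 <= \<bar>a - c\<bar>*exp (te*r)" using Suc.prems th by (intro mult_left_mono) auto
  moreover have "\<bar>x - y\<bar> <= E ==> \<bar>a - c\<bar>*1 <= E ==> \<bar>(a - x) - (c - y)\<bar> <= 2*E" for x y E by (simp add: abs_le_iff)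
  ultimately show ?case unfolding uS by (metis mult.assoc)
 qed
 have lipU: "\<bar>U a r - U c r\<bar> <= 2*\<bar>a - c\<bar>*exp (te*r)" if r: "r:{0..b}" for a c r
 proof (rule tendsto_upperbound)
  show "(%k. \<bar>u a k r - u c k r\<bar>) \<longlonglongrightarrow> \<bar>U a r - U c r\<bar>" by (intro tendsto_intros tendsto_uniform_limitI[OF ulim r])
 qed (use lipu[OF r] in auto)
 have lipU1: "\<bar>U1 a r - U1 c r\<bar> <= L*(2*\<bar>a - c\<bar>)/te*exp (te*r)" if r: "r:{0..b}" for a c r using contr[OF Uc Uc lipU r, of a c] by (simp add: U1_def abs_minus_commute)
 define K where "K = max (2*exp (te*b)) (2*L/te*exp (te*b))"
 have eb: "exp (te*r) <= exp (te*b)" if "r:{0..b}" for r using that th by auto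
 show ?thesis
 proof (rule that[of U U1 K])
  show "U a 0 = a" for a using eq[of 0 a] b by (simp add: rint2_def)
  show "U1 a 0 = 0" for a by (simp add: U1_def rint_def)
  show "(U a HD U1 a r) (at r within {0..b})" if r: "r:{0..b}" for a r
  proof -
   have "((%r. a - rint2 N (%s. f (U a s)) r) HD 0 - rint N (%s. f (U a s)) r) (at r within {0..b})" unfolding rint2_def by (intro DERIV_diff DERIV_const integral_has_real_derivative rc fuc Uc r)
   thus ?thesis unfolding U1_def by (intro has_real_derivative_transform[OF _ r eq]) auto
  qed
  show "((%r. r^N*U1 a r) HD - (r^N*f (U a r))) (at r within {0..b})" if r: "r:{0..b}" for a r
  proof (rule has_real_derivative_transform[OF _ r])
   show "((%r. - integral {0..r} (%s. s^N*f (U a s))) HD - (r^N*f (U a r))) (at r within {0..b})" by (intro DERIV_minus integral_has_real_derivative r ci fuc Uc)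
   show "y^N*U1 a y = - integral {0..y} (%s. s^N*f (U a s))" if "y:{0..b}" for y using that by (cases "y = 0") (auto simp: U1_def rint_def)
  qed
  show "con {0..b} (U1 a)" for a unfolding U1_def by (intro ci rc fuc Uc)
  show "\<bar>U a r - U c r\<bar> <= K*\<bar>a - c\<bar> & \<bar>U1 a r - U1 c r\<bar> <= K*\<bar>a - c\<bar>" if r: "r:{0..b}" for a c r
  proof
   have "2*\<bar>a - c\<bar>*exp (te*r) <= 2*\<bar>a - c\<bar>*exp (te*b)" using eb[OF r] by (intro mult_left_mono) auto
   also have "\<dots> = (2*exp (te*b))*\<bar>a - c\<bar>" by simp
   also have "\<dots> <= K*\<bar>a - c\<bar>" unfolding K_def by (intro mult_right_mono) auto
   finally show "\<bar>U a r - U c r\<bar> <= K*\<bar>a - c\<bar>" using lipU[OF r, of a c] by linarith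
   have "L*(2*\<bar>a - c\<bar>)/te*exp (te*r) <= L*(2*\<bar>a - c\<bar>)/te*exp (te*b)" using eb[OF r] L th by (intro mult_left_mono) auto
   also have "\<dots> = (2*L/te*exp (te*b))*\<bar>a - c\<bar>" by simp
   also have "\<dots> <= K*\<bar>a - c\<bar>" unfolding K_def by (intro mult_right_mono) auto
   finally show "\<bar>U1 a r - U1 c r\<bar> <= K*\<bar>a - c\<bar>" using lipU1[OF r, of a c] by linarith
  qed
  show "U a r = a & U1 a r = 0" if "f a = 0" "r:{0..b}" for a r
  proof -
   have uk: "u a k r = a" for k r
   proof (induction k arbitrary: r)
   case (Suc k) thus ?case using that(1) by (simp add: uS rint2_def rint_def[abs_def])
   qed (simp add: u0)
   hence U: "U a r = a" for r by (simp add: U_def)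
   thus ?thesis using that(1) by (simp add: U1_def rint_def)
  qed
 qed
qed

text \<open>Uniform continuity on the compact product turns positivity on all of \<open>K\<close>
  into an open condition on the parameter.\<close>

lemma pos_open:
 fixes f :: "'z::metric_space => 'k::metric_space => real"
 assumes A: "compact A" and K: "compact K" and c: "con (A \<times> K) (%(z,r). f z r)"
  and z0: "z0:A" and p: "!!r. r:K ==> f z0 r > 0"
 shows "EX e>0. ALL z:A. dist z z0 < e --> (ALL r:K. f z r > 0)"
proof (cases "K = {}")
 case False
 have "con K (%r. (%(z,r). f z r) (z0, r))" by (rule continuous_on_compose2[OF c]) (use z0 in \<open>auto intro!: ci\<close>)
 then obtain r0 where r0: "r0:K" "!!r. r:K ==> f z0 r0 <= f z0 r" using continuous_attains_inf[OF K False, of "%r. f z0 r"] by auto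
 have "uniformly_continuous_on (A \<times> K) (%(z,r). f z r)" by (intro compact_uniformly_continuous c compact_Times A K)
 then obtain e where e: "e > 0" "!!x y. x:A \<times> K ==> y:A \<times> K ==> dist y x < e ==>
   dist ((%(z,r). f z r) y) ((%(z,r). f z r) x) < f z0 r0" using p[OF r0(1)] unfolding uniformly_continuous_on_def by metis
 show ?thesis
 proof (intro exI[of _ e] conjI e(1) ballI impI)
  fix z r assume z: "z:A" "dist z z0 < e" and r: "r:K"
  have "dist (z, r) (z0, r) < e" using z by (simp add: dist_Pair_Pair)
  from e(2)[OF _ _ this] z r z0 have "dist (f z r) (f z0 r) < f z0 r0" by auto
  thus "f z r > 0" using r0(2)[OF r] by (simp add: dist_real_def)
 qed
qed (auto intro: exI[of _ 1])

text \<open>Lagrange's identity in flux form: the mixed products cancel and only the zeroth-order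
  terms survive. All comparisons of two radial equations rest on it.\<close>

lemma wronskian_deriv:
 assumes "(u HD u1 r) (at r within S)" "((%r. r^N*u1 r) HD r^N*a) (at r within S)"
  "(v HD v1 r) (at r within S)" "((%r. r^N * v1 r) HD r^N*b) (at r within S)"
 shows "((%r. r^N*(u1 r * v r - u r * v1 r)) HD r^N*(a * v r - u r*b)) (at r within S)"
proof -
 have "((%r. (r^N*u1 r) * v r - u r*(r^N * v1 r)) HD
   (r^N*a * v r + v1 r*(r^N*u1 r)) - (u1 r*(r^N * v1 r) + r^N*b*u r)) (at r within S)" by (intro DERIV_diff DERIV_mult assms)
 thus ?thesis by (simp add: asi)
qed

text \<open>\<open>F\<close> is typically \<open>r^N\<close> times a derivative or a Wronskian.
  Positivity of \<open>q\<close> near the centre alone makes the decrease strict.\<close>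

lemma flux_neg:
 fixes F q :: "real => real"
 assumes c: "con {0..b} F" and F0: "F 0 = 0"
  and d: "!!r. 0 < r ==> r < b ==> (F HD - (r^N*q r)) (at r)"
  and q: "!!r. 0 < r ==> r < b ==> q r >= 0" and e: "e > 0" "!!r. 0 < r ==> r < e ==> q r > 0"
  and r: "0 < r" "r <= b"
 shows "F r < 0"
proof -
 define s where "s = min r e/2"
 have s: "0 < s" "s < r" "s < e" using r e by (auto simp: s_def)
 have "F s < F 0"
 proof (rule DERIV_neg_imp_decreasing_open[OF s(1)])
  fix x assume x: "0 < x" "x < s"
  have "x^N*q x > 0" using x s e by simp
  thus "EX y. (F HD y) (at x) & y < 0" using d[of x] x s r by (intro exI[of _ "- (x^N*q x)"]) auto
 qed (use c s r in \<open>auto intro: continuous_on_subset\<close>)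
 moreover have "F r <= F s"
 proof (rule DERIV_nonpos_imp_decreasing_open[of s r F])
  show "s <= r" using s by simp
  fix x assume x: "s < x" "x < r"
  have "x^N*q x >= 0" using x s q[of x] r by (intro mult_nonneg_nonneg) auto
  thus "EX y. (F HD y) (at x) & y <= 0" using d[of x] x s r by (intro exI[of _ "- (x^N*q x)"]) auto
 qed (use c s r in \<open>auto intro: continuous_on_subset\<close>)
 ultimately show ?thesis using F0 by simp
qed

context
 fixes N :: nat
begin

text \<open>The sign is reversed against \<open>phi\<close> to match the eigenvalue problem for the
  negative Laplacian.\<close>

definition ph :: "real => real => real" where "ph l = phi N (- l)"
definition ph' :: "real => real => real" where "ph' l = phi' N (- l)"

lemma ph_deriv: "r > 0 ==> (ph l HD ph' l r) (at r)" using phi_deriv[OF bounded_linear_ident, of r N "- l"] by (simp add: ph_def ph'_def)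

lemma ph'_deriv: "r > 0 ==> ((%r. r^N*ph' l r) HD r^N*(- l*ph l r)) (at r)" using phi'_deriv[OF bounded_linear_ident, of r N "- l"] by (simp add: ph_def ph'_def)

lemma ph_0: "ph l 0 = 1" and ph'_0: "ph' l 0 = 0" by (simp_all add: ph_def ph'_def phi_0 phi'_0)

lemma ph_deriv0: "(ph l HD 0) (at_right 0)" using phi_deriv0[OF bounded_linear_ident, of N "- l"] by (simp add: ph_def)

lemma ph_cont_r: "con {0..b} (ph l)" "con {0..b} (ph' l)"
proof -
 have "con {0..max b 1} (ph l)" "con {0..max b 1} (ph' l)" using phi_cont_r[of "max b 1" N "- l"] by (simp_all add: ph_def ph'_def)
 from this[THEN continuous_on_subset, of "{0..b}"] show "con {0..b} (ph l)" "con {0..b} (ph' l)" by auto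
qed

lemma ph_cont: "b > 0 ==> con ({-Z..Z} \<times> {0..b}) (%(l,r). ph l r)"
  "b > 0 ==> con ({-Z..Z} \<times> {0..b}) (%(l,r). ph' l r)"
proof -
 assume b: "b > 0"
 have "con ({-Z..Z} \<times> {0..b}) (%z. (%(l,r). phi N l r) (- fst z, snd z))" by (rule continuous_on_compose2[OF phi_cont[OF b, of Z]]) (auto intro!: ci)
 thus "con ({-Z..Z} \<times> {0..b}) (%(l,r). ph l r)" by (simp add: ph_def case_prod_beta)
 have "con ({-Z..Z} \<times> {0..b}) (%z. (%(l,r). phi' N l r) (- fst z, snd z))" by (rule continuous_on_compose2[OF phi'_cont[OF b, of Z]]) (auto intro!: ci)
 thus "con ({-Z..Z} \<times> {0..b}) (%(l,r). ph' l r)" by (simp add: ph'_def case_prod_beta)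
qed

lemma ph_cont_l: "r >= 0 ==> con UNIV (%l. ph l r)" "r >= 0 ==> con UNIV (%l. ph' l r)"
proof -
 assume r: "r >= 0"
 have *: "isCont (%l. f l r) l" if c: "!!Z. con ({-Z..Z} \<times> {0..r+1}) (%(l,r). f l r)" for f :: "real => real => real" and l
 proof -
  have "con {-(\<bar>l\<bar>+1)..\<bar>l\<bar>+1} (%l. (%(l,r). f l r) (l, r))" by (rule continuous_on_compose2[OF c[of "\<bar>l\<bar>+1"]]) (use r in \<open>auto intro!: ci\<close>)
  moreover have "-(\<bar>l\<bar>+1) < l" "l < \<bar>l\<bar>+1" by linarith+
  ultimately show ?thesis using continuous_on_interior[of "{-(\<bar>l\<bar>+1)..\<bar>l\<bar>+1}" "%l. f l r" l] by auto
 qed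
 show "con UNIV (%l. ph l r)" "con UNIV (%l. ph' l r)" by (rule continuous_at_imp_continuous_on, rule ballI, rule *, rule ph_cont, use r in simp)+
qed

lemma ph_ge1: "l <= 0 ==> r >= 0 ==> ph l r >= 1 & ph' l r >= 0" using phi_ge[of r "- l" N] by (simp add: ph_def ph'_def)

lemma ph_near0: "EX e>0. ALL r. 0 <= r & r < e --> ph l r > 0"
proof -
 have "(ph l \<longlongrightarrow> ph l 0) (at 0 within {0..1})" using ph_cont_r(1)[of 1 l] by (auto simp: continuous_on_def)
 hence "\<forall>\<^sub>F r in at 0 within {0..1}. ph l r > 0" by (rule order_tendstoD) (simp add: ph_0)
 then obtain e where e: "e > 0" "!!r. r:{0..1} ==> r ~= 0 ==> dist r 0 < e ==> ph l r > 0" unfolding eventually_at by blast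
 have "ph l r > 0" if "0 <= r" "r < min e 1" for r using that e(2)[of r] ph_0[of l] by (cases "r = 0") auto
 thus ?thesis using e(1) by (intro exI[of _ "min e 1"]) auto
qed

lemma ph'_neg:
 assumes l: "l > 0" and p: "!!s. 0 <= s ==> s <= b ==> ph l s >= 0" and r: "0 < r" "r <= b"
 shows "ph' l r < 0"
proof -
 obtain e where e: "e > 0" "!!r. 0 <= r ==> r < e ==> ph l r > 0" using ph_near0 by blast
 have "r^N*ph' l r < 0"
 proof (rule flux_neg[where q = "%r. l*ph l r" and b=b and N=N and F = "%r. r^N*ph' l r", OF _ _ _ _ e(1) _ r])
  show "con {0..b} (%r. r^N*ph' l r)" by (intro ci ph_cont_r)
  show "((%r. r^N*ph' l r) HD - (r^N*(l*ph l r))) (at r)" if "0 < r" "r < b" for r using ph'_deriv[OF that(1), of l] by simp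
 qed (use l p e in \<open>auto simp: ph'_0\<close>)
 thus ?thesis using r by (simp add: mult_less_0_iff)
qed

lemma ph_decr:
 assumes l: "l > 0" and p: "!!s. 0 <= s ==> s <= b ==> ph l s >= 0" and r: "0 <= r" "r < s" "s <= b"
 shows "ph l s < ph l r"
proof (rule DERIV_neg_imp_decreasing_open[OF r(2)])
 show "EX y. (ph l HD y) (at x) & y < 0" if "r < x" "x < s" for x using ph_deriv[of x l] ph'_neg[OF l p, of b x] that r by (intro exI[of _ "ph' l x"]) auto
qed (use r in \<open>auto intro: continuous_on_subset[OF ph_cont_r(1)[of b]]\<close>)

text \<open>A nonnegative \<open>ph l\<close> decreases, so the flux equation can be integrated with
  \<open>ph l b\<close> as a lower bound. The estimate limits the \<open>l\<close> for which
  positivity and a Robin-type inequality can coexist.\<close>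

lemma ph_lam_bound:
 assumes l: "l > 0" and p: "!!s. 0 <= s ==> s <= b ==> ph l s >= 0" and b: "b > 0"
 shows "ph' l b <= - l*b*ph l b/real (N + 1)"
proof -
 define F where "F = (%r. r^N*ph' l r + l*ph l b*r^(N + 1)/real (N + 1))"
 have "F b <= F 0"
 proof (rule DERIV_nonpos_imp_decreasing_open[of 0 b F])
  fix x assume x: "0 < x" "x < b"
  have "((%r. l*ph l b*r^(N + 1)/real (N + 1)) HD l*ph l b*x^N) (at x)" by (auto intro!: dei simp del: power_Suc)
  hence "(F HD x^N*(- l*ph l x) + l*ph l b*x^N) (at x)" unfolding F_def by (intro DERIV_add ph'_deriv x)
  moreover have "ph l b < ph l x" using x by (intro ph_decr[OF l p]) auto
  hence "l*x^N*ph l b <= l*x^N*ph l x" using l x by (intro mult_left_mono) auto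
  hence "x^N*(- l*ph l x) + l*ph l b*x^N <= 0" by (simp add: mult_ac)
  ultimately show "EX y. (F HD y) (at x) & y <= 0" by blast
 next
  show "con {0..b} F" unfolding F_def by (intro ci ph_cont_r(2)) auto
 qed (use b in auto)
 hence "b^N*ph' l b + l*ph l b*(b^N*b)/real (N + 1) <= 0" by (simp add: F_def ph'_0 mult_ac)
 hence "b^N*(ph' l b + l*ph l b*b/real (N + 1)) <= 0" by (simp add: asi)
 hence "ph' l b + l*ph l b*b/real (N + 1) <= 0" using zero_less_power[OF b, of N] unfolding mult_le_0_iff by linarith
 thus ?thesis by (simp add: mult_ac)
qed

text \<open>In other terms, the logarithmic derivative at \<open>b\<close> is strictly decreasing in
  the parameter while the functions are positive.\<close>

lemma ph_wronskian:
 assumes p: "!!s. 0 <= s ==> s <= b ==> ph l s > 0" "!!s. 0 <= s ==> s <= b ==> ph m s > 0" and b: "b > 0" and lm: "l > m"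
 shows "ph' l b*ph m b < ph l b*ph' m b"
proof -
 define F where "F = (%r. r^N*(ph' l r*ph m r - ph l r*ph' m r))"
 have "F b < 0"
 proof (rule flux_neg[where q = "%r. (l - m)*(ph l r*ph m r)" and b=b and N=N and F=F, OF _ _ _ _ b])
  show "con {0..b} F" unfolding F_def by (intro ci ph_cont_r)
  show "(F HD - (r^N*((l - m)*(ph l r*ph m r)))) (at r)" if "0 < r" "r < b" for r using wronskian_deriv[OF ph_deriv ph'_deriv ph_deriv ph'_deriv, of r l m] that unfolding F_def by (simp add: asi)
 qed (use p lm b in \<open>auto simp: F_def ph'_0 less_imp_le\<close>)
 hence "ph' l b*ph m b - ph l b*ph' m b < 0" using b by (simp add: F_def mult_less_0_iff)
 thus ?thesis by simp
qed

end

section \<open>Robin eigenvalue and radial steady state in the cylinder\<close>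

context field_road
begin

text \<open>Take the largest \<open>l\<close> for which \<open>ph l\<close> and the Robin expression
  are both nonnegative. The set of such \<open>l\<close> is closed, bounded and contains 0. At its
  maximum the Robin expression vanishes, since otherwise all inequalities would be strict and
  persist for slightly larger \<open>l\<close>.\<close>

lemma robin_exists:
 assumes k: "k > 0"
 shows "EX l>0. (ALL r:{0..R}. ph N l r > 0) & D*ph' N l R + k*ph N l R = 0"
proof -
 \<comment> \<open>The bound that \<open>ph_lam_bound\<close> and a nonnegative Robin expression
   impose on \<open>l\<close>.\<close>
 define B where "B = (real N + 1)*k/(D * R)"
 have B0: "B > 0" using k pos by (simp add: B_def add_nonneg_pos)
 define S where "S = {l:{0..B}. (ALL r:{0..R}. ph N l r >= 0) & D*ph' N l R + k*ph N l R >= 0}"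
 have pd: "ph N l R > 0" "ALL r:{0..R}. ph N l r > 0" "l <= B"
  if l: "l >= 0" and p: "ALL r:{0..R}. ph N l r >= 0" and rb: "D*ph' N l R + k*ph N l R >= 0" for l
 proof -
  show R0: "ph N l R > 0"
  proof (cases "l = 0")
   case True thus ?thesis using ph_ge1[of l R N] pos by simp
  next
   case False
   have "ph' N l R < 0" using False l p pos by (intro ph'_neg[where b=R]) auto
   hence "D*ph' N l R < 0" using pos by (simp add: mult_pos_neg)
   hence "k*ph N l R > 0" using rb by linarith
   thus ?thesis using k by (simp add: zero_less_mult_iff)
  qed
  show "ALL r:{0..R}. ph N l r > 0"
  proof
   fix r assume r: "r:{0..R}"
   show "ph N l r > 0"
   proof (cases "l = 0 | r = R")
   case True thus ?thesis using ph_ge1[of l r N] r R0 by auto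
   next
   case False
   hence "ph N l R < ph N l r" using l p r by (intro ph_decr[where b=R]) auto
   thus ?thesis using R0 by linarith
   qed
  qed
  show "l <= B"
  proof (cases "l = 0")
   case False
   have "ph' N l R <= - l * R*ph N l R/real (N + 1)" using False l p pos by (intro ph_lam_bound) auto
   hence "D*ph' N l R <= D*(- l * R*ph N l R/real (N + 1))" using pos by (intro mult_left_mono) auto
   hence "(D*l * R/real (N + 1))*ph N l R <= k*ph N l R" using rb by (simp add: mult_ac)
   hence "D*l * R/real (N + 1) <= k" using R0 by (rule mult_right_le_imp_le)
   thus ?thesis using pos unfolding B_def by (simp add: field_simps)
  qed (use B0 in simp)
 qed
 have "closed S"
 proof -
  have "S = {0..B} \<inter> ((\<Inter>r\<in>{0..R}. {l. ph N l r >= 0}) \<inter> {l. D*ph' N l R + k*ph N l R >= 0})" by (auto simp: S_def)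
  moreover have "closed {l. ph N l r >= 0}" if "r:{0..R}" for r using that by (intro closed_Collect_le ci ph_cont_l) auto
  moreover have "closed {l. D*ph' N l R + k*ph N l R >= 0}" using pos by (intro closed_Collect_le ci ph_cont_l) auto
  ultimately show ?thesis by (auto intro!: closed_Int closed_INT)
 qed
 moreover have "0:S" unfolding S_def
 proof (safe)
  show "0:{0..B}" using B0 by simp
  show "ph N 0 r >= 0" if "r:{0..R}" for r using ph_ge1[of 0 r N] that by simp
  have "ph N 0 R >= 0" "ph' N 0 R >= 0" using ph_ge1[of 0 R N] pos by auto
  thus "0 <= D*ph' N 0 R + k*ph N 0 R" using pos k by simp
 qed
 moreover have "bounded S" by (rule bounded_subset[of "{0..B}"]) (auto simp: S_def)
 ultimately have "compact S" "S ~= {}" by (auto simp: compact_eq_bounded_closed)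
 then obtain l where l: "l:S" "!!m. m:S ==> m <= l" using compact_attains_sup[of S] by auto
 have lp: "l >= 0" "ALL r:{0..R}. ph N l r >= 0" "D*ph' N l R + k*ph N l R >= 0" using l(1) by (auto simp: S_def)
 note lpp = pd[OF lp]
 have z: "D*ph' N l R + k*ph N l R = 0"
 proof (rule ccontr)
  assume "D*ph' N l R + k*ph N l R ~= 0"
  hence g: "D*ph' N l R + k*ph N l R > 0" using lp by simp
  define Z where "Z = l + 1"
  obtain e where e: "e > 0" "ALL m:{-Z..Z}. dist m l < e --> (ALL r:{0..R}. ph N m r > 0)" using pos_open[OF _ _ ph_cont(1)[OF pos(3), of Z N], of l] lpp(2) lp(1) by (auto simp: Z_def)
  have "isCont (%l. D*ph' N l R + k*ph N l R) l" using ph_cont_l[of R N] pos by (auto intro!: ci simp: continuous_on_eq_continuous_at)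
  hence "\<forall>\<^sub>F m in at l. D*ph' N m R + k*ph N m R > 0" unfolding isCont_def using g by (rule order_tendstoD)
  then obtain e2 where e2: "e2 > 0" "!!m. m ~= l ==> dist m l < e2 ==> D*ph' N m R + k*ph N m R > 0" unfolding eventually_at by blast
  define m where "m = l + min (min e e2) 1/2"
  have m: "m > l" "dist m l < e" "dist m l < e2" "m:{-Z..Z}" using e e2 lp(1) by (auto simp: m_def Z_def dist_real_def)
  have "ALL r:{0..R}. ph N m r >= 0" using e(2) m by (auto intro: less_imp_le)
  moreover have "D*ph' N m R + k*ph N m R >= 0" using e2(2)[of m] m by auto
  moreover have "m >= 0" using m lp by simp
  ultimately have "m:S" using pd(3)[of m] by (auto simp: S_def)
  thus False using l(2)[of m] m by simp
 qed
 have "l ~= 0"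
 proof
  assume "l = 0"
  hence "ph N l R >= 1" "ph' N l R >= 0" using ph_ge1[of l R N] pos by auto
  hence "D*ph' N l R + k*ph N l R > 0" using pos k by (intro add_nonneg_pos) auto
  thus False using z by simp
 qed
 thus ?thesis using lp(1) lpp(2) z by (intro exI[of _ l]) auto
qed

end

context kpp
begin

text \<open>The initial value problem requires a globally Lipschitz nonlinearity; the solution
  selected by shooting has values in \<open>(0, 1)\<close>, where the clamp is the identity.\<close>

lemma clamp_lip:
 obtains L where "L > 0" "!!x y. \<bar>g (max 0 (min 1 x)) - g (max 0 (min 1 y))\<bar> <= L*\<bar>x - y\<bar>"
proof -
 have "local_lipschitz {0::real} {0..1} (%_. g)"
 proof (rule local_lipschitzI)
  fix t x :: real
  obtain e L where e: "e > 0" "ALL a:ball x e. ALL b:ball x e. \<bar>g a - g b\<bar> <= L*\<bar>a - b\<bar>" using g_lip by blast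
  have "(max L 0)-lipschitz_on (cball x (e/2) \<inter> {0..1}) g"
  proof (rule lipschitz_onI)
   fix a b assume "a:cball x (e/2) \<inter> {0..1}" "b:cball x (e/2) \<inter> {0..1}"
   hence "a:ball x e" "b:ball x e" using e(1) by auto
   hence "\<bar>g a - g b\<bar> <= L*\<bar>a - b\<bar>" using e(2) by blast
   also have "\<dots> <= max L 0*\<bar>a - b\<bar>" by (intro mult_right_mono) auto
   finally show "dist (g a) (g b) <= max L 0*dist a b" by (simp add: dist_real_def)
  qed simp
  thus "EX u>0. EX L. ALL t:cball t u \<inter> {0}. L-lipschitz_on (cball x u \<inter> {0..1}) g" using e(1) by (intro exI[of _ "e/2"]) auto
 qed
 then obtain L where L: "L-lipschitz_on {0..1} g" using local_lipschitz_compact_implies_lipschitz[of "{0::real}" "{0..1}" "%_. g"] by auto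
 show ?thesis
 proof (rule that[of "L + 1"])
  show "L + 1 > 0" using lipschitz_on_nonneg[OF L] by simp
  fix x y :: real
  have "\<bar>g (max 0 (min 1 x)) - g (max 0 (min 1 y))\<bar> <= L*\<bar>max 0 (min 1 x) - max 0 (min 1 y)\<bar>" using lipschitz_onD[OF L, of "max 0 (min 1 x)" "max 0 (min 1 y)"] by (simp add: dist_real_def)
  also have "\<dots> <= (L + 1)*\<bar>x - y\<bar>" using lipschitz_on_nonneg[OF L] by (intro mult_mono) auto
  finally show "\<bar>g (max 0 (min 1 x)) - g (max 0 (min 1 y))\<bar> <= (L + 1)*\<bar>x - y\<bar>" .
 qed
qed

text \<open>Shooting in the central value \<open>a\<close>. At \<open>a = 1\<close> the solution is
  the constant 1, with positive Robin expression; for small \<open>a\<close> the expression is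
  negative because \<open>g s / s\<close> stays above \<open>D * l\<close>. A zero in between
  belongs to a decreasing profile that is positive up to \<open>R\<close>.\<close>

lemma exists_U:
 assumes k: "k > 0" and l: "ALL r:{0..R}. ph N l r > 0" "D*ph' N l R + k*ph N l R = 0" and lg: "D*l < g0"
 obtains U U1 :: "real => real" where
  "!!r. r:{0..R} ==> (U HD U1 r) (at r within {0..R})"
  "!!r. r:{0..R} ==> ((%r. r^N*U1 r) HD r^N*(- g (U r)/D)) (at r within {0..R})"
  "U1 0 = 0" "con {0..R} U1"
  "!!r. r:{0..R} ==> 0 < U r & U r < 1" "D*U1 R + k*U R = 0"
proof -
 obtain L where L: "L > 0" "!!x y. \<bar>g (max 0 (min 1 x)) - g (max 0 (min 1 y))\<bar> <= L*\<bar>x - y\<bar>" using clamp_lip by blast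
 define f where "f = (%s. g (max 0 (min 1 s))/D)"
 have fL: "\<bar>f x - f y\<bar> <= L/D*\<bar>x - y\<bar>" for x y using L(2)[of x y] pos by (simp add: f_def diff_divide_distrib[symmetric] divide_right_mono)
 have LD: "L/D > 0" using L pos by simp
 have g01: "g s >= 0" if "0 <= s" "s <= 1" for s using that g_kpp g_0 g_1 by (cases "s = 0 | s = 1") (auto intro: less_imp_le)
 have f0: "f s >= 0" for s unfolding f_def using g01 pos by (intro divide_nonneg_pos) auto
 have fp: "f s > 0" if "0 < s" "s < 1" for s using that g_kpp pos by (simp add: f_def)
 have fg: "f s = g s/D" if "0 <= s" "s <= 1" for s using that by (simp add: f_def)
 show ?thesis
 proof (rule radial_ivp[OF fL LD pos(3), of N])
 fix U U1 :: "real => real => real" and K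
 assume U0: "!!a. U a 0 = a" and U10: "!!a. U1 a 0 = 0" and
  dU: "!!a r. r:{0..R} ==> (U a HD U1 a r) (at r within {0..R})" and
  dU1: "!!a r. r:{0..R} ==> ((%r. r^N*U1 a r) HD - (r^N*f (U a r))) (at r within {0..R})" and
  cU1: "!!a. con {0..R} (U1 a)" and
  lip: "!!a c r. r:{0..R} ==> \<bar>U a r - U c r\<bar> <= K*\<bar>a - c\<bar> & \<bar>U1 a r - U1 c r\<bar> <= K*\<bar>a - c\<bar>" and
  const: "!!a r. f a = 0 ==> r:{0..R} ==> U a r = a & U1 a r = 0"
 have cU: "con {0..R} (U a)" for a by (rule DERIV_continuous_on[OF dU])
 have dUi: "(U a HD U1 a r) (at r)" "((%r. r^N*U1 a r) HD r^N*(- f (U a r))) (at r)"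
  if "0 < r" "r < R" for a r using dU[of r a] dU1[of r a] that by (simp_all add: at_within_Icc_inside)
 have U1neg: "U1 a r < 0" if a: "0 < a" "a < 1" and r: "0 < r" "r <= R" for a r
 proof -
  have "(U a \<longlongrightarrow> U a 0) (at 0 within {0..R})" using cU[of a] pos unfolding continuous_on_def by simp
  hence "(U a \<longlongrightarrow> a) (at 0 within {0..R})" unfolding U0 .
  hence "\<forall>\<^sub>F r in at 0 within {0..R}. U a r > 0 & U a r < 1" using a by (intro eventually_conj order_tendstoD)
  then obtain e where e: "e > 0" "!!r. r:{0..R} ==> r ~= 0 ==> dist r 0 < e ==> U a r > 0 & U a r < 1" unfolding eventually_at by blast
  have mR: "min e R > 0" using e pos by simp
  have "r^N*U1 a r < 0"
  proof (rule flux_neg[where q = "%r. f (U a r)" and b=R and N=N and F = "%r. r^N*U1 a r", OF _ _ _ _ mR _ r])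
   show "con {0..R} (%r. r^N*U1 a r)" by (intro ci cU1)
   show "((%r. r^N*U1 a r) HD - (r^N*f (U a r))) (at r)" if "0 < r" "r < R" for r using dUi(2)[OF that, of a] by simp
   show "f (U a r) > 0" if "0 < r" "r < min e R" for r using e(2)[of r] that by (intro fp) auto
  qed (use U10 f0 in auto)
  thus ?thesis using r by (simp add: mult_less_0_iff)
 qed
 have Udec: "U a s <= U a r" if a: "0 < a" "a < 1" and r: "0 <= r" "r <= s" "s <= R" for a r s
 proof (rule DERIV_nonpos_imp_decreasing_open[OF r(2)])
  show "EX y. (U a HD y) (at x) & y <= 0" if "r < x" "x < s" for x using dUi(1)[of x a] U1neg[OF a, of x] that r by (intro exI[of _ "U1 a x"]) auto
 qed (use r in \<open>auto intro: continuous_on_subset[OF cU]\<close>)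
 define F where "F = (%a. D*U1 a R + k*U a R)"
 have Fc: "con A F" for A
 proof -
  have *: "con UNIV (%a. h a)" if "!!a c. \<bar>h a - h c\<bar> <= K*\<bar>a - c\<bar>" for h :: "real => real"
  proof (rule continuous_at_imp_continuous_on, rule ballI)
   fix x
   have "((%y. K*\<bar>y - x\<bar>) \<longlongrightarrow> K*\<bar>x - x\<bar>) (at x)" by (intro tendsto_intros)
   hence t: "((%y. K*\<bar>y - x\<bar>) \<longlongrightarrow> 0) (at x)" by simp
   have "((%y. h y - h x) \<longlongrightarrow> 0) (at x)" by (rule Lim_null_comparison[OF _ t]) (use that in auto)
   thus "isCont h x" by (simp add: isCont_def LIM_zero_iff)
  qed
  have "con UNIV F" unfolding F_def using lip[of R] pos by (intro ci *) auto
  thus ?thesis by (rule continuous_on_subset) simp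
 qed
 have F1: "F 1 > 0"
 proof -
  have "f 1 = 0" by (simp add: f_def g_1)
  from const[OF this, of R] show ?thesis using pos k by (simp add: F_def)
 qed
 have UR: "U a R > 0" if a: "0 < a" "a < 1" and F: "F a >= 0" for a
 proof -
  have "D*U1 a R < 0" using U1neg[OF a, of R] pos by (simp add: mult_pos_neg)
  hence "k*U a R > 0" using F by (simp add: F_def)
  thus ?thesis using k by (simp add: zero_less_mult_iff)
 qed
 have "\<forall>\<^sub>F h in at_right 0. g h/h > D*l" using order_tendstoD(1)[OF filterlim_mono[OF g_tendsto order_refl at_le[of "{0<..}" UNIV]] lg] by simp
 then obtain e where e: "e > 0" "!!h. 0 < h ==> h < e ==> g h/h > D*l" by (auto simp: eventually_at_right_field)
 define a0 where "a0 = min e 1/2"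
 have a0: "0 < a0" "a0 < 1" "a0 < e" using e by (auto simp: a0_def)
 \<comment> \<open>Were the Robin expression nonnegative, \<open>U a0\<close> would stay in
   \<open>(0, a0]\<close>, where the reaction beats the eigenvalue. Then the Wronskian with the
   eigenfunction is negative at \<open>R\<close>; but \<open>D\<close> times it, without the weight,
   is the Robin expression times \<open>ph N l R\<close>.\<close>
 have Fa0: "F a0 < 0"
 proof (rule ccontr)
  assume "~ F a0 < 0"
  hence Fp: "F a0 >= 0" by simp
  note URp = UR[OF a0(1,2) Fp]
  have Up: "0 < U a0 r" "U a0 r <= a0" if "0 <= r" "r <= R" for r using Udec[OF a0(1,2), of r R] Udec[OF a0(1,2), of 0 r] URp that U0 by auto
  define W where "W = (%r. r^N*(U1 a0 r*ph N l r - U a0 r*ph' N l r))"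
  have "W R < 0"
  proof (rule flux_neg[where q = "%r. (f (U a0 r) - l*U a0 r)*ph N l r" and b=R and N=N and F=W, OF _ _ _ _ pos(3)])
   show "con {0..R} W" unfolding W_def by (intro ci ph_cont_r cU cU1)
   show "W 0 = 0" by (simp add: W_def U10 ph'_0)
   fix r :: real assume r: "0 < r" "r < R"
   show "(W HD - (r^N*((f (U a0 r) - l*U a0 r)*ph N l r))) (at r)" using wronskian_deriv[OF dUi(1)[OF r, of a0] dUi(2)[OF r, of a0] ph_deriv[OF r(1), of N l] ph'_deriv[OF r(1), of N l]] unfolding W_def by (simp add: asi)
   have "g (U a0 r)/U a0 r > D*l" using Up[of r] r a0 by (intro e) auto
   hence "g (U a0 r) > D*l*U a0 r" using Up[of r] r by (simp add: pos_less_divide_eq)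
   hence "f (U a0 r) > l*U a0 r" using Up[of r] r a0 pos by (simp add: fg field_simps)
   thus "(f (U a0 r) - l*U a0 r)*ph N l r > 0" using l(1) r by simp
   thus "(f (U a0 r) - l*U a0 r)*ph N l r >= 0" by simp
  qed (use pos in auto)
  hence "U1 a0 R*ph N l R - U a0 R*ph' N l R < 0" using pos by (simp add: W_def mult_less_0_iff)
  hence "D*(U1 a0 R*ph N l R - U a0 R*ph' N l R) < 0" using pos by (simp add: mult_pos_neg)
  moreover have "D*(U1 a0 R*ph N l R - U a0 R*ph' N l R) = F a0*ph N l R"
  proof -
   have "D*ph' N l R = - k*ph N l R" using l(2) by simp
   hence "D*(U1 a0 R*ph N l R - U a0 R*ph' N l R) = D*U1 a0 R*ph N l R - U a0 R*(- k*ph N l R)" by (simp add: right_diff_distrib mult.left_commute[of D])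
   thus ?thesis by (simp add: F_def asi)
  qed
  moreover have "F a0*ph N l R >= 0" using Fp l(1) pos by (simp add: less_imp_le)
  ultimately show False by simp
 qed
 have "EX a>=a0. a <= 1 & F a = 0" using IVT'[of F a0 0 1] Fa0 F1 a0 Fc by auto
 then obtain a where a: "a0 <= a" "a <= 1" "F a = 0" by blast
 have a1: "0 < a" "a < 1" using a a0 F1 by (cases "a = 1"; auto)+
 have U01: "0 < U a r & U a r < 1" if "r:{0..R}" for r using Udec[OF a1, of r R] Udec[OF a1, of 0 r] UR[OF a1] a(3) that U0[of a] a1 by auto
 show ?thesis
 proof (rule that[of "U a" "U1 a"])
  show "((%r. r^N*U1 a r) HD r^N*(- g (U a r)/D)) (at r within {0..R})" if "r:{0..R}" for r using dU1[OF that, of a] U01[OF that] by (simp add: fg)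
 qed (use dU U10 cU1 U01 a(3) in \<open>auto simp: F_def\<close>)
 qed
qed

end

lemma cont_on_Icc_right:
 fixes f :: "real => real"
 assumes "con {0..b} f" "b > 0"
 shows "(f \<longlongrightarrow> f 0) (at_right 0)"
proof -
 have "(f \<longlongrightarrow> f 0) (at 0 within {0..b})" using assms by (auto simp: continuous_on_def)
 thus ?thesis using assms(2) by (simp add: at_within_Icc_at_right)
qed

lemma ph_C2:
 assumes N: "N + 1 = DIM('a::euclidean_space)" and S: "open S"
 shows "C2_on S (%y::'a. ph N l (norm y))" "y:S ==> has_lap (%y::'a. ph N l (norm y)) y (- l*ph N l (norm y))"
proof -
 have c: "isCont (ph N l) r" if "r > 0" for r using ph_deriv[OF that] by (rule DERIV_isCont)
 have 1: "((%r. - l*ph N l r) \<longlongrightarrow> - l*ph N l 0) (at_right 0)" by (rule cont_on_Icc_right[of 1]) (auto intro!: ci ph_cont_r)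
 have "((%r. r^N*ph' N l r) \<longlongrightarrow> 0^N*ph' N l 0) (at_right 0)" by (rule cont_on_Icc_right[of 1]) (auto intro!: ci ph_cont_r)
 hence 2: "((%r. r^N*ph' N l r) \<longlongrightarrow> 0) (at_right 0)" by (simp add: ph'_0)
 show "C2_on S (%y::'a. ph N l (norm y))" by (rule radial_ode_C2(1)[OF S N, of "ph N l" "ph' N l" "%r. - l*ph N l r"])
   (use 1 2 ph_deriv0 in \<open>auto intro!: ph_deriv ci c ph'_deriv[where l=l and N=N, simplified]\<close>)
 show "y:S ==> has_lap (%y::'a. ph N l (norm y)) y (- l*ph N l (norm y))" by (rule radial_ode_C2(2)[OF S N, of "ph N l" "ph' N l" "%r. - l*ph N l r"])
   (use 1 2 ph_deriv0 in \<open>auto intro!: ph_deriv ci c ph'_deriv[where l=l and N=N, simplified]\<close>)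
qed

lemma continuous_radial:
 assumes "con {0..R} w"
 shows "con (cball (0::'a::real_normed_vector) R) (%y. w (norm y))" by (rule continuous_on_compose2[OF assms]) (auto intro!: ci)

text \<open>This power is strictly subharmonic in every dimension \<open>N + 1\<close>, also where
  the fundamental solution r^(1-N) degenerates to a constant.\<close>

lemma inv_power_lap:
 assumes N: "N + 1 = DIM('a::euclidean_space)" and y: "y ~= (0::'a)"
 shows "has_lap (%y::'a. 1/norm y^(N + 1) - c) y (2*real (N + 1)/norm y^(N + 3))"
proof -
 have S: "open (- {0::'a})" by (intro open_Compl) simp
 define w where "w = (%r::real. 1/r^(N + 1) - c)"
 define w1 where "w1 = (%r::real. - real (N + 1)/r^(N + 2))"
 define Q where "Q = (%r::real. 2*real (N + 1)/r^(N + 3))"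
 have d1: "(w HD w1 r) (at r)" if "r > 0" for r
 proof -
  have "(w HD - (real (N + 1)*r^N)/(r^(N + 1)*r^(N + 1))) (at r)" unfolding w_def using that by (auto intro!: dei simp del: power_Suc)
  moreover have "- (real (N + 1)*r^N)/(r^(N + 1)*r^(N + 1)) = w1 r" using that by (simp add: w1_def field_simps)
  ultimately show ?thesis by simp
 qed
 have d2: "((%r. r^N*w1 r) HD r^N*Q r) (at r)" if r: "r > 0" for r
 proof -
  have "((%r. - real (N + 1)/r^2) HD 2*real (N + 1)/r^3) (at r)" using r by (auto intro!: dei simp: field_simps power2_eq_square power3_eq_cube)
  moreover have "2*real (N + 1)/r^3 = r^N*Q r" using r by (simp add: Q_def power_add)
  moreover have "\<forall>\<^sub>F s in nhds r. - real (N + 1)/s^2 = s^N*w1 s" using t1_space_nhds[of r 0] r by (auto elim!: eventually_mono simp: w1_def power_add power2_eq_square)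
  ultimately show ?thesis using DERIV_cong_ev[OF refl _ refl] by fastforce
 qed
 have "has_lap (%y::'a. w (norm y)) y (Q (norm y))"
 proof (rule radial_ode_C2(2)[OF S N, of w w1 Q])
  show "isCont Q (norm x)" if "x : - {0}" "x ~= 0" for x :: 'a unfolding Q_def using that by (auto intro!: ci)
 qed (use y d1 d2 in auto)
 thus ?thesis by (simp add: w_def Q_def)
qed

lemma has_lap_local_min:
 assumes "has_lap f p L" "\<forall>\<^sub>F q in nhds p. f q >= f p"
 shows "L >= 0" using has_lap_local_max[OF has_lap_cmult[OF assms(1), of "-1"]] assms(2) by simp

context field_road
begin

lemma radial_line:
 fixes y :: "'a::real_normed_vector"
 assumes "norm y = R" "s >= - R"
 shows "norm (y + s *R ((1/R) *R y)) = R + s"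
proof -
 have "y + s *R ((1/R) *R y) = (1 + s/R) *R y" by (simp add: asi)
 hence "norm (y + s *R ((1/R) *R y)) = \<bar>1 + s/R\<bar> * R" using assms by simp
 also have "\<bar>1 + s/R\<bar> = 1 + s/R" using assms pos by (simp add: field_simps)
 also have "(1 + s/R) * R = R + s" using pos by (simp add: field_simps)
 finally show ?thesis .
qed

lemma radial_dn:
 fixes y :: "'a::real_normed_vector"
 assumes y: "norm y = R" and w: "(w HD x) (at_left R)"
 shows "((%s. w (norm (y + s *R ((1/R) *R y)))) HD x) (at_left 0)"
proof -
 have "((%s. w (R + s)) HD x) (at_left 0)"
 proof -
  have "(%s. R + s) ` {..<0} = {..<R}"
  proof (intro set_eqI iffI)
   fix x assume "x:{..<R}"
   thus "x:(%s. R + s) ` {..<0}" by (intro image_eqI[of _ _ "x - R"]) auto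
  qed auto
  hence "(w HD x) (at (R + 0) within (%s. R + s) ` {..<0})" using w by simp
  moreover have "((%s. R + s) HD 1) (at 0 within {..<0})" by (auto intro!: dei)
  ultimately show ?thesis using DERIV_image_chain[of w x "%s. R + s" 0 "{..<0}" 1] by (simp add: o_def)
 qed
 moreover have "\<forall>\<^sub>F s in at_left 0. w (R + s) = w (norm (y + s *R ((1/R) *R y)))" using eventually_line_left[OF pos(3)]
 proof eventually_elim
  case (elim s)
  hence "norm (y + s *R ((1/R) *R y)) = R + s" by (intro radial_line[OF y]) simp
  thus ?case by (simp only:)
 qed
 moreover have "w (R + 0) = w (norm (y + 0 *R ((1/R) *R y)))" using y by simp
 ultimately show ?thesis by (rule has_field_derivative_cong_eventually[THEN iffD1, rotated -1])
qed

lemma ph_dn: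
 fixes y :: "'a::real_normed_vector"
 shows "norm y = R ==> ((%s. ph N l (norm (y + s *R ((1/R) *R y)))) HD ph' N l R) (at_left 0)" using radial_dn[OF _ has_field_derivative_at_within[OF ph_deriv[OF pos(3)]]] by blast

lemma line_in_cball:
 fixes y :: "'a::real_normed_vector"
 assumes "norm y = R"
 shows "\<forall>\<^sub>F s in at_left 0. y + s *R ((1/R) *R y):cball 0 R" using eventually_line_left[OF pos(3)]
proof eventually_elim
 case (elim s)
 thus ?case using radial_line[OF assms, of s] by (simp only: mem_cball dist_0_norm) simp
qed

text \<open>On the annulus between the radii \<open>R/2\<close> and \<open>R\<close> a multiple of
  the subharmonic \<open>cc\<close>, which vanishes on the outer sphere, stays below the
  superharmonic \<open>fi\<close>. Both vanish at \<open>y0\<close>, so \<open>fi\<close> inherits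
  the strictly negative slope of \<open>cc\<close>.\<close>

lemma hopf:
 fixes fi :: "'a::euclidean_space => real"
 assumes c: "con (cball 0 R) fi" and p: "!!y. y:ball 0 R ==> fi y > 0"
  and lp: "!!y. y:ball 0 R ==> EX L<0. has_lap fi y L"
  and y0: "norm y0 = R" "fi y0 = 0"
  and d: "((%s. fi (y0 + s *R ((1/R) *R y0))) HD x) (at_left 0)"
  and nn: "!!y. y:cball 0 R ==> fi y >= 0"
 shows "x < 0"
proof -
 define N where "N = DIM('a) - 1"
 have N: "N + 1 = DIM('a)" using DIM_positive[where 'a='a] by (simp add: N_def)
 define cc where "cc = (%r::real. 1/r^(N + 1) - 1/R^(N + 1))"
 have ne: "sphere (0::'a) (R/2) ~= {}" using pos by simp
 have "con (sphere 0 (R/2)) fi" using pos by (intro continuous_on_subset[OF c]) auto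
 then obtain z where z: "norm z = R/2" "!!y. norm y = R/2 ==> fi z <= fi y" using continuous_attains_inf[OF compact_sphere ne, of fi] by auto
 have pz: "fi z > 0" using z pos by (intro p) auto
 have ch: "cc (R/2) > 0" unfolding cc_def using pos power_strict_mono[of "R/2" R "N + 1"] by (simp add: frac_less2 del: power_Suc)
 \<comment> \<open>On the inner sphere \<open>s0 * cc\<close> equals the minimum of
   \<open>fi\<close>.\<close>
 define s0 where "s0 = fi z/cc (R/2)"
 have s0: "s0 > 0" using pz ch by (simp add: s0_def)
 define A where "A = cball (0::'a) R - ball 0 (R/2)"
 have A: "compact A" "y0:A" using y0 pos by (auto simp: A_def intro!: compact_diff)
 define f where "f = (%y::'a. fi y - s0*cc (norm y))"
 have "con A f" unfolding f_def cc_def by (intro ci continuous_on_subset[OF c]) (use pos in \<open>auto simp: A_def\<close>)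
 then obtain y1 where y1: "y1:A" "!!y. y:A ==> f y1 <= f y" using continuous_attains_inf[OF A(1), of f] A(2) by blast
 have f1: "f y1 >= 0"
 proof (rule ccontr)
  assume neg: "~ f y1 >= 0"
  have "norm y1 ~= R/2" using z(2)[of y1] neg ch by (auto simp: f_def s0_def)
  moreover have "norm y1 ~= R" using nn[of y1] neg by (auto simp: f_def cc_def)
  ultimately have n1: "R/2 < norm y1" "norm y1 < R" using y1(1) by (auto simp: A_def)
  obtain L where L: "L < 0" "has_lap fi y1 L" using lp[of y1] n1 by auto
  have "has_lap f y1 (L - s0*(2*real (N + 1)/norm y1^(N + 3)))" unfolding f_def cc_def using n1 pos by (intro has_lap_diff has_lap_cmult L(2) inv_power_lap[OF N]) auto
  moreover have "\<forall>\<^sub>F y in nhds y1. f y >= f y1"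
  proof -
   have "open (ball (0::'a) R - cball 0 (R/2))" by auto
   hence "\<forall>\<^sub>F y in nhds y1. y:ball (0::'a) R - cball 0 (R/2)" by (rule eventually_nhds_in_open) (use n1 in auto)
   thus ?thesis by eventually_elim (auto intro!: y1(2) simp: A_def)
  qed
  ultimately have "L - s0*(2*real (N + 1)/norm y1^(N + 3)) >= 0" by (rule has_lap_local_min)
  moreover have "s0*(2*real (N + 1)/norm y1^(N + 3)) >= 0" using s0 by simp
  ultimately show False using L(1) by linarith
 qed
 have "(cc HD - (real (N + 1) * R^N)/(R^(N + 1) * R^(N + 1))) (at_left R)" unfolding cc_def using pos by (auto intro!: dei simp del: power_Suc)
 from radial_dn[OF y0(1) this]
 have dch: "((%s. cc (norm (y0 + s *R ((1/R) *R y0)))) HD - (real (N + 1) * R^N)/(R^(N + 1) * R^(N + 1))) (at_left 0)" .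
 have "((%s. s0*cc (norm (y0 + s *R ((1/R) *R y0))) - fi (y0 + s *R ((1/R) *R y0))) HD
  s0*(- (real (N + 1) * R^N)/(R^(N + 1) * R^(N + 1))) - x) (at_left 0)" by (intro DERIV_diff DERIV_cmult dch d)
 moreover have "\<forall>\<^sub>F s in at_left 0. s0*cc (norm (y0 + s *R ((1/R) *R y0))) - fi (y0 + s *R ((1/R) *R y0))
  <= s0*cc (norm (y0 + 0 *R ((1/R) *R y0))) - fi (y0 + 0 *R ((1/R) *R y0))"
 proof -
  have "\<forall>\<^sub>F s in at_left 0. - (R/2) < s & s < (0::real)" using pos by (auto simp: eventually_at_left[of "-(R/2)" 0] intro!: exI[of _ "-(R/2)"])
  thus ?thesis
  proof eventually_elim
   case (elim s)
   hence "norm (y0 + s *R ((1/R) *R y0)) = R + s" by (intro radial_line y0) (use pos in auto)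
   hence "y0 + s *R ((1/R) *R y0):A" using elim by (auto simp: A_def)
   from y1(2)[OF this] f1 show ?case using y0 by (simp add: f_def cc_def)
  qed
 qed
 ultimately have "s0*(- (real (N + 1) * R^N)/(R^(N + 1) * R^(N + 1))) - x >= 0" by (rule left_max_deriv_nonneg)
 moreover have "s0*(- (real (N + 1) * R^N)/(R^(N + 1) * R^(N + 1))) < 0" using s0 pos by (intro mult_pos_neg divide_neg_pos) auto
 ultimately show ?thesis by linarith
qed

text \<open>\<open>principal_eig\<close> admits nonradial eigenfunctions, so uniqueness has to come
  from comparison: \<open>fi\<close> is divided by a \<open>ph N l'\<close> with \<open>l'\<close>
  strictly between \<open>l\<close> and \<open>m\<close>, whose Robin expression has a sign. An
  extremal point of the quotient contradicts the equation or the boundary condition. The definite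
  description in \<open>beta0sq\<close> is justified by this.\<close>

lemma principal_eig_iff:
 assumes k: "k > 0" and l: "l > 0" "ALL r:{0..R}. ph N l r > 0" "D*ph' N l R + k*ph N l R = 0"
  and N: "N + 1 = CARD('m::finite)"
 shows "principal_eig (M::'m itself) D k R m \<longleftrightarrow> m = l"
proof
 have N': "N + 1 = DIM(real^'m)" using N by simp
 assume "m = l"
 show "principal_eig M D k R m" unfolding principal_eig_def \<open>m = l\<close>
 proof (intro exI conjI ballI allI impI)
  show "con (cball 0 R) (%y::real^'m. ph N l (norm y))" by (intro continuous_radial ph_cont_r)
  show "C2_on (ball 0 R) (%y::real^'m. ph N l (norm y))" by (rule ph_C2[OF N']) simp
  fix y :: "real^'m"
  show "ph N l (norm y) > 0" if "y:ball 0 R" using that l by auto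
  show "- laplacian (%y::real^'m. ph N l (norm y)) y = l*ph N l (norm y)" if "y:ball 0 R" using has_lap_laplacian[OF ph_C2(2)[OF N' open_ball that, of l]] by simp
  assume y: "norm y = R"
  show "((%s. ph N l (norm (y + s *R ((1/R) *R y)))) HD ph' N l R) (at_left 0)" by (rule ph_dn[OF y])
  show "D*ph' N l R + k*ph N l (norm y) = 0" using l y by simp
 qed
next
 have N': "N + 1 = DIM(real^'m)" using N by simp
 assume "principal_eig M D k R m"
 then obtain fi :: "real^'m => real" where c: "con (cball 0 R) fi" and C2: "C2_on (ball 0 R) fi"
  and p: "!!y. y:ball 0 R ==> fi y > 0" and lap: "!!y. y:ball 0 R ==> - laplacian fi y = m*fi y"
  and b: "!!y. norm y = R ==> EX x. ((%s. fi (y + s *R ((1/R) *R y))) HD x) (at_left 0) & D*x + k*fi y = 0" unfolding principal_eig_def by blast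
 have hl: "has_lap fi y (- m*fi y)" if "y:ball 0 R" for y
 proof -
  have "laplacian fi y = - m*fi y" using lap[OF that] by linarith
  thus ?thesis using C2_on_imp_has_lap[OF C2 open_ball that] by simp
 qed
 have nn: "fi y >= 0" if "y:cball 0 R" for y using continuous_ge_on_closure[of "ball 0 R" fi y 0] c that p pos by (auto intro: less_imp_le)
 have l0: "0:{- (l + 1)..l + 1}" "l:{- (l + 1)..l + 1}" using l by auto
 obtain e where e: "e > 0" "!!l' r. l':{- (l + 1)..l + 1} ==> dist l' l < e ==> r:{0..R} ==> ph N l' r > 0" using pos_open[OF _ _ ph_cont(1)[OF pos(3), of "l + 1" N] l0(2)] l(2) by auto
 have lR: "ph N l R > 0" using l pos by simp
 have DD: "D*ph' N l R = - k*ph N l R" using l by simp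
 have cont_ratio: "con (cball 0 R) (%y. fi y/ph N l' (norm y))" if "!!r. r:{0..R} ==> ph N l' r > 0" for l' by (intro ci c continuous_radial ph_cont_r) (use that in \<open>auto simp: less_imp_neq[symmetric]\<close>)
 have ne: "cball (0::real^'m) R ~= {}" using pos by simp
 show "m = l"
 proof (rule linorder_cases)
  assume ml: "m > l"
  define h where "h = min (min e 1) (m - l)/2"
  have h1: "h > 0" using e(1) ml by (simp add: h_def)
  have "2*h <= e" "2*h <= 1" "2*h <= m - l" by (simp_all add: h_def)
  with h1 have h: "h > 0" "h < e" "h < 1" "h < m - l" by auto
  \<comment> \<open>Strictly between \<open>l\<close> and \<open>m\<close>, and close enough to
    \<open>l\<close> for \<open>ph N l'\<close> to be positive on \<open>[0, R]\<close>.\<close>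
  define l' where "l' = l + h"
  have l': "l < l'" "l' < m" "dist l' l < e" "l':{- (l + 1)..l + 1}" using h l by (auto simp: l'_def dist_real_def)
  have pl: "ph N l' r > 0" if "r:{0..R}" for r using e(2) l' that by blast
  have "ph' N l' R*ph N l R < ph N l' R*ph' N l R" by (rule ph_wronskian) (use pl l l' pos in auto)
  hence "D*(ph' N l' R*ph N l R) < D*(ph N l' R*ph' N l R)" using pos by simp
  also have "\<dots> = ph N l' R*(D*ph' N l R)" by (simp add: mult_ac)
  finally have "(D*ph' N l' R + k*ph N l' R)*ph N l R < 0" unfolding DD by (simp add: asi)
  hence rn: "D*ph' N l' R + k*ph N l' R < 0" using lR by (simp add: mult_less_0_iff)
  obtain y0 where y0: "y0:cball 0 R" "!!y. y:cball 0 R ==> fi y0/ph N l' (norm y0) <= fi y/ph N l' (norm y)" using continuous_attains_inf[OF compact_cball ne cont_ratio[OF pl]] by auto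
  define t where "t = fi y0/ph N l' (norm y0)"
  have t0: "t >= 0" unfolding t_def using nn[OF y0(1)] pl[of "norm y0"] y0(1) by auto
  define f where "f = (%y. fi y - t*ph N l' (norm y))"
  have f0: "f y0 = 0" using pl[of "norm y0"] y0(1) by (simp add: f_def t_def)
  have fge: "f y >= 0" if "y:cball 0 R" for y using y0(2)[OF that] pl[of "norm y"] that by (simp add: f_def t_def[symmetric] pos_le_divide_eq)
  have ph0: "fi y0 = t*ph N l' (norm y0)" using f0 by (simp add: f_def)
  show "m = l"
  proof (cases "norm y0 < R")
   case True
   hence yb: "y0:ball 0 R" by simp
   have "has_lap f y0 (- m*fi y0 - t*(- l'*ph N l' (norm y0)))" unfolding f_def by (intro has_lap_diff has_lap_cmult hl[OF yb] ph_C2(2)[OF N' open_ball yb])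
   moreover have "\<forall>\<^sub>F y in nhds y0. f y >= f y0" using eventually_nhds_in_open[OF open_ball yb] by eventually_elim (use fge f0 in auto)
   ultimately have "- m*fi y0 - t*(- l'*ph N l' (norm y0)) >= 0" by (rule has_lap_local_min)
   hence "(l' - m)*fi y0 >= 0" using ph0 by (simp add: asi)
   thus ?thesis using p[OF yb] l' by (simp add: zero_le_mult_iff)
  next
   case False
   hence yR: "norm y0 = R" using y0 by simp
   obtain x where x: "((%s. fi (y0 + s *R ((1/R) *R y0))) HD x) (at_left 0)" "D*x + k*fi y0 = 0" using b[OF yR] by blast
   have "((%s. t*ph N l' (norm (y0 + s *R ((1/R) *R y0))) - fi (y0 + s *R ((1/R) *R y0))) HD t*ph' N l' R - x) (at_left 0)" by (intro DERIV_diff DERIV_cmult ph_dn[OF yR] x)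
   moreover have "\<forall>\<^sub>F s in at_left 0. t*ph N l' (norm (y0 + s *R ((1/R) *R y0))) - fi (y0 + s *R ((1/R) *R y0))
   <= t*ph N l' (norm (y0 + 0 *R ((1/R) *R y0))) - fi (y0 + 0 *R ((1/R) *R y0))" using line_in_cball[OF yR] by eventually_elim (use fge f0 in \<open>auto simp: f_def\<close>)
   ultimately have "t*ph' N l' R - x >= 0" by (rule left_max_deriv_nonneg)
   hence "D*x <= D*(t*ph' N l' R)" using pos by (intro mult_left_mono) auto
   moreover have "D*x = - k*(t*ph N l' R)" using x(2) ph0 yR by simp
   ultimately have "t*(D*ph' N l' R + k*ph N l' R) >= 0" by (simp add: asi)
   \<comment> \<open>A boundary minimum of the quotient must be 0. Then \<open>fi\<close> vanishes
     at \<open>y0\<close>, and the negative slope from \<open>hopf\<close> contradicts the boundary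
     condition, which now says that the slope is 0.\<close>
   hence "t = 0" using t0 rn by (auto simp: zero_le_mult_iff)
   hence z: "fi y0 = 0" using ph0 by simp
   have lneg: "EX L<0. has_lap fi y L" if "y:ball 0 R" for y using hl[OF that] p[OF that] ml l by (intro exI[of _ "- m*fi y"]) (auto simp: mult_neg_pos)
   have "x < 0" by (rule hopf[OF c p lneg yR z x(1) nn])
   moreover have "x = 0" using x(2) z pos by simp
   ultimately show ?thesis by simp
  qed
 next
  assume ml: "m < l"
  define h where "h = min e (l - m)/2"
  have h1: "h > 0" using e(1) ml by (simp add: h_def)
  have "2*h <= e" "2*h <= l - m" by (simp_all add: h_def)
  with h1 have h: "h > 0" "h < e" "h < l - m" by auto
  \<comment> \<open>The maximum with 0 keeps the parameter in the interval for which
    \<open>e\<close> was obtained; it remains strictly between \<open>m\<close> and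
    \<open>l\<close>.\<close>
  define l'' where "l'' = max (l - h) 0"
  have l': "l'' < l" "m < l''" "dist l'' l < e" "l'':{- (l + 1)..l + 1}" using h l by (auto simp: l''_def dist_real_def)
  have pl: "ph N l'' r > 0" if "r:{0..R}" for r using e(2) l' that by blast
  have "ph' N l R*ph N l'' R < ph N l R*ph' N l'' R" by (rule ph_wronskian) (use pl l l' pos in auto)
  hence "D*(ph' N l R*ph N l'' R) < D*(ph N l R*ph' N l'' R)" using pos by simp
  moreover have "D*(ph' N l R*ph N l'' R) = - k*ph N l R*ph N l'' R" using DD by (simp add: mult.assoc[symmetric])
  ultimately have "(D*ph' N l'' R + k*ph N l'' R)*ph N l R > 0" by (simp add: asi)
  hence rn: "D*ph' N l'' R + k*ph N l'' R > 0" using lR by (simp add: zero_less_mult_iff)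
  obtain y0 where y0: "y0:cball 0 R" "!!y. y:cball 0 R ==> fi y/ph N l'' (norm y) <= fi y0/ph N l'' (norm y0)" using continuous_attains_sup[OF compact_cball ne cont_ratio[OF pl]] by auto
  define t where "t = fi y0/ph N l'' (norm y0)"
  have "0 < fi 0/ph N l'' (norm (0::real^'m))" using p[of 0] pl[of 0] pos by simp
  also have "\<dots> <= t" unfolding t_def using pos by (intro y0) simp
  finally have t0: "t > 0" .
  define f where "f = (%y. fi y - t*ph N l'' (norm y))"
  have f0: "f y0 = 0" using pl[of "norm y0"] y0(1) by (simp add: f_def t_def)
  have fge: "f y <= 0" if "y:cball 0 R" for y using y0(2)[OF that] pl[of "norm y"] that by (simp add: f_def t_def[symmetric] pos_divide_le_eq)
  have ph0: "fi y0 = t*ph N l'' (norm y0)" using f0 by (simp add: f_def)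
  have p0: "fi y0 > 0" unfolding ph0 using t0 pl[of "norm y0"] y0(1) by simp
  show "m = l"
  proof (cases "norm y0 < R")
   case True
   hence yb: "y0:ball 0 R" by simp
   have "has_lap f y0 (- m*fi y0 - t*(- l''*ph N l'' (norm y0)))" unfolding f_def by (intro has_lap_diff has_lap_cmult hl[OF yb] ph_C2(2)[OF N' open_ball yb])
   moreover have "\<forall>\<^sub>F y in nhds y0. f y <= f y0" using eventually_nhds_in_open[OF open_ball yb] by eventually_elim (use fge f0 in auto)
   ultimately have "- m*fi y0 - t*(- l''*ph N l'' (norm y0)) <= 0" by (rule has_lap_local_max)
   hence "(l'' - m)*fi y0 <= 0" using ph0 by (simp add: asi)
   thus ?thesis using p0 l' by (simp add: mult_le_0_iff)
  next
   case False
   hence yR: "norm y0 = R" using y0 by simp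
   obtain x where x: "((%s. fi (y0 + s *R ((1/R) *R y0))) HD x) (at_left 0)" "D*x + k*fi y0 = 0" using b[OF yR] by blast
   have "((%s. fi (y0 + s *R ((1/R) *R y0)) - t*ph N l'' (norm (y0 + s *R ((1/R) *R y0)))) HD x - t*ph' N l'' R) (at_left 0)" by (intro DERIV_diff DERIV_cmult ph_dn[OF yR] x)
   moreover have "\<forall>\<^sub>F s in at_left 0. fi (y0 + s *R ((1/R) *R y0)) - t*ph N l'' (norm (y0 + s *R ((1/R) *R y0)))
   <= fi (y0 + 0 *R ((1/R) *R y0)) - t*ph N l'' (norm (y0 + 0 *R ((1/R) *R y0)))" using line_in_cball[OF yR] by eventually_elim (use fge f0 in \<open>auto simp: f_def\<close>)
   ultimately have "x - t*ph' N l'' R >= 0" by (rule left_max_deriv_nonneg)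
   hence "D*(t*ph' N l'' R) <= D*x" using pos by (intro mult_left_mono) auto
   moreover have "D*x = - k*(t*ph N l'' R)" using x(2) ph0 yR by simp
   ultimately have "t*(D*ph' N l'' R + k*ph N l'' R) <= 0" by (simp add: asi)
   thus ?thesis using t0 rn by (simp add: mult_le_0_iff)
  qed
 qed simp
qed

end

subsection \<open>Bessel functions and the exterior profile\<close>

text \<open>The integrand of \<open>BesselK\<close> after \<open>j\<close> differentiations in
  \<open>z\<close>, up to sign.\<close>

definition Jint :: "nat => real => real => real => real" where
 "Jint j tu z t = cosh t^j*(exp (- z*cosh t)*cosh (tu*t))"

lemma BesselK_Jint: "BesselK tu z = integral {0..} (Jint 0 tu z)" by (simp add: BesselK_def Jint_def[abs_def])

lemma Jint_nonneg: "Jint j tu z t >= 0" by (simp add: Jint_def cosh_real_nonneg)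

lemma cosh_ge_sq: "t >= 0 ==> cosh t >= t^2/4" for t :: real
proof -
 assume t: "t >= 0"
 have "exp t >= 1 + t + t^2/2" by (rule exp_lower_Taylor_quadratic[OF t])
 hence "t^2/4 <= exp t/2" using t by simp
 also have "\<dots> <= cosh t" by (simp add: cosh_field_def)
 finally show ?thesis .
qed

lemma cosh_le_exp: "cosh x <= exp \<bar>x\<bar>" for x :: real
proof -
 have gen: "(a + b)/2 <= e" if "a <= e" "b <= e" for a b e :: real using that by simp
 show ?thesis unfolding cosh_field_def by (rule gen) auto
qed

text \<open>The quadratic lower bound of \<open>cosh\<close> makes the integrand Gaussian.
  Completing the square in \<open>a * t - z * t^2 / 4\<close> gives the constant
  \<open>exp (a^2 / z)\<close>, and the summand 1 in \<open>a\<close> leaves the factor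
  \<open>exp (- 1 * t)\<close>.\<close>

lemma Jint_bound:
 assumes z: "z > 0"
 shows "EX C. ALL t>=0. Jint j tu z t <= C*exp (- 1*t)"
proof -
 define a where "a = real j + \<bar>tu\<bar> + 1"
 have "Jint j tu z t <= exp (a^2/z)*exp (- 1*t)" if t: "t >= 0" for t
 proof -
  have "cosh t^j <= exp t^j" using cosh_le_exp[of t] t by (intro power_mono) (auto simp: cosh_real_nonneg)
  moreover have "exp (- z*cosh t) <= exp (- z*(t^2/4))" using cosh_ge_sq[OF t] z by simp
  moreover have "cosh (tu*t) <= exp (\<bar>tu\<bar>*t)" using cosh_le_exp[of "tu*t"] t by (simp add: abs_mult)
  ultimately have "Jint j tu z t <= exp t^j*(exp (- z*(t^2/4))*exp (\<bar>tu\<bar>*t))" unfolding Jint_def by (intro mult_mono) (auto simp: cosh_real_nonneg)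
  also have "\<dots> = exp (- z*(t^2/4) + a*t)*exp (- 1*t)" by (simp add: a_def exp_of_nat_mult[symmetric] exp_add[symmetric] asi)
  also have "\<dots> <= exp (a^2/z)*exp (- 1*t)"
  proof (intro mult_right_mono)
   have "0 <= (z*t/2 - a)^2" by simp
   hence "z*(a*t) <= z*(z*t^2/4) + a^2" by (simp add: power2_eq_square asi)
   hence "- z*(t^2/4) + a*t <= a^2/z" using z by (simp add: field_simps)
   thus "exp (- z*(t^2/4) + a*t) <= exp (a^2/z)" by simp
  qed simp
  finally show ?thesis .
 qed
 thus ?thesis by blast
qed

lemma Jint_cont: "con A (Jint j tu z)" unfolding Jint_def by (intro ci)

lemma integrable_cmult: "f integrable_on S ==> (%x. c*f x) integrable_on S" for f :: "real => real" using integrable_cmul[of f S c] by simp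

lemma integrable_bounded_exp:
 assumes c: "con {0..} f" and b: "!!t. t >= 0 ==> \<bar>f t\<bar> <= C*exp (- 1*t)"
 shows "f integrable_on {0::real..}"
proof (rule measurable_bounded_by_integrable_imp_integrable)
 show "f:borel_measurable (lebesgue_on {0..})" by (rule continuous_imp_measurable_on_sets_lebesgue[OF c]) auto
 show "(%t. C*exp (- 1*t)) integrable_on {0..}" by (rule integrable_cmult, rule integrable_on_exp_minus_to_infinity) simp
qed (use b in auto)

lemma Jint_integrable: "z > 0 ==> Jint j tu z integrable_on {0..}"
proof -
 assume "z > 0"
 then obtain C where "ALL t>=0. Jint j tu z t <= C*exp (- 1*t)" using Jint_bound by blast
 thus ?thesis using Jint_nonneg[of j tu z] by (intro integrable_bounded_exp[of _ C] Jint_cont) auto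
qed

text \<open>Differentiation under the integral by a quantitative estimate: for \<bar>h\<bar> < z/2
  the quadratic Taylor remainder of the exponential is at most
  \<open>(h * c)^2 * exp (z / 2 * c)\<close>, which leaves the integrable \<open>Jint 2\<close> at
  \<open>z / 2\<close>.\<close>

lemma BesselK_deriv_J:
 assumes z: "z > 0"
 shows "(BesselK tu HD - integral {0..} (Jint 1 tu z)) (at z)"
proof -
 define C where "C = integral {0..} (Jint 2 tu (z/2))"
 have est: "\<bar>BesselK tu (z + h) - BesselK tu z - h*(- integral {0..} (Jint 1 tu z))\<bar> <= h^2*C" if h: "\<bar>h\<bar> < z/2" for h
 proof -
  have zh: "z + h > 0" "z/2 > 0" using h z by linarith+
  have int: "(%t. Jint 0 tu (z + h) t - Jint 0 tu z t + h*Jint 1 tu z t) integrable_on {0..}" by (intro integrable_add integrable_diff integrable_cmult Jint_integrable zh z)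
  have "BesselK tu (z + h) - BesselK tu z - h*(- integral {0..} (Jint 1 tu z))
   = integral {0..} (%t. Jint 0 tu (z + h) t - Jint 0 tu z t + h*Jint 1 tu z t)" unfolding BesselK_Jint by (simp add: integral_add integral_diff integrable_diff integrable_cmult Jint_integrable zh z)
  also have "norm \<dots> <= integral {0..} (%t. h\<^sup>2*Jint 2 tu (z/2) t)"
  proof (rule integral_norm_bound_integral[OF int])
   show "(%t. h\<^sup>2*Jint 2 tu (z/2) t) integrable_on {0..}" by (intro integrable_cmult Jint_integrable zh)
   fix t :: real assume "t:{0..}"
   define c where "c = cosh t"
   have c: "c >= 1" by (simp add: c_def cosh_real_ge_1)
   obtain x where x: "\<bar>x\<bar> <= \<bar>- h*c\<bar>" "exp (- h*c) = (\<Sum>m<2. (- h*c)^m/fact m) + exp x/fact 2*(- h*c)^2" using Maclaurin_exp_le by blast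
   have e1: "exp (- h*c) - 1 + h*c = exp x/2*(h*c)^2" using x(2) by (simp add: numeral_2_eq_2)
   have "\<bar>h*c\<bar> <= z/2*c" using h c unfolding abs_mult by (intro mult_mono) auto
   hence "x <= z/2*c" using x(1) by auto
   hence "exp x <= exp (z/2*c)" by simp
   hence "exp (- z*c)*exp x <= exp (- z*c)*exp (z/2*c)" by simp
   also have "\<dots> = exp (- (z/2)*c)" by (simp add: exp_add[symmetric])
   finally have e2: "exp (- z*c)*exp x <= exp (- (z/2)*c)" .
   have "exp (- (z + h)*c) - exp (- z*c) + h*(c*exp (- z*c)) = exp (- z*c)*(exp (- h*c) - 1 + h*c)" by (simp add: exp_add[symmetric] asi)
   also have "\<dots> = (exp (- z*c)*exp x)*((h*c)^2/2)" unfolding e1 by simp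
   finally have e3: "exp (- (z + h)*c) - exp (- z*c) + h*(c*exp (- z*c)) = (exp (- z*c)*exp x)*((h*c)^2/2)" .
   have "Jint 0 tu (z + h) t - Jint 0 tu z t + h*Jint 1 tu z t
   = (exp (- (z + h)*c) - exp (- z*c) + h*(c*exp (- z*c)))*cosh (tu*t)" by (simp add: Jint_def c_def asi)
   also have "\<dots> = (exp (- z*c)*exp x)*((h*c)^2/2)*cosh (tu*t)" unfolding e3 ..
   finally have e5: "Jint 0 tu (z + h) t - Jint 0 tu z t + h*Jint 1 tu z t = (exp (- z*c)*exp x)*((h*c)^2/2)*cosh (tu*t)" .
   have "(exp (- z*c)*exp x)*((h*c)^2/2)*cosh (tu*t) >= 0" by (simp add: cosh_real_nonneg)
   hence e4: "norm (Jint 0 tu (z + h) t - Jint 0 tu z t + h*Jint 1 tu z t) = (exp (- z*c)*exp x)*((h*c)^2/2)*cosh (tu*t)" unfolding e5 by (simp only: real_norm_def abs_of_nonneg)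
   note e4
   also have "(exp (- z*c)*exp x)*((h*c)^2/2)*cosh (tu*t) <= exp (- (z/2)*c)*(h*c)^2*cosh (tu*t)" using e2 by (intro mult_mono) (auto simp: cosh_real_nonneg)
   also have "\<dots> = h^2*Jint 2 tu (z/2) t" by (simp add: Jint_def c_def power_mult_distrib)
   finally show "norm (Jint 0 tu (z + h) t - Jint 0 tu z t + h*Jint 1 tu z t) <= h^2*Jint 2 tu (z/2) t" .
  qed
  also have "\<dots> = h^2*C" by (simp add: C_def)
  finally show ?thesis by simp
 qed
 have "((%h. (BesselK tu (z + h) - BesselK tu z)/h) \<longlongrightarrow> - integral {0..} (Jint 1 tu z)) (at 0)"
 proof (subst LIM_zero_iff[symmetric], rule Lim_null_comparison)
  have "((%h. \<bar>h\<bar>*C) \<longlongrightarrow> \<bar>0\<bar>*C) (at 0)" by (intro tendsto_intros)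
  thus "((%h. \<bar>h\<bar>*C) \<longlongrightarrow> 0) (at 0)" by simp
  have "\<forall>\<^sub>F h in at 0. h ~= 0 & \<bar>h\<bar> < z/2" unfolding eventually_at using z by (intro exI[of _ "z/2"]) (auto simp: dist_real_def)
  thus "\<forall>\<^sub>F h in at 0. norm ((BesselK tu (z + h) - BesselK tu z)/h - - integral {0..} (Jint 1 tu z)) <= \<bar>h\<bar>*C"
  proof eventually_elim
   case (elim h)
   have "(BesselK tu (z + h) - BesselK tu z)/h - - integral {0..} (Jint 1 tu z) =
   (BesselK tu (z + h) - BesselK tu z - h*(- integral {0..} (Jint 1 tu z)))/h" using elim by (simp add: field_simps)
   hence "norm ((BesselK tu (z + h) - BesselK tu z)/h - - integral {0..} (Jint 1 tu z))
   <= h^2*C/\<bar>h\<bar>" using est[of h] elim by (simp only: real_norm_def abs_divide) (auto intro: divide_right_mono)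
   also have "h^2*C/\<bar>h\<bar> = \<bar>h\<bar>*C" using elim by (simp add: power2_eq_square abs_if field_simps)
   finally show ?case .
  qed
 qed
 thus ?thesis by (simp add: DERIV_def)
qed

lemma Jint_1: "integral {0..} (Jint 1 tu z) = (BesselK (tu + 1) z + BesselK (tu - 1) z)/2" if z: "z > 0"
proof -
 have "Jint 1 tu z t = (Jint 0 (tu + 1) z t + Jint 0 (tu - 1) z t)/2" for t by (simp add: Jint_def cosh_add cosh_diff asi)
 hence "Jint 1 tu z = (%t. (Jint 0 (tu + 1) z t + Jint 0 (tu - 1) z t)/2)" by (intro ext)
 thus ?thesis unfolding BesselK_Jint by (simp add: integral_add Jint_integrable z)
qed

text \<open>The derivative of \<open>exp (- z * cosh t) * sinh (tu * t)\<close> is a combination of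
  the three integrands, while the function vanishes at 0 and at infinity.\<close>

lemma BesselK_rec:
 assumes z: "z > 0"
 shows "BesselK (tu + 1) z - BesselK (tu - 1) z = 2*tu/z*BesselK tu z"
proof -
 define F where "F = (%t. exp (- z*cosh t) * sinh (tu*t))"
 define f where "f = (%t. tu*Jint 0 tu z t - z/2*(Jint 0 (tu + 1) z t - Jint 0 (tu - 1) z t))"
 have dF: "(F HD f t) (at t)" for t
 proof -
  have "(F HD exp (- z*cosh t)*(- z * sinh t) * sinh (tu*t) + cosh (tu*t)*tu*exp (- z*cosh t)) (at t)" unfolding F_def by (auto intro!: dei)
  moreover have "exp (- z*cosh t)*(- z * sinh t) * sinh (tu*t) + cosh (tu*t)*tu*exp (- z*cosh t) = f t" by (simp add: f_def Jint_def cosh_add cosh_diff asi)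
  ultimately show ?thesis by simp
 qed
 have intf: "f integrable_on {0..}" unfolding f_def by (intro integrable_diff integrable_cmult Jint_integrable z)
 have fI: "integral {0..} f = tu*BesselK tu z - z/2*(BesselK (tu + 1) z - BesselK (tu - 1) z)" unfolding f_def BesselK_Jint by (simp add: integral_diff integrable_diff integrable_cmult Jint_integrable z)
 obtain C where C: "!!t. t >= 0 ==> Jint 0 tu z t <= C*exp (- 1*t)" using Jint_bound[OF z, of 0 tu] by blast
 have Fb: "\<bar>F t\<bar> <= C*exp (- 1*t)" if "t >= 0" for t
 proof -
  have "\<bar>sinh (tu*t)\<bar> <= cosh (tu*t)" by (simp add: sinh_field_def cosh_field_def abs_le_iff)
  hence "\<bar>F t\<bar> <= Jint 0 tu z t" by (simp add: F_def Jint_def abs_mult)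
  thus ?thesis using C[OF that] by linarith
 qed
 have "(%k. integral {0..} (%t. if t:{0..real k} then f t else 0)) \<longlonglongrightarrow> integral {0..} f"
 proof (rule dominated_convergence(2)[where h = "%t. \<bar>f t\<bar>"])
  show "(%t. if t:{0..real k} then f t else 0) integrable_on {0..}" for k
  proof -
   have "f integrable_on {0..real k}" unfolding f_def by (intro integrable_continuous_interval ci Jint_cont)
   moreover have "{0..real k} \<subseteq> {0..}" by auto
   ultimately show ?thesis using integrable_restrict_Int[of "{0..real k}" f "{0..}"] by (simp add: Int_absorb2)
  qed
  have "f absolutely_integrable_on {0..}" unfolding f_def
   by (intro set_integral_diff(1) absolutely_integrable_scaleR_left[unfolded real_scaleR_def] set_integrable_mult_right nonnegative_absolutely_integrable_1 Jint_integrable Jint_nonneg z)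
  thus "(%t. \<bar>f t\<bar>) integrable_on {0..}" unfolding absolutely_integrable_on_def by simp
  show "(%k. if t:{0..real k} then f t else 0) \<longlonglongrightarrow> f t" if "t:{0..}" for t
  proof (rule Lim_transform_eventually[OF tendsto_const])
   show "\<forall>\<^sub>F k in sequentially. f t = (if t:{0..real k} then f t else 0)" using eventually_ge_at_top[of "nat \<lceil>t\<rceil>"] by eventually_elim (use that in \<open>auto simp: nat_le_iff ceiling_le_iff\<close>)
  qed
 qed auto
 moreover have "integral {0..} (%t. if t:{0..real k} then f t else 0) = F (real k)" for k
 proof -
  have "integral {0..} (%t. if t:{0..real k} then f t else 0) = integral {0..real k} f" using integral_restrict_Int[of "{0..}" "{0..real k}" f] by (simp add: Int_absorb2 Int_commute)
  also have "\<dots> = F (real k) - F 0" using dF by (intro integral_unique fundamental_theorem_of_calculus)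
   (auto simp: has_real_derivative_iff_has_vector_derivative[symmetric] intro: has_field_derivative_at_within)
  finally show ?thesis by (simp add: F_def)
 qed
 ultimately have l1: "(%k. F (real k)) \<longlonglongrightarrow> integral {0..} f" by simp
 have l2: "(%k. F (real k)) \<longlonglongrightarrow> 0"
 proof (rule Lim_null_comparison)
  show "\<forall>\<^sub>F k in sequentially. norm (F (real k)) <= C*exp (- 1*real k)" using Fb by auto
  have "(%k. (exp (- 1 :: real))^k) \<longlonglongrightarrow> 0" by (rule LIMSEQ_realpow_zero) auto
  hence "(%k. C*(exp (- 1 :: real))^k) \<longlonglongrightarrow> C*0" by (rule tendsto_mult_left)
  moreover have "C*exp (- 1*real k) = C*(exp (- 1))^k" for k by (simp add: exp_of_nat_mult[symmetric] mult.commute)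
  ultimately show "(%k. C*exp (- 1*real k)) \<longlonglongrightarrow> 0" by (simp only: mult_zero_right)
 qed
 have "integral {0..} f = 0" using LIMSEQ_unique[OF l1 l2] .
 thus ?thesis using fI z by (simp add: field_simps)
qed

text \<open>The derivative is minus half the sum of the neighbouring orders; the recurrence for
  their difference eliminates either of them.\<close>

lemma BesselK_deriv:
 assumes z: "z > 0"
 shows "(BesselK tu HD - BesselK (tu + 1) z + tu/z*BesselK tu z) (at z)"
  and "(BesselK (tu + 1) HD - BesselK tu z - (tu + 1)/z*BesselK (tu + 1) z) (at z)"
proof -
 have "- integral {0..} (Jint 1 tu z) = - BesselK (tu + 1) z + tu/z*BesselK tu z" using BesselK_rec[OF z, of tu] unfolding Jint_1[OF z] by (simp add: field_simps)
 thus "(BesselK tu HD - BesselK (tu + 1) z + tu/z*BesselK tu z) (at z)" using BesselK_deriv_J[OF z, of tu] by simp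
 have "- integral {0..} (Jint 1 (tu + 1) z) = - BesselK tu z - (tu + 1)/z*BesselK (tu + 1) z" using BesselK_rec[OF z, of "tu + 1"] unfolding Jint_1[OF z] by (simp add: field_simps)
 thus "(BesselK (tu + 1) HD - BesselK tu z - (tu + 1)/z*BesselK (tu + 1) z) (at z)" using BesselK_deriv_J[OF z, of "tu + 1"] by simp
qed

lemma BesselK_pos: "z > 0 ==> BesselK tu z > 0"
proof -
 assume z: "z > 0"
 have i: "Jint 0 tu z integrable_on {0..1}" by (intro integrable_continuous_interval Jint_cont)
 have "exp (- z*cosh 1) = integral {0..1::real} (%_. exp (- z*cosh 1))" by simp
 also have "\<dots> <= integral {0..1} (Jint 0 tu z)"
 proof (rule integral_le)
  fix t :: real assume "t:{0..1}"
  hence "exp (- z*cosh 1)*1 <= exp (- z*cosh t)*cosh (tu*t)" using z by (intro mult_mono) (auto simp: cosh_real_ge_1 cosh_real_nonneg_le_iff)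
  thus "exp (- z*cosh 1) <= Jint 0 tu z t" by (simp add: Jint_def)
 qed (use i in auto)
 also have "\<dots> <= BesselK tu z" unfolding BesselK_Jint by (rule integral_subset_le[OF _ i Jint_integrable[OF z]]) (auto simp: Jint_nonneg)
 finally show ?thesis by (rule less_le_trans[rotated]) simp
qed

text \<open>\<open>cosh t \<ge> 1\<close> allows \<open>exp (- (z - a))\<close> to be taken out of
  the integrand.\<close>

lemma BesselK_decay: "0 < a ==> a <= z ==> BesselK tu z <= exp (- (z - a))*BesselK tu a"
proof -
 assume a: "0 < a" "a <= z"
 have "BesselK tu z <= integral {0..} (%t. exp (- (z - a))*Jint 0 tu a t)" unfolding BesselK_Jint
 proof (rule integral_le)
  show "Jint 0 tu z integrable_on {0..}" "(%t. exp (- (z - a))*Jint 0 tu a t) integrable_on {0..}" using a by (auto intro!: Jint_integrable integrable_cmult)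
  fix t :: real
  have "(z - a)*1 <= (z - a)*cosh t" using a cosh_real_ge_1 by (intro mult_left_mono) auto
  hence "- z*cosh t <= - (z - a) + - a*cosh t" by (simp add: asi)
  hence "exp (- z*cosh t) <= exp (- (z - a))*exp (- a*cosh t)" by (simp add: exp_add[symmetric])
  thus "Jint 0 tu z t <= exp (- (z - a))*Jint 0 tu a t" using mult_right_mono[of "exp (- z*cosh t)" _ "cosh (tu*t)"] by (simp add: Jint_def cosh_real_nonneg mult.assoc[symmetric])
 qed
 thus ?thesis by (simp add: BesselK_Jint)
qed

lemma BesselK_cont: "con {0<..} (BesselK tu)" using BesselK_deriv(1) by (intro continuous_at_imp_continuous_on) (auto intro: DERIV_isCont)

text \<open>The order \<tau> of \<open>kappa\<close> in terms of \<open>N = CARD('m) - 1\<close>; it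
  is negative for \<open>N = 0\<close>.\<close>

definition bt :: "nat => real" where "bt N = (real N - 1)/2"
text \<open>The exponentially decaying solution of f'' + (N/r) f' = ga^2 f; \<open>psi'\<close> is
  its derivative after simplification by the Bessel recurrence.\<close>

definition psi :: "nat => real => real => real" where
 "psi N ga r = r powr (- bt N)*BesselK (bt N) (ga*r)"
definition psi' :: "nat => real => real => real" where
 "psi' N ga r = - ga*(r powr (- bt N)*BesselK (bt N + 1) (ga*r))"

context
 fixes ga :: real
 assumes g: "ga > 0"
begin

lemma psi_pos: "r > 0 ==> psi N ga r > 0" and psi'_neg: "r > 0 ==> psi' N ga r < 0" using g BesselK_pos[of "ga*r"] by (auto simp: psi_def psi'_def mult_pos_pos)

lemma psi_deriv:
 assumes r: "r > 0"
 shows "(psi N ga HD psi' N ga r) (at r)"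
proof -
 let ?t = "bt N"
 have gr: "ga*r > 0" using g r by simp
 have k: "((%r. BesselK ?t (ga*r)) HD (- BesselK (?t + 1) (ga*r) + ?t/(ga*r)*BesselK ?t (ga*r))*ga) (at r)" by (rule DERIV_chain2[where g="%r. ga*r" and x=r, OF BesselK_deriv(1)[OF gr]]) (auto intro!: dei)
 have p: "((%r. r powr (- ?t)) HD - ?t*r powr (- ?t - 1)) (at r)" using r by (auto intro!: dei)
 have "((%r. r powr (- ?t)*BesselK ?t (ga*r)) HD
  - ?t*r powr (- ?t - 1)*BesselK ?t (ga*r) + (- BesselK (?t + 1) (ga*r) + ?t/(ga*r)*BesselK ?t (ga*r))*ga*r powr (- ?t)) (at r)" by (rule DERIV_mult[OF p k])
 moreover have "r powr (- ?t - 1) = r powr (- ?t)/r" using r by (simp add: powr_diff)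
 ultimately show ?thesis unfolding psi_def[abs_def] psi'_def using g r by (simp add: field_simps)
qed

lemma psi'_deriv:
 assumes r: "r > 0"
 shows "((%r. r^N*psi' N ga r) HD r^N*(ga^2*psi N ga r)) (at r)"
proof -
 let ?t = "bt N"
 have gr: "ga*r > 0" using g r by simp
 have pw: "s^N * s powr (- ?t) = s powr (?t + 1)" if "s > 0" for s :: real using that by (simp add: powr_realpow[symmetric] powr_add[symmetric] bt_def field_simps)
 have k: "((%r. BesselK (?t + 1) (ga*r)) HD (- BesselK ?t (ga*r) - (?t + 1)/(ga*r)*BesselK (?t + 1) (ga*r))*ga) (at r)" by (rule DERIV_chain2[where g="%r. ga*r" and x=r, OF BesselK_deriv(2)[OF gr]]) (auto intro!: dei)
 have p: "((%r. - ga*r powr (?t + 1)) HD - ga*((?t + 1)*r powr ?t)) (at r)" using r by (auto intro!: dei)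
 have "((%r. (- ga*r powr (?t + 1))*BesselK (?t + 1) (ga*r)) HD
  - ga*((?t + 1)*r powr ?t)*BesselK (?t + 1) (ga*r) + (- BesselK ?t (ga*r) - (?t + 1)/(ga*r)*BesselK (?t + 1) (ga*r))*ga*(- ga*r powr (?t + 1))) (at r)" by (rule DERIV_mult[OF p k])
 moreover have "r powr (?t + 1) = r powr ?t*r" using r by (simp add: powr_add)
 moreover have "- ga*((?t + 1)*x)*b + (- a - (?t + 1)/(ga*r)*b)*ga*(- ga*(x*r)) = ga^2*(x*r*a)" for x a b using g r by (simp add: field_simps power2_eq_square)
 ultimately have "((%r. (- ga*r powr (?t + 1))*BesselK (?t + 1) (ga*r)) HD ga\<^sup>2*(r powr (?t + 1)*BesselK ?t (ga*r))) (at r)" by simp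
 moreover have "ga^2*(r powr (?t + 1)*BesselK ?t (ga*r)) = r^N*(ga^2*psi N ga r)" unfolding psi_def pw[OF r, symmetric] by (simp add: mult_ac)
 moreover have "\<forall>\<^sub>F s in nhds r. (- ga * s powr (?t + 1))*BesselK (?t + 1) (ga * s) = s^N*psi' N ga s"
 proof -
  have "\<forall>\<^sub>F s in nhds r. s:{0<..}" using r by (intro eventually_nhds_in_open) auto
  thus ?thesis
  proof eventually_elim
   case (elim s)
   thus ?case unfolding psi'_def using pw[of s] by (simp add: mult_ac)
  qed
 qed
 ultimately show ?thesis using DERIV_cong_ev[OF refl _ refl] by fastforce
qed

lemma psi_decr:
 assumes "0 < r" "r <= s"
 shows "psi N ga s <= psi N ga r"
proof (rule DERIV_nonpos_imp_nonincreasing[OF assms(2)])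
 fix x assume "r <= x" "x <= s"
 thus "EX y. (psi N ga HD y) (at x) & y <= 0" using psi_deriv[of x N] psi'_neg[of x N] assms by (intro exI[of _ "psi' N ga x"]) auto
qed

text \<open>The power of \<open>r\<close> in front may grow, so half of the rate \<open>ga\<close>
  is given up to absorb it.\<close>

lemma psi_decay:
 assumes R: "R > 0"
 shows "EX C>0. EX a>0. ALL r>=R. psi N ga r <= C*exp (- a*r)"
proof -
 define t where "t = \<bar>bt N\<bar>"
 have lim: "((%r. r powr t*exp (- (ga/2)*r)) \<longlongrightarrow> 0) at_top" using g by real_asymp
 hence "\<forall>\<^sub>F r in at_top. r powr t*exp (- (ga/2)*r) < 1" by (rule order_tendstoD) simp
 then obtain r0 where r0: "!!r. r >= r0 ==> r powr t*exp (- (ga/2)*r) < 1" unfolding eventually_at_top_linorder by blast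
 define r1 where "r1 = max (max R 1) r0"
 define A where "A = exp (ga * R)*BesselK (bt N) (ga * R)"
 define B where "B = psi N ga R*exp (ga/2*r1)"
 have A: "A > 0" using BesselK_pos[of "ga * R"] g R by (simp add: A_def)
 have B: "B > 0" using psi_pos[OF R] by (simp add: B_def)
 show ?thesis
 proof (intro exI conjI allI impI)
  show "A + B > 0" "ga/2 > 0" using A B g by auto
  fix r assume r: "r >= R"
  show "psi N ga r <= (A + B)*exp (- (ga/2)*r)"
  proof (cases "r >= r1")
   case True
   hence r': "r >= 1" "r >= r0" by (auto simp: r1_def)
   have "r powr (- bt N) <= r powr t" using r' by (intro powr_mono) (auto simp: t_def)
   moreover have "BesselK (bt N) (ga*r) <= exp (- (ga*r - ga * R))*BesselK (bt N) (ga * R)" using r g R by (intro BesselK_decay) auto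
   ultimately have "psi N ga r <= r powr t*(exp (- (ga*r - ga * R))*BesselK (bt N) (ga * R))" unfolding psi_def using BesselK_pos[of "ga*r" "bt N"] g r R by (intro mult_mono) auto
   also have "\<dots> = (r powr t*exp (- (ga/2)*r))*(A*exp (- (ga/2)*r))"
   proof -
   have "exp (- (ga*r - ga * R)) = exp (- (ga/2)*r)*(exp (ga * R)*exp (- (ga/2)*r))" by (simp add: exp_add[symmetric])
   thus ?thesis by (simp only: A_def mult_ac)
   qed
   also have "\<dots> <= 1*(A*exp (- (ga/2)*r))" using r0[OF r'(2)] A by (intro mult_right_mono) auto
   also have "\<dots> <= (A + B)*exp (- (ga/2)*r)" using B by simp
   finally show ?thesis .
  next
   case False
   have "psi N ga r <= psi N ga R" using r R by (intro psi_decr) auto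
   also have "\<dots> = B*exp (- (ga/2)*r1)" by (simp add: B_def exp_add[symmetric])
   also have "\<dots> <= (A + B)*exp (- (ga/2)*r)" using A B False g by (intro mult_mono) auto
   finally show ?thesis .
  qed
 qed
qed

end

lemma psi_joint_cont: "con ({0<..} \<times> {0<..}) (%(ga,r). psi N ga r)" "con ({0<..} \<times> {0<..}) (%(ga,r). psi' N ga r)" unfolding psi_def psi'_def case_prod_beta by (intro ci continuous_on_compose2[OF BesselK_cont]; force)+

context field_road
begin

text \<open>The decay rate of exterior functions that are stationary and independent of
  \<open>x\<close>.\<close>

definition gam :: real where "gam = sqrt (ro/d)"

lemma gam: "gam > 0" "d*gam^2 = ro" "d*gam = sqrt (d*ro)"
proof -
 show "gam > 0" "d*gam^2 = ro" using pos by (simp_all add: gam_def)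
 have "(d*gam)^2 = d*(d*gam^2)" by (simp add: power2_eq_square)
 hence "(d*gam)^2 = d*ro" unfolding \<open>d * gam^2 = ro\<close> .
 thus "d*gam = sqrt (d*ro)" using pos \<open>gam > 0\<close> by (intro real_sqrt_unique[symmetric]) auto
qed

text \<open>The factor \<open>R powr (- bt N)\<close> cancels from the fraction. In this form
  \<open>kappa\<close> is what remains when a multiple of \<open>psi\<close> is fitted to the
  exterior flux condition and eliminated from the interior one.\<close>

lemma kappa_psi:
 assumes N: "N + 1 = CARD('m::finite)"
 shows "kappa (M::'m itself) d R mq nq ro = mq*(- d*psi' N gam R)/(nq*psi N gam R + (- d*psi' N gam R))"
  "kappa M d R mq nq ro > 0"
proof -
 have t: "(real (CARD('m) + 1) - 3)/2 = bt N" using N by (simp add: bt_def flip: N)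
 define P where "P = R powr (- bt N)"
 have P: "P > 0" using pos by (simp add: P_def)
 define A where "A = BesselK (bt N) (gam * R)"
 define B where "B = BesselK (bt N + 1) (gam * R)"
 have AB: "A > 0" "B > 0" using BesselK_pos gam pos by (auto simp: A_def B_def)
 have 1: "- d*psi' N gam R = P*(sqrt (d*ro)*B)" unfolding psi'_def B_def P_def gam(3)[symmetric] by simp
 have 2: "psi N gam R = P*A" by (simp add: psi_def A_def P_def)
 have k: "kappa M d R mq nq ro = mq * sqrt (d*ro)*B/(nq*A + sqrt (d*ro)*B)" unfolding kappa_def Let_def t A_def B_def gam_def by simp
 also have "\<dots> = (P*(mq * sqrt (d*ro)*B))/(P*(nq*A + sqrt (d*ro)*B))" using P by simp
 also have "\<dots> = mq*(- d*psi' N gam R)/(nq*psi N gam R + (- d*psi' N gam R))" unfolding 1 2 by (simp add: asi)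
 finally show "kappa M d R mq nq ro = mq*(- d*psi' N gam R)/(nq*psi N gam R + (- d*psi' N gam R))" .
 show "kappa M d R mq nq ro > 0" unfolding k using AB pos by (simp add: add_pos_pos)
qed

lemma beta0_char:
 assumes N: "N + 1 = CARD('m::finite)"
 obtains l where "l > 0" "ALL r:{0..R}. ph N l r > 0"
  "D*ph' N l R + kappa (M::'m itself) d R mq nq ro*ph N l R = 0" "beta0sq M D d R mq nq ro = l"
proof -
 note k = kappa_psi(2)[OF N, of M]
 obtain l where l: "l > 0" "ALL r:{0..R}. ph N l r > 0" "D*ph' N l R + kappa M d R mq nq ro*ph N l R = 0" using robin_exists[OF k] by blast
 have "beta0sq M D d R mq nq ro = l" unfolding beta0sq_def principal_eig_iff[OF k l N] by simp
 with l that show ?thesis by blast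
qed

end

section \<open>Functions separating \<open>(x, t)\<close> from the radius\<close>

lemma has_par_sep:
 fixes F :: "'a::euclidean_space => real"
 assumes "((%s. a (fst p) s) HD a') (at t)" "has_d2 (%x. a x t) (fst p) c" "has_lap F (snd p) L"
 shows "has_par (%p t. a (fst p) t*F (snd p)) p t (a'*F (snd p)) (c*F (snd p) + a (fst p) t*L)" unfolding has_par_def using DERIV_cmult_right[OF assms(1), of "F (snd p)"] has_lap_prod[OF assms(2,3)] by simp

lemma has_par_add:
 "has_par f p t a l ==> has_par h p t b m ==> has_par (%p t. f p t + h p t) p t (a + b) (l + m)" by (auto simp: has_par_def intro: DERIV_add has_lap_add)

lemma has_par_time:
 assumes "(h HD h') (at t)"
 shows "has_par (%p t. h t) (p::'a::euclidean_space) t h' 0" using assms has_lap_const by (auto simp: has_par_def)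

lemma dn_in_add: "dn_in R f p a ==> dn_in R h p b ==> dn_in R (%p. f p + h p) p (a + b)" by (auto simp: dn_in_def intro: DERIV_add)
lemma dn_out_add: "dn_out R f p a ==> dn_out R h p b ==> dn_out R (%p. f p + h p) p (a + b)" by (auto simp: dn_out_def intro: DERIV_add)
lemma dn_in_const: "dn_in R (%p. k) p 0" and dn_out_const: "dn_out R (%p. k) p 0" by (auto simp: dn_in_def dn_out_def)

context field_road begin

lemma dn_in_sep:
 fixes p :: "'m::finite pt"
 assumes p: "nr p = R" and w: "(w HD x) (at_left R)"
 shows "dn_in R (%p. a (fst p)*w (nr p)) p (a (fst p)*x)"
proof -
 have "((%s. w (norm (snd p + s *R ((1/R) *R snd p)))) HD x) (at_left 0)" by (rule radial_dn[OF p w])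
 from DERIV_cmult[OF this, of "a (fst p)"] show ?thesis by (simp add: dn_in_def nrm_def)
qed

lemma radial_dn_out:
 fixes y :: "'a::real_normed_vector"
 assumes y: "norm y = R" and w: "(w HD x) (at_right R)"
 shows "((%s. w (norm (y + s *R ((1/R) *R y)))) HD x) (at_right 0)"
proof -
 have "((%s. w (R + s)) HD x) (at_right 0)"
 proof -
  have "(%s. R + s) ` {0<..} = {R<..}"
  proof (intro set_eqI iffI)
   fix x assume "x:{R<..}"
   thus "x:(%s. R + s) ` {0<..}" by (intro image_eqI[of _ _ "x - R"]) auto
  qed auto
  hence "(w HD x) (at (R + 0) within (%s. R + s) ` {0<..})" using w by simp
  moreover have "((%s. R + s) HD 1) (at 0 within {0<..})" by (auto intro!: dei)
  ultimately show ?thesis using DERIV_image_chain[of w x "%s. R + s" 0 "{0<..}" 1] by (simp add: o_def)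
 qed
 moreover have "\<forall>\<^sub>F s in at_right 0. w (R + s) = w (norm (y + s *R ((1/R) *R y)))" using eventually_line_right
 proof eventually_elim
  case (elim s)
  hence "norm (y + s *R ((1/R) *R y)) = R + s" by (intro radial_line[OF y]) (use pos in simp)
  thus ?case by (simp only:)
 qed
 moreover have "w (R + 0) = w (norm (y + 0 *R ((1/R) *R y)))" using y by simp
 ultimately show ?thesis by (rule has_field_derivative_cong_eventually[THEN iffD1, rotated -1])
qed

lemma dn_out_sep:
 fixes p :: "'m::finite pt"
 assumes p: "nr p = R" and w: "(w HD x) (at_right R)"
 shows "dn_out R (%p. a (fst p)*w (nr p)) p (a (fst p)*x)"
proof -
 have "((%s. w (norm (snd p + s *R ((1/R) *R snd p)))) HD x) (at_right 0)" by (rule radial_dn_out[OF p w])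
 from DERIV_cmult[OF this, of "a (fst p)"] show ?thesis by (simp add: dn_out_def nrm_def)
qed

lemma cont_sep_in:
 fixes a :: "real => real => real" and w :: "real => real"
 assumes "con S (%(x,t). a x t)" "con {0..R} w" "!!x t. t:I ==> (x, t):S"
 shows "con (OC \<times> I) (%(p::'m::finite pt,t). a (fst p) t*w (nr p))"
proof -
 have "con (OC \<times> I) (%z::'m pt \<times> real. (%(x,t). a x t) ((%z. (fst (fst z), snd z)) z))"
 proof (rule continuous_on_compose2[OF assms(1)])
  show "con (OC \<times> I) (%z::'m pt \<times> real. (fst (fst z), snd z))" by (rule continuous_on_Pair[OF continuous_on_fst[OF continuous_on_fst[OF continuous_on_id]] continuous_on_snd[OF continuous_on_id]])
  show "(%z::'m pt \<times> real. (fst (fst z), snd z)) ` (OC \<times> I) \<subseteq> S" by (rule image_subsetI, rule assms(3)) (simp add: mem_Times_iff)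
 qed
 moreover have "con (OC \<times> I) (%z::'m pt \<times> real. w (norm (snd (fst z))))" by (rule continuous_on_compose2[OF assms(2)]) (auto intro!: ci simp: OmegaC_def)
 ultimately show ?thesis unfolding case_prod_beta by (simp add: continuous_on_mult)
qed

lemma cont_sep_out:
 fixes a :: "real => real => real" and w :: "real => real"
 assumes "con S (%(x,t). a x t)" "con {R..} w" "!!x t. t:I ==> (x, t):S"
 shows "con (EC \<times> I) (%(p::'m::finite pt,t). a (fst p) t*w (nr p))"
proof -
 have "con (EC \<times> I) (%z::'m pt \<times> real. (%(x,t). a x t) ((%z. (fst (fst z), snd z)) z))"
 proof (rule continuous_on_compose2[OF assms(1)])
  show "con (EC \<times> I) (%z::'m pt \<times> real. (fst (fst z), snd z))" by (rule continuous_on_Pair[OF continuous_on_fst[OF continuous_on_fst[OF continuous_on_id]] continuous_on_snd[OF continuous_on_id]])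
  show "(%z::'m pt \<times> real. (fst (fst z), snd z)) ` (EC \<times> I) \<subseteq> S" by (rule image_subsetI, rule assms(3)) (simp add: mem_Times_iff)
 qed
 moreover have "con (EC \<times> I) (%z::'m pt \<times> real. w (norm (snd (fst z))))" by (rule continuous_on_compose2[OF assms(2)]) (auto intro!: ci simp: ExtC_def)
 ultimately show ?thesis unfolding case_prod_beta by (simp add: continuous_on_mult)
qed

end

section \<open>Supersolutions, extinction and the positive steady state\<close>

context kpp begin

lemma g_gt1: "s >= 1 ==> g s <= 0" using g_neg g_1 by (cases "s = 1") (auto intro: less_imp_le)

text \<open>\<open>G\<close> is \<open>- D\<close> times the Laplacian of the interior profile.\<close>

definition profile where
 "profile (M::'m::finite itself) Fi Fi1 G Ps Ps1 B \<longleftrightarrow>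
  con {0..R} Fi & (ALL r:{0..R}. Fi r > 0) & con {0..R} G & (ALL r:{0..R}. G r > 0) &
  (ALL y::real^'m. norm y < R --> has_lap (%y. Fi (norm y)) y (- G (norm y)/D)) &
  (Fi HD Fi1) (at_left R) &
  con {R..} Ps & (ALL r>=R. 0 < Ps r & Ps r <= B) &
  (ALL y::real^'m. norm y > R --> has_lap (%y. Ps (norm y)) y (ro/d*Ps (norm y))) &
  (Ps HD Ps1) (at_right R) &
  D*Fi1 = nq*Ps R - mq*Fi R & - d*Ps1 = mq*Fi R - nq*Ps R"

text \<open>The additive parts \<open>h / mq\<close> and \<open>h / nq\<close> drop out of both
  exchange terms, and the profile satisfies the flux conditions by itself. What remains are the two
  scalar inequalities \<open>cu\<close> and \<open>cv\<close>.\<close>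

lemma super_Ah:
 fixes u v :: "'m::finite pt => real => real"
 assumes P: "profile TYPE('m) Fi Fi1 G Ps Ps1 B"
  and adm: "admissible_data R u0 v0" and S: "sol u0 v0 u v" and ta: "0 <= ta"
  and dA: "!!t. (A HD A' t) (at t)" and dh: "!!t. (h HD h' t) (at t)"
  and nn: "!!t. ta <= t ==> t <= T ==> A t >= 0 & h t >= 0"
  and iu: "!!p. p:OC ==> u p ta <= A ta*Fi (nr p) + h ta/mq"
  and iv: "!!p. p:EC ==> v p ta <= A ta*Ps (nr p) + h ta/nq"
  and cu: "!!t r. ta < t ==> t <= T ==> r:{0..R} ==> A' t*Fi r + h' t/mq + A t*G r >= g (A t*Fi r + h t/mq)"
  and cv: "!!t r. ta < t ==> t <= T ==> r >= R ==> A' t*Ps r + h' t/nq + ro*h t/nq >= 0"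
  and t: "ta <= t" "t <= T"
 shows "(p:OC --> u p t <= A t*Fi (nr p) + h t/mq) &
  (p:EC --> v p t <= A t*Ps (nr p) + h t/nq)"
proof -
 have Fic: "con {0..R} Fi" and Fip: "!!r. r:{0..R} ==> Fi r > 0"
  and Gc: "con {0..R} G" and Gp: "!!r. r:{0..R} ==> G r > 0"
  and lapFi: "!!y::real^'m. norm y < R ==> has_lap (%y. Fi (norm y)) y (- G (norm y)/D)"
  and dFi: "(Fi HD Fi1) (at_left R)"
  and Psc: "con {R..} Ps" and Psb: "!!r. r >= R ==> 0 < Ps r & Ps r <= B"
  and lapPs: "!!y::real^'m. norm y > R ==> has_lap (%y. Ps (norm y)) y (ro/d*Ps (norm y))"
  and dPs: "(Ps HD Ps1) (at_right R)"
  and bc: "D*Fi1 = nq*Ps R - mq*Fi R" "- d*Ps1 = mq*Fi R - nq*Ps R" using P unfolding profile_def by blast+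
 define w where "w = (%(p::'m pt) t. A t*Fi (nr p) + h t/mq)"
 define z where "z = (%(p::'m pt) t. A t*Ps (nr p) + h t/nq)"
 have Ac: "con X A" and hc: "con X h" for X by (rule DERIV_continuous_on, rule has_field_derivative_at_within, rule dA)
   (rule DERIV_continuous_on, rule has_field_derivative_at_within, rule dh)
 have c1: "con UNIV (%(x::real,t). A t)" unfolding case_prod_beta by (intro continuous_on_compose2[OF Ac[of UNIV]] ci) auto
 have hcx: "con (X::('m pt \<times> real) set) (%(p,t). h t/c)" if "c ~= 0" for X c unfolding case_prod_beta using that by (intro ci continuous_on_compose2[OF hc[of UNIV]]) auto
 have par_w: "has_par w p t (A' t*Fi (nr p) + h' t/mq) (A t*(- G (nr p)/D))"
  if "p:OI" for p :: "'m pt" and t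
 proof -
  have "has_par (%p t. A t*Fi (nr p)) p t (A' t*Fi (nr p)) (0*Fi (nr p) + A t*(- G (nr p)/D))" by (rule has_par_sep[where a="%x. A" and F="%y. Fi (norm y)"]) (use dA has_d2_const lapFi that in \<open>auto simp: OmegaI_def\<close>)
  from has_par_add[OF this has_par_time[where h="%t. h t/mq"]] show ?thesis using DERIV_cdivide[OF dh[of t], of mq] by (simp add: w_def)
 qed
 have par_z: "has_par z p t (A' t*Ps (nr p) + h' t/nq) (A t*(ro/d*Ps (nr p)))"
  if "p:EI" for p :: "'m pt" and t
 proof -
  have "has_par (%p t. A t*Ps (nr p)) p t (A' t*Ps (nr p)) (0*Ps (nr p) + A t*(ro/d*Ps (nr p)))" by (rule has_par_sep[where a="%x. A" and F="%y. Ps (norm y)"]) (use dA has_d2_const lapPs that in \<open>auto simp: ExtI_def\<close>)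
  from has_par_add[OF this has_par_time[where h="%t. h t/nq"]] show ?thesis using DERIV_cdivide[OF dh[of t], of nq] by (simp add: z_def)
 qed
 have main: "(p:OC --> u p t <= w p t) & (p:EC --> v p t <= z p t)"
 proof (rule super_cmp[OF adm S ta, of T w z])
  show "con (OC \<times> {ta..T}) (%(p, t). w p t)" using continuous_on_add[OF cont_sep_in[OF c1, of Fi "{ta..T}"] hcx[of mq]] Fic pos by (simp add: w_def case_prod_beta)
  show "con (EC \<times> {ta..T}) (%(p, t). z p t)" using continuous_on_add[OF cont_sep_out[OF c1, of Ps "{ta..T}"] hcx[of nq]] Psc pos by (simp add: z_def case_prod_beta)
  show "w p s >= 0" if "p:OC" "s:{ta..T}" for p s
  proof -
   have "Fi (nr p) > 0" using Fip that by (auto simp: OmegaC_def)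
   thus ?thesis using nn[of s] that pos by (simp add: w_def)
  qed
  show "z p s >= 0" if "p:EC" "s:{ta..T}" for p s
  proof -
   have "Ps (nr p) > 0" using Psb that by (auto simp: ExtC_def)
   thus ?thesis using nn[of s] that pos by (simp add: z_def)
  qed
  show "u p ta <= w p ta" if "p:OC" for p using iu[OF that] by (simp add: w_def)
  show "v p ta <= z p ta" if "p:EC" for p using iv[OF that] by (simp add: z_def)
 next
  fix p :: "'m pt" and s assume a: "p:OI" "ta < s" "s <= T"
  have "D*(A s*(- G (nr p)/D)) + g (w p s) <= A' s*Fi (nr p) + h' s/mq"
  proof -
   have "D*(A s*(- G (nr p)/D)) = - (A s*G (nr p))" using pos by simp
   moreover have "nr p:{0..R}" using a(1) by (simp add: OmegaI_def)
   ultimately show ?thesis using cu[OF a(2,3), of "nr p"] unfolding w_def by linarith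
  qed
  thus "EX ft l. has_par w p s ft l & ft >= D*l + g (w p s)" using par_w[OF a(1)] by blast
 next
  fix p :: "'m pt" and s assume a: "p:EI" "ta < s" "s <= T"
  have "d*(A s*(ro/d*Ps (nr p))) - ro*z p s <= A' s*Ps (nr p) + h' s/nq"
  proof -
   have "d*(A s*(ro/d*Ps (nr p))) = ro*(A s*Ps (nr p))" using pos by simp
   moreover have "R <= nr p" using a(1) by (simp add: ExtI_def)
   moreover have "ro*z p s = ro*(A s*Ps (nr p)) + ro*h s/nq" by (simp add: z_def distrib_left)
   ultimately show ?thesis using cv[OF a(2,3), of "nr p"] by linarith
  qed
  thus "EX ft l. has_par z p s ft l & ft >= d*l - ro*z p s" using par_z[OF a(1)] by blast
 next
  fix p :: "'m pt" and s assume a: "nr p = R" "ta < s" "s <= T"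
  have "dn_in R (%p. w p s) p (A s*Fi1 + 0)" unfolding w_def by (intro dn_in_add dn_in_const dn_in_sep[OF a(1), where a="%x. A s"] dFi)
  moreover have "D*(A s*Fi1) = nq*z p s - mq*w p s"
  proof -
   have "D*(A s*Fi1) = A s*(D*Fi1)" by simp
   also have "\<dots> = A s*(nq*Ps R - mq*Fi R)" using bc by simp
   also have "\<dots> = nq*z p s - mq*w p s" using a(1) pos by (simp add: w_def z_def asi)
   finally show ?thesis .
  qed
  ultimately show "EX x. dn_in R (%p. w p s) p x & D*x >= nq*z p s - mq*w p s" by (intro exI[of _ "A s*Fi1"]) auto
 next
  fix p :: "'m pt" and s assume a: "nr p = R" "ta < s" "s <= T"
  have "dn_out R (%p. z p s) p (A s*Ps1 + 0)" unfolding z_def by (intro dn_out_add dn_out_const dn_out_sep[OF a(1), where a="%x. A s"] dPs)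
  moreover have "- d*(A s*Ps1) = mq*w p s - nq*z p s"
  proof -
   have "- d*(A s*Ps1) = A s*(- d*Ps1)" by simp
   also have "\<dots> = A s*(mq*Fi R - nq*Ps R)" using bc by simp
   also have "\<dots> = mq*w p s - nq*z p s" using a(1) pos by (simp add: w_def z_def asi)
   finally show ?thesis .
  qed
  ultimately show "EX x. dn_out R (%p. z p s) p x & - d*x >= mq*w p s - nq*z p s" by (intro exI[of _ "A s*Ps1"]) auto
 qed (use t in auto)
 thus ?thesis by (simp add: w_def z_def)
qed

text \<open>Three stages: while \<open>A0 * Fi \<ge> 1\<close> makes the reaction nonpositive, the
  additive part decays from \<open>h0\<close> to a small \<open>h1\<close>; then the amplitude
  descends linearly from \<open>A0\<close> to \<open>A1\<close>, paid for by the uniform strictness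
  of \<open>strict\<close>; finally both stay fixed.\<close>

lemma upper_bound:
 fixes u v :: "'m::finite pt => real => real"
 assumes P: "profile TYPE('m) Fi Fi1 G Ps Ps1 B"
  and adm: "admissible_data R u0 v0" and S: "sol u0 v0 u v"
  and Ai: "Ai >= 0" and strict: "!!A r. A > Ai ==> r:{0..R} ==> g (A*Fi r) < A*G r"
  and e: "e > 0"
 shows "\<forall>\<^sub>F t in at_top. (ALL p:OC. u p t <= Ai*Fi (nr p) + e) & (ALL p:EC. v p t <= Ai*Ps (nr p) + e)"
proof -
 have Fic: "con {0..R} Fi" and Fip: "!!r. r:{0..R} ==> Fi r > 0"
  and Gc: "con {0..R} G" and Gp: "!!r. r:{0..R} ==> G r > 0"
  and lapFi: "!!y::real^'m. norm y < R ==> has_lap (%y. Fi (norm y)) y (- G (norm y)/D)"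
  and dFi: "(Fi HD Fi1) (at_left R)"
  and Psc: "con {R..} Ps" and Psb: "!!r. r >= R ==> 0 < Ps r & Ps r <= B"
  and lapPs: "!!y::real^'m. norm y > R ==> has_lap (%y. Ps (norm y)) y (ro/d*Ps (norm y))"
  and dPs: "(Ps HD Ps1) (at_right R)"
  and bc: "D*Fi1 = nq*Ps R - mq*Fi R" "- d*Ps1 = mq*Fi R - nq*Ps R" using P unfolding profile_def by blast+
 have ne: "{0..R} ~= {}" using pos by simp
 obtain r1 where r1: "r1:{0..R}" "!!r. r:{0..R} ==> Fi r1 <= Fi r" using continuous_attains_inf[OF compact_Icc ne Fic] by auto
 obtain r2 where r2: "r2:{0..R}" "!!r. r:{0..R} ==> Fi r <= Fi r2" using continuous_attains_sup[OF compact_Icc ne Fic] by auto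
 obtain r3 where r3: "r3:{0..R}" "!!r. r:{0..R} ==> G r3 <= G r" using continuous_attains_inf[OF compact_Icc ne Gc] by auto
 define F where "F = Fi r2"
 have F: "F > 0" "!!r. r:{0..R} ==> Fi r <= F" using r2 Fip by (auto simp: F_def)
 have B: "B > 0" using Psb[of R] by auto
 obtain M where M: "M > 0" "!!p s. p:OC ==> s:{0..0} ==> \<bar>u p s\<bar> <= M"
  "!!p s. p:EC ==> s:{0..0} ==> \<bar>v p s\<bar> <= M" using sol_bound[OF S, of 0] by metis
 define h0 where "h0 = M*(mq + nq)"
 have h0: "h0 > 0" "M <= h0/mq" "M <= h0/nq"
 proof -
  show "h0 > 0" using M(1) pos unfolding h0_def by simp
  show "M <= h0/mq" "M <= h0/nq" using M(1) pos by (simp_all add: h0_def pos_le_divide_eq distrib_left)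
 qed
 \<comment> \<open>The excess over \<open>Ai\<close> contributes at most \<open>e/2\<close>; the
   other half is reserved for \<open>h1\<close>.\<close>
 define A1 where "A1 = Ai + e/(2*(F + B))"
 have A1: "A1 > Ai" "(A1 - Ai)*F <= e/2" "(A1 - Ai)*B <= e/2" using e F(1) B by (auto simp: A1_def field_simps)
 define A0 where "A0 = A1 + 1/Fi r1"
 have A0: "A0 > A1" "A0*Fi r1 >= 1" using Fip[OF r1(1)] A1(1) Ai by (auto simp: A0_def field_simps)
 have A0p: "A0 > 0" using A0 A1 Ai by linarith
 have A0Fi: "A0*Fi r >= 1" if "r:{0..R}" for r using A0(2) mult_left_mono[OF r1(2)[OF that], of A0] A0p by linarith
 have "con ({A1..A0} \<times> {0..R}) (%z. fst z*G (snd z) - g (fst z*Fi (snd z)))" by (intro ci continuous_on_compose2[OF continuous_g[of UNIV]] continuous_on_compose2[OF Gc] continuous_on_compose2[OF Fic]) auto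
 moreover have "compact ({A1..A0} \<times> {0..R})" "{A1..A0} \<times> {0..R} ~= {}" using A0(1) pos by (auto simp: compact_Times)
 ultimately obtain z0 where z0: "z0:{A1..A0} \<times> {0..R}" "!!z. z:{A1..A0} \<times> {0..R} ==>
  fst z0*G (snd z0) - g (fst z0*Fi (snd z0)) <= fst z*G (snd z) - g (fst z*Fi (snd z))" using continuous_attains_inf[of "{A1..A0} \<times> {0..R}" "%z. fst z*G (snd z) - g (fst z*Fi (snd z))"] by meson
 \<comment> \<open>The least strictness over all amplitudes crossed during the descent.\<close>
 define m where "m = fst z0*G (snd z0) - g (fst z0*Fi (snd z0))"
 have m: "m > 0" using strict[of "fst z0" "snd z0"] z0(1) A1(1) by (auto simp: m_def)
 have mm: "m <= A*G r - g (A*Fi r)" if "A1 <= A" "A <= A0" "r:{0..R}" for A r using z0(2)[of "(A, r)"] that by (simp add: m_def)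
 define h1 where "h1 = min h0 (min (m*mq/(2*g0)) (min (e*mq/2) (e*nq/2)))"
 have h1: "h1 > 0" "h1 <= h0" "g0*(h1/mq) <= m/2" "h1/mq <= e/2" "h1/nq <= e/2"
 proof -
  show "h1 > 0" "h1 <= h0" using h0 m pos g0_pos e by (auto simp: h1_def)
  have "h1 <= m*mq/(2*g0)" "h1 <= e*mq/2" "h1 <= e*nq/2" by (auto simp: h1_def)
  thus "g0*(h1/mq) <= m/2" "h1/mq <= e/2" "h1/nq <= e/2" using pos g0_pos by (auto simp: field_simps)
 qed
 have slack: "g (A*Fi r + h1/mq) <= A*G r - m/2" if "A1 <= A" "A <= A0" "r:{0..R}" for A r
 proof -
  have "A*Fi r >= 0" using that A1(1) Ai Fip[OF that(3)] by simp
  hence "g (A*Fi r + h1/mq) - g (A*Fi r) <= g0*(h1/mq)" using g_diff_le[of "A*Fi r" "A*Fi r + h1/mq"] h1(1) pos by simp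
  thus ?thesis using mm[OF that] h1(3) by linarith
 qed
 \<comment> \<open>Decay rate of \<open>h\<close>: at most \<open>ro\<close>, the damping available
   outside, and small enough for \<open>A0 * G\<close> to cover it inside.\<close>
 define eps where "eps = min ro (mq*A0*G r3/h0)"
 have eps: "eps > 0" "eps <= ro" "eps*h0/mq <= A0*G r3"
 proof -
  show "eps > 0" "eps <= ro" using pos A0p Gp[OF r3(1)] h0 by (auto simp: eps_def)
  have "eps <= mq*A0*G r3/h0" by (simp add: eps_def)
  thus "eps*h0/mq <= A0*G r3" using h0 pos by (simp add: field_simps)
 qed
 define t1 where "t1 = ln (h0/h1)/eps"
 have t1: "t1 >= 0" "h0*exp (- eps*t1) = h1"
 proof -
  show "t1 >= 0" using h0 h1 eps by (simp add: t1_def)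
  have "- eps*t1 = ln (h1/h0)" using h0 h1 eps by (simp add: t1_def ln_div)
  hence "exp (- eps*t1) = h1/h0" using h0 h1 by simp
  thus "h0*exp (- eps*t1) = h1" using h0 by simp
 qed
 have ph1: "(p:OC --> u p t1 <= A0*Fi (nr p) + (h0*exp (- eps*t1))/mq) &
  (p:EC --> v p t1 <= A0*Ps (nr p) + (h0*exp (- eps*t1))/nq)" for p :: "'m pt"
 proof (rule super_Ah[OF P adm S order_refl, of "%t. A0" "%t. 0" "%t. h0*exp (- eps*t)" "%t. - eps*(h0*exp (- eps*t))" t1])
  show "((%t. h0*exp (- eps*t)) HD - eps*(h0*exp (- eps*t))) (at t)" for t by (auto intro!: dei)
  show "0 <= A0 & 0 <= h0*exp (- eps*t)" for t using A0p h0 by simp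
  show "u p 0 <= A0*Fi (nr p) + h0*exp (- eps*0)/mq" if "p:OC" for p using M(2)[OF that, of 0] h0(2) A0Fi[of "nr p"] that by (auto simp: OmegaC_def)
  show "v p 0 <= A0*Ps (nr p) + h0*exp (- eps*0)/nq" if "p:EC" for p
  proof -
   have "A0*Ps (nr p) >= 0" using Psb[of "nr p"] that A0p by (auto simp: ExtC_def)
   thus ?thesis using M(3)[OF that, of 0] h0(3) by auto
  qed
 next
  fix t r :: real assume t: "0 < t" "t <= t1" and r: "r:{0..R}"
  have "h0*exp (- eps*t) <= h0*1" using h0 eps t by (intro mult_left_mono) auto
  hence "eps*(h0*exp (- eps*t))/mq <= eps*h0/mq" using eps pos by (intro divide_right_mono mult_left_mono) auto
  also have "\<dots> <= A0*G r" using eps(3) mult_left_mono[OF r3(2)[OF r], of A0] A0p by linarith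
  finally have a: "eps*(h0*exp (- eps*t))/mq <= A0*G r" .
  have "A0*Fi r + h0*exp (- eps*t)/mq >= 1" using A0Fi[OF r] h0 pos by (simp add: add_increasing2)
  from g_gt1[OF this] a show "g (A0*Fi r + h0*exp (- eps*t)/mq) <= 0*Fi r + - eps*(h0*exp (- eps*t))/mq + A0*G r" by simp
 next
  fix t r :: real assume t: "0 < t" "t <= t1" and r: "r >= R"
  have "eps*(h0*exp (- eps*t))/nq <= ro*(h0*exp (- eps*t))/nq" using eps h0 pos by (intro divide_right_mono mult_right_mono) auto
  thus "0 <= 0*Ps r + - eps*(h0*exp (- eps*t))/nq + ro*(h0*exp (- eps*t))/nq" by simp
 qed (use t1 in auto)
 \<comment> \<open>Descent rate of the amplitude: half of \<open>m\<close> pays for it inside;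
   outside, where the profile solves its equation exactly, the damping \<open>ro * h1 / nq\<close>
   does.\<close>
 define ea where "ea = min (m/(2*F)) (ro*h1/(nq*B))"
 have ea: "ea > 0" "ea*F <= m/2" "ea*B <= ro*h1/nq"
 proof -
  show "ea > 0" using m F h1 pos B by (simp add: ea_def)
  have "ea <= m/(2*F)" "ea <= ro*h1/(nq*B)" by (auto simp: ea_def)
  thus "ea*F <= m/2" "ea*B <= ro*h1/nq" using F B pos by (auto simp: field_simps)
 qed
 define t2 where "t2 = t1 + (A0 - A1)/ea"
 have t2: "t2 >= t1" "A0 - ea*(t2 - t1) = A1" using ea A0 by (auto simp: t2_def)
 have ph2: "(p:OC --> u p t2 <= (A0 - ea*(t2 - t1))*Fi (nr p) + h1/mq) &
  (p:EC --> v p t2 <= (A0 - ea*(t2 - t1))*Ps (nr p) + h1/nq)" for p :: "'m pt"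
 proof (rule super_Ah[OF P adm S t1(1), of "%t. A0 - ea*(t - t1)" "%t. - ea" "%t. h1" "%t. 0" t2])
  show "((%t. A0 - ea*(t - t1)) HD - ea) (at t)" for t by (auto intro!: dei)
  have Ab: "A1 <= A0 - ea*(t - t1)" "A0 - ea*(t - t1) <= A0" if "t1 <= t" "t <= t2" for t
  proof -
   have "ea*(t - t1) <= ea*(t2 - t1)" "0 <= ea*(t - t1)" using ea that by auto
   thus "A1 <= A0 - ea*(t - t1)" "A0 - ea*(t - t1) <= A0" using t2 by linarith+
  qed
  show "0 <= A0 - ea*(t - t1) & 0 <= h1" if "t1 <= t" "t <= t2" for t using Ab[OF that] A1(1) Ai h1 by linarith
  show "u p t1 <= (A0 - ea*(t1 - t1))*Fi (nr p) + h1/mq" if "p:OC" for p using ph1[of p, THEN conjunct1, rule_format, OF that] t1(2) by simp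
  show "v p t1 <= (A0 - ea*(t1 - t1))*Ps (nr p) + h1/nq" if "p:EC" for p using ph1[of p, THEN conjunct2, rule_format, OF that] t1(2) by simp
 next
  fix t r :: real assume t: "t1 < t" "t <= t2" and r: "r:{0..R}"
  have "ea*(t - t1) <= ea*(t2 - t1)" "0 <= ea*(t - t1)" using ea t by auto
  hence A: "A1 <= A0 - ea*(t - t1)" "A0 - ea*(t - t1) <= A0" using t2 by linarith+
  have "ea*Fi r <= ea*F" using F(2)[OF r] ea by simp
  thus "g ((A0 - ea*(t - t1))*Fi r + h1/mq) <= - ea*Fi r + 0/mq + (A0 - ea*(t - t1))*G r" using slack[OF A r] ea(2) by simp
 next
  fix t r :: real assume t: "t1 < t" "t <= t2" and r: "r >= R"
  have "ea*Ps r <= ea*B" using Psb[OF r] ea by simp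
  thus "0 <= - ea*Ps r + 0/nq + ro*h1/nq" using ea(3) by simp
 qed (use t2 in auto)
 have ph3: "(p:OC --> u p t <= A1*Fi (nr p) + h1/mq) &
  (p:EC --> v p t <= A1*Ps (nr p) + h1/nq)" if t: "t >= t2" for p :: "'m pt" and t
 proof (rule super_Ah[OF P adm S, of t2 "%t. A1" "%t. 0" "%t. h1" "%t. 0" t])
  show "0 <= t2" using t1 t2 by linarith
  show "0 <= A1 & 0 <= h1" using A1(1) Ai h1 by simp
  show "u p t2 <= A1*Fi (nr p) + h1/mq" if "p:OC" for p using ph2[of p, THEN conjunct1, rule_format, OF that] t2 by simp
  show "v p t2 <= A1*Ps (nr p) + h1/nq" if "p:EC" for p using ph2[of p, THEN conjunct2, rule_format, OF that] t2 by simp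
  show "g (A1*Fi r + h1/mq) <= 0*Fi r + 0/mq + A1*G r" if "r:{0..R}" for r using slack[of A1 r] that A0 m by simp
  show "0 <= 0*Ps r + 0/nq + ro*h1/nq" for r using pos h1 by simp
 qed (use t in auto)
 show ?thesis
 proof (rule eventually_mono[OF eventually_ge_at_top[of t2]], intro conjI ballI)
  fix t and p :: "'m pt" assume t: "t >= t2"
  {
   assume p: "p:OC"
   have "(A1 - Ai)*Fi (nr p) <= (A1 - Ai)*F" using F(2)[of "nr p"] p A1(1) by (auto simp: OmegaC_def)
   thus "u p t <= Ai*Fi (nr p) + e" using ph3[OF t, THEN conjunct1, rule_format, OF p] A1(2) h1(4) unfolding left_diff_distrib by linarith
  next
   assume p: "p:EC"
   have "(A1 - Ai)*Ps (nr p) <= (A1 - Ai)*B" using Psb[of "nr p"] p A1(1) by (auto simp: ExtC_def)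
   thus "v p t <= Ai*Ps (nr p) + e" using ph3[OF t, THEN conjunct2, rule_format, OF p] A1(3) h1(5) unfolding left_diff_distrib by linarith
  }
 qed
qed

end

lemma C2_on_snd:
 fixes F :: "'a::euclidean_space => real" and T :: "(real \<times> 'a) set"
 assumes "C2_on S F" "!!p. p:T ==> snd p:S"
 shows "C2_on T (%p. F (snd p))"
proof -
 obtain f' f'' where f: "!!p. p:S ==> (F has_derivative f' p) (at p)"
  "!!p h. p:S ==> ((%q. f' q h) has_derivative f'' p h) (at p)"
  "!!h k. con S (%p. f'' p h k)" using assms(1) unfolding C2_on_def by blast
 have s: "(snd has_derivative snd) (at p)" for p :: "real \<times> 'a" by (rule bounded_linear_imp_has_derivative[OF bounded_linear_snd])
 have ch: "((%p. k (snd p)) has_derivative (%h. k' (snd h))) (at p)"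
  if "(k has_derivative k') (at (snd p))" for k k' and p :: "real \<times> 'a" using diff_chain_at[OF s that] by (simp add: o_def)
 have c: "con T (%p. f'' (snd p) (snd h) (snd k))" for h k :: "real \<times> 'a" by (rule continuous_on_compose2[OF f(3)]) (use assms(2) in \<open>auto intro!: ci\<close>)
 show ?thesis unfolding C2_on_def by (intro exI[of _ "%p h. f' (snd p) (snd h)"] exI[of _ "%p h k. f'' (snd p) (snd h) (snd k)"]
   conjI ballI allI ch f assms(2) c)
qed

context field_road begin

lemma psi_C2:
 fixes S :: "'a::euclidean_space set"
 assumes N: "N + 1 = DIM('a)" and g: "ga > 0" and S: "open S" "0 \<notin> S"
 shows "C2_on S (%y. psi N ga (norm y))"
  "y:S ==> has_lap (%y. psi N ga (norm y)) y (ga^2*psi N ga (norm y))"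
proof -
 have c: "isCont (%r. ga\<^sup>2*psi N ga r) (norm y)" if "y ~= 0" for y :: 'a using that by (intro isCont_mult DERIV_isCont[OF psi_deriv[OF g]] continuous_const) simp
 have d: "(psi N ga HD psi' N ga (norm y)) (at (norm y))"
  "((%r. r^N*psi' N ga r) HD norm y^N*(ga^2*psi N ga (norm y))) (at (norm y))"
  if "y ~= 0" for y :: 'a using psi_deriv[OF g, of "norm y" N] psi'_deriv[OF g, of "norm y" N] that by auto
 note * = radial_ode_C2[of S N "psi N ga" "psi' N ga" "%r. ga\<^sup>2*psi N ga r", OF S(1) N d(1) d(2) c]
 show "C2_on S (%y. psi N ga (norm y))" by (rule *(1)) (use S(2) in blast)+
 show "y:S ==> has_lap (%y. psi N ga (norm y)) y (ga^2*psi N ga (norm y))" by (rule *(2)) (use S(2) in blast)+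
qed

lemma psi_cont: "ga > 0 ==> con {R..} (psi N ga)" using pos by (intro continuous_at_imp_continuous_on ballI DERIV_isCont[OF psi_deriv]) auto

lemma open_outside: "open {y::'a::real_normed_vector. R < norm y}" by (intro open_Collect_less ci)

text \<open>The multiple of \<open>psi N gam\<close> that the exterior flux condition selects when
  the interior value at the interface is \<open>w\<close>.\<close>

definition bpsi :: "nat => real => real" where
 "bpsi N w = mq*w/(nq*psi N gam R + (- d*psi' N gam R))"

lemma bpsi_denom: "nq*psi N gam R + (- d*psi' N gam R) > 0" using mult_pos_pos[OF pos(5) psi_pos[OF gam(1) pos(3), of N]] mult_pos_neg[OF pos(2) psi'_neg[OF gam(1) pos(3), of N]] by linarith

end

context kpp begin

text \<open>Once the exterior multiple is fixed by \<open>bpsi\<close>, the interior flux condition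
  becomes the Robin condition with \<open>kappa\<close>.\<close>

lemma profile_I:
 assumes N: "N + 1 = CARD('m::finite)"
  and Fi: "con {0..R} Fi" "!!r. r:{0..R} ==> Fi r > 0"
  and G: "con {0..R} G" "!!r. r:{0..R} ==> G r > 0"
  and lap: "!!y::real^'m. norm y < R ==> has_lap (%y. Fi (norm y)) y (- G (norm y)/D)"
  and dFi: "(Fi HD Fi1) (at_left R)" "D*Fi1 + kappa TYPE('m) d R mq nq ro*Fi R = 0"
 shows "profile TYPE('m) Fi Fi1 G (%r. bpsi N (Fi R)*psi N gam r) (bpsi N (Fi R)*psi' N gam R) (bpsi N (Fi R)*psi N gam R)"
proof -
 note den = bpsi_denom[of N]
 have "Fi R > 0" using Fi(2) pos by simp
 hence b: "bpsi N (Fi R) > 0" using den pos unfolding bpsi_def by simp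
 have bn: "bpsi N (Fi R)*(nq*psi N gam R + (- d*psi' N gam R)) = mq*Fi R" using den unfolding bpsi_def by simp
 have "kappa TYPE('m) d R mq nq ro*Fi R = bpsi N (Fi R)*(- d*psi' N gam R)" unfolding kappa_psi(1)[OF N] bpsi_def by simp
 hence b1: "D*Fi1 = - (bpsi N (Fi R)*(- d*psi' N gam R))" using dFi(2) by linarith
 have lps: "has_lap (%y. bpsi N (Fi R)*psi N gam (norm y)) y (ro/d*(bpsi N (Fi R)*psi N gam (norm y)))"
  if "norm y > R" for y :: "real^'m"
 proof -
  have "ro/d = gam^2" using gam(2) pos by (simp add: field_simps)
  moreover have "has_lap (%y. psi N gam (norm y)) y (gam^2*psi N gam (norm y))" by (rule psi_C2(2)[OF _ gam(1) open_outside]) (use N pos that in auto)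
  ultimately show ?thesis using has_lap_cmult[of _ y _ "bpsi N (Fi R)"] by (metis mult.left_commute)
 qed
 show ?thesis unfolding profile_def
 proof (intro conjI allI impI ballI)
  fix r assume r: "R <= r"
  have "r > 0" using r pos by simp
  thus "0 < bpsi N (Fi R)*psi N gam r" using b psi_pos[OF gam(1)] by simp
  show "bpsi N (Fi R)*psi N gam r <= bpsi N (Fi R)*psi N gam R" using b psi_decr[OF gam(1) pos(3) r] by simp
 next
  show "((%r. bpsi N (Fi R)*psi N gam r) HD bpsi N (Fi R)*psi' N gam R) (at_right R)" by (rule DERIV_cmult, rule has_field_derivative_at_within, rule psi_deriv[OF gam(1) pos(3)])
  show "con {R..} (%r. bpsi N (Fi R)*psi N gam r)" by (intro ci psi_cont gam)
  show "D*Fi1 = nq*(bpsi N (Fi R)*psi N gam R) - mq*Fi R" using b1 bn by (simp add: asi)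
  show "- d*(bpsi N (Fi R)*psi' N gam R) = mq*Fi R - nq*(bpsi N (Fi R)*psi N gam R)" using bn by (simp add: asi)
 qed (use Fi G lap dFi lps in auto)
qed

lemma zero_profile:
 assumes N: "N + 1 = CARD('m::finite)" and l: "l > 0" "ALL r:{0..R}. ph N l r > 0"
  "D*ph' N l R + kappa TYPE('m) d R mq nq ro*ph N l R = 0"
 shows "EX Ps Ps1 B. profile TYPE('m) (ph N l) (ph' N l R) (%r. D*l*ph N l r) Ps Ps1 B"
proof (intro exI, rule profile_I[OF N])
 show "has_lap (%y. ph N l (norm y)) y (- (D*l*ph N l (norm y))/D)" for y :: "real^'m" using ph_C2(2)[where S=UNIV and l=l and N=N and 'a="real^'m"] N pos by simp
 show "(ph N l HD ph' N l R) (at_left R)" by (rule has_field_derivative_at_within, rule ph_deriv[OF pos(3)])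
qed (use l pos in \<open>auto intro!: ci ph_cont_r\<close>)

text \<open>\<open>upper_bound\<close> with \<open>Ai = 0\<close> and the Robin eigenfunction as
  profile. The critical case \<open>g0 = D * l\<close> is included because
  \<open>g s < g0 * s\<close> is strict for every positive \<open>s\<close>.\<close>

lemma conv_zero_I:
 fixes u v :: "'m::finite pt => real => real"
 assumes N: "N + 1 = CARD('m)" and l: "l > 0" "ALL r:{0..R}. ph N l r > 0"
  "D*ph' N l R + kappa TYPE('m) d R mq nq ro*ph N l R = 0" and lg: "g0 <= D*l"
  and adm: "admissible_data R u0 v0" and S: "sol u0 v0 u v"
 shows "conv_zero R u v"
proof -
 obtain Ps Ps1 B where P: "profile TYPE('m) (ph N l) (ph' N l R) (%r. D*l*ph N l r) Ps Ps1 B" using zero_profile[OF N l] by blast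
 have st: "g (A*ph N l r) < A*(D*l*ph N l r)" if "A > 0" "r:{0..R}" for A r
 proof -
  have "A*ph N l r > 0" using that l by simp
  hence "g (A*ph N l r) < g0*(A*ph N l r)" "g0*(A*ph N l r) <= D*l*(A*ph N l r)" using g_lt lg by (auto intro!: mult_right_mono)
  thus ?thesis by (simp add: mult_ac)
 qed
 show ?thesis unfolding conv_zero_def
 proof (intro allI impI)
  fix e :: real assume e: "e > 0"
  hence "e/2 > 0" by simp
  have "\<forall>\<^sub>F t in at_top. (ALL p:OC. u p t <= 0*ph N l (nr p) + e/2) & (ALL p:EC. v p t <= 0*Ps (nr p) + e/2)" by (rule upper_bound[OF P adm S order_refl]) (use st e in auto)
  hence "\<forall>\<^sub>F t in at_top. (ALL p:OC. u p t <= e/2) & (ALL p:EC. v p t <= e/2)" by simp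
  from this eventually_ge_at_top[of 0]
  show "\<forall>\<^sub>F t in at_top. (ALL p:OC. \<bar>u p t\<bar> < e) & (ALL p:EC. \<bar>v p t\<bar> < e)"
  proof eventually_elim
   case (elim t)
   have "\<bar>u p t\<bar> < e" if "p:OC" for p using elim(1)[THEN conjunct1, rule_format, OF that] nonneg(1)[OF adm S elim(2) that] e by simp
   moreover have "\<bar>v p t\<bar> < e" if "p:EC" for p using elim(1)[THEN conjunct2, rule_format, OF that] nonneg(2)[OF adm S elim(2) that] e by simp
   ultimately show ?case by blast
  qed
 qed
qed

lemma exists_steady:
 assumes N: "N + 1 = CARD('m::finite)" and l: "l > 0" "ALL r:{0..R}. ph N l r > 0"
  "D*ph' N l R + kappa TYPE('m) d R mq nq ro*ph N l R = 0" and lg: "D*l < g0"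
 obtains U U1 :: "real => real" where
  "con {0..R} U" "!!r. r:{0..R} ==> 0 < U r & U r < 1"
  "(U HD U1 R) (at_left R)"
  "!!y::real^'m. norm y < R ==> has_lap (%y. U (norm y)) y (- g (U (norm y))/D)"
  "D*U1 R + kappa TYPE('m) d R mq nq ro*U R = 0"
  "profile TYPE('m) U (U1 R) (%r. g (U r)) (%r. bpsi N (U R)*psi N gam r) (bpsi N (U R)*psi' N gam R) (bpsi N (U R)*psi N gam R)"
  "pos_steady D d R mq nq ro g (%p::'m pt. U (nr p)) (%p. bpsi N (U R)*psi N gam (nr p))"
proof -
 obtain U U1 :: "real => real" where
  U: "!!r. r:{0..R} ==> (U HD U1 r) (at r within {0..R})"
  "!!r. r:{0..R} ==> ((%r. r^N*U1 r) HD r^N*(- g (U r)/D)) (at r within {0..R})"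
  "U1 0 = 0" "con {0..R} U1" "!!r. r:{0..R} ==> 0 < U r & U r < 1"
  "D*U1 R + kappa TYPE('m) d R mq nq ro*U R = 0" by (rule exists_U[OF kappa_psi(2)[OF N, of "TYPE('m)"] l(2,3) lg]) (rule that)
 have Uc: "con {0..R} U" by (rule DERIV_continuous_on[OF U(1)])
 have gUc: "con {0..R} (%r. g (U r))" by (rule continuous_on_compose2[OF continuous_g[of UNIV] Uc]) simp
 have dR: "(U HD U1 R) (at_left R)" using U(1)[of R] pos by (simp add: at_within_Icc_at_left)
 have y: "norm y:{0..R}" "0 < norm y" "norm y < R" if "y:ball 0 R" "y ~= 0" for y :: "real^'m" using that by auto
 have r1: "(U HD U1 (norm y)) (at (norm y))" "((%r. r^N*U1 r) HD norm y^N*(- g (U (norm y))/D)) (at (norm y))"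
  if "y:ball 0 R" "y ~= 0" for y :: "real^'m" using U(1,2)[OF y(1)[OF that]] at_within_Icc_at[OF y(2,3)[OF that]] by simp_all
 have r2: "isCont (%r. - g (U r)/D) (norm y)" if "y:ball 0 R" "y ~= 0" for y :: "real^'m" using isCont_o2[OF DERIV_isCont[OF r1(1)[OF that]] isCont_g] pos by (intro ci) auto
 have r3: "((%r. - g (U r)/D) \<longlongrightarrow> - g (U 0)/D) (at_right 0) & ((%r. r^N*U1 r) \<longlongrightarrow> 0) (at_right 0) & (U HD 0) (at_right 0)"
 proof (intro conjI)
  have "con {0..R} (%r. - g (U r)/D)" using pos by (intro ci gUc) auto
  from cont_on_Icc_right[OF this pos(3)] show "((%r. - g (U r)/D) \<longlongrightarrow> - g (U 0)/D) (at_right 0)" .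
  have "con {0..R} (%r. r^N*U1 r)" by (intro ci U(4))
  from cont_on_Icc_right[OF this pos(3)] show "((%r. r^N*U1 r) \<longlongrightarrow> 0) (at_right 0)" using U(3) by simp
  show "(U HD 0) (at_right 0)" using U(1)[of 0] U(3) pos by (simp add: at_within_Icc_at_right)
 qed
 have C2: "C2_on (ball 0 R) (%y::real^'m. U (norm y))" by (rule radial_ode_C2(1)[OF open_ball _ r1(1) r1(2) r2 r3]) (use N in auto)
 have lap: "has_lap (%y. U (norm y)) y (- g (U (norm y))/D)" if "norm y < R" for y :: "real^'m" by (rule radial_ode_C2(2)[OF open_ball[of 0 R] _ r1(1) r1(2) r2 r3]) (use N that in auto)
 have gU: "g (U r) > 0" if "r:{0..R}" for r using g_kpp U(5)[OF that] by simp
 have P: "profile TYPE('m) U (U1 R) (%r. g (U r)) (%r. bpsi N (U R)*psi N gam r) (bpsi N (U R)*psi' N gam R) (bpsi N (U R)*psi N gam R)" by (rule profile_I[OF N Uc _ gUc gU lap dR U(6)]) (use U(5) in auto)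
 let ?V = "%r. bpsi N (U R)*psi N gam r"
 have Vc: "con {R..} ?V" and Vp: "!!r. r >= R ==> 0 < ?V r"
  and lV: "!!y::real^'m. norm y > R ==> has_lap (%y. ?V (norm y)) y (ro/d*?V (norm y))"
  and dV: "(?V HD bpsi N (U R)*psi' N gam R) (at_right R)"
  and bc: "D*U1 R = nq*?V R - mq*U R" "- d*(bpsi N (U R)*psi' N gam R) = mq*U R - nq*?V R" using P unfolding profile_def by blast+
 have C2V: "C2_on {y::real^'m. R < norm y} (%y. ?V (norm y))"
 proof -
  have "C2_on {y::real^'m. R < norm y} (%y. psi N gam (norm y))" by (rule psi_C2(1)[OF _ gam(1) open_outside]) (use N pos in auto)
  then obtain f' f'' where f: "!!p. R < norm p ==> ((%y. psi N gam (norm y)) has_derivative f' p) (at p)"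
   "!!p h. R < norm p ==> ((%q. f' q h) has_derivative f'' p h) (at (p::real^'m))"
   "!!h k. con {y. R < norm y} (%p. f'' p h k)" unfolding C2_on_def by blast
  show ?thesis unfolding C2_on_def by (intro exI[of _ "%p h. bpsi N (U R)*f' p h"] exI[of _ "%p h k. bpsi N (U R)*f'' p h k"] conjI ballI allI
   has_derivative_mult_right f ci) auto
 qed
 have "pos_steady D d R mq nq ro g (%p::'m pt. U (nr p)) (%p. ?V (nr p))" unfolding pos_steady_def
 proof (intro conjI ballI allI impI)
  show "con (OC) (%p::'m pt. U (nr p))" by (rule continuous_on_compose2[OF Uc]) (auto intro!: ci simp: OmegaC_def)
  show "con (EC) (%p::'m pt. ?V (nr p))" by (rule continuous_on_compose2[OF Vc]) (auto intro!: ci simp: ExtC_def)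
  show "C2_on (OI) (%p::'m pt. U (nr p))" by (rule C2_on_snd[OF C2]) (simp add: OmegaI_def)
  show "C2_on (EI) (%p::'m pt. ?V (nr p))" by (rule C2_on_snd[OF C2V]) (simp add: ExtI_def)
 next
  fix p :: "'m pt" assume p: "p:OI"
  thus "0 < U (nr p)" using U(5) by (simp add: OmegaI_def)
  have "has_lap (%p. U (nr p)) p (- g (U (nr p))/D)" by (rule has_lap_snd[where F="%y. U (norm y)", OF lap]) (use p in \<open>simp add: OmegaI_def\<close>)
  from has_lap_laplacian[OF this] show "- D*laplacian (%p. U (nr p)) p = g (U (nr p))" using pos by simp
 next
  fix p :: "'m pt" assume p: "p:EI"
  thus "0 < ?V (nr p)" using Vp by (simp add: ExtI_def)
  have "has_lap (%p. ?V (nr p)) p (ro/d*?V (nr p))" by (rule has_lap_snd[where F="%y. ?V (norm y)", OF lV]) (use p in \<open>simp add: ExtI_def\<close>)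
  from has_lap_laplacian[OF this] show "- d*laplacian (%p. ?V (nr p)) p = - ro*?V (nr p)" using pos by simp
 next
  fix p :: "'m pt" assume p: "nr p = R"
  have "dn_in R (%p. 1*U (nr p)) p (1*U1 R)" by (rule dn_in_sep[OF p dR, where a="%x. 1"])
  moreover have "dn_out R (%p. 1*?V (nr p)) p (1*(bpsi N (U R)*psi' N gam R))" by (rule dn_out_sep[OF p dV, where a="%x. 1"])
  ultimately show "EX dU dV. ((%s. U (norm (snd (p + s *R nrm R p)))) HD dU) (at_left 0) &
   ((%s. ?V (norm (snd (p + s *R nrm R p)))) HD dV) (at_right 0) &
   D*dU = nq*?V (nr p) - mq*U (nr p) & - d*dV = mq*U (nr p) - nq*?V (nr p)" using bc p unfolding dn_in_def dn_out_def by (intro exI conjI) auto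
 qed
 from that[of U U1, OF Uc U(5) dR lap U(6) P this] show ?thesis .
qed

text \<open>\<open>upper_bound\<close> with \<open>Ai = 1\<close>: multiples \<open>A > 1\<close> of
  the steady state are strict supersolutions since \<open>g s / s\<close> decreases
  strictly.\<close>

lemma upper_steady:
 fixes u v :: "'m::finite pt => real => real"
 assumes U: "!!r. r:{0..R} ==> 0 < U r & U r < 1" and P: "profile TYPE('m) U Fi1 (%r. g (U r)) Ps Ps1 B"
  and adm: "admissible_data R u0 v0" and S: "sol u0 v0 u v" and e: "e > 0"
 shows "\<forall>\<^sub>F t in at_top. (ALL p:OC. u p t <= U (nr p) + e) & (ALL p:EC. v p t <= Ps (nr p) + e)"
proof -
 have *: "g (A*U r) < A*g (U r)" if "A > 1" "r:{0..R}" for A r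
 proof -
  have "U r < A*U r" "U r > 0" using that U[OF that(2)] by auto
  hence "g (A*U r)/(A*U r) < g (U r)/U r" using g_skpp by blast
  thus ?thesis using \<open>U r > 0\<close> that by (simp add: field_simps)
 qed
 have "\<forall>\<^sub>F t in at_top. (ALL p:OC. u p t <= 1*U (nr p) + e) & (ALL p:EC. v p t <= 1*Ps (nr p) + e)" by (rule upper_bound[OF P adm S _ * e]) auto
 thus ?thesis by simp
qed

end

subsection \<open>Strong positivity\<close>

lemma norm_add_scale_sq: "(norm (v + r *R b))^2 = (norm v)^2 + 2*r*(v \<bullet> b) + r^2*(norm b)^2"
 for v b :: "'a::real_inner" unfolding power2_norm_eq_inner by (simp add: inner_add_left inner_add_right inner_commute power2_eq_square asi)

lemma has_lap_cube:
 fixes p p0 :: "'a::euclidean_space"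
 shows "has_lap (%q. (c - (norm (q - p0))^2)^3) p
  (24*(norm (p - p0))^2*(c - (norm (p - p0))^2) - 6*DIM('a)*(c - (norm (p - p0))^2)^2)"
proof -
 define A where "A = (norm (p - p0))^2"
 have "has_d2 (%r. (c - (norm (p + r *R b - p0))^2)^3) 0 (24*(c - A)*((p - p0) \<bullet> b)^2 - 6*(c - A)^2)" if b: "b:Basis" for b
 proof -
  define B where "B = (p - p0) \<bullet> b"
  have "has_d2 (%r. (c - (A + 2*r*B + r^2))^3) 0 (24*(c - A)*B^2 - 6*(c - A)^2)" by (rule has_d2_I[where h="%r. 3*(c - (A + 2*r*B + r^2))^2*(- (2*B + 2*r))"])
   (auto intro!: dei simp: power2_eq_square asi)
  moreover have "(norm (p + r *R b - p0))^2 = A + 2*r*B + r^2" for r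
  proof -
   have "p + r *R b - p0 = (p - p0) + r *R b" by simp
   thus ?thesis by (simp only: norm_sq_line[OF b] A_def B_def)
  qed
  ultimately show ?thesis by (simp add: B_def)
 qed
 moreover have "(\<Sum>b\<in>Basis. ((p - p0) \<bullet> b)\<^sup>2) = A" unfolding A_def power2_norm_eq_inner by (subst (2) euclidean_inner) (simp add: power2_eq_square)
 hence "(\<Sum>b\<in>Basis. 24*(c - A)*((p - p0) \<bullet> b)^2 - 6*(c - A)^2) = 24*A*(c - A) - 6*DIM('a)*(c - A)^2" unfolding sum_subtractf sum_distrib_left[symmetric] by (simp add: mult_ac)
 ultimately show ?thesis unfolding has_lap_def A_def[symmetric] by (intro exI[of _ "%b. 24*(c - A)*((p - p0) \<bullet> b)^2 - 6*(c - A)^2"]) auto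
qed

text \<open>Positive exactly on a moving ball of radius \<open>s\<close>: \<open>a\<close> is the
  position of its centre at time \<open>t1\<close> and \<open>e\<close> its velocity.\<close>

definition qq :: "'a::real_inner => 'a => real => real => 'a => real => real" where
 "qq a e t1 s p t = s^2 - (norm (p - (a + (t - t1) *R e)))^2"

text \<open>The cube avoids a truncation: only points where the bump is positive matter for comparison.\<close>

definition mbump :: "real => real => 'a::real_inner => 'a => real => real => 'a => real => real" where
 "mbump eps k a e t1 s p t = eps*exp (- k*(t - t1))*(qq a e t1 s p t)^3"

lemma mbump_cont: "con A (%(p,t). mbump eps k a e t1 s p t)" unfolding mbump_def qq_def case_prod_beta by (intro ci)

lemma mbump_pos_iff: "eps > 0 ==> mbump eps k a e t1 s p t > 0 \<longleftrightarrow> qq a e t1 s p t > 0" unfolding mbump_def by (simp add: zero_less_mult_iff mult_less_0_iff)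

lemma mbump_le:
 assumes "eps > 0" "k >= 0" "t >= t1" "s > 0"
 shows "mbump eps k a e t1 s p t <= eps * s^6"
proof -
 have "(qq a e t1 s p t)^3 <= (s^2)^3" by (rule power_mono_odd) (auto simp: qq_def)
 also have "\<dots> = s^6" by simp
 finally have 1: "(qq a e t1 s p t)^3 <= s^6" .
 have "eps*exp (- k*(t - t1)) <= eps*1" using assms by (intro mult_left_mono) auto
 hence "eps*exp (- k*(t - t1)) * s^6 <= eps * s^6" using assms by simp
 moreover have "eps*exp (- k*(t - t1))*(qq a e t1 s p t)^3 <= eps*exp (- k*(t - t1)) * s^6" using 1 assms by (intro mult_left_mono) auto
 ultimately show ?thesis unfolding mbump_def by linarith
qed

text \<open>Near the edge of the ball the Laplacian of the cube is of lower order in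
  \<open>qq\<close> than the transport term and wins; further inside the decay rate \<open>k\<close>
  does. The quotient in \<open>k\<close> is the value at which the resulting quadratic in
  \<open>qq\<close> has discriminant 0. \<open>ka\<close> is the loss rate, 0 in the cylinder and
  \<open>ro\<close> outside.\<close>

lemma mbump_par:
 fixes a e p :: "'a::euclidean_space" and K s k :: real
 assumes K: "K > 0" and s: "s > 0" and eps: "eps > 0"
  and k: "k = ka + (6 * s*norm e + 6*K*DIM('a) + 24*K)^2/(96*K * s^2)"
  and q: "mbump eps k a e t1 s p t > 0"
 shows "EX ft l. has_par (mbump eps k a e t1 s) p t ft l & ft <= K*l - ka*mbump eps k a e t1 s p t"
proof -
 define Q where "Q = qq a e t1 s p t"
 define E where "E = eps*exp (- k*(t - t1))"
 define p0 where "p0 = a + (t - t1) *R e"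
 define i where "i = (p - p0) \<bullet> e"
 have Q0: "Q > 0" using q by (simp add: Q_def mbump_pos_iff[OF eps])
 have E0: "E > 0" using eps by (simp add: E_def)
 have QA: "(norm (p - p0))^2 = s^2 - Q" by (simp add: Q_def qq_def p0_def)
 have n: "norm (p - p0) <= s" by (rule power2_le_imp_le) (use QA Q0 s in simp_all)
 have i: "i <= s*norm e" unfolding i_def using norm_cauchy_schwarz[of "p - p0" e] mult_right_mono[OF n, of "norm e"] by simp
 have qt: "(qq a e t1 s p HD 2*i) (at t)"
 proof -
  have *: "qq a e t1 s p r = s^2 - ((norm (p - a))^2 + 2*(t1 - r)*((p - a) \<bullet> e) + (t1 - r)^2*(norm e)^2)" for r
  proof -
   have "p - (a + (r - t1) *R e) = (p - a) + (t1 - r) *R e" by (simp add: asi)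
   thus ?thesis unfolding qq_def by (simp only: norm_add_scale_sq)
  qed
  have "i = (p - a) \<bullet> e + (t1 - t)*(norm e)^2" unfolding i_def p0_def by (simp add: asi power2_norm_eq_inner)
  thus ?thesis unfolding * by (auto intro!: dei simp: asi)
 qed
 have dt: "(mbump eps k a e t1 s p HD E*(- k*Q^3 + 6*Q^2*i)) (at t)" unfolding mbump_def by (auto intro!: dei qt simp: E_def Q_def asi power2_eq_square power3_eq_cube)
 have lp: "has_lap (%q. mbump eps k a e t1 s q t) p (E*(24*(s^2 - Q)*Q - 6*DIM('a)*Q^2))" using has_lap_cmult[OF has_lap_cube[of "s^2" p0 p], of E] QA by (simp add: mbump_def qq_def E_def p0_def)
 define c where "c = 6 * s*norm e + 6*K*DIM('a) + 24*K"
 \<comment> \<open>In the rescaled variable the quadratic is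
   \<open>24 * B * (X - 1)^2\<close>.\<close>
 define B X where "B = K * s^2" and "X = c*Q/(48*(K * s^2))"
 have B: "B > 0" using K s by (simp add: B_def)
 have X: "c*Q = 48*B*X" using B unfolding X_def B_def[symmetric] by simp
 have "(k - ka)*Q^2 = c^2/(96*B)*Q^2" using k by (simp add: c_def B_def mult.assoc)
 also have "\<dots> = (c*Q)^2/(96*B)" by (simp add: power_mult_distrib)
 also have "\<dots> = 24*B*X^2" unfolding X using B by (simp add: power2_eq_square)
 finally have kX: "(k - ka)*Q^2 = 24*B*X^2" .
 have "0 <= 24*B*(X - 1)^2" using B by simp
 also have "\<dots> = 24*B*X^2 - 48*B*X + 24*B" by (simp add: power2_eq_square asi)
 finally have 1: "c*Q <= (k - ka)*Q^2 + 24*K * s^2" using X kX by (simp add: B_def)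
 have "6*Q*i <= 6*Q*(s*norm e)" using i Q0 by (intro mult_left_mono) auto
 hence 2: "- k*Q^2 + 6*Q*i <= K*(24*(s^2 - Q) - 6*DIM('a)*Q) - ka*Q^2" using 1 by (simp add: c_def asi)
 have "E*Q*(- k*Q^2 + 6*Q*i) <= E*Q*(K*(24*(s^2 - Q) - 6*DIM('a)*Q) - ka*Q^2)" using 2 E0 Q0 by (intro mult_left_mono) auto
 moreover have "E*(- k*Q^3 + 6*Q^2*i) <= K*(E*(24*(s^2 - Q)*Q - 6*DIM('a)*Q^2)) - ka*mbump eps k a e t1 s p t"
  if "E*Q*(- k*Q^2 + 6*Q*i) <= E*Q*(K*(24*(s^2 - Q) - 6*DIM('a)*Q) - ka*Q^2)"
 proof -
  have m: "mbump eps k a e t1 s p t = E*Q^3" by (simp add: mbump_def Q_def E_def)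
  show ?thesis using that unfolding m by (simp add: asi power2_eq_square power3_eq_cube)
 qed
 ultimately show ?thesis using dt lp unfolding has_par_def by blast
qed

context field_road begin

lemma nrm_inner:
 fixes p c :: "'m::finite pt"
 assumes "nr p = R"
 shows "(p - c) \<bullet> nrm R p = ((norm (snd (p - c)))^2 + R^2 - (norm (snd c))^2)/(2 * R)"
  "(p - c) \<bullet> nrm R p >= R - norm (snd c)" "norm (nrm R p) = 1"
proof -
 have pp: "snd p \<bullet> snd p = R^2" using assms by (simp flip: power2_norm_eq_inner)
 have "(p - c) \<bullet> nrm R p = (1/R)*(snd p \<bullet> snd p - snd c \<bullet> snd p)" by (simp add: nrm_def inner_prod_def inner_diff_left diff_divide_distrib)
 hence i: "(p - c) \<bullet> nrm R p = (R^2 - snd c \<bullet> snd p)/R" by (simp add: pp)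
 have "(norm (snd (p - c)))^2 = snd p \<bullet> snd p + snd c \<bullet> snd c - 2*(snd c \<bullet> snd p)" unfolding power2_norm_eq_inner snd_diff inner_diff_left inner_diff_right by (simp add: inner_commute[of "snd p" "snd c"])
 hence eq: "(norm (snd (p - c)))^2 + R^2 - (norm (snd c))^2 = 2*(R^2 - snd c \<bullet> snd p)" by (simp add: pp power2_norm_eq_inner)
 show "(p - c) \<bullet> nrm R p = ((norm (snd (p - c)))^2 + R^2 - (norm (snd c))^2)/(2 * R)" unfolding i eq using pos by (simp add: field_simps)
 have "snd c \<bullet> snd p <= norm (snd c) * R" using norm_cauchy_schwarz[of "snd c" "snd p"] assms by simp
 hence "(R - norm (snd c)) * R <= R^2 - snd c \<bullet> snd p" by (simp add: left_diff_distrib power2_eq_square)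
 thus "(p - c) \<bullet> nrm R p >= R - norm (snd c)" unfolding i using pos by (simp only: pos_le_divide_eq)
 have n1: "norm ((1/R) *R snd p) = 1" unfolding norm_scaleR assms using pos by simp
 show "norm (nrm R p) = 1" unfolding nrm_def norm_Pair n1 by simp
qed

lemma mbump_line:
 fixes p a e :: "'m::finite pt" and t t1 s :: real
 assumes "nr p = R"
 defines "Q == qq a e t1 s p t" and "j == (p - (a + (t - t1) *R e)) \<bullet> nrm R p"
 shows "((%r. mbump eps k a e t1 s (p + r *R nrm R p) t) HD
  eps*exp (- k*(t - t1))*(3*Q^2*(- 2*j))) (at 0 within X)"
proof -
 have *: "qq a e t1 s (p + r *R nrm R p) t = Q - (2*r*j + r^2)" for r
 proof -
  have "p + r *R nrm R p - (a + (t - t1) *R e) = (p - (a + (t - t1) *R e)) + r *R nrm R p" by simp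
  thus ?thesis unfolding qq_def Q_def j_def by (simp only: norm_add_scale_sq nrm_inner(3)[OF assms(1)]) simp
 qed
 show ?thesis unfolding mbump_def * by (auto intro!: dei)
qed

text \<open>The centre keeps depth \<open>h\<close> while the radius slightly exceeds
  \<open>h\<close>, so the ball may just pierce the interface. There \<open>qq\<close> is at most
  \<open>ea * h\<close> but the gradient is governed by \<open>j \<ge> h\<close>, which covers the
  loss through the interface even if the other component is 0.\<close>

lemma qq_boundary_in:
 fixes p a e :: "'m::finite pt" and t t1 s :: real
 assumes p: "nr p = R" and c: "norm (snd (a + (t - t1) *R e)) <= R - h" and h: "h > 0" "s^2 = h^2 + ea*h"
  and ea: "ea > 0" "mq*ea <= 6*D"
 defines "Q == qq a e t1 s p t" and "j == (p - (a + (t - t1) *R e)) \<bullet> nrm R p"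
 assumes q: "Q > 0"
 shows "6*D*j >= mq*Q"
proof -
 have j: "j >= h" using nrm_inner(2)[OF p, of "a + (t - t1) *R e"] c by (simp add: j_def)
 have "j <= norm (p - (a + (t - t1) *R e))" using norm_cauchy_schwarz[of "p - (a + (t - t1) *R e)" "nrm R p"] nrm_inner(3)[OF p] by (simp add: j_def)
 hence "h^2 <= (norm (p - (a + (t - t1) *R e)))^2" using j h by (intro power_mono) auto
 hence "Q <= ea*h" using h by (simp add: Q_def qq_def)
 hence "mq*Q <= mq*ea*h" using pos by simp
 also have "\<dots> <= 6*D*h" using ea h by (intro mult_right_mono) auto
 also have "\<dots> <= 6*D*j" using j pos by simp
 finally show ?thesis .
qed

text \<open>Seen from outside the interface curves away from the ball, so the normal component is
  estimated by the cosine formula in \<open>nrm_inner\<close>. This halves the gradient, whence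
  \<open>3 * d\<close> against \<open>6 * D\<close>, and needs \<open>ea \<le> R\<close>.\<close>

lemma qq_boundary_out:
 fixes p a e :: "'m::finite pt" and t t1 s :: real
 assumes p: "nr p = R" and c: "norm (snd (a + (t - t1) *R e)) >= R + h" and h: "h > 0" "s^2 = h^2 + ea*h"
  and ea: "ea > 0" "nq*ea <= 3*d" "ea <= R"
 defines "Q == qq a e t1 s p t" and "j == (p - (a + (t - t1) *R e)) \<bullet> nrm R p"
 assumes q: "Q > 0"
 shows "- (6*d*j) >= nq*Q"
proof -
 define c0 where "c0 = a + (t - t1) *R e"
 have n1: "norm (snd (p - c0)) <= norm (p - c0)" using norm_snd_le[of "snd (p - c0)" "fst (p - c0)"] unfolding prod.collapse .
 have hh: "norm (snd c0) - R <= norm (snd (p - c0))" using norm_triangle_ineq2[of "snd c0" "snd p"] p by (simp add: norm_minus_commute)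
 have "h <= norm (p - c0)" using hh c n1 by (simp add: c0_def)
 hence "h^2 <= (norm (p - c0))^2" using h by (intro power_mono) auto
 hence Q: "Q <= ea*h" using h by (simp add: Q_def qq_def c0_def)
 have "(norm (snd (p - c0)))^2 <= (norm (p - c0))^2" using n1 by (intro power_mono) auto
 also have "\<dots> = h^2 + ea*h - Q" using h by (simp add: Q_def qq_def c0_def)
 finally have "(norm (snd (p - c0)))^2 <= h^2 + ea*h" using q by simp
 moreover have "(R + h)^2 <= (norm (snd c0))^2" using c h pos by (intro power_mono) (auto simp: c0_def)
 ultimately have "(norm (snd (p - c0)))^2 + R^2 - (norm (snd c0))^2 <= ea*h - 2 * R*h" by (simp add: power2_sum)
 also have "\<dots> <= R*h - 2 * R*h" using ea h by simp
 finally have "j <= (- R*h)/(2 * R)" unfolding j_def c0_def[symmetric] nrm_inner(1)[OF p] using pos by (intro divide_right_mono) auto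
 hence "h <= - 2*j" using pos by simp
 hence "3*d*h <= 3*d*(- 2*j)" using pos by (intro mult_left_mono) auto
 moreover have "nq*Q <= nq*ea*h" using Q pos by simp
 moreover have "nq*ea*h <= 3*d*h" using ea h by (intro mult_right_mono) auto
 ultimately show ?thesis by linarith
qed

end

context kpp begin

lemma inf_pos:
 assumes "compact K" "K ~= {}" "con K f" "!!p. p:K ==> f p > (0::real)"
 obtains m where "m > 0" "!!p. p:K ==> m <= f p" using continuous_attains_inf[OF assms(1-3)] assms(4) by blast

text \<open>A bump placed below \<open>u\<close> at time \<open>t1\<close> is carried along the
  segment from \<open>a\<close> to \<open>b\<close>, whose points all have depth at least
  \<open>h\<close>; paired with 0 outside it is a subsolution.\<close>

lemma move_in:
 fixes u v :: "'m::finite pt => real => real"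
 assumes adm: "admissible_data R u0 v0" and S: "sol u0 v0 u v" and t: "0 <= t1" "t1 < t2"
  and h: "h > 0" "s^2 = h^2 + ea*h" "s > 0" and ea: "ea > 0" "mq*ea <= 6*D"
  and ab: "norm (snd a) <= R - h" "norm (snd b) <= R - h"
  and i: "!!p. p:OC ==> dist a p <= s ==> u p t1 > 0"
  and p: "p:OC" "dist p b < s"
 shows "u p t2 > 0"
proof -
 let ?K = "cball a s \<inter> OC"
 have "compact ?K" by (simp add: compact_Int_closed closed_OmegaC)
 moreover have "a:?K" using ab h by (simp add: OmegaC_def)
 hence "?K ~= {}" by blast
 moreover have "con ?K (%p. u p t1)" using sol_cont_at(1)[OF S t(1)] by (rule continuous_on_subset) auto
 ultimately obtain m where m: "m > 0" "!!p. p:?K ==> m <= u p t1" by (rule inf_pos[of ?K "%p. u p t1"]) (use i in auto)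
 \<comment> \<open>At most \<open>m\<close>, to start below \<open>u\<close>; at most 1/2, to stay
   where \<open>g\<close> is positive.\<close>
 define eps where "eps = min m (1/2)/s^6"
 have eps: "eps > 0" "eps * s^6 <= m" "eps * s^6 <= 1/2" using m h by (auto simp: eps_def)
 define e where "e = (1/(t2 - t1)) *R (b - a)"
 define k where "k = 0 + (6 * s*norm e + 6*D*DIM('m pt) + 24*D)^2/(96*D * s^2)"
 have k0: "k >= 0" using pos by (simp add: k_def)
 have e2: "a + (t2 - t1) *R e = b" using t by (simp add: e_def)
 have cen: "norm (snd (a + (r - t1) *R e)) <= R - h" if "t1 <= r" "r <= t2" for r
 proof -
  define x where "x = (r - t1)/(t2 - t1)"
  have x: "0 <= x" "x <= 1" using that t by (auto simp: x_def)
  have "snd (a + (r - t1) *R e) = (1 - x) *R snd a + x *R snd b" by (simp add: e_def x_def asi)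
  also have "norm \<dots> <= (1 - x)*norm (snd a) + x*norm (snd b)" using x by (intro norm_triangle_le) simp
  also have "\<dots> <= (1 - x)*(R - h) + x*(R - h)" using x ab by (intro add_mono mult_left_mono) auto
  finally show ?thesis by (simp add: asi)
 qed
 define w where "w = mbump eps k a e t1 s"
 have "(p:OC --> w p t2 <= u p t2) & (p:EC --> 0 <= v p t2)"
 proof (rule sub_cmp[OF adm S t(1), where T=t2 and w=w and z="%p t. 0" and M="1/2"])
  show "con (OC \<times> {t1..t2}) (%(p, t). w p t)" unfolding w_def by (rule mbump_cont)
  show "w p t <= 1/2" if "t:{t1..t2}" for p t using mbump_le[OF eps(1) k0 _ h(3), of t1 t a e p] that eps by (simp add: w_def)
  show "w p t1 <= u p t1" if p: "p:OC" for p
  proof (cases "w p t1 > 0")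
   case True
   hence "qq a e t1 s p t1 > 0" by (simp add: w_def mbump_pos_iff[OF eps(1)])
   hence "(dist a p)^2 < s^2" by (simp add: qq_def dist_norm norm_minus_commute)
   hence "dist a p <= s" using h power_less_imp_less_base by (metis less_imp_le)
   hence "m <= u p t1" using m(2) p by simp
   thus ?thesis using mbump_le[OF eps(1) k0 _ h(3), of t1 t1 a e p] eps by (simp add: w_def)
  next
   case False
   thus ?thesis using nonneg(1)[OF adm S t(1) p] by linarith
  qed
  show "0 <= v p t1" if "p:EC" for p using nonneg(2)[OF adm S t(1) that] .
 next
  fix p :: "'m pt" and t assume a: "p:OI" "t1 < t" "t <= t2" "0 < w p t"
  obtain ft l where f: "has_par w p t ft l" "ft <= D*l - 0*w p t" using mbump_par[OF pos(1) h(3) eps(1) k_def a(4)[unfolded w_def]] unfolding w_def by blast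
  have "w p t <= 1/2" using mbump_le[OF eps(1) k0 _ h(3), of t1 t] a eps unfolding w_def by (smt (verit))
  hence "g (w p t) > 0" using g_kpp a(4) by simp
  thus "EX ft l. has_par w p t ft l & ft <= D*l + g (w p t)" using f by (intro exI[of _ ft] exI[of _ l]) auto
 next
  fix p :: "'m pt" and t assume a: "nr p = R" "t1 < t" "t <= t2" "0 < w p t"
  let ?Q = "qq a e t1 s p t" and ?j = "(p - (a + (t - t1) *R e)) \<bullet> nrm R p" and ?E = "eps*exp (- k*(t - t1))"
  have Q: "?Q > 0" using a(4) by (simp add: w_def mbump_pos_iff[OF eps(1)])
  have j: "6*D*?j >= mq*?Q" using qq_boundary_in[OF a(1) cen h(1,2) ea Q] a by simp
  have "D*(?E*(3*?Q^2*(- 2*?j))) <= nq*0 - mq*w p t"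
  proof -
   have "?E*?Q^2*(mq*?Q) <= ?E*?Q^2*(6*D*?j)" using j eps by (intro mult_left_mono) auto
   thus ?thesis by (simp add: w_def mbump_def power2_eq_square power3_eq_cube asi)
  qed
  thus "EX x. dn_in R (%p. w p t) p x & D*x <= nq*0 - mq*w p t" using mbump_line[OF a(1)] unfolding dn_in_def w_def by blast
 qed (use t in auto)
 moreover have "w p t2 > 0"
 proof -
  have "(norm (p - b))^2 < s^2" using p(2) by (intro power_strict_mono) (auto simp: dist_norm)
  thus ?thesis unfolding w_def mbump_pos_iff[OF eps(1)] qq_def e2 by simp
 qed
 ultimately show ?thesis using p(1) by simp
qed

text \<open>The centre travels along a ray of fixed direction \<open>y\<close>, because a segment
  between two exterior points may cross the cylinder.\<close>

lemma move_out:
 fixes u v :: "'m::finite pt => real => real"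
 assumes adm: "admissible_data R u0 v0" and S: "sol u0 v0 u v" and t: "0 <= t1" "t1 < t2"
  and h: "h > 0" "s^2 = h^2 + ea*h" "s > 0" and ea: "ea > 0" "nq*ea <= 3*d" "ea <= R"
  and ab: "norm y = 1" "ra >= R + h" "rb >= R + h"
  and i: "!!p. p:EC ==> dist (x, ra *R y) p <= s ==> v p t1 > 0"
  and p: "p:EC" "dist p (x, rb *R y) < s"
 shows "v p t2 > 0"
proof -
 define a b where "a = (x, ra *R y)" and "b = (x, rb *R y)"
 let ?K = "cball a s \<inter> EC"
 have "compact ?K" by (simp add: compact_Int_closed closed_ExtC)
 moreover have "a:?K" using ab h pos by (auto simp: ExtC_def a_def)
 hence "?K ~= {}" by blast
 moreover have "con ?K (%p. v p t1)" using sol_cont_at(2)[OF S t(1)] by (rule continuous_on_subset) auto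
 ultimately obtain m where m: "m > 0" "!!p. p:?K ==> m <= v p t1" by (rule inf_pos[of ?K "%p. v p t1"]) (use i in \<open>auto simp: a_def\<close>)
 define eps where "eps = m/s^6"
 have eps: "eps > 0" "eps * s^6 <= m" using m h by (auto simp: eps_def)
 define e where "e = (1/(t2 - t1)) *R (b - a)"
 define k where "k = ro + (6 * s*norm e + 6*d*DIM('m pt) + 24*d)^2/(96*d * s^2)"
 have k0: "k >= 0" using pos by (simp add: k_def)
 have e2: "a + (t2 - t1) *R e = b" using t by (simp add: e_def)
 have cen: "norm (snd (a + (r - t1) *R e)) >= R + h" if "t1 <= r" "r <= t2" for r
 proof -
  define q where "q = (r - t1)/(t2 - t1)"
  have q: "0 <= q" "q <= 1" using that t by (auto simp: q_def)
  have eq: "snd (a + (r - t1) *R e) = ((1 - q)*ra + q*rb) *R y" by (simp add: e_def q_def a_def b_def asi)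
  have "(1 - q)*ra + q*rb >= (1 - q)*(R + h) + q*(R + h)" using q ab by (intro add_mono mult_left_mono) auto
  hence "R + h <= (1 - q)*ra + q*rb" by (simp add: asi)
  thus ?thesis unfolding eq norm_scaleR ab(1) by simp
 qed
 define w where "w = mbump eps k a e t1 s"
 have "(p:OC --> 0 <= u p t2) & (p:EC --> w p t2 <= v p t2)"
 proof (rule sub_cmp[OF adm S t(1), where T=t2 and z=w and w="%p t. 0" and M="m"])
  show "con (EC \<times> {t1..t2}) (%(p, t). w p t)" unfolding w_def by (rule mbump_cont)
  show "w p t <= m" if "t:{t1..t2}" for p t using mbump_le[OF eps(1) k0 _ h(3), of t1 t a e p] that eps by (simp add: w_def)
  show "w p t1 <= v p t1" if p: "p:EC" for p
  proof (cases "w p t1 > 0")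
   case True
   hence "qq a e t1 s p t1 > 0" by (simp add: w_def mbump_pos_iff[OF eps(1)])
   hence "(dist a p)^2 < s^2" by (simp add: qq_def dist_norm norm_minus_commute)
   hence "dist a p <= s" using h power_less_imp_less_base by (metis less_imp_le)
   hence "m <= v p t1" using m(2) p by simp
   thus ?thesis using mbump_le[OF eps(1) k0 _ h(3), of t1 t1 a e p] eps by (simp add: w_def)
  next
   case False
   thus ?thesis using nonneg(2)[OF adm S t(1) p] by linarith
  qed
  show "0 <= u p t1" if "p:OC" for p using nonneg(1)[OF adm S t(1) that] .
 next
  fix p :: "'m pt" and t assume a: "p:EI" "t1 < t" "t <= t2" "0 < w p t"
  show "EX ft l. has_par w p t ft l & ft <= d*l - ro*w p t" using mbump_par[OF pos(2) h(3) eps(1) k_def a(4)[unfolded w_def]] unfolding w_def by blast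
 next
  fix p :: "'m pt" and t assume a: "nr p = R" "t1 < t" "t <= t2" "0 < w p t"
  let ?Q = "qq a e t1 s p t" and ?j = "(p - (a + (t - t1) *R e)) \<bullet> nrm R p" and ?E = "eps*exp (- k*(t - t1))"
  have Q: "?Q > 0" using a(4) by (simp add: w_def mbump_pos_iff[OF eps(1)])
  have j: "- (6*d*?j) >= nq*?Q" using qq_boundary_out[OF a(1) cen h(1,2) ea Q] a by simp
  have "- d*(?E*(3*?Q^2*(- 2*?j))) <= mq*0 - nq*w p t"
  proof -
   have "?E*?Q^2*(nq*?Q) <= ?E*?Q^2*(- (6*d*?j))" using j eps by (intro mult_left_mono) auto
   thus ?thesis by (simp add: w_def mbump_def power2_eq_square power3_eq_cube asi)
  qed
  thus "EX x. dn_out R (%p. w p t) p x & - d*x <= mq*0 - nq*w p t" using mbump_line[OF a(1)] unfolding dn_out_def w_def by blast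
 qed (use t m in auto)
 moreover have "w p t2 > 0"
 proof -
  have "(norm (p - b))^2 < s^2" using p(2) by (intro power_strict_mono) (auto simp: dist_norm b_def)
  thus ?thesis unfolding w_def mbump_pos_iff[OF eps(1)] qq_def e2 by simp
 qed
 ultimately show ?thesis using p(1) by simp
qed

text \<open>If one component vanished at an interface point where the other is positive, it would
  have a minimum there, and its one-sided derivative would contradict the sign that the flux
  condition prescribes.\<close>

lemma transfer:
 fixes u v :: "'m::finite pt => real => real"
 assumes adm: "admissible_data R u0 v0" and S: "sol u0 v0 u v" and t: "t > 0" and p: "nr p = R"
 shows "u p t > 0 \<longleftrightarrow> v p t > 0"
proof -
 have pO: "p:OC" "p:EC" using p by (auto simp: OmegaC_def ExtC_def)
 have t0: "t >= 0" using t by simp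
 note nu = nonneg(1)[OF adm S t0] and nv = nonneg(2)[OF adm S t0]
 obtain x y where b: "dn_in R (%p. u p t) p x" "dn_out R (%p. v p t) p y"
  "D*x = nq * v p t - mq*u p t" "- d*y = mq*u p t - nq * v p t" using sol_b[OF S p t] .
 have "False" if "v p t > 0" "u p t = 0"
 proof -
  have "((%s. - u (p + s *R nrm R p) t) HD - x) (at_left 0)" using b(1) unfolding dn_in_def by (rule DERIV_minus)
  moreover have "\<forall>\<^sub>F s in at_left 0. - u (p + s *R nrm R p) t <= - u (p + 0 *R nrm R p) t" using eventually_line_left[OF pos(3)]
  proof eventually_elim
   case (elim s)
   hence "p + s *R nrm R p:OC" using norm_snd_line[OF p pos(3), of s] by (simp add: OmegaC_def)
   from nu[OF this] show ?case using that by simp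
  qed
  ultimately have "x <= 0" using left_max_deriv_nonneg[of "%s. - u (p + s *R nrm R p) t" "-x" 0] by simp
  hence "D*x <= 0" using pos by (simp add: mult_nonneg_nonpos)
  moreover have "nq * v p t > 0" using that pos by simp
  ultimately show False using b(3) that by simp
 qed
 moreover have "False" if "u p t > 0" "v p t = 0"
 proof -
  have "((%s. - v (p + s *R nrm R p) t) HD - y) (at_right 0)" using b(2) unfolding dn_out_def by (rule DERIV_minus)
  moreover have "\<forall>\<^sub>F s in at_right 0. - v (p + s *R nrm R p) t <= - v (p + 0 *R nrm R p) t" using eventually_line_right
  proof eventually_elim
   case (elim s)
   hence "p + s *R nrm R p:EC" using norm_snd_line[OF p pos(3), of s] pos by (simp add: ExtC_def)
   from nv[OF this] show ?case using that by simp
  qed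
  ultimately have "y >= 0" using right_max_deriv_nonpos[of "%s. - v (p + s *R nrm R p) t" "-y" 0] by simp
  hence "d*y >= 0" using pos by simp
  moreover have "mq*u p t > 0" using that pos by simp
  ultimately show False using b(4) that by simp
 qed
 ultimately show ?thesis using nu[OF pO(1)] nv[OF pO(2)] by fastforce
qed

text \<open>Depth and radius for a bump within a given distance; \<open>h < s\<close> is what lets a
  ball centred at depth \<open>h\<close> cover interface points.\<close>

lemma small_h:
 fixes ea e :: real
 assumes "ea > 0" "e > 0"
 obtains h s where "h > 0" "h <= e" "s > 0" "s^2 = h^2 + ea*h" "h < s" "s + h <= e"
proof -
 \<comment> \<open>The second bound is made for \<open>h^2 + ea * h \<le> (e/2)^2\<close>.\<close>
 define h where "h = min (e/2) (e^2/(4*(e + 2*ea)))"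
 have h: "h > 0" "h <= e/2" "h <= e^2/(4*(e + 2*ea))" unfolding h_def using assms by (simp add: add_pos_pos) (rule min.cobounded1, rule min.cobounded2)
 define s where "s = sqrt (h^2 + ea*h)"
 have s2: "s^2 = h^2 + ea*h" using h assms by (simp add: s_def)
 have sh: "h < s" unfolding s_def using h assms by (intro real_less_rsqrt) simp
 have "h*(4*(e + 2*ea)) <= e^2" using h(3) assms by (simp add: pos_le_divide_eq)
 hence "4*(h*e) + 8*(ea*h) <= e^2" by (simp add: asi)
 moreover have "h^2 <= h*e" using h assms by (simp add: power2_eq_square)
 moreover have "(e/2)^2 = e^2/4" by (simp add: power_divide)
 moreover have "ea*h > 0" "h*e > 0" using h assms by auto
 ultimately have "h^2 + ea*h <= (e/2)^2" by linarith
 hence "s <= e/2" unfolding s_def using assms by (intro real_le_lsqrt) auto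
 thus ?thesis using that[of h s] h sh s2 by auto
qed

lemma ball_pos:
 assumes c: "con X f" and p: "p:X" "f p > (0::real)"
 obtains e where "e > 0" "!!q. q:X ==> dist p q <= e ==> f q > 0"
proof -
 obtain e where e: "e > 0" "!!q. q:X ==> dist q p < e ==> dist (f q) (f p) < f p" using c p unfolding continuous_on_iff by metis
 have "f q > 0" if "q:X" "dist p q <= e/2" for q using e(2)[of q] that e(1) by (auto simp: dist_real_def dist_commute)
 thus ?thesis using that[of "e/2"] e(1) by auto
qed

text \<open>Shrinking the cross-section moves every point of the closed cylinder by at most
  \<open>h < s\<close> to a point of depth at least \<open>h\<close>; bumps with such centres start
  within the positivity ball of \<open>a0\<close> and end covering \<open>p\<close>.\<close>

lemma u_pos_later:
 fixes u v :: "'m::finite pt => real => real"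
 assumes adm: "admissible_data R u0 v0" and S: "sol u0 v0 u v" and t: "0 <= t1" "t1 < t2"
  and a0: "a0:OC" "u a0 t1 > 0" and p: "p:OC"
 shows "u p t2 > 0"
proof -
 obtain e where e: "e > 0" "!!q. q:OC ==> dist a0 q <= e ==> u q t1 > 0" using ball_pos[OF sol_cont_at(1)[OF S t(1)] a0] by metis
 define ea where "ea = 6*D/mq"
 have ea: "ea > 0" "mq*ea <= 6*D" using pos by (auto simp: ea_def)
 have "min e R > 0" using e pos by simp
 from small_h[OF ea(1) this] obtain h s where h: "h > 0" "h <= min e R" "s > 0" "s^2 = h^2 + ea*h" "h < s" "s + h <= min e R" .
 define c where "c = (%q::'m pt. (fst q, (1 - h/R) *R snd q))"
 have c: "norm (snd (c q)) <= R - h" "dist q (c q) <= h" if "q:OC" for q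
 proof -
  have n: "norm (snd q) <= R" using that by (simp add: OmegaC_def)
  have hR: "0 <= 1 - h/R" using h pos by simp
  have "norm (snd (c q)) = (1 - h/R)*norm (snd q)" using hR by (simp add: c_def)
  also have "\<dots> <= (1 - h/R) * R" using hR n by (rule mult_left_mono[rotated])
  also have "\<dots> = R - h" using pos by (simp add: left_diff_distrib)
  finally show "norm (snd (c q)) <= R - h" .
  have "q - c q = (0, (h/R) *R snd q)" by (simp add: c_def prod_eq_iff asi)
  hence "dist q (c q) = h / R*norm (snd q)" using h pos by (simp add: dist_norm norm_Pair)
  also have "\<dots> <= h/R * R" using h pos n by (intro mult_left_mono) auto
  finally show "dist q (c q) <= h" using pos by simp
 qed
 show ?thesis
 proof (rule move_in[OF adm S t h(1,4,3) ea c(1)[OF a0(1)] c(1)[OF p] _ p])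
  show "dist p (c p) < s" using c(2)[OF p] h by simp
  fix q assume q: "q:OC" "dist (c a0) q <= s"
  have "dist a0 q <= e" using dist_triangle[of a0 q "c a0"] c(2)[OF a0(1)] q h by simp
  thus "u q t1 > 0" using e(2) q by blast
 qed
qed

lemma v_pos_later:
 fixes u v :: "'m::finite pt => real => real"
 assumes adm: "admissible_data R u0 v0" and S: "sol u0 v0 u v" and t: "0 <= t1" "t1 < t2"
  and y: "norm y = 1" and r: "ra >= R" "rb >= R" and a: "v (x, ra *R y) t1 > 0"
 shows "v (x, rb *R y) t2 > 0"
proof -
 have aX: "(x, r *R y):EC" if "r >= R" for r using that y pos by (simp add: ExtC_def)
 obtain e where e: "e > 0" "!!q. q:EC ==> dist (x, ra *R y) q <= e ==> v q t1 > 0" using ball_pos[OF sol_cont_at(2)[OF S t(1)] aX[OF r(1)] a] by metis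
 define ea where "ea = min R (3*d/nq)"
 have ea: "ea > 0" "nq*ea <= 3*d" "ea <= R"
 proof -
  show "ea > 0" "ea <= R" using pos by (auto simp: ea_def)
  have "ea <= 3*d/nq" by (simp add: ea_def)
  thus "nq*ea <= 3*d" using pos by (simp add: pos_le_divide_eq mult.commute)
 qed
 from small_h[OF ea(1) e(1)] obtain h s where h: "h > 0" "h <= e" "s > 0" "s^2 = h^2 + ea*h" "h < s" "s + h <= e" .
 have dd: "dist (x, r *R y) (x, (r + h) *R y) = h" for r
 proof -
  have "r *R y - (r + h) *R y = (- h) *R y" by (simp add: asi)
  thus ?thesis using h y by (simp add: dist_Pair_Pair dist_norm)
 qed
 show ?thesis
 proof (rule move_out[OF adm S t h(1,4,3) ea y, of "ra + h" "rb + h" x _])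
  show "dist (x, rb *R y) (x, (rb + h) *R y) < s" using dd h by simp
  fix q assume q: "q:EC" "dist (x, (ra + h) *R y) q <= s"
  have "dist (x, ra *R y) q <= e" using dist_triangle[of "(x, ra *R y)" q "(x, (ra + h) *R y)"] dd[of ra] q h by simp
  thus "v q t1 > 0" using e(2) q by blast
 qed (use r aX in auto)
qed

lemma polar: "(p::'m::finite pt):EC ==> EX y r. norm y = 1 & r >= R & p = (fst p, r *R y)"
proof -
 assume p: "p:EC"
 hence n: "nr p >= R" by (simp add: ExtC_def)
 hence "nr p > 0" using pos by linarith
 thus ?thesis using n by (intro exI[of _ "(1/nr p) *R snd p"] exI[of _ "nr p"]) (auto simp: prod_eq_iff)
qed

text \<open>Positivity goes along a ray to the interface, crosses it by \<open>transfer\<close>,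
  spreads through the cylinder, crosses back and leaves along the ray of the target point. Transport
  takes positive time, so the available time is halved.\<close>

theorem strong_positivity:
 fixes u v :: "'m::finite pt => real => real"
 assumes adm: "admissible_data R u0 v0" and S: "sol u0 v0 u v" and t: "t > 0"
 shows "p:OC ==> u p t > 0" "p:EC ==> v p t > 0"
proof -
 have up: "EX a:OC. u a s > 0" if s: "s > 0" for s
 proof -
  have "(EX p:OC. u p 0 > 0) | (EX p:EC. v p 0 > 0)" using adm S unfolding admissible_data_def is_solution_def by (smt (verit))
  thus ?thesis
  proof
   assume "EX p:OC. u p 0 > 0"
   then obtain a where "a:OC" "u a 0 > 0" by blast
   with u_pos_later[OF adm S order_refl s this] show ?thesis by blast
  next
   assume "EX p:EC. v p 0 > 0"
   then obtain a where a: "a:EC" "v a 0 > 0" by blast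
   obtain y r where y: "norm y = 1" "r >= R" "a = (fst a, r *R y)" using polar[OF a(1)] by blast
   have "v (fst a, r *R y) 0 > 0" using a(2) y(3) by simp
   hence "v (fst a, R *R y) s > 0" by (rule v_pos_later[OF adm S order_refl s y(1,2) order_refl])
   moreover have "norm (snd (fst a, R *R y)) = R" using y pos by simp
   ultimately have "u (fst a, R *R y) s > 0" using transfer[OF adm S s] by blast
   thus ?thesis using y pos by (intro bexI[of _ "(fst a, R *R y)"]) (auto simp: OmegaC_def)
  qed
 qed
 have u: "u p s > 0" if p: "p:OC" and s: "s > 0" for p s
 proof -
  have "s/2 > 0" "0 <= s/2" "s/2 < s" using s by auto
  thus ?thesis using up u_pos_later[OF adm S _ _ _ _ p] by blast
 qed
 show "p:OC ==> u p t > 0" using u t by blast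
 assume p: "p:EC"
 obtain y r where y: "norm y = 1" "r >= R" "p = (fst p, r *R y)" using polar[OF p] by blast
 have n: "norm (snd (fst p, R *R y)) = R" using y pos by simp
 have "(fst p, R *R y):OC" using n by (simp add: OmegaC_def)
 hence "u (fst p, R *R y) (t/2) > 0" using u t by simp
 hence "v (fst p, R *R y) (t/2) > 0" using transfer[OF adm S _ n] t by simp
 moreover have "0 <= t/2" "t/2 < t" using t by auto
 ultimately have "v (fst p, r *R y) t > 0" using v_pos_later[OF adm S _ _ y(1) order_refl y(2)] by blast
 thus "v p t > 0" using y(3) by simp
qed

end

subsection \<open>Standing subsolutions\<close>

text \<open>A cosine arch extended by 0 through the clamped argument; where it is positive, X'' = -
  dv^2 X holds exactly.\<close>

definition bumpX :: "real => real => real" where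
 "bumpX dv x = cos (max (- (pi/2)) (min (pi/2) (dv*x)))"

lemma bumpX_cont: "con A (bumpX dv)" unfolding bumpX_def by (intro ci)

lemma bumpX_bound: "0 <= bumpX dv x" "bumpX dv x <= 1"
proof -
 have "- (pi/2) <= max (- (pi/2)) (min (pi/2) (dv*x))" by (rule max.cobounded1)
 moreover have "max (- (pi/2)) (min (pi/2) (dv*x)) <= pi/2" using pi_gt_zero by (intro max.boundedI min.cobounded1) linarith
 ultimately show "0 <= bumpX dv x" unfolding bumpX_def by (intro cos_ge_zero)
 show "bumpX dv x <= 1" by (simp add: bumpX_def)
qed

lemma bumpX_0: "bumpX dv 0 = 1" by (simp add: bumpX_def)

lemma bumpX_pos: "bumpX dv x > 0 ==> - (pi/2) < dv*x & dv*x < pi/2"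
proof (rule ccontr)
 assume p: "bumpX dv x > 0" and n: "~ (- (pi/2) < dv*x & dv*x < pi/2)"
 have pi: "- (pi/2) <= pi/2" using pi_gt_zero by linarith
 from n consider "dv*x <= - (pi/2)" | "dv*x >= pi/2" by linarith
 hence "max (- (pi/2)) (min (pi/2) (dv*x)) = - (pi/2) | max (- (pi/2)) (min (pi/2) (dv*x)) = pi/2" using pi by cases (auto simp: min_def max_def)
 hence "bumpX dv x = 0" unfolding bumpX_def by (metis cos_minus cos_pi_half)
 thus False using p by simp
qed

lemma bumpX_d2:
 assumes "bumpX dv (x - x0) > 0"
 shows "has_d2 (%x. c*bumpX dv (x - x0)) x (- (dv^2*(c*bumpX dv (x - x0))))"
proof -
 have b: "- (pi/2) < dv*(x - x0)" "dv*(x - x0) < pi/2" using bumpX_pos[OF assms] by auto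
 have eq: "\<forall>\<^sub>F s in nhds x. c*cos (dv*(s - x0)) = c*bumpX dv (s - x0)"
 proof -
  have "open {s. - (pi/2) < dv*(s - x0) & dv*(s - x0) < pi/2}" by (intro open_Collect_conj open_Collect_less ci)
  from eventually_nhds_in_open[OF this, of x] b
  have "\<forall>\<^sub>F s in nhds x. - (pi/2) < dv*(s - x0) & dv*(s - x0) < pi/2" by simp
  thus ?thesis by eventually_elim (simp add: bumpX_def)
 qed
 have "has_d2 (%s. c*cos (dv*(s - x0))) x (- (dv^2*(c*cos (dv*(x - x0)))))" by (rule has_d2_I[where h="%s. c*(- dv * sin (dv*(s - x0)))"])
   (auto intro!: dei simp: power2_eq_square)
 from has_d2_cong[OF this eq] show ?thesis using b by (simp add: bumpX_def)
qed

context kpp begin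

text \<open>Expressing the Laplacian of \<open>H\<close> by a larger \<open>Q\<close> admits shifted
  profiles \<open>Q - const\<close>, which become nonpositive at a finite radius. The growth of the
  amplitude, at relative rate at most \<open>a\<close>, and the loss \<open>dv^2\<close> due to the
  arch are the two expenses that the strictness in \<open>gF\<close> and in the exterior equation
  has to cover.\<close>

lemma standing_sub:
 fixes u v :: "'m::finite pt => real => real"
 assumes Fc: "con {0..R} F" and Fp: "!!r. r:{0..R} ==> F r > 0"
  and lF: "!!y::real^'m. norm y < R ==> has_lap (%y. F (norm y)) y (- G (norm y)/D)"
  and dF: "(F HD F1) (at_left R)"
  and Hc: "con {R..} H" and HQ: "!!r. r >= R ==> H r <= Q r & Q r >= 0"
  and lH: "!!y::real^'m. norm y > R ==> has_lap (%y. H (norm y)) y (ga2*Q (norm y))"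
  and dH: "(H HD H1) (at_right R)"
  and bc: "D*F1 <= nq*H R - mq*F R" "- d*H1 <= mq*F R - nq*H R"
  and ka: "0 < A0" "A0 <= ka" and a: "a > 0" "d*ga2 = ro + d*dv^2 + a"
  and gF: "!!r s. r:{0..R} ==> 0 < s ==> s <= ka ==> (a + D*dv^2)*(s*F r) + s*G r <= g (s*F r)"
  and adm: "admissible_data R u0 v0" and S: "sol u0 v0 u v" and t1: "0 <= t1"
  and iu: "!!p. p:OC ==> A0*bumpX dv (fst p - x0)*F (nr p) <= u p t1"
  and iv: "!!p. p:EC ==> A0*bumpX dv (fst p - x0)*H (nr p) <= v p t1"
  and t: "t1 <= t" and Qb: "!!r. r >= R ==> Q r <= M0"
 defines "A == %t. ka - (ka - A0)*exp (- (a*A0/ka)*(t - t1))"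
 shows "(p:OC --> A t*bumpX dv (fst p - x0)*F (nr p) <= u p t) &
  (p:EC --> A t*bumpX dv (fst p - x0)*H (nr p) <= v p t)"
proof -
 \<comment> \<open>With this rate
   \<open>a' * (ka - A s) \<le> a' * ka = a * A0 \<le> a * A s\<close>.\<close>
 define a' where "a' = a*A0/ka"
 have a': "a' > 0" "a'*ka = a*A0" using a ka by (auto simp: a'_def)
 have Ab: "A0 <= A s" "A s <= ka" "A s > 0" if "t1 <= s" for s
 proof -
  have e: "exp (- a'*(s - t1)) <= 1" using a' that by simp
  have "(ka - A0)*exp (- a'*(s - t1)) <= (ka - A0)*1" using ka e by (intro mult_left_mono) auto
  thus "A0 <= A s" by (simp add: A_def a'_def)
  thus "A s > 0" using ka by linarith
  show "A s <= ka" using ka by (simp add: A_def)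
 qed
 have dA: "(A HD a'*(ka - A s)) (at s)" for s unfolding A_def a'_def[symmetric] by (auto intro!: dei simp: asi)
 have dA': "a'*(ka - A s) <= a*A s" if "t1 <= s" for s
 proof -
  have "a'*(ka - A s) <= a'*ka" using Ab[OF that] a' by (intro mult_left_mono) auto
  also have "\<dots> <= a*A s" using a' a Ab(1)[OF that] by simp
  finally show ?thesis .
 qed
 define X where "X = (%x. bumpX dv (x - x0))"
 define w where "w = (%(p::'m pt) t. A t*X (fst p)*F (nr p))"
 define z where "z = (%(p::'m pt) t. A t*X (fst p)*H (nr p))"
 have Xb: "0 <= X x" "X x <= 1" for x using bumpX_bound by (auto simp: X_def)
 have d2: "has_d2 (%x. A s*X x) x (- (dv^2*(A s*X x)))" if "X x > 0" for s x using bumpX_d2[of dv x x0 "A s"] that by (simp add: X_def)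
 have Xt: "((%s. A s*X x) HD a'*(ka - A s)*X x) (at s)" for x s by (rule DERIV_cmult_right[OF dA])
 have Ac: "con UNIV A" by (rule DERIV_continuous_on, rule has_field_derivative_at_within, rule dA)
 have cAX: "con UNIV (%(x::real,t). A t*X x)" unfolding case_prod_beta X_def by (intro continuous_on_mult continuous_on_compose2[OF Ac] continuous_on_compose2[OF bumpX_cont[of UNIV]] ci) auto
 obtain BF where BF: "BF > 0" "!!r. r:{0..R} ==> F r <= BF"
 proof -
  have "{0..R} ~= {}" using pos by simp
  from continuous_attains_sup[OF compact_Icc this Fc] obtain r where "r:{0..R}" "ALL s:{0..R}. F s <= F r" by blast
  thus ?thesis using that[of "F r"] Fp by auto
 qed
 have main: "(p:OC --> w p t <= u p t) & (p:EC --> z p t <= v p t)" if bz: "!!p s. p:EC ==> z p s <= ka*M | s < t1" and M: "M >= BF" for M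
 proof (rule sub_cmp[OF adm S t1, where T=t and w=w and z=z and M="ka*M"])
  show "con (OC \<times> {t1..t}) (%(p, t). w p t)" unfolding w_def by (rule cont_sep_in[OF cAX Fc]) simp
  show "con (EC \<times> {t1..t}) (%(p, t). z p t)" unfolding z_def by (rule cont_sep_out[OF cAX Hc]) simp
  show "w p s <= ka*M" if "p:OC" "s:{t1..t}" for p s
  proof -
   have r: "nr p:{0..R}" using that by (simp add: OmegaC_def)
   have "A s*X (fst p) <= ka*1" using Ab[of s] that Xb ka by (intro mult_mono) auto
   hence "w p s <= ka*BF" unfolding w_def using Fp[OF r] BF(2)[OF r] ka by (intro mult_mono) auto
   also have "\<dots> <= ka*M" using M ka by simp
   finally show ?thesis .
  qed
  show "z p s <= ka*M" if "p:EC" "s:{t1..t}" for p s using bz[OF that(1), of s] that(2) by auto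
  show "w p t1 <= u p t1" if "p:OC" for p using iu[OF that] by (simp add: w_def X_def A_def)
  show "z p t1 <= v p t1" if "p:EC" for p using iv[OF that] by (simp add: z_def X_def A_def)
 next
  fix p :: "'m pt" and s assume a1: "p:OI" "t1 < s" "s <= t" "0 < w p s"
  let ?r = "nr p"
  have r: "?r:{0..R}" "?r < R" using a1(1) by (auto simp: OmegaI_def)
  have As: "0 < A s" "A s <= ka" using Ab[of s] a1 by auto
  have Xp: "X (fst p) > 0"
  proof -
   have "A s*F ?r > 0" using As Fp[OF r(1)] by simp
   thus ?thesis using a1(4) Xb(1)[of "fst p"] unfolding w_def by (cases "X (fst p) = 0") auto
  qed
  have P: "has_par w p s (a'*(ka - A s)*X (fst p)*F ?r) (- (dv^2*(A s*X (fst p)))*F ?r + A s*X (fst p)*(- G ?r/D))" unfolding w_def by (rule has_par_sep[where a="%x t. A t*X x" and F="%y. F (norm y)", OF Xt d2[OF Xp] lF[OF r(2)]])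
  define q where "q = A s*X (fst p)"
  have q: "0 < q" "q <= ka"
  proof -
   show "0 < q" using As Xp by (simp add: q_def)
   have "q <= ka*1" unfolding q_def using As Xb ka by (intro mult_mono) auto
   thus "q <= ka" by simp
  qed
  have "a'*(ka - A s)*X (fst p)*F ?r <= a*A s*X (fst p)*F ?r" using dA'[of s] a1 Xp Fp[OF r(1)] by (intro mult_right_mono) auto
  also have "\<dots> = a*(q*F ?r)" by (simp add: q_def)
  also have "\<dots> <= D*(- (dv^2*q)*F ?r + q*(- G ?r/D)) + g (q*F ?r)" using gF[OF r(1) q] pos by (simp add: asi)
  finally show "EX ft l. has_par w p s ft l & ft <= D*l + g (w p s)" using P unfolding q_def w_def by blast
 next
  fix p :: "'m pt" and s assume a1: "p:EI" "t1 < s" "s <= t" "0 < z p s"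
  let ?r = "nr p"
  have r: "R <= ?r" "R < ?r" using a1(1) by (auto simp: ExtI_def)
  have As: "0 < A s" "A s <= ka" using Ab[of s] a1 by auto
  have Xp: "X (fst p) > 0" using a1(4) Xb(1)[of "fst p"] unfolding z_def by (cases "X (fst p) = 0") auto
  define q where "q = A s*X (fst p)"
  have q: "0 < q" using As Xp by (simp add: q_def)
  have Hp: "H ?r > 0" using a1(4) q unfolding z_def q_def[symmetric] by (simp add: zero_less_mult_iff)
  have P: "has_par z p s (a'*(ka - A s)*X (fst p)*H ?r) (- (dv^2*(A s*X (fst p)))*H ?r + A s*X (fst p)*(ga2*Q ?r))" unfolding z_def by (rule has_par_sep[where a="%x t. A t*X x" and F="%y. H (norm y)", OF Xt d2[OF Xp] lH[OF r(2)]])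
  have "a'*(ka - A s)*X (fst p)*H ?r <= a*A s*X (fst p)*H ?r" using dA'[of s] a1 Xp Hp by (intro mult_right_mono) auto
  also have "\<dots> = q*(a*H ?r)" by (simp add: q_def)
  also have "\<dots> <= q*(- (d*dv^2)*H ?r + (d*ga2)*Q ?r - ro*H ?r)"
  proof (rule mult_left_mono)
   have "(ro + d*dv^2 + a)*H ?r <= (ro + d*dv^2 + a)*Q ?r" using HQ[OF r(1)] pos a by (intro mult_left_mono) auto
   thus "a*H ?r <= - (d*dv^2)*H ?r + (d*ga2)*Q ?r - ro*H ?r" unfolding a(2) by (simp add: asi)
  qed (use q in simp)
  also have "\<dots> = d*(- (dv^2*q)*H ?r + q*(ga2*Q ?r)) - ro*(q*H ?r)" by (simp add: asi)
  finally show "EX ft l. has_par z p s ft l & ft <= d*l - ro*z p s" using P unfolding q_def z_def by blast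
 next
  fix p :: "'m pt" and s assume a1: "nr p = R" "t1 < s" "s <= t" "0 < w p s"
  have q: "0 <= A s*X (fst p)" using Ab[of s] a1 Xb by simp
  have "dn_in R (%p. w p s) p (A s*X (fst p)*F1)" unfolding w_def by (rule dn_in_sep[OF a1(1) dF, where a="%x. A s*X x"])
  moreover have "D*(A s*X (fst p)*F1) <= nq*z p s - mq*w p s" using mult_left_mono[OF bc(1) q] a1(1) by (simp add: w_def z_def asi)
  ultimately show "EX x. dn_in R (%p. w p s) p x & D*x <= nq*z p s - mq*w p s" by blast
 next
  fix p :: "'m pt" and s assume a1: "nr p = R" "t1 < s" "s <= t" "0 < z p s"
  have q: "0 <= A s*X (fst p)" using Ab[of s] a1 Xb by simp
  have "dn_out R (%p. z p s) p (A s*X (fst p)*H1)" unfolding z_def by (rule dn_out_sep[OF a1(1) dH, where a="%x. A s*X x"])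
  moreover have "- d*(A s*X (fst p)*H1) <= mq*w p s - nq*z p s" using mult_left_mono[OF bc(2) q] a1(1) by (simp add: w_def z_def asi)
  ultimately show "EX x. dn_out R (%p. z p s) p x & - d*x <= mq*w p s - nq*z p s" by blast
 qed (use t in auto)
 show ?thesis
 proof -
  define M where "M = max BF (max M0 0)"
  have "z p s <= ka*M | s < t1" if p: "p:EC" for p s
  proof (cases "s < t1")
   case False
   have r: "nr p >= R" using p by (simp add: ExtC_def)
   have "A s*X (fst p) <= ka*1" using Ab[of s] False Xb ka by (intro mult_mono) auto
   moreover have "0 <= A s*X (fst p)" using Ab[of s] False Xb by simp
   moreover have "H (nr p) <= M" using HQ[OF r] Qb[OF r] max.cobounded1[of M0 0] max.cobounded2[of "max M0 0" BF] unfolding M_def by linarith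
   moreover have "M >= 0" by (simp add: M_def)
   ultimately have "A s*X (fst p)*H (nr p) <= ka*M" by (smt (verit) mult_left_mono mult_right_mono)
   thus ?thesis by (simp add: z_def)
  qed simp
  from main[OF this] show ?thesis by (simp add: w_def z_def X_def M_def)
 qed
qed

lemma exp_neg_le: "y > 0 ==> exp (- y) <= 1/y" for y :: real
proof -
 assume y: "y > 0"
 have "y <= exp y" using exp_ge_add_one_self[of y] by linarith
 thus ?thesis using y by (simp add: exp_minus divide_simps)
qed

lemma psi_small:
 assumes "ga > 0" "e > 0"
 obtains R3 where "R3 >= R" "!!r. r >= R3 ==> psi N ga r <= e"
proof -
 obtain C a where C: "C > 0" "a > 0" "ALL r>=R. psi N ga r <= C*exp (- a*r)" using psi_decay[OF assms(1) pos(3)] by blast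
 have "psi N ga r <= e" if r: "r >= max R (C/(a*e))" for r
 proof -
  have r': "r >= R" "r > 0" "C/(a*e) <= r" using r pos by auto
  have "exp (- (a*r)) <= 1/(a*r)" using r' C by (intro exp_neg_le) simp
  hence "C*exp (- a*r) <= C*(1/(a*r))" using C by (intro mult_left_mono) auto
  also have "\<dots> <= e" using r' C assms by (simp add: divide_simps mult_ac)
  finally show ?thesis using C(3) r' by force
 qed
 thus ?thesis using that[of "max R (C/(a*e))"] by simp
qed

definition qpsi :: "nat => real => real => real => real" where
 "qpsi N w ga r = mq*w/(nq*psi N ga R + (- d*psi' N ga R))*psi N ga r"

lemma qpsi_gam: "qpsi N w gam r = bpsi N w*psi N gam r" by (simp add: qpsi_def bpsi_def)

lemma qpsi_denom: "ga > 0 ==> nq*psi N ga R + (- d*psi' N ga R) > 0" using mult_pos_pos[OF pos(5) psi_pos[of ga R N]] mult_pos_neg[OF pos(2) psi'_neg[of ga R N]] pos(3) by linarith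

lemma qpsi_near:
 assumes e: "e > 0" and r3: "r3 >= R"
 obtains te where "te > 0" "!!ga r. gam <= ga ==> ga <= gam + te ==> r:{R..r3} ==> \<bar>qpsi N w ga r - qpsi N w gam r\<bar> < e"
proof -
 let ?K = "{gam..gam+1} \<times> {R..r3}"
 have g0: "fst z > 0" "snd z > 0" if "z:?K" for z using that gam(1) pos by (auto simp: mem_Times_iff)
 have c: "con ?K (%z. (%(ga,r). f ga r) (k z))" if "con ({0<..} \<times> {0<..}) (%(ga,r). f ga r)" "con ?K k"
  "!!z. z:?K ==> k z:{0<..} \<times> {0<..}" for f :: "real => real => real" and k by (rule continuous_on_compose2[OF that(1,2)]) (use that(3) in blast)
 have c1: "con ?K (%z. psi N (fst z) (snd z))" using c[OF psi_joint_cont(1), of "%z. z"] g0 by (simp add: case_prod_beta mem_Times_iff)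
 have c2: "con ?K (%z. psi N (fst z) R)" "con ?K (%z. psi' N (fst z) R)"
 proof -
  have k: "con ?K (%z. (fst z, R))" by (intro ci)
  have i: "(fst z, R):{0<..} \<times> {0<..}" if "z:?K" for z using g0(1)[OF that] pos by simp
  show "con ?K (%z. psi N (fst z) R)" using c[OF psi_joint_cont(1) k i] by simp
  show "con ?K (%z. psi' N (fst z) R)" using c[OF psi_joint_cont(2) k i] by simp
 qed
 have "nq*psi N (fst z) R + (- d*psi' N (fst z) R) ~= 0" if "z:?K" for z using qpsi_denom[OF g0(1)[OF that], of N] by linarith
 hence "con ?K (%z. qpsi N w (fst z) (snd z))" unfolding qpsi_def by (intro ci c1 c2) auto
 hence "uniformly_continuous_on ?K (%z. qpsi N w (fst z) (snd z))" by (rule compact_uniformly_continuous) (intro compact_Times compact_Icc)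
 then obtain x where x: "x > 0" "!!z z'. z:?K ==> z':?K ==> dist z' z < x ==> dist (qpsi N w (fst z') (snd z')) (qpsi N w (fst z) (snd z)) < e" using e unfolding uniformly_continuous_on_def by metis
 show ?thesis
 proof (rule that[of "min 1 (x/2)"])
  fix ga r assume a: "gam <= ga" "ga <= gam + min 1 (x/2)" "r:{R..r3}"
  have "dist (ga, r) (gam, r) < x" using a x(1) by (simp add: dist_Pair_Pair dist_real_def)
  thus "\<bar>qpsi N w ga r - qpsi N w gam r\<bar> < e" using x(2)[of "(gam, r)" "(ga, r)"] a by (simp add: dist_real_def)
 qed (use x in auto)
qed

text \<open>For \<open>k = 0\<close> strict decrease of \<open>g s / s\<close> gives
  \<open>g (ka * U r) / ka > g (U r)\<close>, and compactness leaves room for a small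
  \<open>k\<close>. The parabola is there to lower the slope at \<open>R\<close> without changing
  the value.\<close>

lemma F_slack:
 assumes Uc: "con {0..R} U" and U01: "!!r. r:{0..R} ==> 0 < U r & U r < 1" and ka: "0 < ka" "ka < 1"
 obtains k m1 where "k > 0" "m1 > 0" "!!r. r:{0..R} ==> m1 + g (U r) + c*k <= g (ka*(U r + k*(R^2 - r^2)))/ka"
proof -
 define f where "f = (%k r. g (ka*(U r + k*(R^2 - r^2)))/ka - (g (U r) + c*k))"
 have gc: "con X (%x. g (h x))" if "con X h" for X :: "'z::topological_space set" and h by (rule continuous_on_compose2[OF continuous_g[of UNIV] that]) simp
 have Uc': "con (X \<times> {0..R}) (%z. U (snd z))" for X :: "real set" by (rule continuous_on_compose2[OF Uc]) (auto intro!: ci)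
 have c: "con ({0..1} \<times> {0..R}) (%(k,r). f k r)" unfolding f_def case_prod_beta using ka by (intro ci gc Uc') auto
 have p: "f 0 r > 0" if r: "r:{0..R}" for r
 proof -
  have u: "0 < ka*U r" "ka*U r < U r" using U01[OF r] ka by auto
  hence "g (U r)/U r < g (ka*U r)/(ka*U r)" using g_skpp by blast
  thus ?thesis using u ka U01[OF r] by (simp add: f_def field_simps)
 qed
 obtain e where e: "e > 0" "ALL k:{0..1}. dist k 0 < e --> (ALL r:{0..R}. f k r > 0)" using pos_open[OF compact_Icc compact_Icc c _ p] by auto
 define k where "k = min 1 (e/2)"
 have k: "k:{0..1}" "k > 0" "dist k 0 < e" using e(1) by (auto simp: k_def dist_real_def)
 hence fk: "!!r. r:{0..R} ==> f k r > 0" using e(2) by blast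
 have "con {0..R} (%r. f k r)" unfolding f_def using ka by (intro ci gc Uc) auto
 then obtain m1 where "m1 > 0" "!!r. r:{0..R} ==> m1 <= f k r" by (rule inf_pos[OF compact_Icc, rotated]) (use fk pos in auto)
 thus ?thesis using that[of k m1] k by (simp add: f_def asi)
qed

text \<open>The waiting time \<open>L\<close> may depend on the level \<open>m\<close>, but neither
  on the solution nor on the starting time \<open>t1\<close> nor on the position \<open>x0\<close>.
  Thanks to this uniformity it can be used at every position behind a moving front.\<close>

lemma standing:
 assumes N: "N + 1 = CARD('m::finite)" and Uc: "con {0..R} U" and U01: "!!r. r:{0..R} ==> 0 < U r & U r < 1"
  and dU: "(U HD U1) (at_left R)"
  and lU: "!!y::real^'m. norm y < R ==> has_lap (%y. U (norm y)) y (- g (U (norm y))/D)"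
  and bU: "D*U1 = nq*(bpsi N (U R)*psi N gam R) - mq*U R"
  and e: "e > 0" and r3: "r3 >= R"
 obtains X' R3 where "X' > 0" "R3 >= R"
  "!!m. m > 0 ==> EX L>=0. ALL u0 v0 (u::'m pt => real => real) v t1 x0. admissible_data R u0 v0 & sol u0 v0 u v & 0 <= t1 &
   (ALL p:OC. \<bar>fst p - x0\<bar> <= X' --> m <= u p t1) &
   (ALL p:EC. \<bar>fst p - x0\<bar> <= X' & nr p <= R3 --> m <= v p t1) -->
   (ALL t>=t1 + L. (ALL p:OC. fst p = x0 --> U (nr p) - e <= u p t) &
   (ALL p:EC. fst p = x0 & nr p <= r3 --> bpsi N (U R)*psi N gam (nr p) - e <= v p t))"
proof -
 define V where "V = (%r. bpsi N (U R)*psi N gam r)"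
 have UR: "U R > 0" using U01[of R] pos by simp
 have b0: "bpsi N (U R) > 0" using bpsi_denom[of N] UR pos unfolding bpsi_def by simp
 have Vp: "V r > 0" "V r <= V R" if "r >= R" for r using b0 psi_pos[OF gam(1), of r N] psi_decr[OF gam(1) pos(3) that, of N] that pos by (auto simp: V_def)
 have VR: "V R > 0" using Vp by simp
 \<comment> \<open>The amplitude loses \<open>e1\<close> twice: its limit is \<open>1 - e1\<close>,
   and it is used when still \<open>e1\<close> short of that limit.\<close>
 define e1 where "e1 = min (1/2) (e/(4*(1 + V R)))"
 have e1: "e1 > 0" "e1 <= 1/2" "2*e1 <= e/2" "2*e1*V R <= e/2"
 proof -
  show "e1 > 0" using e VR by (simp add: e1_def)
  show "e1 <= 1/2" unfolding e1_def by (rule min.cobounded1)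
  have "e1 <= e/(4*(1 + V R))" by (simp add: e1_def)
  hence "e1*(4*(1 + V R)) <= e" using VR by (simp add: pos_le_divide_eq)
  hence *: "4*e1 + 4*(e1*V R) <= e" by (simp add: asi)
  moreover have "e1*V R > 0" using VR \<open>e1 > 0\<close> by simp
  ultimately show "2*e1 <= e/2" "2*e1*V R <= e/2" using \<open>e1 > 0\<close> by linarith+
 qed
 define ka where "ka = 1 - e1"
 have ka: "0 < ka" "ka < 1" using e1 by (auto simp: ka_def)
 obtain k m1 where k: "k > 0" "m1 > 0" "!!r. r:{0..R} ==> m1 + g (U r) + 2*real CARD('m)*D*k <= g (ka*(U r + k*(R^2 - r^2)))/ka" using F_slack[OF Uc U01 ka] by metis
 define F where "F = (%r. U r + k*(R^2 - r^2))"
 have Fc: "con {0..R} F" unfolding F_def by (intro ci Uc)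
 have FU: "U r <= F r" if "r:{0..R}" for r
 proof -
  have "r^2 <= R^2" using that by (intro power_mono) auto
  thus ?thesis using k by (simp add: F_def)
 qed
 have Fp: "F r > 0" if "r:{0..R}" for r using FU[OF that] U01[OF that] by linarith
 have FR: "F R = U R" by (simp add: F_def)
 define FB where "FB = 1 + k * R^2"
 have FB: "FB > 0" "F r <= FB" if "r:{0..R}" for r
 proof -
  show "FB > 0" using k by (simp add: FB_def add_pos_nonneg)
  have "k*(R^2 - r^2) <= k * R^2" using k by simp
  thus "F r <= FB" using U01[OF that] by (simp add: F_def FB_def)
 qed
 have FB0: "FB > 0" using FB(1)[of R] pos by simp
 \<comment> \<open>The exterior value at \<open>R\<close> will fall short of \<open>V R\<close> by
   at most \<open>2 * e2\<close>; the parabola, which lowers the interior slope by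
   \<open>2 * k * R\<close>, pays for this in the flux condition.\<close>
 define e2 where "e2 = min (e/4) (k * R*D/nq)"
 have e2: "e2 > 0" "e2 <= e/4" "nq*e2 <= k * R*D"
 proof -
  show "e2 > 0" using e k(1) pos by (simp add: e2_def)
  show "e2 <= e/4" unfolding e2_def by (rule min.cobounded1)
  have "e2 <= k * R*D/nq" by (simp add: e2_def)
  thus "nq*e2 <= k * R*D" using pos by (simp add: pos_le_divide_eq mult.commute)
 qed
 obtain te where te0: "te > 0"
  "!!ga r. gam <= ga ==> ga <= gam + te ==> r:{R..r3} ==> \<bar>qpsi N (U R) ga r - qpsi N (U R) gam r\<bar> < e2" by (rule qpsi_near[OF e2(1) r3, of N "U R"]) (rule that)
 have te: "te > 0" "!!ga r. gam <= ga ==> ga <= gam + te ==> r:{R..r3} ==> \<bar>qpsi N (U R) ga r - V r\<bar> < e2" using te0 by (simp_all only: qpsi_gam V_def)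
 \<comment> \<open>Raising the decay rate by \<open>te1\<close> costs at most \<open>te1 * W\<close>
   of the slack \<open>m1\<close>.\<close>
 define W where "W = FB*(1 + D/d)*(d*(2*gam + 1))"
 have W: "W > 0" unfolding W_def using FB0 pos gam(1) by (intro mult_pos_pos add_pos_pos) auto
 define te1 where "te1 = min te (min 1 (m1/W))"
 have te1: "te1 > 0" "te1 <= te" "te1 <= 1" "te1*W <= m1"
 proof -
  show "te1 > 0" "te1 <= te" "te1 <= 1" using te(1) k(1,2) W by (simp_all add: te1_def)
  have "te1 <= m1/W" by (simp add: te1_def)
  thus "te1*W <= m1" using W by (simp add: pos_le_divide_eq)
 qed
 \<comment> \<open>The steeper decay gives \<open>d * ga^2 = ro + Te\<close>; one half of
   \<open>Te\<close> is spent on the arch, the other on the growth of the amplitude.\<close>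
 define ga where "ga = gam + te1"
 have ga: "ga > 0" "gam <= ga" "ga <= gam + te" using te1 gam(1) by (auto simp: ga_def)
 define Te where "Te = d*(te1*(2*gam + te1))"
 have Te: "Te > 0" "d*ga^2 = ro + Te" "Te*(1 + D/d)*FB <= m1"
 proof -
  show "Te > 0" unfolding Te_def using te1 gam(1) pos by (intro mult_pos_pos add_pos_pos) auto
  show "d*ga^2 = ro + Te"
  proof -
   have "d*ga^2 = d*gam^2 + Te" unfolding ga_def Te_def by (simp add: power2_eq_square asi)
   thus ?thesis using gam(2) by simp
  qed
  have "Te*((1 + D/d)*FB) <= (d*(te1*(2*gam + 1)))*((1 + D/d)*FB)" unfolding Te_def using te1 gam(1) pos FB0 by (intro mult_right_mono mult_left_mono add_left_mono) auto
  also have "\<dots> = te1*W" by (simp add: W_def mult_ac)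
  finally show "Te*(1 + D/d)*FB <= m1" using te1 by (simp add: mult.assoc)
 qed
 define a where "a = Te/2"
 define dv where "dv = sqrt (Te/(2*d))"
 have a0: "a > 0" using Te by (simp add: a_def)
 have dv: "dv > 0" "d*dv^2 = Te/2" "D*dv^2 = Te/2*(D/d)" using Te pos by (auto simp: dv_def)
 have a: "d*ga^2 = ro + d*dv^2 + a" using Te dv by (simp add: a_def)
 have aD: "(a + D*dv^2)*F r <= m1" if "r:{0..R}" for r
 proof -
  have "a + D*dv^2 = Te*(1 + D/d)/2" unfolding dv(3) a_def by (simp add: asi)
  also have "\<dots> <= Te*(1 + D/d)"
  proof -
   have "0 <= Te*(1 + D/d)" using Te(1) pos by (intro mult_nonneg_nonneg add_nonneg_nonneg) auto
   moreover have "x/2 <= x" if "0 <= x" for x :: real using that by simp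
   ultimately show ?thesis by blast
  qed
  finally have "(a + D*dv^2)*F r <= Te*(1 + D/d)*FB" using FB[OF that] Fp[OF that] a0 pos Te(1) by (intro mult_mono) auto
  thus ?thesis using Te(3) by linarith
 qed
 define b' where "b' = mq*U R/(nq*psi N ga R + (- d*psi' N ga R))"
 note den = qpsi_denom[OF ga(1), of N]
 have b': "b' > 0" "b'*(nq*psi N ga R + (- d*psi' N ga R)) = mq*U R" using den UR pos by (auto simp: b'_def)
 define Q where "Q = (%r. b'*psi N ga r)"
 have Qq: "Q = qpsi N (U R) ga" by (rule ext) (simp add: Q_def qpsi_def b'_def)
 have Qp: "Q r > 0" "Q r <= Q R" if "r >= R" for r using b' psi_pos[OF ga(1), of r N] psi_decr[OF ga(1) pos(3) that, of N] that pos by (auto simp: Q_def)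
 have QR: "Q R > 0" using Qp by simp
 define H where "H = (%r. Q r - e2)"
 have HV: "\<bar>H r - V r\<bar> <= e/2" if "r:{R..r3}" for r using te(2)[OF ga(2,3) that] e2 unfolding H_def Qq by (simp add: abs_le_iff abs_less_iff)
 have "e2/b' > 0" using e2 b' by simp
 \<comment> \<open>From \<open>R3\<close> on the shifted profile is nonpositive, so no lower bound
   for \<open>v\<close> is required there.\<close>
 then obtain R3 where R3: "R3 >= R" "!!r. r >= R3 ==> psi N ga r <= e2/b'" using psi_small[OF ga(1)] by metis
 have HR3: "H r <= 0" if "r >= R3" for r using R3(2)[OF that] b'(1) by (simp add: H_def Q_def field_simps)
 have lF: "has_lap (%y. F (norm y)) y (- (g (U (norm y)) + 2*real CARD('m)*D*k)/D)" if "norm y < R" for y :: "real^'m"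
 proof -
  have "has_lap (%y. U (norm y) + (k * R^2 + (- k)*(norm (y - 0))^2)) y (- g (U (norm y))/D + (0 + (- k)*(2*DIM(real^'m))))" by (intro has_lap_add lU that has_lap_const has_lap_cmult has_lap_norm2)
  moreover have "- g (U (norm y))/D + (0 + (- k)*(2*DIM(real^'m))) = - (g (U (norm y)) + 2*real CARD('m)*D*k)/D" using pos by (simp add: field_simps)
  moreover have "(%y::real^'m. U (norm y) + (k * R^2 + (- k)*(norm (y - 0))^2)) = (%y. F (norm y))" by (rule ext) (simp add: F_def asi)
  ultimately show ?thesis by simp
 qed
 have dF: "(F HD U1 - 2*k * R) (at_left R)" unfolding F_def by (rule dei dU refl | simp)+
 have Hc: "con {R..} H" unfolding H_def Q_def by (intro ci psi_cont ga)
 have lH: "has_lap (%y. H (norm y)) y (ga^2*Q (norm y))" if "norm y > R" for y :: "real^'m"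
 proof -
  have "has_lap (%y. psi N ga (norm y)) y (ga^2*psi N ga (norm y))" by (rule psi_C2(2)[OF _ ga(1) open_outside]) (use N pos that in auto)
  from has_lap_diff[OF has_lap_cmult[OF this, of b'] has_lap_const[of e2]] show ?thesis by (simp add: H_def Q_def mult_ac)
 qed
 have dH: "(H HD b'*psi' N ga R) (at_right R)"
 proof -
  have "(H HD b'*psi' N ga R - 0) (at R)" unfolding H_def Q_def by (intro DERIV_diff DERIV_cmult DERIV_const psi_deriv[OF ga(1) pos(3)])
  thus ?thesis using has_field_derivative_at_within by fastforce
 qed
 have bc1: "D*(U1 - 2*k * R) <= nq*H R - mq*F R"
 proof -
  have "\<bar>Q R - V R\<bar> < e2" using te(2)[OF ga(2,3), of R] r3 by (simp add: Qq)
  hence "V R - e2 - e2 <= H R" by (simp add: H_def)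
  hence "nq*(V R - e2 - e2) <= nq*H R" using pos by simp
  hence "nq*V R - nq*e2 - nq*e2 <= nq*H R" by (simp only: right_diff_distrib)
  moreover have "D*(U1 - 2*k * R) = D*U1 - 2*(k * R*D)" by (simp add: asi)
  ultimately show ?thesis using bU e2(3) unfolding FR V_def by linarith
 qed
 have bc2: "- d*(b'*psi' N ga R) <= mq*F R - nq*H R"
 proof -
  have "nq*e2 >= 0" using pos e2 by simp
  thus ?thesis using b'(2) unfolding FR H_def Q_def by (simp add: asi)
 qed
 have gF: "(a + D*dv^2)*(s*F r) + s*(g (U r) + 2*real CARD('m)*D*k) <= g (s*F r)"
  if r: "r:{0..R}" and s: "0 < s" "s <= ka" for r s
 proof -
  have "g (ka*F r)/(ka*F r) <= g (s*F r)/(s*F r)" using s Fp[OF r] by (intro g_ratio) auto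
  hence "s*(g (ka*F r)/ka) <= g (s*F r)" using s ka Fp[OF r] by (simp add: field_simps)
  moreover have "s*(m1 + g (U r) + 2*real CARD('m)*D*k) <= s*(g (ka*F r)/ka)" using k(3)[OF r] s unfolding F_def by (intro mult_left_mono) auto
  moreover have "s*((a + D*dv^2)*F r) <= s*m1" using aD[OF r] s by (intro mult_left_mono) auto
  ultimately show ?thesis by (simp add: asi)
 qed
 show ?thesis
 proof (rule that[of "pi/(2*dv)" R3])
  show "pi/(2*dv) > 0" using dv by simp
  show "R3 >= R" by fact
 next
  fix m :: real assume m: "m > 0"
  define A0 where "A0 = min ka (m/(FB + Q R))"
  have A0: "0 < A0" "A0 <= ka" "A0*(FB + Q R) <= m"
  proof -
   show "0 < A0" "A0 <= ka" using ka m FB0 QR by (auto simp: A0_def)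
   have "A0 <= m/(FB + Q R)" by (simp add: A0_def)
   thus "A0*(FB + Q R) <= m" using FB0 QR by (simp add: pos_le_divide_eq)
  qed
  have A0': "A0*FB <= m" "A0*Q R <= m" using A0(3) mult_pos_pos[OF A0(1) FB0] mult_pos_pos[OF A0(1) QR] by (auto simp: distrib_left)
  define a' where "a' = a*A0/ka"
  have a': "a' > 0" using a0 A0 ka by (simp add: a'_def)
  show "EX L>=0. ALL u0 v0 (u::'m pt => real => real) v t1 x0. admissible_data R u0 v0 & sol u0 v0 u v & 0 <= t1 &
   (ALL p:OC. \<bar>fst p - x0\<bar> <= pi/(2*dv) --> m <= u p t1) &
   (ALL p:EC. \<bar>fst p - x0\<bar> <= pi/(2*dv) & nr p <= R3 --> m <= v p t1) -->
   (ALL t>=t1 + L. (ALL p:OC. fst p = x0 --> U (nr p) - e <= u p t) &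
   (ALL p:EC. fst p = x0 & nr p <= r3 --> bpsi N (U R)*psi N gam (nr p) - e <= v p t))"
  \<comment> \<open>After this time \<open>a' * (t - t1) \<ge> 1 / e1\<close>, and
    \<open>exp (- y) \<le> 1 / y\<close> brings the remaining deficit of the amplitude below
    \<open>e1\<close>.\<close>
  proof (intro exI[of _ "1/(a'*e1)"] conjI allI impI ballI)
   show "0 <= 1/(a'*e1)" using a' e1 by simp
  next
   fix u0 v0 and u v :: "'m pt => real => real" and t1 x0 t and p :: "'m pt"
   assume H0: "admissible_data R u0 v0 & sol u0 v0 u v & 0 <= t1 &
   (ALL p:OC. \<bar>fst p - x0\<bar> <= pi/(2*dv) --> m <= u p t1) &
   (ALL p:EC. \<bar>fst p - x0\<bar> <= pi/(2*dv) & nr p <= R3 --> m <= v p t1)"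
   and t: "t >= t1 + 1/(a'*e1)"
   hence adm: "admissible_data R u0 v0" and S: "sol u0 v0 u v" and t1: "0 <= t1"
   and iu: "!!p. p:OC ==> \<bar>fst p - x0\<bar> <= pi/(2*dv) ==> m <= u p t1"
   and iv: "!!p. p:EC ==> \<bar>fst p - x0\<bar> <= pi/(2*dv) ==> nr p <= R3 ==> m <= v p t1" by blast+
   have y: "a'*(t - t1) >= 1/e1" "t >= t1"
   proof -
   have "a'*(1/(a'*e1)) <= a'*(t - t1)" using t a' by (intro mult_left_mono) auto
   thus "a'*(t - t1) >= 1/e1" using a' by simp
   have "1/(a'*e1) >= 0" using a' e1 by simp
   thus "t >= t1" using t by linarith
   qed
   have Xx: "\<bar>x - x0\<bar> <= pi/(2*dv)" if "bumpX dv (x - x0) > 0" for x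
   proof -
   have "\<bar>dv*(x - x0)\<bar> <= pi/2" using bumpX_pos[OF that] by (simp only: abs_le_iff) linarith
   hence "dv*\<bar>x - x0\<bar> <= pi/2" using dv(1) by (simp add: abs_mult)
   thus ?thesis using dv(1) by (simp add: field_simps)
   qed
   define A where "A = ka - (ka - A0)*exp (- (a*A0/ka)*(t - t1))"
   have main: "(p:OC --> A*bumpX dv (fst p - x0)*F (nr p) <= u p t) &
   (p:EC --> A*bumpX dv (fst p - x0)*H (nr p) <= v p t)" unfolding A_def
   proof (rule standing_sub[OF Fc Fp lF dF Hc _ lH dH bc1 bc2 A0(1,2) a0 a gF adm S t1 _ _ y(2)])
   show "H r <= Q r & Q r >= 0" "Q r <= Q R" if "r >= R" for r using Qp[OF that] e2 by (auto simp: H_def)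
   next
   fix p :: "'m pt" assume p: "p:OC"
   have r: "nr p:{0..R}" using p by (simp add: OmegaC_def)
   show "A0*bumpX dv (fst p - x0)*F (nr p) <= u p t1"
   proof (cases "bumpX dv (fst p - x0) > 0")
   case True
   have "A0*bumpX dv (fst p - x0)*F (nr p) <= A0*1*FB" using A0 FB(2)[OF r] Fp[OF r] bumpX_bound[of dv "fst p - x0"] by (intro mult_mono) auto
   thus ?thesis using iu[OF p Xx[OF True]] A0' by simp
   next
   case False
   hence "bumpX dv (fst p - x0) = 0" using bumpX_bound[of dv "fst p - x0"] by simp
   thus ?thesis using nonneg(1)[OF adm S t1 p] by simp
   qed
   next
   fix p :: "'m pt" assume p: "p:EC"
   have r: "R <= nr p" using p by (simp add: ExtC_def)
   show "A0*bumpX dv (fst p - x0)*H (nr p) <= v p t1"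
   proof (cases "bumpX dv (fst p - x0) > 0 & H (nr p) > 0")
   case True
   hence r3: "nr p <= R3" using HR3[of "nr p"] by force
   have "A0*bumpX dv (fst p - x0)*H (nr p) <= A0*1*Q R" using A0 True Qp(2)[OF r] e2 bumpX_bound[of dv "fst p - x0"] by (intro mult_mono) (auto simp: H_def)
   thus ?thesis using iv[OF p Xx r3] True A0' by simp
   next
   case False
   hence "bumpX dv (fst p - x0) = 0 | H (nr p) <= 0" using bumpX_bound(1)[of dv "fst p - x0"] by linarith
   hence "bumpX dv (fst p - x0)*H (nr p) <= 0" using bumpX_bound(1)[of dv "fst p - x0"] by (auto intro: mult_nonneg_nonpos)
   hence "A0*(bumpX dv (fst p - x0)*H (nr p)) <= 0" using A0(1) by (simp add: mult_nonneg_nonpos)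
   thus ?thesis using nonneg(2)[OF adm S t1 p] by (simp add: mult.assoc)
   qed
   qed
   have A: "1 - 2*e1 <= A" "A <= 1"
   proof -
   have ee: "1/e1 > 0" using e1 by simp
   have "exp (- (a'*(t - t1))) <= 1/(a'*(t - t1))" using y ee by (intro exp_neg_le) linarith
   also have "\<dots> <= 1/(1/e1)"
   proof (rule divide_left_mono)
   have "0 < a'*(t - t1)" using y ee by linarith
   thus "0 < a'*(t - t1)*(1/e1)" using ee by (rule mult_pos_pos)
   qed (use y in auto)
   finally have "exp (- (a*A0/ka)*(t - t1)) <= e1" by (simp add: a'_def)
   hence "(ka - A0)*exp (- (a*A0/ka)*(t - t1)) <= 1*e1" using A0 ka by (intro mult_mono) auto
   thus "1 - 2*e1 <= A" by (simp add: A_def ka_def)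
   have "(ka - A0)*exp (- (a*A0/ka)*(t - t1)) >= 0" using A0 by simp
   thus "A <= 1" using ka by (simp add: A_def)
   qed
   have A': "A >= 0" using A(1) e1 by linarith
   show "U (nr p) - e <= u p t" if p: "p:OC" and x: "fst p = x0"
   proof -
   have r: "nr p:{0..R}" using p by (simp add: OmegaC_def)
   have "A*F (nr p) <= u p t" using main p x by (simp add: bumpX_0)
   moreover have "A*U (nr p) <= A*F (nr p)" using FU[OF r] A' by (rule mult_left_mono)
   moreover have "(1 - A)*U (nr p) <= (2*e1)*1" using A U01[OF r] e1 by (intro mult_mono) auto
   ultimately show ?thesis using e1 e unfolding left_diff_distrib by linarith
   qed
   show "bpsi N (U R)*psi N gam (nr p) - e <= v p t" if p: "p:EC" and x: "fst p = x0 & nr p <= r3"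
   proof -
   have r: "nr p:{R..r3}" "R <= nr p" using p x by (auto simp: ExtC_def)
   have "A*H (nr p) <= v p t" using main p x by (simp add: bumpX_0)
   moreover have "A*(V (nr p) - e/2) <= A*H (nr p)"

   proof (rule mult_left_mono[OF _ A'])
   show "V (nr p) - e/2 <= H (nr p)" using HV[OF r(1)] unfolding abs_le_iff by linarith
   qed
   moreover have "(1 - A)*V (nr p) <= (2*e1)*V R" using A Vp[OF r(2)] e1 by (intro mult_mono) auto
   moreover have "A*(e/2) <= 1*(e/2)" using A e by (intro mult_right_mono) auto
   ultimately show ?thesis using e1(4) unfolding V_def left_diff_distrib right_diff_distrib by linarith
   qed
  qed
 qed
qed

lemma pos_level:
 fixes u v :: "'m::finite pt => real => real"
 assumes adm: "admissible_data R u0 v0" and S: "sol u0 v0 u v" and t: "t > 0" and b: "b >= 0" "R3 >= R"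
 shows "EX m>0. (ALL p:OC. \<bar>fst p\<bar> <= b --> m <= u p t) & (ALL p:EC. \<bar>fst p\<bar> <= b & nr p <= R3 --> m <= v p t)"
proof -
 let ?A = "{-b..b} \<times> cball (0::real^'m) R" and ?B = "({-b..b} \<times> cball (0::real^'m) R3) \<inter> EC"
 have c: "compact ?A" "compact ?B" by (auto intro!: compact_Times compact_Int_closed closed_ExtC)
 have A: "?A \<subseteq> OC" "?B \<subseteq> EC" by (auto simp: OmegaC_def)
 have "(0, 0):?A" using b pos by simp
 hence neA: "?A ~= {}" by blast
 obtain e :: "real^'m" where e: "norm e = R" using vector_choose_size[of R] pos by auto
 hence "(0, e):?B" using b by (simp add: ExtC_def)
 hence neB: "?B ~= {}" by blast
 have cu: "con ?A (%p. u p t)" "con ?B (%p. v p t)" using sol_cont_at[OF S, of t] t A by (auto intro: continuous_on_subset)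
 obtain m1 where m1: "m1 > 0" "!!p. p:?A ==> m1 <= u p t" by (rule inf_pos[OF c(1) neA cu(1)]) (use strong_positivity(1)[OF adm S t] A in blast)+
 obtain m2 where m2: "m2 > 0" "!!p. p:?B ==> m2 <= v p t" by (rule inf_pos[OF c(2) neB cu(2)]) (use strong_positivity(2)[OF adm S t] A in blast)+
 show ?thesis
 proof (intro exI[of _ "min m1 m2"] conjI ballI impI)
  show "min m1 m2 > 0" using m1 m2 by simp
  fix p :: "'m pt"
  { assume "p:OC" "\<bar>fst p\<bar> <= b"
   hence "p:?A" by (cases p) (auto simp: OmegaC_def abs_le_iff)
   thus "min m1 m2 <= u p t" using m1(2) by (meson min.coboundedI1) }
  assume "p:EC" "\<bar>fst p\<bar> <= b & nr p <= R3"
  hence "p:?B" by (cases p) (auto simp: abs_le_iff)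
  thus "min m1 m2 <= v p t" using m2(2) by (meson min.coboundedI2)
 qed
qed

end

section \<open>Exponential modes of the linearised problem and their admissible parameters\<close>

context field_road begin

text \<open>Value and slope at \<open>R\<close> that the flux conditions force on the exterior part
  when the interior part is \<open>phi N z\<close>. \<open>KV\<close> continues these data by the
  exterior equation with parameter \<open>m\<close>; its factor \<open>R^N\<close> undoes the slope
  1/R^N of the second basis solution.\<close>

definition sv :: "nat => 'z::{real_normed_field,banach} => 'z" where
 "sv N z = (of_real D*phi' N z R + of_real mq*phi N z R)/of_real nq"
definition sd :: "nat => 'z::{real_normed_field,banach} => 'z" where
 "sd N z = of_real D*phi' N z R/of_real d"
definition KV :: "nat => 'z::{real_normed_field,banach} => 'z => real => 'z" where
 "KV N z m r = sv N z * vx R N True m r + (sd N z * of_real (R^N)) * vx R N False m r"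
definition KV' :: "nat => 'z::{real_normed_field,banach} => 'z => real => 'z" where
 "KV' N z m r = sv N z * vx' R N True m r + (sd N z * of_real (R^N)) * vx' R N False m r"

lemma KV_R: "KV N z m R = sv N z" "KV' N z m R = sd N z" using pos by (simp_all add: KV_def KV'_def vx_R flip: of_real_mult)

lemma KV_deriv:
 assumes l: "bounded_linear l" and r: "r > R"
 shows "((%r. l (KV N z m r)) HD l (KV' N z m r)) (at r)"
  "((%r. r^N*l (KV' N z m r)) HD r^N*l (m*KV N z m r)) (at r)"
proof -
 have b: "bounded_linear (%w. l (k*w))" for k by (rule bounded_linear_compose[OF l bounded_linear_mult_right])
 note a = linear_add[OF bounded_linear.linear[OF l]]
 show "((%r. l (KV N z m r)) HD l (KV' N z m r)) (at r)" unfolding KV_def KV'_def a by (intro DERIV_add vx_deriv(1)[OF pos(3) b r])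
 have "r^N*l (m*KV N z m r) = r^N*l (sv N z*(m * vx R N True m r)) + r^N*l ((sd N z * of_real (R^N))*(m * vx R N False m r))" unfolding distrib_left[symmetric] a[symmetric] by (simp add: KV_def distrib_left mult.left_commute)
 thus "((%r. r^N*l (KV' N z m r)) HD r^N*l (m*KV N z m r)) (at r)" unfolding KV'_def a distrib_left by (simp only:) (intro DERIV_add vx_deriv(2)[OF pos(3) b r])
qed

lemma KV_deriv_R:
 assumes l: "bounded_linear l"
 shows "((%r. l (KV N z m r)) HD l (sd N z)) (at_right R)"
proof -
 have b: "bounded_linear (%w. l (k*w))" for k by (rule bounded_linear_compose[OF l bounded_linear_mult_right])
 note a = linear_add[OF bounded_linear.linear[OF l]]
 have "((%r. l (KV N z m r)) HD l (KV' N z m R)) (at_right R)" unfolding KV_def KV'_def a by (intro DERIV_add vx_deriv_R[OF pos(3) b])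
 thus ?thesis by (simp add: KV_R)
qed

lemma phi_cont_gen:
 fixes f :: "'x::topological_space => 'z::{real_normed_field,banach}"
 assumes "compact X" "con X f" "con X h" "!!x. x:X ==> 0 <= h x"
 shows "con X (%x. phi N (f x) (h x))" "con X (%x. phi' N (f x) (h x))"
proof -
 obtain Z where Z: "!!x. x:X ==> norm (f x) <= Z" using compact_imp_bounded[OF compact_continuous_image[OF assms(2,1)]] unfolding bounded_iff by blast
 obtain b where b: "!!x. x:X ==> norm (h x) <= b" using compact_imp_bounded[OF compact_continuous_image[OF assms(3,1)]] unfolding bounded_iff by blast
 have h: "(f x, h x):cball 0 Z \<times> {0..max b 1}" if "x:X" for x using Z[OF that] b[OF that] assms(4)[OF that] by auto
 have i: "(%x. (f x, h x)) ` X \<subseteq> cball 0 Z \<times> {0..max b 1}" using h by blast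
 have c: "con X (%x. (f x, h x))" by (intro continuous_on_Pair assms)
 have m: "max b 1 > 0" by simp
 show "con X (%x. phi N (f x) (h x))" "con X (%x. phi' N (f x) (h x))" using continuous_on_compose2[OF phi_cont[OF m] c i] continuous_on_compose2[OF phi'_cont[OF m] c i] by simp_all
qed

lemma KV_cont_gen:
 fixes f k :: "'x::topological_space => 'z::{real_normed_field,banach}"
 assumes "compact X" "con X f" "con X k" "con X h" "!!x. x:X ==> R <= h x"
 shows "con X (%x. KV N (f x) (k x) (h x))" "con X (%x. KV' N (f x) (k x) (h x))"
proof -
 obtain Z where Z: "!!x. x:X ==> norm (k x) <= Z" using compact_imp_bounded[OF compact_continuous_image[OF assms(3,1)]] unfolding bounded_iff by blast
 obtain b where b: "!!x. x:X ==> norm (h x) <= b" using compact_imp_bounded[OF compact_continuous_image[OF assms(4,1)]] unfolding bounded_iff by blast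
 have h: "(k x, h x):cball 0 Z \<times> {R..max b (R + 1)}" if "x:X" for x using Z[OF that] b[OF that] assms(5)[OF that] by auto
 have i: "(%x. (k x, h x)) ` X \<subseteq> cball 0 Z \<times> {R..max b (R + 1)}" using h by blast
 have c: "con X (%x. (k x, h x))" by (intro continuous_on_Pair assms)
 have m: "max b (R + 1) > R" by simp
 have v: "con X (%x. vx R N i (k x) (h x))" "con X (%x. vx' R N i (k x) (h x))" for i using continuous_on_compose2[OF vx_cont(1)[OF pos(3) m] c i] continuous_on_compose2[OF vx_cont(2)[OF pos(3) m] c i] by simp_all
 have p: "con X (%x. phi N (f x) R)" "con X (%x. phi' N (f x) R)" using phi_cont_gen[OF assms(1,2) continuous_on_const, of R] pos by simp_all
 show "con X (%x. KV N (f x) (k x) (h x))" "con X (%x. KV' N (f x) (k x) (h x))" unfolding KV_def KV'_def sv_def sd_def using pos by (intro ci v p; simp)+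
qed

lemma KV_cont_r: "con {R..b} (KV N z m)" "con {R..b} (KV' N z m)" using KV_cont_gen[OF compact_Icc continuous_on_const continuous_on_const continuous_on_id, of R b N z m] by simp_all

text \<open>Joint continuity of \<open>phi\<close> and \<open>KV\<close> has been obtained on
  compact parameter sets; a convergent sequence together with its limit is one.\<close>

lemma isCont_compactD:
 fixes f :: "'x::heine_borel => 'y::metric_space"
 assumes "X \<longlonglongrightarrow> x" "!!K. compact K ==> con K f"
 shows "(%k. f (X k)) \<longlonglongrightarrow> f x"
proof -
 let ?K = "insert x (range X)"
 have "con ?K f" by (rule assms(2)[OF compact_sequence_with_limit[OF assms(1)]])
 thus ?thesis by (rule continuous_on_tendsto_compose[OF _ assms(1)]) auto
qed

text \<open>Weak inequalities make the condition closed under limits of the parameters; strictness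
  is recovered in \<open>apair_phi\<close> and \<open>apair_V\<close>.\<close>

definition apair :: "nat => real => real => real => bool" where
 "apair N R2 z m \<longleftrightarrow> (ALL r:{0..R}. phi N z r >= 0) & (ALL r:{R..R2}. KV N z m r >= 0)"

lemma apair_lim:
 assumes X: "X \<longlonglongrightarrow> z" and Y: "Y \<longlonglongrightarrow> m" and a: "\<forall>\<^sub>F k in sequentially. apair N R2 (X k) (Y k)"
 shows "apair N R2 z m"
proof -
 have XY: "(%k. (X k, Y k)) \<longlonglongrightarrow> (z, m)" by (intro tendsto_Pair X Y)
 have "phi N z r >= 0" if r: "r:{0..R}" for r
 proof (rule tendsto_lowerbound)
  show "(%k. phi N (X k) r) \<longlonglongrightarrow> phi N z r" by (rule isCont_compactD[OF X]) (use r in \<open>auto intro!: phi_cont_gen continuous_on_id continuous_on_const\<close>)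
  show "\<forall>\<^sub>F k in sequentially. 0 <= phi N (X k) r" using a by eventually_elim (use r in \<open>auto simp: apair_def\<close>)
 qed simp
 moreover have "KV N z m r >= 0" if r: "r:{R..R2}" for r
 proof (rule tendsto_lowerbound)
  have "(%k. (%p. KV N (fst p) (snd p) r) (X k, Y k)) \<longlonglongrightarrow> (%p. KV N (fst p) (snd p) r) (z, m)"
   by (rule isCont_compactD[OF XY]) (use r in \<open>auto intro!: KV_cont_gen continuous_on_fst continuous_on_snd continuous_on_id continuous_on_const\<close>)
  thus "(%k. KV N (X k) (Y k) r) \<longlonglongrightarrow> KV N z m r" by simp
  show "\<forall>\<^sub>F k in sequentially. 0 <= KV N (X k) (Y k) r" using a by eventually_elim (use r in \<open>auto simp: apair_def\<close>)
 qed simp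
 ultimately show ?thesis by (auto simp: apair_def)
qed

text \<open>\<open>KV \<ge> 0\<close> at \<open>R\<close> says
  \<open>D * phi' + mq * phi \<ge> 0\<close>. For negative \<open>z\<close> this keeps
  \<open>phi\<close> positive up to \<open>R\<close> and, through \<open>ph_lam_bound\<close>,
  bounds \<open>z\<close> from below.\<close>

lemma apair_phi:
 assumes a: "apair N R2 z m" and R2: "R2 >= R"
 shows "r:{0..R} ==> phi N z r > 0" "z >= - (real (N + 1)*mq/(D * R))"
proof -
 have s: "D*phi' N z R + mq*phi N z R >= 0"
 proof -
  have "KV N z m R >= 0" using a R2 by (simp add: apair_def)
  thus ?thesis using pos by (simp add: KV_R sv_def zero_le_divide_iff)
 qed
 have p: "ph N (- z) s >= 0" if "0 <= s" "s <= R" for s using a that by (auto simp: apair_def ph_def)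
 have *: "(r:{0..R} --> phi N z r > 0) & z >= - (real (N + 1)*mq/(D * R))"
 proof (cases "z >= 0")
  case True
  have "phi N z r > 0" if "r:{0..R}" using phi_ge(1)[of r z N] that True by simp
  moreover have "0 <= real (N + 1)*mq/(D * R)" using pos by simp
  ultimately show ?thesis using True by linarith
 next
  case False
  hence l: "- z > 0" by simp
  have n: "phi' N z R < 0" using ph'_neg[OF l p pos(3) order_refl] by (simp add: ph'_def)
  have "mq*phi N z R > 0" using s mult_pos_neg[OF pos(1) n] by linarith
  hence pR: "phi N z R > 0" using pos by (simp add: zero_less_mult_iff)
  have 1: "phi N z r > 0" if "r:{0..R}"
  proof (cases "r = R")
   case False
   hence "ph N (- z) R < ph N (- z) r" using that by (intro ph_decr[OF l p]) auto
   thus ?thesis using pR by (simp add: ph_def)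
  qed (use pR in simp)
  have "phi' N z R <= z * R*phi N z R/real (N + 1)" using ph_lam_bound[OF l p pos(3)] by (simp add: ph_def ph'_def)
  from mult_left_mono[OF this, of D] have "D*phi' N z R <= D*(z * R*phi N z R/real (N + 1))" using pos by linarith
  hence "0 <= (D*(z * R)/real (N + 1) + mq)*phi N z R" using s by (simp add: asi)
  hence "0 <= D*(z * R)/real (N + 1) + mq" using pR by (simp add: zero_le_mult_iff)
  hence "- (real (N + 1)*mq) <= z*(D * R)" by (simp add: field_simps)
  hence "- (real (N + 1)*mq)/(D * R) <= z" using pos by (subst pos_divide_le_eq) auto
  thus ?thesis using 1 by simp
 qed
 show "r:{0..R} ==> phi N z r > 0" "z >= - (real (N + 1)*mq/(D * R))" using * by auto
qed

text \<open>Uniqueness for the initial value problem: the Wronskian of the two basis solutions,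
  weighted by \<open>r^N\<close>, is constantly 1.\<close>

lemma KV_det:
 fixes m :: real
 assumes r: "r >= R" and 0: "KV N z m r = 0" "KV' N z m r = 0"
 shows "sv N z = 0"
proof (cases "r = R")
 case True thus ?thesis using 0 by (simp add: KV_R)
next
 case False
 hence Rr: "R < r" using r by simp
 let ?T = "vx R N True m" and ?F = "vx R N False m" and ?T' = "vx' R N True m" and ?F' = "vx' R N False m"
 have d: "((%s. s^N*(?F' s*?T s - ?F s*?T' s)) HD 0) (at s within {R..r})" if "s:{R..r}" for s
  using wronskian_deriv[OF vx_deriv_within[OF pos(3) bounded_linear_ident that Rr, of N False m] vx_deriv_within[OF pos(3) bounded_linear_ident that Rr, of N True m]] by simp
 have "r^N*(?F' r*?T r - ?F r*?T' r) = R^N*(?F' R*?T R - ?F R*?T' R)" by (rule has_field_derivative_zero_constant[OF convex_real_interval(5) d, THEN exE]) (use Rr in auto)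
 also have "\<dots> = 1" using pos by (simp add: vx_R)
 finally have n: "?F' r*?T r - ?F r*?T' r ~= 0" by auto
 have "sv N z*(?F' r*?T r - ?F r*?T' r) = ?F' r*KV N z m r - ?F r*KV' N z m r" by (simp add: KV_def KV'_def asi)
 thus ?thesis using n 0 by simp
qed

text \<open>Inside the interval a zero of the nonnegative \<open>KV\<close> would be a double zero,
  against \<open>KV_det\<close>. A zero at \<open>R\<close> would make the slope \<open>sd\<close>
  negative and push \<open>KV\<close> below 0.\<close>

lemma apair_V:
 assumes a: "apair N R2 z m" and R2: "R2 > R"
 shows "sv N z > 0" "r:{R..<R2} ==> KV N z m r > 0"
proof -
 have nn: "KV N z m r >= 0" if "r:{R..R2}" for r using a that by (simp add: apair_def)
 have pR: "phi N z R > 0" using apair_phi(1)[OF a, of R] R2 pos by simp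
 show s: "sv N z > 0"
 proof (rule ccontr)
  assume "~ ?thesis"
  hence s0: "sv N z = 0" using nn[of R] R2 by (simp add: KV_R)
  hence "D*phi' N z R + mq*phi N z R = 0" using pos by (simp add: sv_def)
  hence "D*phi' N z R < 0" using mult_pos_pos[OF pos(4) pR] by linarith
  hence sd: "sd N z < 0" using pos by (simp add: sd_def divide_neg_pos)
  have "((%r. - KV N z m r) HD - sd N z) (at_right R)" by (intro DERIV_minus KV_deriv_R[OF bounded_linear_ident])
  moreover have "\<forall>\<^sub>F r in at_right R. - KV N z m r <= - KV N z m R"
  proof -
   have "\<forall>\<^sub>F r in at_right R. r > R & r < R2" using R2 by (auto simp: eventually_at_right[OF R2])
   thus ?thesis by eventually_elim (use nn s0 in \<open>auto simp: KV_R\<close>)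
  qed
  ultimately have "- sd N z <= 0" by (rule right_max_deriv_nonpos)
  thus False using sd by simp
 qed
 show "KV N z m r > 0" if r: "r:{R..<R2}"
 proof (rule ccontr)
  assume "~ ?thesis"
  hence r0: "KV N z m r = 0" using nn[of r] r by auto
  hence "r ~= R" using s by (auto simp: KV_R)
  hence rR: "R < r" "r < R2" using r by auto
  have "KV' N z m r = 0"
  proof (rule DERIV_local_min[OF KV_deriv(1)[OF bounded_linear_ident rR(1)]])
   show "0 < min (r - R) (R2 - r)" using rR by simp
   show "ALL y. \<bar>r - y\<bar> < min (r - R) (R2 - r) --> KV N z m r <= KV N z m y" using r0 nn by (auto simp: abs_less_iff)
  qed
  thus False using KV_det[OF _ r0] rR s by simp
 qed
qed

lemma KV'_deriv_at:
 fixes m :: real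
 assumes r: "r > R"
 shows "(KV' N z m HD m*KV N z m r - real N/r*KV' N z m r) (at r)"
proof -
 have r0: "r > 0" using r pos by simp
 have "((%r. (r^N*KV' N z m r)*inverse (r^N)) HD
  (r^N*(m*KV N z m r))*inverse (r^N) + (- (inverse (r^N)*(real N*r^(N - Suc 0))*inverse (r^N)))*(r^N*KV' N z m r)) (at r)" using r0 by (intro DERIV_mult KV_deriv(2)[OF bounded_linear_ident r] DERIV_inverse'[OF DERIV_pow]) auto
 moreover have "(r^N*(m*KV N z m r))*inverse (r^N) + (- (inverse (r^N)*(real N*r^(N - Suc 0))*inverse (r^N)))*(r^N*KV' N z m r)
  = m*KV N z m r - real N/r*KV' N z m r" using r0 by (cases N) (auto simp: field_simps)
 ultimately have *: "((%r. (r^N*KV' N z m r)*inverse (r^N)) HD m*KV N z m r - real N/r*KV' N z m r) (at r)" by simp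
 have "\<forall>\<^sub>F s in nhds r. (s^N*KV' N z m s)*inverse (s^N) = KV' N z m s" using eventually_nhds_in_open[OF open_greaterThan, of r 0] r0 by (auto elim!: eventually_mono)
 from DERIV_cong_ev[OF refl this refl] * show ?thesis by simp
qed

text \<open>For \<open>m = - k^2\<close> the quantity p = - V'/V satisfies the Riccati equation p' =
  k^2 - (N/r) p + p^2. Once \<open>N / r \<le> k\<close>, the arctangent of \<open>p / k\<close>
  grows at rate at least \<open>k/2\<close>, so over a length \<open>2 * pi / k\<close> it would
  leave its range.\<close>

lemma no_oscillation:
 fixes m :: real
 assumes V: "!!r. r >= R ==> KV N z m r > 0"
 shows "m >= 0"
proof (rule ccontr)
 assume "~ ?thesis"
 define k where "k = sqrt (- m)"
 have k: "k > 0" "k^2 = - m" using \<open>~ m >= 0\<close> by (auto simp: k_def)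
 define p where "p = (%r. - KV' N z m r/KV N z m r)"
 define a where "a = max (R + 1) (real N/k)"
 have dp: "(p HD k\<^sup>2 - real N/r*p r + (p r)^2) (at r)" if "r > R" for r
 proof -
  have v: "KV N z m r ~= 0" using V[of r] that by simp
  have "(p HD ((- (m*KV N z m r - real N/r*KV' N z m r))*KV N z m r - (- KV' N z m r)*KV' N z m r)/(KV N z m r*KV N z m r)) (at r)" unfolding p_def by (intro DERIV_divide DERIV_minus KV'_deriv_at KV_deriv(1)[OF bounded_linear_ident] that v)
  moreover have "((- (m*KV N z m r - real N/r*KV' N z m r))*KV N z m r - (- KV' N z m r)*KV' N z m r)/(KV N z m r*KV N z m r)
   = k^2 - real N/r*p r + (p r)^2" unfolding k(2) p_def using v by (simp add: field_simps power2_eq_square)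
  ultimately show ?thesis by simp
 qed
 define q where "q = (%r. arctan (p r/k) - k/2*r)"
 have dq: "EX y. (q HD y) (at r) & y >= 0" if r: "a <= r" for r
 proof -
  have rR: "r > R" "r > 0" "real N/k <= r" using r pos by (auto simp: a_def)
  hence Nr: "real N/r <= k" using k(1) by (simp add: field_simps)
  let ?p' = "k^2 - real N/r*p r + (p r)^2"
  have "real N/r*p r <= (k^2 + (p r)^2)/2"
  proof -
   have "real N/r*p r <= real N/r*\<bar>p r\<bar>" using rR by (intro mult_left_mono) auto
   also have "\<dots> <= k*\<bar>p r\<bar>" using Nr by (intro mult_right_mono) auto
   also have "\<dots> <= (k^2 + \<bar>p r\<bar>\<^sup>2)/2" using sum_squares_bound[of k "\<bar>p r\<bar>"] by simp
   finally show ?thesis by simp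
  qed
  hence p': "?p' >= (k^2 + (p r)^2)/2" by (simp add: field_simps)
  have "(q HD inverse (1 + (p r/k)^2)*(?p'/k) - k/2) (at r)" unfolding q_def by (rule dei dp[OF rR(1)] refl | use k in simp)+
  moreover have "inverse (1 + (p r/k)^2)*(?p'/k) - k/2 >= 0"
  proof -
   have s: "k^2 + (p r)^2 > 0" using add_pos_nonneg[OF zero_less_power[OF k(1), of 2] zero_le_power2[of "p r"]] .
   have "inverse (1 + (p r/k)^2)*(P/k) = k*P/(k^2 + (p r)^2)" for P
   proof -
   have "1 + (p r/k)^2 = (k^2 + (p r)^2)/k^2" using k(1) by (simp add: power_divide add_divide_distrib)
   thus ?thesis using k(1) by (simp add: power2_eq_square)
   qed
   hence "inverse (1 + (p r/k)^2)*(?p'/k) = k*?p'/(k^2 + (p r)^2)" .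
   also have "\<dots> >= k*((k^2 + (p r)^2)/2)/(k^2 + (p r)^2)" using p' k(1) s by (intro divide_right_mono mult_left_mono) auto
   also have "k*((k^2 + (p r)^2)/2)/(k^2 + (p r)^2) = k/2"
   proof -
   have "k*(S/2)/S = k/2" if "S > 0" for S :: real using that by simp
   from this[OF s] show ?thesis .
   qed
   finally show ?thesis by simp
  qed
  ultimately show ?thesis by blast
 qed
 let ?b = "a + 2*pi/k"
 have ab: "a <= ?b" using k by simp
 have "q a <= q ?b" by (rule DERIV_nonneg_imp_nondecreasing[OF ab]) (use dq in blast)
 moreover have "k/2*?b = k/2*a + pi" using k(1) by (simp add: distrib_left)
 ultimately have "arctan (p ?b/k) - arctan (p a/k) >= pi" unfolding q_def by linarith
 moreover have "arctan (p ?b/k) < pi/2" "- (pi/2) < arctan (p a/k)" by (rule arctan_ubound, rule arctan_lbound)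
 ultimately show False by linarith
qed

text \<open>A solution that stays nonnegative up to infinity cannot descend more steeply at
  \<open>R\<close> than the decaying \<open>psi\<close>. Otherwise the weighted Wronskian stays
  below \<open>- dv\<close>, and as \<open>r^N\<close> times the square of \<open>psi\<close> tends
  to 0, the quotient of the two functions eventually decreases at least linearly and turns
  negative.\<close>

lemma barrier:
 fixes m :: real
 assumes g: "ga > 0" "m <= ga^2" and V: "!!r. r >= R ==> KV N z m r >= 0"
 shows "sd N z*psi N ga R - sv N z*psi' N ga R >= 0"
proof (rule ccontr)
 let ?V = "KV N z m" and ?V' = "KV' N z m" and ?p = "psi N ga" and ?p' = "psi' N ga"
 assume n: "~ ?thesis"
 define W where "W = (%r. r^N*(?V' r*?p r - ?V r*?p' r))"
 define dv where "dv = - W R"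
 have dv: "dv > 0" using n pos by (simp add: dv_def W_def KV_R mult_pos_neg)
 have pp: "?p r > 0" if "r >= R" for r using psi_pos[OF g(1)] that pos by simp
 have Wr: "W r <= - dv" if r: "r >= R" for r
 proof (cases "r = R")
  case False
  hence Rr: "R < r" using r by simp
  have "W r <= W R"
  proof (rule DERIV_nonpos_imp_decreasing_open[of R r W])
   show "R <= r" by fact
   fix x assume x: "R < x" "x < r"
   have x0: "x > 0" using x pos by simp
   have "(W HD x^N*((m*?V x)*?p x - ?V x*(ga^2*?p x))) (at x)" unfolding W_def by (intro wronskian_deriv KV_deriv[OF bounded_linear_ident x(1)] psi_deriv[OF g(1) x0] psi'_deriv[OF g(1) x0])
   moreover have "x^N*((m*?V x)*?p x - ?V x*(ga^2*?p x)) = - (x^N*((ga^2 - m)*(?V x*?p x)))" by (simp add: asi)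
   moreover have "0 <= x^N*((ga^2 - m)*(?V x*?p x))" using x x0 g V[of x] pp[of x] by simp
   ultimately show "EX y. (W HD y) (at x) & y <= 0" by auto
  next
   have c: "con {R..r} ?p" "con {R..r} ?p'"
   proof -
   have i: "con {R..r} (%s. (ga, s))" "(%s. (ga, s)) ` {R..r} \<subseteq> {0<..} \<times> {0<..}" using g pos by (auto intro!: ci)
   show "con {R..r} ?p" "con {R..r} ?p'" using continuous_on_compose2[OF psi_joint_cont(1) i] continuous_on_compose2[OF psi_joint_cont(2) i] by simp_all
   qed
   show "con {R..r} W" unfolding W_def by (intro ci KV_cont_r c)
  qed
  thus ?thesis by (simp add: dv_def)
 qed (simp add: dv_def)
 obtain C a where C: "C > 0" "a > 0" "ALL r>=R. ?p r <= C*exp (- a*r)" using psi_decay[OF g(1) pos(3)] by blast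
 have "((%r. r^N*(C*exp (- a*r))^2) \<longlongrightarrow> 0) at_top" using C by real_asymp
 from order_tendstoD(2)[OF this zero_less_one] obtain b0 where b0: "!!r. r >= b0 ==> r^N*(C*exp (- a*r))^2 < 1" by (auto simp: eventually_at_top_linorder)
 define b where "b = max b0 (R + 1)"
 have b: "b > R" "b >= b0" by (auto simp: b_def)
 define F where "F = (%r. ?V r/?p r + dv*r)"
 \<comment> \<open>Far enough for a decrease at rate \<open>dv\<close> to exceed the value of the
   quotient at \<open>b\<close> by 1.\<close>
 define c where "c = b + (?V b/?p b + 1)/dv"
 have Vb: "?V b/?p b >= 0" using V[of b] pp[of b] b by simp
 hence bc: "b <= c" using dv by (simp add: c_def)
 have "F c <= F b"
 proof (rule DERIV_nonpos_imp_nonincreasing[OF bc])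
  fix x assume x: "b <= x" "x <= c"
  have xR: "x > R" "x > 0" using x b pos by auto
  have px: "?p x > 0" using pp xR by simp
  have "(F HD (?V' x*?p x - ?V x*?p' x)/(?p x*?p x) + dv*1) (at x)" unfolding F_def using px by (intro DERIV_add DERIV_divide DERIV_cmult DERIV_ident KV_deriv(1)[OF bounded_linear_ident xR(1)] psi_deriv[OF g(1) xR(2)]) simp
  moreover have "(?V' x*?p x - ?V x*?p' x)/(?p x*?p x) <= - dv"
  proof -
   have "x^N*(?p x)^2 <= x^N*(C*exp (- a*x))^2" using C(3) xR px by (intro mult_left_mono power_mono) auto
   also have "\<dots> <= 1" using b0[of x] x b by simp
   finally have "dv*(x^N*(?p x)^2) <= dv*1" using dv by (intro mult_left_mono) auto
   moreover have "x^N*(?V' x*?p x - ?V x*?p' x) <= - dv" using Wr[of x] xR by (simp add: W_def)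
   ultimately have "x^N*(?V' x*?p x - ?V x*?p' x) <= x^N*(- (dv*(?p x)^2))" by (simp add: mult_ac)
   hence "?V' x*?p x - ?V x*?p' x <= - (dv*(?p x)^2)" using zero_less_power[OF xR(2), of N] by (simp only: mult_le_cancel_left_pos)
   hence "?V' x*?p x - ?V x*?p' x <= - dv*(?p x*?p x)" by (simp add: power2_eq_square)
   thus ?thesis using px by (simp add: pos_divide_le_eq)
  qed
  ultimately show "EX y. (F HD y) (at x) & y <= 0" by (intro exI conjI) auto
 qed
 moreover have "dv*c = dv*b + ?V b/?p b + 1"
 proof -
  have "dv*(x/dv) = x" for x using dv by simp
  thus ?thesis unfolding c_def distrib_left by simp
 qed
 ultimately have "?V c/?p c < 0" by (simp add: F_def)
 moreover have "?V c/?p c >= 0" using V[of c] pp[of c] bc b by simp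
 ultimately show False by simp
qed

text \<open>Inserting exp(-a (x - c t)) times a radial function into the linear equations with
  reaction slope \<open>G\<close> leaves radial equations with these parameters: the balances are c
  a = D (a^2 + z) + G inside and c a = d (a^2 + m) - ro outside.\<close>

definition zc :: "real => real => 'z::{real_normed_field,banach} => 'z" where
 "zc G c a = (of_real c*a - of_real G)/of_real D - a^2"
definition mc :: "real => 'z::{real_normed_field,banach} => 'z" where
 "mc c a = (of_real c*a + of_real ro)/of_real d - a^2"

text \<open>\<open>R2\<close> is the radius up to which the exterior part is controlled;
  admissibility for every \<open>R2\<close> is a nonnegative mode on the whole exterior.\<close>

definition admc :: "nat => real => real => real => real => bool" where
 "admc N R2 G c a \<longleftrightarrow> apair N R2 (zc G c a) (mc c a)"

lemma admc_mono: "admc N R2 G c a ==> R1 <= R2 ==> admc N R1 G c a" by (auto simp: admc_def apair_def)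

text \<open>For large exponents the term \<open>- a^2\<close> would push \<open>zc\<close> below the
  lower bound of \<open>apair_phi\<close>.\<close>

lemma alpha_bound:
 assumes a: "admc N R2 G c a" "R2 >= R" "0 <= c" "c <= C" "0 <= a" "G >= 0"
 shows "a <= C/D + real (N + 1)*mq/(D * R) + 1"
proof (rule ccontr)
 let ?B = "real (N + 1)*mq/(D * R)"
 assume n: "~ ?thesis"
 have B: "?B >= 0" "C/D >= 0" using pos a by auto
 have a1: "a >= 1" using n B by linarith
 have "- ?B <= (c*a - G)/D - a^2" using apair_phi(2)[OF a(1)[unfolded admc_def] a(2)] by (simp add: zc_def)
 moreover have "(c*a - G)/D <= C/D*a"
 proof -
  have "c*a <= C*a" using a by (intro mult_right_mono) auto
  hence "(c*a - G)/D <= C*a/D" using a pos by (intro divide_right_mono) auto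
  thus ?thesis by simp
 qed
 ultimately have "a*a <= C/D*a + ?B" by (simp add: power2_eq_square)
 also have "\<dots> <= C/D*a + ?B*a" using B a1 mult_left_mono[of 1 a ?B] by simp
 also have "\<dots> = (C/D + ?B)*a" by (simp add: distrib_right)
 finally have "a <= C/D + ?B" using a1 by simp
 thus False using n by linarith
qed

text \<open>Exponents are bounded by \<open>alpha_bound\<close>, so a subsequence of the parameters
  converges. Each radius in \<open>T\<close> has to be admissible only eventually; this permits
  radii tending to infinity together with slopes \<open>Gs\<close> tending to
  \<open>G\<close>.\<close>

lemma admc_compact:
 assumes a: "!!k. 0 <= cs k & cs k <= C" "!!k. 0 <= as k" "!!k. 0 <= Gs k" "Gs \<longlonglongrightarrow> G"
  and T: "!!R2. R2:T ==> \<forall>\<^sub>F k in sequentially. admc N R2 (Gs k) (cs k) (as k)" and R2: "!!k. admc N R (Gs k) (cs k) (as k)"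
 obtains c a r where "strict_mono r" "(cs \<circ> r) \<longlonglongrightarrow> c" "0 <= c" "c <= C" "0 <= a" "!!R2. R2:T ==> admc N R2 G c a"
proof -
 let ?A = "C/D + real (N + 1)*mq/(D * R) + 1"
 have "compact ({0..C} \<times> {0..?A})" by (intro compact_Times compact_Icc)
 moreover have "(cs k, as k):{0..C} \<times> {0..?A}" for k using a alpha_bound[OF R2[of k] order_refl, of C] by simp
 ultimately obtain l r where l: "l:{0..C} \<times> {0..?A}" "strict_mono r" "((%k. (cs k, as k)) \<circ> r) \<longlonglongrightarrow> l" unfolding compact_def by meson
 have c: "(%k. cs (r k)) \<longlonglongrightarrow> fst l" "(%k. as (r k)) \<longlonglongrightarrow> snd l" using tendsto_fst[OF l(3)] tendsto_snd[OF l(3)] by (simp_all add: o_def)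
 have G: "(%k. Gs (r k)) \<longlonglongrightarrow> G" using LIMSEQ_subseq_LIMSEQ[OF a(4) l(2)] by (simp add: o_def)
 have "admc N R2 G (fst l) (snd l)" if "R2:T" for R2 unfolding admc_def
 proof (rule apair_lim)
  show "(%k. zc (Gs (r k)) (cs (r k)) (as (r k))) \<longlonglongrightarrow> zc G (fst l) (snd l)"
   "(%k. mc (cs (r k)) (as (r k))) \<longlonglongrightarrow> mc (fst l) (snd l)" unfolding zc_def mc_def using pos by (intro tendsto_intros c G; simp)+
  show "\<forall>\<^sub>F k in sequentially. apair N R2 (zc (Gs (r k)) (cs (r k)) (as (r k))) (mc (cs (r k)) (as (r k)))" using eventually_subseq[OF l(2) T[OF that]] by (simp add: admc_def)
 qed
 thus ?thesis using that[of r "fst l" "snd l"] l c by (auto simp: o_def mem_Times_iff)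
qed

text \<open>At exponent 1 this speed makes both spectral parameters nonnegative, and then every term
  of the power series is nonnegative.\<close>

lemma admc_exists:
 assumes G: "G >= 0"
 shows "EX c>=0. ALL R2. admc N R2 G c 1"
proof (intro exI conjI allI)
 let ?c = "G + D + d"
 show "0 <= ?c" using G pos by simp
 fix R2
 have z: "zc G ?c (1::real) >= 0" "mc ?c (1::real) >= 0" using G pos by (auto simp: zc_def mc_def field_simps)
 have p: "phi N (zc G ?c (1::real)) r >= 1" "phi' N (zc G ?c (1::real)) r >= 0" if "r >= 0" for r using phi_ge[OF that z(1)] by auto
 have s: "sv N (zc G ?c (1::real)) >= 0" "sd N (zc G ?c (1::real)) >= 0" using p[of R] pos by (auto simp: sv_def sd_def)
 have "KV N (zc G ?c (1::real)) (mc ?c 1) r >= 0" if "r >= R" for r using s vx_ge(1)[OF pos(3) that z(2)] pos unfolding KV_def by (intro add_nonneg_nonneg mult_nonneg_nonneg) auto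
 thus "admc N R2 G ?c 1" using p by (force simp: admc_def apair_def)
qed

text \<open>At speed 0 the interior parameter lies below \<open>- l\<close>, so by
  \<open>ph_wronskian\<close> the Robin expression with \<open>kappa\<close> is negative at
  \<open>R\<close>. The exterior parameter is at most \<open>gam^2\<close>, and
  \<open>barrier\<close> with rate \<open>gam\<close> says that the same expression is
  nonnegative.\<close>

lemma admc_pos_speed:
 assumes a: "!!R2. admc N R2 G 0 a" and l: "ALL r:{0..R}. ph N l r > 0" "D*ph' N l R + k*ph N l R = 0" and lg: "D*l < G"
  and k: "k = mq*(- d*psi' N gam R)/(nq*psi N gam R + (- d*psi' N gam R))"
 shows False
proof -
 define z where "z = zc G 0 a"
 have z: "- z > l"
 proof -
  have "l < G/D" using lg pos by (simp add: field_simps)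
  moreover have "- z = G/D + a^2" by (simp add: z_def zc_def)
  ultimately show ?thesis using zero_le_power2[of a] by linarith
 qed
 have ap: "apair N R2 z (mc 0 a)" for R2 using a[of R2] by (simp add: admc_def z_def)
 have p: "phi N z r > 0" if "r:{0..R}" for r by (rule apair_phi(1)[OF ap order_refl that])
 have "ph' N (- z) R*ph N l R < ph N (- z) R*ph' N l R" by (rule ph_wronskian) (use p l pos z in \<open>auto simp: ph_def\<close>)
 hence "D*(phi' N z R*ph N l R) < D*(phi N z R*ph' N l R)" using pos by (simp add: ph_def ph'_def)
 also have "\<dots> = phi N z R*(D*ph' N l R)" by simp
 also have "\<dots> = phi N z R*(- (k*ph N l R))" using l(2) by (metis add_eq_0_iff add.commute)
 finally have "(D*phi' N z R)*ph N l R < (- k*phi N z R)*ph N l R" by (simp add: mult_ac)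
 hence s: "D*phi' N z R < - k*phi N z R"
 proof (rule mult_right_less_imp_less)
  show "0 <= ph N l R" using bspec[OF l(1), of R] pos by simp
 qed
 have "mc 0 a <= gam^2"
 proof -
  have "ro/d = gam^2" using gam(2) pos by (simp add: field_simps)
  thus ?thesis by (simp add: mc_def)
 qed
 hence "sd N z*psi N gam R - sv N z*psi' N gam R >= 0"
 proof (rule barrier[OF gam(1)])
  show "KV N z (mc 0 a) r >= 0" if "r >= R" for r using ap[of r] that by (simp add: apair_def)
 qed
 hence "0 <= (d*nq)*(sd N z*psi N gam R - sv N z*psi' N gam R)" using pos by simp
 also have "\<dots> = D*phi' N z R*(nq*psi N gam R + (- d*psi' N gam R)) - mq*phi N z R*(d*psi' N gam R)" using pos by (simp add: sd_def sv_def field_simps)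
 also have "\<dots> < (- k*phi N z R)*(nq*psi N gam R + (- d*psi' N gam R)) - mq*phi N z R*(d*psi' N gam R)" using s bpsi_denom[of N] by (simp only: diff_strict_right_mono mult_strict_right_mono)
 also have "\<dots> = - (k*(nq*psi N gam R + (- d*psi' N gam R)))*phi N z R - mq*phi N z R*(d*psi' N gam R)" by simp
 also have "k*(nq*psi N gam R + (- d*psi' N gam R)) = mq*(- d*psi' N gam R)" unfolding k using bpsi_denom[of N] by (simp only: nonzero_eq_divide_eq[symmetric] less_irrefl)
 finally show False by (simp add: asi)
qed

end

context kpp begin

text \<open>\<open>KV\<close> need not decay, so at the larger speed \<open>c2\<close> a multiple of
  \<open>psi N ga\<close> replaces it. The surplus \<open>(c2 - c1) * a\<close> is put into
  \<open>ga^2\<close>, which keeps the exterior equation exact; \<open>no_oscillation\<close> makes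
  \<open>ga\<close> real, and \<open>barrier\<close> turns the interior flux condition into an
  inequality of the right direction. The sign \<open>si\<close> selects the end of the
  cylinder.\<close>

lemma speed_super:
 fixes u v :: "'m::finite pt => real => real"
 assumes N: "N + 1 = CARD('m)" and a: "!!R2. admc N R2 g0 c1 a" "a > 0" and c: "c1 < c2" and si: "si = 1 | si = - 1"
  and adm: "admissible_data R u0 v0" and cs: "compact_support R u0 v0" and S: "sol u0 v0 u v"
 shows "EX C>0. ALL t>=0. (ALL p:OC. u p t <= C*exp (- a*(si*fst p - c2*t))) &
  (ALL p:EC. v p t <= C*exp (- a*(si*fst p - c2*t)))"
proof -
 define z m where "z = zc g0 c1 a" and "m = mc c1 a"
 have ap: "apair N R2 z m" for R2 using a(1)[of R2] by (simp add: admc_def z_def m_def)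
 have php: "phi N z r > 0" if "r:{0..R}" for r by (rule apair_phi(1)[OF ap order_refl that])
 have KVp: "KV N z m r > 0" if "r >= R" for r by (rule apair_V(2)[OF ap, of "r + 1"]) (use that in auto)
 have m0: "m >= 0" by (rule no_oscillation[OF KVp])
 define ga where "ga = sqrt (m + (c2 - c1)*a/d)"
 have pg: "(c2 - c1)*a/d > 0" using c a pos by simp
 have ga: "ga > 0" "ga^2 = m + (c2 - c1)*a/d" using m0 pg by (auto simp: ga_def)
 have dga: "d*ga^2 = c2*a + ro - d*a^2" unfolding ga(2) m_def mc_def using pos by (simp add: field_simps)
 have bar: "sd N z*psi N ga R - sv N z*psi' N ga R >= 0"
 proof (rule barrier[OF ga(1)])
  show "m <= ga^2" using ga(2) pg by simp
  show "KV N z m r >= 0" if "r >= R" for r using KVp[OF that] by simp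
 qed
 let ?den = "nq*psi N ga R + (- d*psi' N ga R)"
 have den: "?den > 0" by (rule qpsi_denom[OF ga(1)])
 define b where "b = mq*phi N z R/?den"
 have phR: "phi N z R > 0" using php pos by simp
 have b: "b > 0" "b*?den = mq*phi N z R" using den phR pos by (auto simp: b_def)
 have bc2: "- d*(b*psi' N ga R) = mq*phi N z R - nq*(b*psi N ga R)" using b(2) by (simp add: asi)
 have bc1: "D*phi' N z R >= nq*(b*psi N ga R) - mq*phi N z R"
 proof -
  have "0 <= (d*nq)*(sd N z*psi N ga R - sv N z*psi' N ga R)" using bar pos by simp
  also have "\<dots> = D*phi' N z R*?den + (mq*phi N z R)*(- d*psi' N ga R)" using pos by (simp add: sd_def sv_def field_simps)
  also have "\<dots> = (D*phi' N z R + b*(- d*psi' N ga R))*?den" unfolding b(2)[symmetric] by (simp add: asi)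
  finally have "0 <= D*phi' N z R + b*(- d*psi' N ga R)" using den by (simp add: zero_le_mult_iff)
  moreover have "b*(- d*psi' N ga R) = - d*(b*psi' N ga R)" by simp
  ultimately show ?thesis using bc2 by linarith
 qed
 have phc: "con {0..R} (phi N z)" by (rule phi_cont_r[OF pos(3)])
 obtain pm where pm: "pm > 0" "!!r. r:{0..R} ==> pm <= phi N z r" by (rule inf_pos[OF compact_Icc _ phc php]) (use pos in auto)
 obtain r1 where r1: "r1:{0..R}" "ALL r:{0..R}. phi N z r <= phi N z r1" using continuous_attains_sup[OF compact_Icc _ phc] pos by fastforce
 define B where "B = max (phi N z r1) (b*psi N ga R)"
 have psd: "psi N ga r <= psi N ga R" if "r >= R" for r using psi_decr[OF ga(1) pos(3) that] .
 have psp: "psi N ga r > 0" if "r >= R" for r using psi_pos[OF ga(1)] that pos by simp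
 have B: "B > 0" "!!r. r:{0..R} ==> phi N z r <= B" "!!r. r >= R ==> b*psi N ga r <= B"
 proof -
  show "B > 0" using php[OF r1(1)] by (simp add: B_def)
  show "phi N z r <= B" if "r:{0..R}" for r using r1(2) that by (auto simp: B_def max.coboundedI1)
  show "b*psi N ga r <= B" if "r >= R" for r using psd[OF that] b by (simp add: B_def max.coboundedI2)
 qed
 obtain M where M: "M > 0" "!!p s. p:OC ==> s:{0..0} ==> \<bar>u p s\<bar> <= M"
  "!!p s. p:EC ==> s:{0..0} ==> \<bar>v p s\<bar> <= M" using sol_bound[OF S, of 0] by metis
 obtain r0 where r0: "!!p. p:OC ==> norm p >= r0 ==> u0 p = 0" "!!p. p:EC ==> norm p >= r0 ==> v0 p = 0" using cs unfolding compact_support_def by blast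
 \<comment> \<open>The initial data vanish where \<open>norm p \<ge> q\<close>; on the remaining
   region \<open>Lb\<close> bounds both radial factors from below, which determines
   \<open>K\<close>.\<close>
 define q where "q = max r0 R"
 have q: "q >= r0" "q >= R" "q > 0" using pos by (auto simp: q_def)
 define Lb where "Lb = min pm (b*psi N ga q)"
 have Lb: "Lb > 0" using pm psp[OF q(2)] b by (simp add: Lb_def)
 define K where "K = M*exp (a*q)/Lb"
 have K: "K > 0" "K*exp (- a*q)*Lb = M" using M Lb by (auto simp: K_def simp flip: exp_add)
 define e where "e = (%x t. K*exp (- a*(si*x - c2*t)))"
 have e0: "e x t > 0" for x t using K by (simp add: e_def)
 define w where "w = (%(p::'m pt) t. e (fst p) t*phi N z (nr p))"
 define y where "y = (%(p::'m pt) t. e (fst p) t*(b*psi N ga (nr p)))"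
 have et: "(e x HD a*c2*e x t) (at t)" for x t unfolding e_def by (auto intro!: dei)
 have si2: "si * si = 1" using si by auto
 have ex: "has_d2 (%x. e x t) x (a^2*e x t)" for x t by (rule has_d2_I[where h="%x. - a * si*e x t"])
   (auto intro!: dei simp: e_def power2_eq_square si2 mult_ac)
 have lph: "has_lap (%y. phi N z (norm y)) y (z*phi N z (norm y))" for y :: "real^'m" using ph_C2(2)[of N UNIV y "- z"] N by (simp add: ph_def)
 have lps: "has_lap (%y. b*psi N ga (norm y)) y (b*(ga^2*psi N ga (norm y)))" if "norm y > R" for y :: "real^'m" by (intro has_lap_cmult psi_C2(2)[OF _ ga(1) open_outside]) (use N pos that in auto)
 have ec: "con UNIV (%(x,t). e x t)" unfolding e_def case_prod_beta by (intro ci)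
 have init: "p0 <= e x 0*h" if "\<bar>x\<bar> <= q" "p0 <= M" "Lb <= h" for x h p0
 proof -
  have "si*x <= q" using si that by auto
  hence "exp (- a*q) <= exp (- a*(si*x - c2*0))" using a by simp
  hence "K*exp (- a*q) <= e x 0" unfolding e_def using K by (intro mult_left_mono) auto
  hence "K*exp (- a*q)*Lb <= e x 0*h" using that Lb e0[of x 0] K by (intro mult_mono) auto
  thus ?thesis using K that by simp
 qed
 have "(p:OC --> u p t <= w p t) & (p:EC --> v p t <= y p t)" if t: "t >= 0" for p t
 proof (rule super_cmp[OF adm S order_refl, of t w y])
  show "con (OC \<times> {0..t}) (%(p, t). w p t)" unfolding w_def by (rule cont_sep_in[OF ec phc]) simp
  show "con (EC \<times> {0..t}) (%(p, t). y p t)" unfolding y_def by (rule cont_sep_out[OF ec]) (auto intro!: ci psi_cont ga)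
  show "w p s >= 0" if "p:OC" for p s using php[of "nr p"] e0[of "fst p" s] that by (simp add: w_def OmegaC_def)
  show "y p s >= 0" if "p:EC" for p s using psp[of "nr p"] b e0[of "fst p" s] that by (simp add: y_def ExtC_def)
  show "u p 0 <= w p 0" if p: "p:OC" for p
  proof (cases "norm p >= r0")
   case True
   hence "u p 0 = 0" using r0(1)[OF p] S p by (simp add: is_solution_def)
   thus ?thesis using php[of "nr p"] e0[of "fst p" 0] p by (simp add: w_def OmegaC_def)
  next
   case False
   hence "\<bar>fst p\<bar> <= q" using norm_fst_le[of "fst p" "snd p"] q by simp
   moreover have "Lb <= phi N z (nr p)" using pm(2)[of "nr p"] p by (auto simp: Lb_def OmegaC_def)
   ultimately show ?thesis unfolding w_def using init M(2)[OF p, of 0] by (simp add: abs_le_iff)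
  qed
  show "v p 0 <= y p 0" if p: "p:EC" for p
  proof (cases "norm p >= r0")
   case True
   hence "v p 0 = 0" using r0(2)[OF p] S p by (simp add: is_solution_def)
   thus ?thesis using psp[of "nr p"] b e0[of "fst p" 0] p by (simp add: y_def ExtC_def)
  next
   case False
   hence "\<bar>fst p\<bar> <= q" "nr p <= q" using norm_fst_le[of "fst p" "snd p"] norm_snd_le[of "snd p" "fst p"] q by auto
   moreover have "0 < nr p" using p pos by (auto simp: ExtC_def)
   hence "psi N ga q <= psi N ga (nr p)" using psi_decr[OF ga(1)] calculation by blast
   hence "b*psi N ga q <= b*psi N ga (nr p)" using b by simp
   hence "Lb <= b*psi N ga (nr p)" by (simp add: Lb_def min.coboundedI2)
   ultimately show ?thesis unfolding y_def using init M(3)[OF p, of 0] by (simp add: abs_le_iff)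
  qed
 next
  fix p :: "'m pt" and s assume p: "p:OI"
  let ?r = "nr p"
  have r: "?r:{0..R}" using p by (simp add: OmegaI_def)
  have P: "has_par w p s (a*c2*e (fst p) s*phi N z ?r) (a^2*e (fst p) s*phi N z ?r + e (fst p) s*(z*phi N z ?r))" unfolding w_def by (rule has_par_sep[where F="%y. phi N z (norm y)", OF et ex lph])
  have w0: "w p s > 0" using e0[of "fst p" s] php[OF r] by (simp add: w_def)
  have "D*(a^2*e (fst p) s*phi N z ?r + e (fst p) s*(z*phi N z ?r)) = (D*a^2 + D*z)*w p s" by (simp add: w_def asi)
  also have "D*a^2 + D*z = c1*a - g0" using pos by (simp add: z_def zc_def field_simps)
  finally have "D*(a^2*e (fst p) s*phi N z ?r + e (fst p) s*(z*phi N z ?r)) + g (w p s) <= c1*a*w p s" using g_le[of "w p s"] w0 by (simp add: left_diff_distrib)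
  also have "\<dots> <= c2*a*w p s" using c a w0 by (intro mult_right_mono) auto
  also have "\<dots> = a*c2*e (fst p) s*phi N z ?r" by (simp add: w_def)
  finally show "EX ft l. has_par w p s ft l & ft >= D*l + g (w p s)" using P by blast
 next
  fix p :: "'m pt" and s assume p: "p:EI"
  let ?r = "nr p"
  have r: "R < ?r" using p by (simp add: ExtI_def)
  have P: "has_par y p s (a*c2*e (fst p) s*(b*psi N ga ?r)) (a^2*e (fst p) s*(b*psi N ga ?r) + e (fst p) s*(b*(ga^2*psi N ga ?r)))" unfolding y_def by (rule has_par_sep[where F="%y. b*psi N ga (norm y)", OF et ex lps[OF r]])
  have "d*(a^2*e (fst p) s*(b*psi N ga ?r) + e (fst p) s*(b*(ga^2*psi N ga ?r))) - ro*y p s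
   = (d*a^2 + d*ga^2 - ro)*y p s" by (simp add: y_def asi)
  also have "\<dots> = a*c2*e (fst p) s*(b*psi N ga ?r)" unfolding dga by (simp add: y_def)
  finally show "EX ft l. has_par y p s ft l & ft >= d*l - ro*y p s" using P by force
 next
  fix p :: "'m pt" and s assume p: "nr p = R"
  have "dn_in R (%p. w p s) p (e (fst p) s*phi' N z R)" unfolding w_def by (rule dn_in_sep[OF p, where a="%x. e x s"]) (rule has_field_derivative_at_within, rule phi_deriv[OF bounded_linear_ident pos(3)])
  moreover have "D*(e (fst p) s*phi' N z R) >= nq*y p s - mq*w p s" using mult_left_mono[OF bc1 less_imp_le[OF e0[of "fst p" s]]] p by (simp add: w_def y_def asi)
  ultimately show "EX x. dn_in R (%p. w p s) p x & D*x >= nq*y p s - mq*w p s" by blast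
 next
  fix p :: "'m pt" and s assume p: "nr p = R"
  have "dn_out R (%p. y p s) p (e (fst p) s*(b*psi' N ga R))" unfolding y_def by (rule dn_out_sep[OF p, where a="%x. e x s"]) (rule has_field_derivative_at_within, rule DERIV_cmult, rule psi_deriv[OF ga(1) pos(3)])
  moreover have "- d*(e (fst p) s*(b*psi' N ga R)) = mq*w p s - nq*y p s" using arg_cong[OF bc2, of "%x. e (fst p) s*x"] p by (simp add: w_def y_def asi)
  ultimately show "EX x. dn_out R (%p. y p s) p x & - d*x >= mq*w p s - nq*y p s" by force
 qed (use t in auto)
 note main = this
 show ?thesis
 proof (intro exI[of _ "K*B"] conjI allI impI ballI)
  show "K*B > 0" using K B by simp
  fix t :: real and p :: "'m pt" assume t: "t >= 0"
  { assume p: "p:OC"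
   have "w p t <= e (fst p) t*B" unfolding w_def using B(2)[of "nr p"] p e0[of "fst p" t] by (intro mult_left_mono) (auto simp: OmegaC_def)
   thus "u p t <= K*B*exp (- a*(si*fst p - c2*t))" using main[OF t, of p] p by (simp add: e_def mult_ac) }
  assume p: "p:EC"
  have "y p t <= e (fst p) t*B" unfolding y_def using B(3)[of "nr p"] p e0[of "fst p" t] by (intro mult_left_mono) (auto simp: ExtC_def)
  thus "v p t <= K*B*exp (- a*(si*fst p - c2*t))" using main[OF t, of p] p by (simp add: e_def mult_ac)
 qed
qed

text \<open>A speed strictly between \<open>c1\<close> and \<open>c\<close> leaves an exponentially
  small factor wherever \<bar>x\<bar> is at least \<open>c * t\<close>.\<close>

lemma spread_out_I:
 fixes u v :: "'m::finite pt => real => real"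
 assumes N: "N + 1 = CARD('m)" and a: "!!R2. admc N R2 g0 c1 a" "a > 0" and c: "c1 < c"
  and adm: "admissible_data R u0 v0" and cs: "compact_support R u0 v0" and S: "sol u0 v0 u v"
 shows "spread_out R c u v"
proof -
 define c2 where "c2 = (c1 + c)/2"
 have c2: "c1 < c2" "c2 < c" using c by (auto simp: c2_def)
 obtain C1 where C1: "C1 > 0" "ALL t>=0. (ALL p:OC. u p t <= C1*exp (- a*(1*fst p - c2*t))) &
  (ALL p:EC. v p t <= C1*exp (- a*(1*fst p - c2*t)))" using speed_super[OF N a c2(1) _ adm cs S, of 1] by auto
 obtain C2 where C2: "C2 > 0" "ALL t>=0. (ALL p:OC. u p t <= C2*exp (- a*(-1*fst p - c2*t))) &
  (ALL p:EC. v p t <= C2*exp (- a*(-1*fst p - c2*t)))" using speed_super[OF N a c2(1) _ adm cs S, of "-1"] by auto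
 define C where "C = max C1 C2"
 have C: "f <= C*exp (- (a*(c - c2))*t)"
  if h: "f <= C1*exp (- a*(1*x - c2*t))" "f <= C2*exp (- a*(-1*x - c2*t))" "\<bar>x\<bar> >= c*t" for f x t
 proof -
  have e: "exp (- a*(s*x - c2*t)) <= exp (- (a*(c - c2))*t)" if "s*x >= c*t" for s
  proof -
   have "a*(c*t - c2*t) <= a*(s*x - c2*t)" using that a by simp
   thus ?thesis by (simp add: asi)
  qed
  have k: "k*exp (- a*(s*x - c2*t)) <= C*exp (- (a*(c - c2))*t)" if "s*x >= c*t" "0 < k" "k <= C" for s k using e[OF that(1)] that by (intro mult_mono) auto
  consider "1*x >= c*t" | "-1*x >= c*t" using h(3) by linarith
  thus ?thesis using h k[of 1 C1] k[of "-1" C2] C1(1) C2(1) by cases (auto simp: C_def)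
 qed
 show ?thesis unfolding spread_out_def
 proof (intro allI impI)
  fix e :: real assume e: "e > 0"
  have "((%t. C*exp (- q*t)) \<longlongrightarrow> 0) at_top" if "q > 0" for q :: real using that by real_asymp
  hence "((%t. C*exp (- (a*(c - c2))*t)) \<longlongrightarrow> 0) at_top" using a c2 by simp
  from order_tendstoD(2)[OF this e] eventually_ge_at_top[of 0]
  show "\<forall>\<^sub>F t in at_top. (ALL p:OC. c*t <= \<bar>fst p\<bar> --> \<bar>u p t\<bar> < e) & (ALL p:EC. c*t <= \<bar>fst p\<bar> --> \<bar>v p t\<bar> < e)"
  proof eventually_elim
   case (elim t)
   have "\<bar>u p t\<bar> < e" if "p:OC" "c*t <= \<bar>fst p\<bar>" for p using C[of "u p t" "fst p" t] C1(2) C2(2) elim that nonneg(1)[OF adm S elim(2) that(1)] by fastforce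
   moreover have "\<bar>v p t\<bar> < e" if "p:EC" "c*t <= \<bar>fst p\<bar>" for p using C[of "v p t" "fst p" t] C1(2) C2(2) elim that nonneg(2)[OF adm S elim(2) that(1)] by fastforce
   ultimately show ?case by blast
  qed
 qed
qed

end

section \<open>The truncated problem: least speed and complex exponents\<close>

context field_road begin

text \<open>The infimum of the admissible speeds is attained by \<open>admc_compact\<close>. The
  exponent found there is positive: at exponent 0 the parameters do not involve the speed, so
  \<open>c\<close> would be admissible too.\<close>

lemma trunc_min:
 assumes R2: "R2 > R" and G: "G >= 0" and c: "c >= 0"
  and no: "!!c' a. 0 <= c' ==> c' <= c ==> 0 <= a ==> ~ admc N R2 G c' a"
 obtains c2 a2 where "c < c2" "0 < a2" "admc N R2 G c2 a2" "!!c' a. 0 <= c' ==> c' < c2 ==> 0 <= a ==> ~ admc N R2 G c' a"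
proof -
 define S where "S = {c'. 0 <= c' & (EX a>=0. admc N R2 G c' a)}"
 define c2 where "c2 = Inf S"
 have ne: "S ~= {}" using admc_exists[OF G, of N] unfolding S_def by (metis (mono_tags, lifting) empty_iff mem_Collect_eq zero_le_one)
 have bb: "bdd_below S" by (intro bdd_belowI[of _ 0]) (simp add: S_def)
 have min: "~ admc N R2 G c' a" if "0 <= c'" "c' < c2" "0 <= a" for c' a using cInf_lower[of c' S, OF _ bb] that by (force simp: S_def c2_def)
 have "EX c' a. 0 <= c' & 0 <= a & admc N R2 G c' a & c2 <= c' & c' < c2 + 1/real (Suc k)" for k
 proof -
  have "Inf S < c2 + 1/real (Suc k)" by (simp add: c2_def)
  then obtain c' where "c':S" "c' < c2 + 1/real (Suc k)" using cInf_lessD[OF ne] by blast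
  thus ?thesis using cInf_lower[of c' S, OF _ bb] by (auto simp: S_def c2_def)
 qed
 then obtain cs as where ca: "!!k. 0 <= cs k" "!!k. 0 <= as k" "!!k. admc N R2 G (cs k) (as k)" "!!k. c2 <= cs k" "!!k. cs k < c2 + 1/real (Suc k)" by metis
 have C: "cs k <= c2 + 1" for k
 proof -
  have "1/real (Suc k) <= 1" by simp
  thus ?thesis using ca(5)[of k] by linarith
 qed
 obtain c3 a r where r: "strict_mono r" "(cs \<circ> r) \<longlonglongrightarrow> c3" "0 <= c3" "c3 <= c2 + 1" "0 <= a" "!!R'. R':{R2} ==> admc N R' G c3 a"
 proof (rule admc_compact[of cs "c2 + 1" as "%k. G" G "{R2}" N])
  show "admc N R G (cs k) (as k)" for k by (rule admc_mono[OF ca(3)]) (use R2 in simp)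
 qed (use ca C G in auto)
 have "cs \<longlonglongrightarrow> c2"
 proof (rule tendsto_sandwich[OF _ _ tendsto_const])
  show "(%k. c2 + 1/real (Suc k)) \<longlonglongrightarrow> c2" using tendsto_add[OF tendsto_const LIMSEQ_inverse_real_of_nat, of c2] by (simp add: inverse_eq_divide)
 qed (use ca(4,5) less_imp_le in \<open>auto intro!: always_eventually\<close>)
 hence "c3 = c2" using LIMSEQ_subseq_LIMSEQ[OF _ r(1)] r(2) LIMSEQ_unique by blast
 hence ad: "admc N R2 G c2 a" using r(6) by simp
 have c20: "0 <= c2" using r(3) \<open>c3 = c2\<close> by simp
 have cc: "c < c2" using no[OF c20 _ r(5)] ad by force
 have "a ~= 0"
 proof
  assume "a = 0"
  hence "admc N R2 G c 0" using ad by (simp add: admc_def zc_def mc_def)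
  thus False using no[OF c order_refl order_refl] by simp
 qed
 thus ?thesis using that[OF cc _ ad min] r(5) by simp
qed

text \<open>If \<open>KV\<close> were positive at \<open>R2\<close>, all inequalities would be
  strict on compact intervals and a slightly smaller speed would do. The slope cannot vanish as
  well, by \<open>KV_det\<close>.\<close>

lemma trunc_min_zero:
 assumes R2: "R2 > R" and c2: "0 < c2" and a: "admc N R2 G c2 a" "0 <= a"
  and min: "!!c' a. 0 <= c' ==> c' < c2 ==> 0 <= a ==> ~ admc N R2 G c' a"
 shows "KV N (zc G c2 a) (mc c2 a) R2 = 0" "KV' N (zc G c2 a) (mc c2 a) R2 < 0"
proof -
 let ?V = "KV N (zc G c2 a) (mc c2 a)" and ?V' = "KV' N (zc G c2 a) (mc c2 a)"
 have ap: "apair N R2 (zc G c2 a) (mc c2 a)" using a by (simp add: admc_def)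
 have nn: "?V r >= 0" if "r:{R..R2}" for r using ap that by (simp add: apair_def)
 show 0: "?V R2 = 0"
 proof (rule ccontr)
  assume "?V R2 ~= 0"
  hence p2: "?V r > 0" if "r:{R..R2}" for r using apair_V(2)[OF ap R2, of r] nn[of R2] R2 that by (cases "r = R2") auto
  have p1: "phi N (zc G c2 a) r > 0" if "r:{0..R}" for r using apair_phi(1)[OF ap _ that] R2 by simp
  have cc: "con X (%x::real \<times> real. zc G (fst x) a)" "con X (%x::real \<times> real. mc (fst x) a)" for X unfolding zc_def mc_def using pos by (intro ci; simp)+
  have 1: "con ({0..c2} \<times> {0..R}) (%(c,r). phi N (zc G c a) r)" unfolding case_prod_beta by (rule phi_cont_gen[OF _ cc(1)]) (auto intro!: compact_Times ci)
  have 2: "con ({0..c2} \<times> {R..R2}) (%(c,r). KV N (zc G c a) (mc c a) r)" unfolding case_prod_beta by (rule KV_cont_gen[OF _ cc]) (auto intro!: compact_Times ci)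
  obtain e1 where e1: "e1 > 0" "ALL c:{0..c2}. dist c c2 < e1 --> (ALL r:{0..R}. phi N (zc G c a) r > 0)" using pos_open[OF compact_Icc compact_Icc 1 _ p1] c2 by auto
  obtain e2 where e2: "e2 > 0" "ALL c:{0..c2}. dist c c2 < e2 --> (ALL r:{R..R2}. KV N (zc G c a) (mc c a) r > 0)" using pos_open[OF compact_Icc compact_Icc 2 _ p2] c2 by auto
  define c where "c = max 0 (c2 - min e1 e2/2)"
  have c: "0 <= c" "c < c2" "dist c c2 < e1" "dist c c2 < e2" using e1(1) e2(1) c2 by (auto simp: c_def dist_real_def)
  hence "admc N R2 G c a" using e1(2) e2(2) unfolding admc_def apair_def by (auto intro!: less_imp_le)
  thus False using min[OF c(1,2) a(2)] by simp
 qed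
 have "((%r. - ?V r) HD - ?V' R2) (at_left R2)" by (rule has_field_derivative_at_within, rule DERIV_minus, rule KV_deriv(1)[OF bounded_linear_ident R2])
 moreover have "\<forall>\<^sub>F r in at_left R2. - ?V r <= - ?V R2"
 proof -
  have "\<forall>\<^sub>F r in at_left R2. R < r & r < R2" using R2 by (auto simp: eventually_at_left[OF R2])
  thus ?thesis by eventually_elim (use nn 0 in auto)
 qed
 ultimately have "- ?V' R2 >= 0" by (rule left_max_deriv_nonneg)
 moreover have "?V' R2 ~= 0" using KV_det[OF _ 0] R2 apair_V(1)[OF ap R2] by fastforce
 ultimately show "?V' R2 < 0" by simp
qed

lemma KV_of_real:
 assumes "r >= R"
 shows "KV N (complex_of_real z) (of_real m) r = of_real (KV N z m r)" "KV' N (complex_of_real z) (of_real m) r = of_real (KV' N z m r)" using pos assms by (simp_all add: KV_def KV'_def sv_def sd_def phi_of_real vx_of_real)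

lemma zc_of_real: "zc G c (complex_of_real a) = of_real (zc G c a)" "mc c (complex_of_real a) = of_real (mc c a)" by (simp_all add: zc_def mc_def)

lemma zc_cont: "con X (%x::real \<times> complex. zc G (fst x) (snd x))" "con X (%x::real \<times> complex. mc (fst x) (snd x))" unfolding zc_def mc_def using pos by (intro ci; simp)+

lemma zc_cont3: "con X (%x::(real \<times> complex) \<times> real. zc G (fst (fst x)) (snd (fst x)))" "con X (%x::(real \<times> complex) \<times> real. mc (fst (fst x)) (snd (fst x)))" unfolding zc_def mc_def using pos by (intro ci; simp)+

lemma KV_holo:
 assumes "r >= R"
 shows "(%al::complex. KV N (zc G c al) (mc c al) r) holomorphic_on A"
proof -
 have z: "(%al::complex. zc G c al) holomorphic_on A" "(%al::complex. mc c al) holomorphic_on A" unfolding zc_def mc_def using pos by (intro holomorphic_intros; simp)+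
 note c = holomorphic_on_compose[OF z(1), unfolded o_def] holomorphic_on_compose[OF z(2), unfolded o_def]
 show ?thesis unfolding KV_def sv_def sd_def using pos assms by (intro holomorphic_intros c(1)[OF phi_holo(1)] c(1)[OF phi_holo(2)] c(2)[OF vx_holo(1)]) auto
qed

text \<open>This shows that the function whose roots are studied is not identically 0. The square of
  \<open>\<i>\<close> is real, so the parameters have the positive imaginary parts
  \<open>c / D\<close> and \<open>c / d\<close>; the weighted Wronskian of imaginary and real part
  then grows from the origin through the interface up to \<open>R2\<close>, hence is positive
  there.\<close>

lemma KV_imag_nonzero:
 assumes c: "c > 0" and R2: "R2 > R"
 shows "KV N (zc G c \<i>) (mc c \<i>) R2 ~= 0"
proof
 define z m where "z = zc G c \<i>" and "m = mc c \<i>"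
 assume 0: "KV N (zc G c \<i>) (mc c \<i>) R2 = 0"
 have im: "Im z = c/D" "Im m = c/d" by (simp_all add: z_def m_def zc_def mc_def)
 let ?p = "phi N z" and ?p' = "phi' N z" and ?V = "KV N z m" and ?V' = "KV' N z m"
 have sq: "Im (w*q) * Re q - Im q * Re (w*q) = Im w*((Re q)^2 + (Im q)^2)" for w q :: complex by (simp add: power2_eq_square asi)
 define F where "F = (%r. - (r^N*(Im (?p' r) * Re (?p r) - Im (?p r) * Re (?p' r))))"
 have "con {0..R} (%r. Re (?p r))" by (intro ci phi_cont_r pos)
 then obtain e0 where e0: "e0 > 0" "ALL x':{0..R}. dist x' 0 < e0 --> dist (Re (?p x')) (Re (?p 0)) < 1" unfolding continuous_on_iff using pos by (metis atLeastAtMost_iff less_imp_le order_refl zero_less_one)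
 define e where "e = e0/2"
 have e: "e > 0" using e0 by (simp add: e_def)
 have ep: "Re (?p q) > 0" if "q:{0..R}" "q <= e" for q
 proof -
  have "dist (Re (?p q)) 1 < 1" using e0 that by (simp add: phi_0 e_def)
  thus ?thesis by (simp add: dist_real_def)
 qed
 have "F R < 0"
 proof (rule flux_neg[where N=N and b=R and F=F and r=R and q="%r. Im z*((Re (?p r))^2 + (Im (?p r))^2)" and e="min e R"])
  show "con {0..R} F" unfolding F_def by (intro ci phi_cont_r pos)
  show "F 0 = 0" by (simp add: F_def phi'_0)
  fix r assume r: "0 < r" "r < R"
  have "((%r. r^N*(Im (?p' r) * Re (?p r) - Im (?p r) * Re (?p' r))) HD r^N*(Im (z*?p r) * Re (?p r) - Im (?p r) * Re (z*?p r))) (at r)" by (intro wronskian_deriv phi_deriv phi'_deriv bounded_linear_Im bounded_linear_Re r)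
  from DERIV_minus[OF this] show "(F HD - (r^N*(Im z*((Re (?p r))^2 + (Im (?p r))^2)))) (at r)" unfolding F_def sq .
  show "0 <= Im z*((Re (?p r))^2 + (Im (?p r))^2)" using im c pos by simp
 next
  fix r assume r: "0 < r" "r < min e R"
  hence "Re (?p r) > 0" using ep[of r] by simp
  thus "0 < Im z*((Re (?p r))^2 + (Im (?p r))^2)" using im c pos by (simp add: add_pos_nonneg)
 qed (use e pos in auto)
 hence wp: "Im (?p' R) * Re (?p R) - Im (?p R) * Re (?p' R) > 0" using pos by (simp add: F_def zero_less_mult_iff)
 define H where "H = (%r. r^N*(Im (?V' r) * Re (?V r) - Im (?V r) * Re (?V' r)))"
 have "H R > 0"
 proof -
  have "Im (sd N z) * Re (sv N z) - Im (sv N z) * Re (sd N z) = D*mq/(d*nq)*(Im (?p' R) * Re (?p R) - Im (?p R) * Re (?p' R))" using pos by (simp add: sd_def sv_def field_simps)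
  thus ?thesis using wp pos by (simp add: H_def KV_R)
 qed
 moreover have "- H R2 <= - H R"
 proof (rule DERIV_nonpos_imp_decreasing_open[of R R2 "%r. - H r"])
  show "R <= R2" using R2 by simp
  show "con {R..R2} (%r. - H r)" unfolding H_def by (intro ci KV_cont_r)
  fix r assume r: "R < r" "r < R2"
  have "(H HD r^N*(Im (m*?V r) * Re (?V r) - Im (?V r) * Re (m*?V r))) (at r)" unfolding H_def by (intro wronskian_deriv KV_deriv bounded_linear_Im bounded_linear_Re r)
  from DERIV_minus[OF this] show "EX y. ((%r. - H r) HD y) (at r) & y <= 0" unfolding sq by (intro exI conjI) (use im c pos r in auto)
 qed
 moreover have "H R2 = 0" using 0 by (simp add: H_def z_def m_def)
 ultimately show False by simp
qed

text \<open>Hurwitz' theorem along speeds \<open>ck\<close> increasing to \<open>c2\<close>: if none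
  of these functions had a zero in the disc, the limit would have none, contrary to the zero at
  \<open>a2\<close>. A constant limit is excluded by analytic continuation to
  \<open>\<i>\<close>.\<close>

lemma complex_root:
 assumes R2: "R2 > R" and c: "0 <= c" "c < c2" and 0: "KV N (zc G c2 a2) (mc c2 a2) R2 = 0" and e: "e > 0"
 shows "EX c' al. c < c' & c' < c2 & dist c' c2 < e & al:ball (complex_of_real a2) e & KV N (zc G c' al) (mc c' al) R2 = 0"
proof (rule ccontr)
 assume n: "~ ?thesis"
 define f where "f = (%c al. KV N (zc G c al) (mc c (al::complex)) R2)"
 define h where "h = min e (c2 - c)"
 have h: "h > 0" "h <= e" "h <= c2 - c" using e c by (auto simp: h_def)
 define ck where "ck = (%k. c2 - h/(real k + 2))"
 have ck: "c < ck k" "ck k < c2" "dist (ck k) c2 < e" for k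
 proof -
  have "h/(real k + 2) < h/1" using h by (intro divide_strict_left_mono) auto
  moreover have "0 < h/(real k + 2)" using h by simp
  ultimately show "c < ck k" "ck k < c2" "dist (ck k) c2 < e" using h by (auto simp: ck_def dist_real_def)
 qed
 have ckl: "ck \<longlonglongrightarrow> c2" unfolding ck_def by real_asymp
 let ?S = "ball (complex_of_real a2) e"
 have "f c2 (of_real a2) ~= 0"
 proof (rule Hurwitz_no_zeros[of ?S "%k. f (ck k)" "f c2"])
  show "f (ck k) holomorphic_on ?S" "f c2 holomorphic_on ?S" for k unfolding f_def using R2 by (auto intro!: KV_holo)
  show "f (ck k) w ~= 0" if "w:?S" for k w using n ck[of k] that unfolding f_def by blast
  show "~ f c2 constant_on ?S"
  proof
   assume "f c2 constant_on ?S"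
   then obtain y where y: "!!w. w:?S ==> f c2 w = y" unfolding constant_on_def by blast
   have "f c2 (of_real a2) = 0" using 0 R2 by (simp add: f_def zc_of_real KV_of_real)
   hence z: "f c2 w = 0" if "w:?S" for w using y[OF that] y[of "of_real a2"] e by simp
   have "f c2 \<i> = 0" by (rule analytic_continuation[of "f c2" UNIV ?S "of_real a2"])
   (use z e R2 in \<open>auto simp: islimpt_ball f_def intro!: KV_holo\<close>)
   thus False using KV_imag_nonzero[of c2 R2 N G] c R2 by (simp add: f_def)
  qed
  show "uniform_limit K (%k. f (ck k)) (f c2) sequentially" if K: "compact K" for K
  proof -
   have "compact ({0..c2} \<times> K)" by (intro compact_Times compact_Icc K)
   hence "uniformly_continuous_on ({0..c2} \<times> K) (%x. f (fst x) (snd x))" unfolding f_def by (intro compact_uniformly_continuous KV_cont_gen zc_cont continuous_on_const) (use R2 in auto)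
   hence "EX N. ALL n>=N. ALL w:K. dist (f (ck n) w) (f c2 w) < eps" if "eps > 0" for eps
   proof -
   from \<open>uniformly_continuous_on _ _\<close> that obtain dv where dv: "dv > 0"
   "!!x x'. x:{0..c2} \<times> K ==> x':{0..c2} \<times> K ==> dist x' x < dv ==> dist (f (fst x') (snd x')) (f (fst x) (snd x)) < eps" unfolding uniformly_continuous_on_def by metis
   obtain N0 where N0: "!!n. n >= N0 ==> dist (ck n) c2 < dv" using ckl dv(1) unfolding lim_sequentially by blast
   have "dist (f (ck n) w) (f c2 w) < eps" if "n >= N0" "w:K" for n w using dv(2)[of "(c2, w)" "(ck n, w)"] N0[OF that(1)] that(2) ck[of n] c by (simp add: dist_Pair_Pair)
   thus ?thesis by blast
   qed
   thus ?thesis unfolding uniform_limit_sequentially_iff by blast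
  qed
 qed (use e in auto)
 thus False using 0 R2 by (simp add: f_def zc_of_real KV_of_real)
qed

text \<open>A real root would be an admissible exponent at a speed below the least one. The cone
  condition that the imaginary part be smaller than the real part is open where the limit is
  positive; near \<open>R2\<close>, where \<open>KV\<close> vanishes, it follows by integrating the
  analogous condition on the derivative back from \<open>R2\<close>.\<close>

lemma complex_mode:
 assumes R2: "R2 > R" and G: "G >= 0" and c: "c >= 0"
  and no: "!!c' a. 0 <= c' ==> c' <= c ==> 0 <= a ==> ~ admc N R2 G c' a"
 obtains c' and al :: complex where "c < c'" "Im al ~= 0" "KV N (zc G c' al) (mc c' al) R2 = 0"
  "!!r. r:{0..R} ==> \<bar>Im (phi N (zc G c' al) r)\<bar> < Re (phi N (zc G c' al) r)"
  "!!r. r:{R..<R2} ==> \<bar>Im (KV N (zc G c' al) (mc c' al) r)\<bar> < Re (KV N (zc G c' al) (mc c' al) r)"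
proof -
 obtain c2 a2 where c2: "c < c2" "0 < a2" "admc N R2 G c2 a2" "!!c' a. 0 <= c' ==> c' < c2 ==> 0 <= a ==> ~ admc N R2 G c' a" using trunc_min[OF R2 G c no] by blast
 have c20: "0 < c2" "0 <= a2" using c c2 by auto
 note V0 = trunc_min_zero[OF R2 c20(1) c2(3) c20(2) c2(4)]
 have ap: "apair N R2 (zc G c2 a2) (mc c2 a2)" using c2(3) by (simp add: admc_def)
 define A where "A = {0..c2} \<times> cball (complex_of_real a2) 1"
 have A: "compact A" "(c2, of_real a2):A" using c20 by (auto simp: A_def intro!: compact_Times)
 let ?p = "%x r. phi N (zc G (fst x) (snd x)) r :: complex"
 let ?V = "%x r. KV N (zc G (fst x) (snd x)) (mc (fst x) (snd x)) r :: complex" and ?V' = "%x r. KV' N (zc G (fst x) (snd x)) (mc (fst x) (snd x)) r :: complex"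
 have cp: "con (A \<times> {0..R}) (%(x,r). Re (?p x r) - \<bar>Im (?p x r)\<bar>)" unfolding case_prod_beta by (intro ci phi_cont_gen compact_Times compact_Icc A zc_cont3) auto
 have cV: "con (A \<times> {R..b}) (%(x,r). Re (?V x r) - \<bar>Im (?V x r)\<bar>)" for b unfolding case_prod_beta by (intro ci KV_cont_gen compact_Times compact_Icc A zc_cont3) auto
 have cV': "con (A \<times> {b..R2}) (%(x,r). - Re (?V' x r) - \<bar>Im (?V' x r)\<bar>)" if "b >= R" for b unfolding case_prod_beta using that by (intro ci KV_cont_gen compact_Times compact_Icc A zc_cont3) auto
 let ?x0 = "(c2, complex_of_real a2)"
 have x0: "?p ?x0 r = of_real (phi N (zc G c2 a2) r)" if "r >= 0" for r using that by (simp add: zc_of_real phi_of_real)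
 have x1: "?V ?x0 r = of_real (KV N (zc G c2 a2) (mc c2 a2) r)" "?V' ?x0 r = of_real (KV' N (zc G c2 a2) (mc c2 a2) r)" if "r >= R" for r using that by (simp_all add: zc_of_real KV_of_real)
 obtain e1 where e1: "e1 > 0" "ALL x:A. dist x ?x0 < e1 --> (ALL r:{0..R}. Re (?p x r) - \<bar>Im (?p x r)\<bar> > 0)"
 proof -
  have "Re (?p ?x0 r) - \<bar>Im (?p ?x0 r)\<bar> > 0" if "r:{0..R}" for r using x0[of r] apair_phi(1)[OF ap _ that] R2 that by simp
  note p0 = this
  have "EX e>0. ALL x:A. dist x ?x0 < e --> (ALL r:{0..R}. Re (?p x r) - \<bar>Im (?p x r)\<bar> > 0)" by (rule pos_open[OF A(1) compact_Icc cp A(2)]) (rule p0)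
  thus ?thesis by (elim exE conjE) (rule that)
 qed
 have "con {R..R2} (KV' N (zc G c2 a2) (mc c2 a2))" by (rule KV_cont_r)
 then obtain dv where dv: "dv > 0" "ALL r:{R..R2}. dist r R2 < dv --> dist (KV' N (zc G c2 a2) (mc c2 a2) r) (KV' N (zc G c2 a2) (mc c2 a2) R2) < - KV' N (zc G c2 a2) (mc c2 a2) R2"
  unfolding continuous_on_iff using V0(2) R2 by (metis atLeastAtMost_iff less_imp_le neg_0_less_iff_less order_refl)
 \<comment> \<open>The value is positive on \<open>[R, b]\<close> and the slope is negative on
   \<open>[b, R2]\<close>; \<open>e2\<close> and \<open>e3\<close> handle these two
   intervals.\<close>
 define b where "b = max R (R2 - dv/2)"
 have b: "R <= b" "b < R2" using dv R2 by (auto simp: b_def)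
 have nb: "KV' N (zc G c2 a2) (mc c2 a2) r < 0" if "r:{b..R2}" for r
 proof -
  have "r:{R..R2}" "dist r R2 < dv" using that dv(1) by (auto simp: b_def dist_real_def)
  thus ?thesis using dv(2) by (fastforce simp: dist_real_def)
 qed
 obtain e2 where e2: "e2 > 0" "ALL x:A. dist x ?x0 < e2 --> (ALL r:{R..b}. Re (?V x r) - \<bar>Im (?V x r)\<bar> > 0)"
 proof -
  have "Re (?V ?x0 r) - \<bar>Im (?V ?x0 r)\<bar> > 0" if "r:{R..b}" for r using x1(1)[of r] apair_V(2)[OF ap R2, of r] b that by simp
  note p0 = this
  have "EX e>0. ALL x:A. dist x ?x0 < e --> (ALL r:{R..b}. Re (?V x r) - \<bar>Im (?V x r)\<bar> > 0)" by (rule pos_open[OF A(1) compact_Icc cV A(2)]) (rule p0)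
  thus ?thesis by (elim exE conjE) (rule that)
 qed
 obtain e3 where e3: "e3 > 0" "ALL x:A. dist x ?x0 < e3 --> (ALL r:{b..R2}. - Re (?V' x r) - \<bar>Im (?V' x r)\<bar> > 0)"
 proof -
  have "- Re (?V' ?x0 r) - \<bar>Im (?V' ?x0 r)\<bar> > 0" if "r:{b..R2}" for r using x1(2)[of r] nb[OF that] b that by simp
  note p0 = this
  have "EX e>0. ALL x:A. dist x ?x0 < e --> (ALL r:{b..R2}. - Re (?V' x r) - \<bar>Im (?V' x r)\<bar> > 0)" by (rule pos_open[OF A(1) compact_Icc cV'[OF b(1)] A(2)]) (rule p0)
  thus ?thesis by (elim exE conjE) (rule that)
 qed
 \<comment> \<open>Staying below \<open>a2\<close> keeps real exponents positive, staying below 1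
   keeps the pair in \<open>A\<close>; the factor 2 accounts for the two coordinates in the
   distance.\<close>
 define e where "e = min (min (min e1 e2) (min e3 1)) a2/2"
 have e: "e > 0" "2*e <= e1" "2*e <= e2" "2*e <= e3" "e <= 1" "e < a2" using e1 e2 e3 c2(2) unfolding e_def by auto
 obtain c' al where ca: "c < c'" "c' < c2" "dist c' c2 < e" "al:ball (complex_of_real a2) e" "KV N (zc G c' al) (mc c' al) R2 = 0" using complex_root[OF R2 c c2(1) V0(1) e(1)] by blast
 define x where "x = (c', al)"
 have xA: "x:A" using ca e c by (auto simp: x_def A_def dist_commute)
 have dx: "dist x ?x0 < 2*e" using ca sqrt_sum_squares_le_sum_abs[of "dist c' c2" "dist al (of_real a2)"] unfolding x_def dist_Pair_Pair by (simp add: dist_commute)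
 have P: "\<bar>Im (?p x r)\<bar> < Re (?p x r)" if "r:{0..R}" for r using e1(2) xA dx e(2) that by force
 have Vb: "\<bar>Im (?V x r)\<bar> < Re (?V x r)" if r: "r:{R..<R2}" for r
 proof (cases "r <= b")
  case True
  thus ?thesis using e2(2) xA dx e(3) r by force
 next
  case False
  have R2': "?V x R2 = 0" using ca(5) by (simp add: x_def)
  have s: "s*Im (?V x r) + Re (?V x r) > 0" if "s = 1 | s = -1" for s
  proof -
   have "s*Im (?V x R2) + Re (?V x R2) < s*Im (?V x r) + Re (?V x r)"
   proof (rule DERIV_neg_imp_decreasing[of r R2 "%r. s*Im (?V x r) + Re (?V x r)"])
   show "r < R2" using r by simp
   fix q assume q: "r <= q" "q <= R2"
   hence qR: "q > R" using False b by simp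
   have "((%r. s*Im (?V x r) + Re (?V x r)) HD s*Im (?V' x q) + Re (?V' x q)) (at q)" by (intro DERIV_add DERIV_cmult KV_deriv bounded_linear_Im bounded_linear_Re qR)
   moreover have "- Re (?V' x q) - \<bar>Im (?V' x q)\<bar> > 0" using e3(2) xA dx e(4) q False by force
   hence "s*Im (?V' x q) + Re (?V' x q) < 0" using that by auto
   ultimately show "EX y. ((%r. s*Im (?V x r) + Re (?V x r)) HD y) (at q) & y < 0" by blast
   qed
   thus ?thesis using R2' by simp
  qed
  show ?thesis using s[of 1] s[of "-1"] by auto
 qed
 have "Im al ~= 0"
 proof
  assume i: "Im al = 0"
  hence al: "al = of_real (Re al)" by (simp add: complex_eq_iff)
  have "\<bar>Re al - a2\<bar> < e"
  proof -
   have "\<bar>Re al - a2\<bar> <= cmod (al - of_real a2)" using abs_Re_le_cmod[of "al - of_real a2"] by simp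
   thus ?thesis using ca(4) by (simp add: dist_norm norm_minus_commute)
  qed
  hence a0: "0 <= Re al" using e by linarith
  have z: "zc G c' al = of_real (zc G c' (Re al))" "mc c' al = of_real (mc c' (Re al))" using al zc_of_real by metis+
  have "admc N R2 G c' (Re al)" unfolding admc_def apair_def
  proof (intro conjI ballI)
   fix r assume r: "r:{0..R}"
   show "0 <= phi N (zc G c' (Re al)) r" using P[OF r] r by (simp add: x_def z phi_of_real)
  next
   fix r assume r: "r:{R..R2}"
   show "0 <= KV N (zc G c' (Re al)) (mc c' (Re al)) r"
   proof (cases "r = R2")
   case True thus ?thesis using ca(5) R2 by (simp add: z KV_of_real)
   next
   case False thus ?thesis using Vb[of r] r by (simp add: x_def z KV_of_real)
   qed
  qed
  thus False using c2(4)[OF _ ca(2) a0] ca(1) c by simp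
 qed
 thus ?thesis using that[OF ca(1) _ ca(5)] P Vb by (simp add: x_def)
qed

end

text \<open>The phase is clamped where the bump is nonpositive, so the bump is exact wherever it is positive.\<close>

definition kk :: "real => real => real => real => real => real => real" where
 "kk X c si s x t = max (- X) (min X (si*x - c*(t - 1) - s))"
definition osc :: "real => real => real => real => real => real => (real => real) => (real => real) => 'm::finite pt => real => real" where
 "osc a b X c si s F H p t = exp (- a*kk X c si s (fst p) t)*cos (b*kk X c si s (fst p) t)*F (nr p)
  + exp (- a*kk X c si s (fst p) t) * sin (b*kk X c si s (fst p) t)*H (nr p)"

text \<open>Inside the clamp \<open>osc\<close> is the real part of exp(-(a + i b) k) (F + i H), and
  the hypotheses on \<open>F\<close> and \<open>H\<close> say that the Laplacian multiplies F + i H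
  by zr + i zi. \<open>ka\<close> is the linear reaction rate, \<open>G\<close> in the cylinder and
  \<open>- ro\<close> outside.\<close>

lemma osc_par:
 fixes p :: "'m::finite pt" and a b c K ka :: real
 assumes x: "\<bar>si*fst p - c*(t - 1) - s\<bar> < X" and si: "si * si = 1"
  and F: "has_lap (%y. F (norm y)) (snd p) (zr*F (nr p) - zi*H (nr p))"
  and H: "has_lap (%y. H (norm y)) (snd p) (zr*H (nr p) + zi*F (nr p))"
  and zr: "K*zr = c*a - ka - K*(a^2 - b^2)" and zi: "K*zi = c*b - 2*K*a*b"
 shows "EX ft l. has_par (osc a b X c si s F H) p t ft l & ft = K*l + ka * osc a b X c si s F H p t"
proof -
 define f where "f = (%x t. si*x - c*(t - 1) - s)"
 define C where "C = (%x t. exp (- a*f x t)*cos (b*f x t))"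
 define S where "S = (%x t. exp (- a*f x t) * sin (b*f x t))"
 define w where "w = (%(p::'m pt) t. C (fst p) t*F (nr p) + S (fst p) t*H (nr p))"
 have t: "((%t. C x t) HD c*(a*C x t + b*S x t)) (at t)"
  "((%t. S x t) HD c*(a*S x t - b*C x t)) (at t)" for x t unfolding C_def S_def f_def by (auto intro!: dei simp: asi)
 have d1: "((%x. C x t) HD si*(- a*C x t - b*S x t)) (at x)"
  "((%x. S x t) HD si*(- a*S x t + b*C x t)) (at x)" for x t unfolding C_def S_def f_def by (auto intro!: dei simp: asi)
 have d2: "has_d2 (%x. C x t) x ((a^2 - b^2)*C x t + 2*a*b*S x t)"
  "has_d2 (%x. S x t) x ((a^2 - b^2)*S x t - 2*a*b*C x t)" for x t
 proof -
  have "((%x. si*(- a*C x t - b*S x t)) HD (si * si)*((a^2 - b^2)*C x t + 2*a*b*S x t)) (at x)" by (auto intro!: dei d1 simp: asi power2_eq_square)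
  thus "has_d2 (%x. C x t) x ((a^2 - b^2)*C x t + 2*a*b*S x t)" unfolding si by (intro has_d2_I[OF d1(1)]) simp
  have "((%x. si*(- a*S x t + b*C x t)) HD (si * si)*((a^2 - b^2)*S x t - 2*a*b*C x t)) (at x)" by (auto intro!: dei d1 simp: asi power2_eq_square)
  thus "has_d2 (%x. S x t) x ((a^2 - b^2)*S x t - 2*a*b*C x t)" unfolding si by (intro has_d2_I[OF d1(2)]) simp
 qed
 let ?F = "F (nr p)" and ?H = "H (nr p)" and ?C = "C (fst p) t" and ?S = "S (fst p) t"
 let ?ft = "c*(a*?C + b*?S)*?F + c*(a*?S - b*?C)*?H"
 let ?l = "(((a^2 - b^2)*?C + 2*a*b*?S)*?F + ?C*(zr*?F - zi*?H)) + (((a^2 - b^2)*?S - 2*a*b*?C)*?H + ?S*(zr*?H + zi*?F))"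
 have P: "has_par w p t ?ft ?l" unfolding w_def by (intro has_par_add has_par_sep[where F="%y. F (norm y)"] has_par_sep[where F="%y. H (norm y)"] t d2 F H)
 have "K*?l + ka*w p t - ?ft = (K*zr - (c*a - ka - K*(a^2 - b^2)))*(?C*?F + ?S*?H) + (K*zi - (c*b - 2*K*a*b))*(?S*?F - ?C*?H)" by (simp add: w_def asi)
 hence eq: "?ft = K*?l + ka*w p t" unfolding zr zi by simp
 have ow: "osc a b X c si s F H q r = w q r" if "\<bar>f (fst q) r\<bar> < X" for q :: "'m pt" and r
 proof -
  have "kk X c si s (fst q) r = f (fst q) r" using that by (auto simp: kk_def f_def abs_less_iff)
  thus ?thesis by (simp add: osc_def w_def C_def S_def)
 qed
 have xf: "\<bar>f (fst p) t\<bar> < X" using x by (simp add: f_def)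
 have "open {r. \<bar>f (fst p) r\<bar> < X}" "open {q::'m pt. \<bar>f (fst q) t\<bar> < X}" unfolding f_def by (intro open_Collect_less ci)+
 hence "\<forall>\<^sub>F r in nhds t. r:{r. \<bar>f (fst p) r\<bar> < X}" "\<forall>\<^sub>F q in nhds p. q:{q. \<bar>f (fst q) t\<bar> < X}" by (intro eventually_nhds_in_open; use xf in simp)+
 hence ev: "\<forall>\<^sub>F r in nhds t. osc a b X c si s F H p r = w p r" "\<forall>\<^sub>F q in nhds p. w q t = osc a b X c si s F H q t" by (auto elim!: eventually_mono simp: ow)
 have "has_par (osc a b X c si s F H) p t ?ft ?l" using P has_lap_cong[OF _ ev(2)] DERIV_cong_ev[OF refl ev(1) refl] unfolding has_par_def by blast
 thus ?thesis using eq ow[OF xf] by (intro exI conjI) auto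
qed

lemma kk_bound: "X >= 0 ==> \<bar>kk X c si s x t\<bar> <= X" by (auto simp: kk_def abs_le_iff)

lemma osc_bound:
 assumes "X >= 0" "\<bar>F (nr p)\<bar> <= B" "\<bar>H (nr p)\<bar> <= B"
 shows "osc a b X c si s F H (p::'m::finite pt) t <= 2*B*exp (\<bar>a\<bar>*X)"
proof -
 let ?k = "kk X c si s (fst p) t"
 have "- a*?k <= \<bar>a\<bar>*\<bar>?k\<bar>" by (metis abs_ge_self abs_minus_cancel abs_mult)
 also have "\<dots> <= \<bar>a\<bar>*X" using kk_bound[OF assms(1)] by (intro mult_left_mono) auto
 finally have e: "exp (- a*?k) <= exp (\<bar>a\<bar>*X)" by simp
 have 1: "exp (- a*?k)*q*h <= exp (\<bar>a\<bar>*X)*B" if "\<bar>q\<bar> <= 1" "\<bar>h\<bar> <= B" for q h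
 proof -
  have "q*h <= \<bar>q\<bar>*\<bar>h\<bar>" by (metis abs_ge_self abs_mult)
  also have "\<dots> <= 1*B" using that by (intro mult_mono) auto
  finally have "exp (- a*?k)*(q*h) <= exp (- a*?k)*B" by (intro mult_left_mono) auto
  also have "\<dots> <= exp (\<bar>a\<bar>*X)*B" using e that by (intro mult_right_mono) auto
  finally show ?thesis by (simp add: mult.assoc)
 qed
 show ?thesis unfolding osc_def using add_mono[OF 1[OF abs_cos_le_one[of "b*?k"] assms(2)] 1[OF abs_sin_le_one[of "b*?k"] assms(3)]] by (simp add: mult_ac)
qed

text \<open>The half width \<open>X\<close> freezes the phase at plus or minus 3 pi/4, where sine
  and cosine have equal size and the cosine is negative; \<open>\<bar>H\<bar> \<le> F\<close> then
  decides the sign.\<close>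

lemma osc_nonpos:
 assumes b: "b ~= 0" and X: "X = 3*pi/(4*\<bar>b\<bar>)" and FH: "\<bar>H (nr p)\<bar> <= F (nr p)"
  and x: "\<bar>si*fst p - c*(t - 1) - s\<bar> >= X"
 shows "osc a b X c si s F H (p::'m::finite pt) t <= 0"
proof -
 let ?k = "kk X c si s (fst p) t" and ?F = "F (nr p)" and ?H = "H (nr p)"
 have X0: "X > 0" using b X by simp
 have "?k = X | ?k = - X" using x X0 unfolding kk_def by (auto simp: abs_if split: if_splits)
 moreover have "b*X = 3*pi/4 | b*X = - (3*pi/4)" using b unfolding X by (cases "b > 0") (auto simp: field_simps)
 ultimately have k: "b*?k = 3*pi/4 | b*?k = - (3*pi/4)" by auto
 have c34: "cos (3*pi/4) = - (sqrt 2/2)" "sin (3*pi/4) = sqrt 2/2"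
 proof -
  have e: "3*pi/4 = pi - pi/4" by simp
  show "cos (3*pi/4) = - (sqrt 2/2)" unfolding e cos_pi_minus cos_45 ..
  show "sin (3*pi/4) = sqrt 2/2" unfolding e sin_pi_minus sin_45 ..
 qed
 have "cos (b*?k)*?F + sin (b*?k)*?H = sqrt 2/2*(?H - ?F) | cos (b*?k)*?F + sin (b*?k)*?H = sqrt 2/2*(- ?H - ?F)" using k by (elim disjE) (simp_all only: c34 cos_minus sin_minus, simp_all add: asi)
 moreover have "sqrt 2/2*(?H - ?F) <= 0" "sqrt 2/2*(- ?H - ?F) <= 0" using FH by (auto intro!: mult_nonneg_nonpos)
 ultimately have "cos (b*?k)*?F + sin (b*?k)*?H <= 0" by auto
 hence "exp (- a*?k)*(cos (b*?k)*?F + sin (b*?k)*?H) <= 0" by (intro mult_nonneg_nonpos) auto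
 thus ?thesis by (simp add: osc_def asi)
qed

context field_road begin

lemma phi_lap:
 fixes y :: "'a::euclidean_space"
 assumes N: "N + 1 = DIM('a)" and l: "bounded_linear l"
 shows "has_lap (%y. l (phi N z (norm y))) y (l (z*phi N z (norm y)))"
proof -
 have l': "bounded_linear (%w. l (z*w))" by (rule bounded_linear_compose[OF l bounded_linear_mult_right])
 show ?thesis
 proof (rule radial_ode_C2(2)[of UNIV N "%r. l (phi N z r)" "%r. l (phi' N z r)" "%r. l (z*phi N z r)"])
  have "con {0..1} (%r. l (z*phi N z r))" by (rule bounded_linear.continuous_on[OF l' phi_cont_r(1)]) simp
  moreover have "con {0..1} (%r. r^N*l (phi' N z r))" by (intro ci bounded_linear.continuous_on[OF l phi_cont_r(2)]) simp
  ultimately show "((%r. l (z*phi N z r)) \<longlongrightarrow> l (z*phi N z 0)) (at_right 0) & ((%r. r^N*l (phi' N z r)) \<longlongrightarrow> 0) (at_right 0) & ((%r. l (phi N z r)) HD 0) (at_right 0)"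
   using cont_on_Icc_right[of 1 "%r. l (z*phi N z r)"] cont_on_Icc_right[of 1 "%r. r^N*l (phi' N z r)"] phi_deriv0[OF l, of N z] by (simp add: phi'_0 linear_0[OF bounded_linear.linear[OF l]])
  show "isCont (%r. l (z*phi N z r)) (norm y)" if "y ~= 0" for y :: 'a using DERIV_isCont[OF phi_deriv[OF l', of "norm y" N z]] that by simp
 qed (use N phi_deriv[OF l] phi'_deriv[OF l] in auto)
qed

lemma KV_lap:
 fixes y :: "'a::euclidean_space"
 assumes N: "N + 1 = DIM('a)" and l: "bounded_linear l" and y: "norm y > R"
 shows "has_lap (%y. l (KV N z m (norm y))) y (l (m*KV N z m (norm y)))"
proof -
 have l': "bounded_linear (%w. l (m*w))" by (rule bounded_linear_compose[OF l bounded_linear_mult_right])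
 show ?thesis
 proof (rule radial_ode_C2(2)[of "{y. R < norm y}" N "%r. l (KV N z m r)" "%r. l (KV' N z m r)" "%r. l (m*KV N z m r)"])
  show "isCont (%r. l (m*KV N z m r)) (norm y)" if "y:{y. R < norm y}" for y :: 'a using DERIV_isCont[OF KV_deriv(1)[OF l', of "norm y" N z m]] that by simp
 qed (use N y pos KV_deriv[OF l] open_outside in auto)
qed

end

context kpp begin

lemma moving:
 fixes al :: complex
 assumes N: "N + 1 = CARD('m::finite)" and G: "G < g0" and R3: "R <= R3" "R3 < R2" and al: "Im al ~= 0" and X': "X' >= 0" and si: "si = 1 | si = - 1"
  and 0: "KV N (zc G c al) (mc c al) R2 = 0"
  and ph: "!!r. r:{0..R} ==> \<bar>Im (phi N (zc G c al) r)\<bar> < Re (phi N (zc G c al) r)"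
  and kv: "!!r. r:{R..<R2} ==> \<bar>Im (KV N (zc G c al) (mc c al) r)\<bar> < Re (KV N (zc G c al) (mc c al) r)"
  and adm: "admissible_data R u0 v0" and S: "sol u0 v0 (u::'m pt => real => real) v"
 shows "EX m>0. ALL t>=1. ALL p. \<bar>si*fst p - c*(t - 1)\<bar> <= X' --> (p:OC --> m <= u p t) & (p:EC & nr p <= R3 --> m <= v p t)"
proof -
 define z m where "z = zc G c al" and "m = mc c al"
 define a b where "a = Re al" and "b = Im al"
 define X where "X = 3*pi/(4*\<bar>b\<bar>)"
 have b0: "b ~= 0" using al by (simp add: b_def)
 have X0: "X > 0" using b0 by (simp add: X_def)
 have si2: "si * si = 1" using si by auto
 have R2: "R < R2" using R3 by simp
 have sq: "al^2 = Complex (a^2 - b^2) (2*a*b)" by (simp add: complex_eq_iff a_def b_def power2_eq_square)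
 have zr: "D * Re z = c*a - G - D*(a^2 - b^2)" "D*Im z = c*b - 2*D*a*b" unfolding z_def zc_def sq using pos by (simp_all add: a_def b_def field_simps)
 have mr: "d * Re m = c*a - (- ro) - d*(a^2 - b^2)" "d*Im m = c*b - 2*d*a*b" unfolding m_def mc_def sq using pos by (simp_all add: a_def b_def field_simps)
 define F H where "F = (%r. Re (phi N z r))" and "H = (%r. Im (phi N z r))"
 \<comment> \<open>\<open>min r R2\<close> freezes the profile at its value 0 beyond
   \<open>R2\<close>.\<close>
 define P Q where "P = (%r. Re (KV N z m (min r R2)))" and "Q = (%r. Im (KV N z m (min r R2)))"
 have FH: "\<bar>H r\<bar> <= F r" "0 < F r" if "r:{0..R}" for r using ph[OF that] by (auto simp: F_def H_def z_def)
 have P0: "P r = 0" "Q r = 0" if "r >= R2" for r using 0 that by (auto simp: P_def Q_def z_def m_def min_def)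
 have PQ1: "\<bar>Q r\<bar> <= P r" "0 < P r" if "r:{R..<R2}" for r using kv[OF that] that by (auto simp: P_def Q_def z_def m_def min_def)
 have PQ: "\<bar>Q r\<bar> <= P r" "0 <= P r" if "r >= R" for r using PQ1[of r] P0[of r] that by (cases "r < R2"; force)+
 have Fc: "con {0..R} F" "con {0..R} H" unfolding F_def H_def by (intro ci phi_cont_r pos)+
 have KVc: "con {R..} (%r. KV N z m (min r R2))" by (rule continuous_on_compose2[OF KV_cont_r(1)[of R2]]) (use R2 in \<open>auto intro!: ci\<close>)
 have Pc: "con {R..} P" "con {R..} Q" unfolding P_def Q_def by (intro ci KVc)+
 have ne: "{0..R} ~= {}" "{R..R2} ~= {}" using pos R2 by auto
 obtain B1 where B1: "!!r. r:{0..R} ==> F r <= B1" using continuous_attains_sup[OF compact_Icc ne(1) Fc(1)] by blast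
 have Pc2: "con {R..R2} P" "con {R..R3} P" using Pc(1) by (auto intro: continuous_on_subset)
 obtain B2 where B2: "!!r. r:{R..R2} ==> P r <= B2" using continuous_attains_sup[OF compact_Icc ne(2) Pc2(1)] by blast
 define B where "B = max 1 (max B1 B2)"
 have B: "B >= 1" "!!r. r:{0..R} ==> \<bar>F r\<bar> <= B & \<bar>H r\<bar> <= B" "!!r. r >= R ==> \<bar>P r\<bar> <= B & \<bar>Q r\<bar> <= B"
 proof -
  have Bs: "B1 <= B" "B2 <= B" by (auto simp: B_def)
  show "B >= 1" by (simp add: B_def)
  show "\<bar>F r\<bar> <= B & \<bar>H r\<bar> <= B" if "r:{0..R}" for r using FH[OF that] B1[OF that] Bs by linarith
  show "\<bar>P r\<bar> <= B & \<bar>Q r\<bar> <= B" if "r >= R" for r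
  proof (cases "r <= R2")
   case True thus ?thesis using PQ[OF that] B2[of r] Bs that by simp
  next
   case False thus ?thesis using P0[of r] \<open>B >= 1\<close> by simp
  qed
 qed
 define E where "E = 2*B*exp (\<bar>a\<bar>*X)"
 have E: "E > 0" using B(1) by (simp add: E_def)
 obtain f1 where f1: "f1 > 0" "!!r. r:{0..R} ==> f1 <= F r" by (rule inf_pos[OF compact_Icc ne(1) Fc(1)]) (use FH in auto)
 have ne3: "{R..R3} ~= {}" using R3 by simp
 obtain p1 where p1: "p1 > 0" "!!r. r:{R..R3} ==> p1 <= P r" by (rule inf_pos[OF compact_Icc ne3 Pc2(2)]) (use PQ1 R3 in auto)
 \<comment> \<open>Since \<open>G < g0\<close>, the nonlinear reaction dominates the linear one at
   small positive values.\<close>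
 obtain s0 where s0: "s0 > 0" "!!x. 0 < x ==> x < s0 ==> G*x <= g x"
 proof -
  have "\<forall>\<^sub>F h in at 0. g h/h > G" using order_tendstoD(1)[OF g_tendsto G] .
  then obtain s1 where s1: "s1 > 0" "!!x. x ~= 0 ==> dist x 0 < s1 ==> g x/x > G" unfolding eventually_at by auto
  have "G*x <= g x" if "0 < x" "x < s1" for x
  proof -
   have "G < g x/x" using s1(2)[of x] that by (simp add: dist_real_def)
   thus ?thesis using that by (simp add: pos_less_divide_eq)
  qed
  thus ?thesis using that s1(1) by blast
 qed
 have "X' + X >= 0" "R2 >= R" using X' X0 R2 by auto
 from pos_level[OF adm S zero_less_one this] obtain m1 where m1: "m1 > 0" "!!p. p:OC ==> \<bar>fst p\<bar> <= X' + X ==> m1 <= u p 1"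
  "!!p. p:EC ==> \<bar>fst p\<bar> <= X' + X ==> nr p <= R2 ==> m1 <= v p 1" by blast
 \<comment> \<open>\<open>E\<close> bounds the bump, so this scaling keeps it below the level
   \<open>m1\<close> at time 1 and below \<open>s0\<close> at all times.\<close>
 define eps where "eps = min m1 (s0/2)/E"
 have eps: "eps > 0" "eps*E <= m1" "eps*E < s0" using E m1(1) s0(1) by (auto simp: eps_def)
 define w where "w = (%s. osc a b X c si s (%r. eps*F r) (%r. eps*H r) :: 'm pt => _)"
 define y where "y = (%s. osc a b X c si s (%r. eps*P r) (%r. eps*Q r) :: 'm pt => _)"
 have sc: "\<bar>eps*f\<bar> <= eps*B" if "\<bar>f\<bar> <= B" for f using eps(1) that by (simp add: abs_mult)
 have wE: "w s p t <= eps*E" if "p:OC" for s t p unfolding w_def E_def using osc_bound[OF less_imp_le[OF X0] sc sc, of F p H] B(2)[of "nr p"] that by (simp add: OmegaC_def mult_ac)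
 have yE: "y s p t <= eps*E" if "p:EC" for s t p unfolding y_def E_def using osc_bound[OF less_imp_le[OF X0] sc sc, of P p Q] B(3)[of "nr p"] that by (simp add: ExtC_def mult_ac)
 have ab: "\<bar>eps*h\<bar> <= eps*f" if "\<bar>h\<bar> <= f" for h f using eps(1) that by (simp add: abs_mult)
 have wx: "\<bar>si*fst p - c*(t - 1) - s\<bar> < X" if "w s p t > 0" "p:OC" for s t p
 proof (rule ccontr)
  assume "~ ?thesis"
  hence "w s p t <= 0" unfolding w_def using FH(1)[of "nr p"] that(2) by (intro osc_nonpos[OF b0 X_def ab]) (auto simp: OmegaC_def)
  thus False using that(1) by simp
 qed
 have yx: "\<bar>si*fst p - c*(t - 1) - s\<bar> < X & nr p < R2" if "y s p t > 0" "p:EC" for s t p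
 proof (rule ccontr)
  assume n: "~ ?thesis"
  show False
  proof (cases "nr p < R2")
   case True
   hence "y s p t <= 0" unfolding y_def using PQ(1)[of "nr p"] that(2) n by (intro osc_nonpos[OF b0 X_def ab]) (auto simp: ExtC_def)
   thus False using that(1) by simp
  next
   case False
   thus False using that(1) P0[of "nr p"] by (simp add: y_def osc_def)
  qed
 qed
 have kc: "con UNIV (%(x,t). exp (- a*kk X c si s x t)*cos (b*kk X c si s x t))"
  "con UNIV (%(x,t). exp (- a*kk X c si s x t) * sin (b*kk X c si s x t))" for s unfolding kk_def case_prod_beta by (intro ci)+
 have ceps: "con Z (%r. eps*f r)" if "con Z f" for Z and f :: "real => real" using that by (intro ci)
 have Dph: "D * Re (phi' N z R) = nq*P R - mq*F R" "D*Im (phi' N z R) = nq*Q R - mq*H R" using R2 pos by (simp_all add: P_def Q_def F_def H_def KV_R sv_def field_simps)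
 have dsd: "d * Re (sd N z) = D * Re (phi' N z R)" "d*Im (sd N z) = D*Im (phi' N z R)" using pos by (simp_all add: sd_def)
 have main: "(p:OC --> w s p t <= u p t) & (p:EC --> y s p t <= v p t)" if s: "\<bar>s\<bar> <= X'" and t: "t >= 1" for s t p
 proof (rule sub_cmp[OF adm S, where ta=1 and T=t and w="w s" and z="y s" and M="eps*E"])
  show "con (OC \<times> {1..t}) (%(p, t). w s p t)" using continuous_on_add[OF cont_sep_in[OF kc(1) ceps[OF Fc(1)], of "{1..t}"] cont_sep_in[OF kc(2) ceps[OF Fc(2)], of "{1..t}"]] by (simp add: w_def osc_def case_prod_beta)
  show "con (EC \<times> {1..t}) (%(p, t). y s p t)" using continuous_on_add[OF cont_sep_out[OF kc(1) ceps[OF Pc(1)], of "{1..t}"] cont_sep_out[OF kc(2) ceps[OF Pc(2)], of "{1..t}"]] by (simp add: y_def osc_def case_prod_beta)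
  have xb: "\<bar>x\<bar> <= X' + X" if "\<bar>si*x - c*(1 - 1) - s\<bar> < X" for x using that s si by auto
  show "w s p 1 <= u p 1" if p: "p:OC" for p
  proof (cases "w s p 1 > 0")
   case True
   show ?thesis using m1(2)[OF p xb[OF wx[OF True p]]] wE[OF p, of s 1] eps by linarith
  next
   case False
   thus ?thesis using nonneg(1)[OF adm S zero_le_one p] by linarith
  qed
  show "y s p 1 <= v p 1" if p: "p:EC" for p
  proof (cases "y s p 1 > 0")
   case True
   thus ?thesis using m1(3)[OF p xb] yx[OF True p] yE[OF p, of s 1] eps by fastforce
  next
   case False
   thus ?thesis using nonneg(2)[OF adm S zero_le_one p] by linarith
  qed
 next
  fix p :: "'m pt" and r assume p: "p:OI" and w0: "0 < w s p r"
  have pC: "p:OC" using p by (rule OmegaI_sub)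
  note x = wx[OF w0 pC]
  have F: "has_lap (%y. eps*F (norm y)) (snd p) (Re z*(eps*F (nr p)) - Im z*(eps*H (nr p)))" using has_lap_cmult[OF phi_lap[of N Re z "snd p"], of eps] N bounded_linear_Re by (simp add: F_def H_def asi)
  have H: "has_lap (%y. eps*H (norm y)) (snd p) (Re z*(eps*H (nr p)) + Im z*(eps*F (nr p)))" using has_lap_cmult[OF phi_lap[of N Im z "snd p"], of eps] N bounded_linear_Im by (simp add: F_def H_def asi)
  obtain ft l where f: "has_par (w s) p r ft l" "ft = D*l + G*w s p r" using osc_par[OF x si2 F H zr] unfolding w_def by blast
  have "G*w s p r <= g (w s p r)" using s0(2)[OF w0] wE[OF pC, of s r] eps by simp
  thus "EX ft l. has_par (w s) p r ft l & ft <= D*l + g (w s p r)" using f by (intro exI[of _ ft] exI[of _ l]) simp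
 next
  fix p :: "'m pt" and r assume p: "p:EI" and y0: "0 < y s p r"
  have pC: "p:EC" using p by (rule ExtI_sub)
  have pr: "R < nr p" "nr p < R2" using p yx[OF y0 pC] by (auto simp: ExtI_def)
  have ev: "\<forall>\<^sub>F q in nhds (snd p). norm q < R2"
  proof -
   have "open {q::real^'m. norm q < R2}" by (intro open_Collect_less ci)
   from eventually_nhds_in_open[OF this, of "snd p"] pr show ?thesis by simp
  qed
  have lapl: "has_lap (%y. eps*l (KV N z m (min (norm y) R2))) (snd p) (eps*l (m*KV N z m (nr p)))" if "bounded_linear l" for l
  proof (rule has_lap_cong[OF has_lap_cmult[OF KV_lap[OF _ that pr(1)]]])
   show "N + 1 = DIM(real^'m)" using N by simp
   show "\<forall>\<^sub>F q in nhds (snd p). eps*l (KV N z m (norm q)) = eps*l (KV N z m (min (norm q) R2))" using ev by eventually_elim simp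
  qed
  have F: "has_lap (%y. eps*P (norm y)) (snd p) (Re m*(eps*P (nr p)) - Im m*(eps*Q (nr p)))" using lapl[OF bounded_linear_Re] pr by (simp add: P_def Q_def asi)
  have H: "has_lap (%y. eps*Q (norm y)) (snd p) (Re m*(eps*Q (nr p)) + Im m*(eps*P (nr p)))" using lapl[OF bounded_linear_Im] pr by (simp add: P_def Q_def asi)
  obtain ft l where "has_par (y s) p r ft l" "ft = d*l + - ro*y s p r" using osc_par[OF conjunct1[OF yx[OF y0 pC]] si2 F H mr] unfolding y_def by blast
  thus "EX ft l. has_par (y s) p r ft l & ft <= d*l - ro*y s p r" by auto
 next
  fix p :: "'m pt" and r assume p: "nr p = R"
  let ?k = "kk X c si s (fst p) r"
  let ?C = "exp (- a*?k)*cos (b*?k)" and ?S = "exp (- a*?k) * sin (b*?k)"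
  have dl: "((%r. eps*l (phi N z r)) HD eps*l (phi' N z R)) (at_left R)" if "bounded_linear l" for l by (rule DERIV_cmult, rule has_field_derivative_at_within, rule phi_deriv[OF that pos(3)])
  have "dn_in R (%p. w s p r) p (?C*(eps * Re (phi' N z R)) + ?S*(eps*Im (phi' N z R)))" unfolding w_def osc_def F_def H_def by (intro dn_in_add dn_in_sep[OF p dl, where a="%x. exp (- a*kk X c si s x r)*cos (b*kk X c si s x r)"]
   dn_in_sep[OF p dl, where a="%x. exp (- a*kk X c si s x r) * sin (b*kk X c si s x r)"] bounded_linear_Re bounded_linear_Im)
  moreover have "D*(?C*(eps * Re (phi' N z R)) + ?S*(eps*Im (phi' N z R))) = nq*y s p r - mq*w s p r"
  proof -
   have "D*(?C*(eps * Re (phi' N z R)) + ?S*(eps*Im (phi' N z R))) = ?C*(eps*(D * Re (phi' N z R))) + ?S*(eps*(D*Im (phi' N z R)))" by (simp add: distrib_left mult.left_commute)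
   thus ?thesis unfolding Dph by (simp add: w_def y_def osc_def p asi)
  qed
  ultimately show "EX x. dn_in R (%p. w s p r) p x & D*x <= nq*y s p r - mq*w s p r" by force
 next
  fix p :: "'m pt" and r assume p: "nr p = R"
  let ?k = "kk X c si s (fst p) r"
  let ?C = "exp (- a*?k)*cos (b*?k)" and ?S = "exp (- a*?k) * sin (b*?k)"
  have dl: "((%r. eps*l (KV N z m (min r R2))) HD eps*l (sd N z)) (at_right R)" if "bounded_linear l" for l
  proof (rule DERIV_cmult)
   have "\<forall>\<^sub>F r in at_right R. r < R2" using R2 by (auto simp: eventually_at_right[OF R2])
   hence "\<forall>\<^sub>F r in at_right R. l (KV N z m r) = l (KV N z m (min r R2))" by (auto elim!: eventually_mono)
   from has_field_derivative_cong_eventually[OF this] R2 KV_deriv_R[OF that, of N z m]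
   show "((%r. l (KV N z m (min r R2))) HD l (sd N z)) (at_right R)" by simp
  qed
  have "dn_out R (%p. y s p r) p (?C*(eps * Re (sd N z)) + ?S*(eps*Im (sd N z)))" unfolding y_def osc_def P_def Q_def by (intro dn_out_add dn_out_sep[OF p dl, where a="%x. exp (- a*kk X c si s x r)*cos (b*kk X c si s x r)"]
   dn_out_sep[OF p dl, where a="%x. exp (- a*kk X c si s x r) * sin (b*kk X c si s x r)"] bounded_linear_Re bounded_linear_Im)
  moreover have "- d*(?C*(eps * Re (sd N z)) + ?S*(eps*Im (sd N z))) = mq*w s p r - nq*y s p r"
  proof -
   have "- d*(?C*(eps * Re (sd N z)) + ?S*(eps*Im (sd N z))) = - (?C*(eps*(d * Re (sd N z))) + ?S*(eps*(d*Im (sd N z))))" by (simp add: distrib_left mult.left_commute)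
   thus ?thesis unfolding dsd Dph by (simp add: w_def y_def osc_def p asi)
  qed
  ultimately show "EX x. dn_out R (%p. y s p r) p x & - d*x <= mq*w s p r - nq*y s p r" by force
 qed (use t wE yE in auto)
 show ?thesis
 proof (intro exI[of _ "eps*min f1 p1"] conjI allI impI)
  show "eps*min f1 p1 > 0" using eps f1 p1 by simp
  fix t and p :: "'m pt" assume t: "1 <= t" and x: "\<bar>si*fst p - c*(t - 1)\<bar> <= X'"
  have k: "kk X c si (si*fst p - c*(t - 1)) (fst p) t = 0" using X0 by (simp add: kk_def)
  note mn = main[OF x t, of p]
  { assume p: "p:OC"
   hence "eps*F (nr p) <= u p t" using mn k by (simp add: w_def osc_def)
   moreover have "eps*min f1 p1 <= eps*F (nr p)" using f1(2)[of "nr p"] p eps by (intro mult_left_mono) (auto simp: OmegaC_def)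
   ultimately show "eps*min f1 p1 <= u p t" by linarith }
  assume p: "p:EC & nr p <= R3"
  hence "eps*P (nr p) <= v p t" using mn k by (simp add: y_def osc_def)
  moreover have "eps*min f1 p1 <= eps*P (nr p)" using p1(2)[of "nr p"] p eps by (intro mult_left_mono) (auto simp: ExtC_def)
  ultimately show "eps*min f1 p1 <= v p t" by linarith
 qed
qed

end

section \<open>The spreading speed and the conclusion\<close>

context kpp begin

text \<open>A front of speed \<open>c' > c\<close> reaches \<open>x0\<close> at time
  \<open>1 + \<bar>x0\<bar> / c'\<close> and leaves the level \<open>m\<close> around it; from then
  on \<open>standing\<close> needs a waiting time independent of \<open>x0\<close>. For
  \<bar>x0\<bar> at most \<open>c * t\<close> both fit into the time \<open>t\<close> once it is
  large. The upper bound is global.\<close>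

lemma spread_in_I:
 fixes u v :: "'m::finite pt => real => real"
 assumes N: "N + 1 = CARD('m)" and Uc: "con {0..R} U" and U01: "!!r. r:{0..R} ==> 0 < U r & U r < 1"
  and dU: "(U HD U1) (at_left R)"
  and lU: "!!y::real^'m. norm y < R ==> has_lap (%y. U (norm y)) y (- g (U (norm y))/D)"
  and bU: "D*U1 = nq*(bpsi N (U R)*psi N gam R) - mq*U R"
  and P: "profile TYPE('m) U U1 (%r. g (U r)) (%r. bpsi N (U R)*psi N gam r) Ps1 B"
  and c: "c > 0" and gap: "!!R3. EX R2>R3. EX G. R < R2 & 0 <= G & G < g0 & (ALL c' a. 0 <= c' & c' <= c & 0 <= a --> ~ admc N R2 G c' a)"
  and adm: "admissible_data R u0 v0" and S: "sol u0 v0 u v"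
 shows "spread_in R c u v (%p. U (nr p)) (%p. bpsi N (U R)*psi N gam (nr p))"
proof -
 let ?V = "%r. bpsi N (U R)*psi N gam r"
 have main: "\<forall>\<^sub>F t in at_top. (ALL p:OC. \<bar>fst p\<bar> <= c*t --> \<bar>u p t - U (nr p)\<bar> < e) &
  (ALL p:EC. \<bar>fst p\<bar> <= c*t & nr p <= b --> \<bar>v p t - ?V (nr p)\<bar> < e)" if e: "e > 0" for b e :: real
 proof -
  have h: "e/2 > 0" "max R b >= R" using e by auto
  obtain X' R3 where X: "X' > 0" "R3 >= R" and
   st: "!!m. m > 0 ==> EX L>=0. ALL u0 v0 (u::'m pt => real => real) v t1 x0. admissible_data R u0 v0 & sol u0 v0 u v & 0 <= t1 &
   (ALL p:OC. \<bar>fst p - x0\<bar> <= X' --> m <= u p t1) &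
   (ALL p:EC. \<bar>fst p - x0\<bar> <= X' & nr p <= R3 --> m <= v p t1) -->
   (ALL t>=t1 + L. (ALL p:OC. fst p = x0 --> U (nr p) - e/2 <= u p t) &
   (ALL p:EC. fst p = x0 & nr p <= max R b --> ?V (nr p) - e/2 <= v p t))" by (rule standing[OF N Uc U01 dU lU bU h]) (assumption | rule that)+
  obtain R2 G where R2: "R3 < R2" "R < R2" "0 <= G" "G < g0" and no: "ALL c' a. 0 <= c' & c' <= c & 0 <= a --> ~ admc N R2 G c' a" using gap[of R3] by blast
  have c0: "0 <= c" using c by simp
  obtain c' and al :: complex where ca: "c < c'" "Im al ~= 0" "KV N (zc G c' al) (mc c' al) R2 = 0"
   "!!r. r:{0..R} ==> \<bar>Im (phi N (zc G c' al) r)\<bar> < Re (phi N (zc G c' al) r)"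
   "!!r. r:{R..<R2} ==> \<bar>Im (KV N (zc G c' al) (mc c' al) r)\<bar> < Re (KV N (zc G c' al) (mc c' al) r)" by (rule complex_mode[OF R2(2,3) c0]) (use no in blast, rule that)
  have mv: "EX m>0. ALL t>=1. ALL p. \<bar>si*fst p - c'*(t - 1)\<bar> <= X' --> (p:OC --> m <= u p t) & (p:EC & nr p <= R3 --> m <= v p t)"
   if "si = 1 | si = -1" for si by (rule moving[OF N R2(4) X(2) R2(1) ca(2) less_imp_le[OF X(1)] that ca(3) _ _ adm S]) (use ca in auto)
  obtain ma where ma: "ma > 0" "ALL t>=1. ALL p. \<bar>1*fst p - c'*(t - 1)\<bar> <= X' --> (p:OC --> ma <= u p t) & (p:EC & nr p <= R3 --> ma <= v p t)" using mv[of 1] by blast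
  obtain mb where mb: "mb > 0" "ALL t>=1. ALL p. \<bar>-1*fst p - c'*(t - 1)\<bar> <= X' --> (p:OC --> mb <= u p t) & (p:EC & nr p <= R3 --> mb <= v p t)" using mv[of "-1"] by blast
  define m where "m = min ma mb"
  have m: "m > 0" "m <= ma" "m <= mb" using ma mb by (auto simp: m_def)
  have c'0: "c' > 0" using ca(1) c by simp
  have lev: "(ALL p:OC. \<bar>fst p - x0\<bar> <= X' --> m <= u p (1 + \<bar>x0\<bar>/c')) &
   (ALL p:EC. \<bar>fst p - x0\<bar> <= X' & nr p <= R3 --> m <= v p (1 + \<bar>x0\<bar>/c'))" for x0
  proof -
   have t: "1 <= 1 + \<bar>x0\<bar>/c'" "c'*(1 + \<bar>x0\<bar>/c' - 1) = \<bar>x0\<bar>" using c'0 by auto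
   show ?thesis
   proof (cases "x0 >= 0")
   case True
   hence "\<bar>1*fst p - c'*(1 + \<bar>x0\<bar>/c' - 1)\<bar> <= X'" if "\<bar>fst p - x0\<bar> <= X'" for p :: "'m pt" using that unfolding t by simp
   thus ?thesis using ma(2) t(1) m by (meson order_trans)
   next
   case False
   hence "\<bar>-1*fst p - c'*(1 + \<bar>x0\<bar>/c' - 1)\<bar> <= X'" if "\<bar>fst p - x0\<bar> <= X'" for p :: "'m pt" using that unfolding t by simp
   thus ?thesis using mb(2) t(1) m by (meson order_trans)
   qed
  qed
  obtain L where L: "L >= 0" and L': "ALL u0 v0 (u::'m pt => real => real) v t1 x0. admissible_data R u0 v0 & sol u0 v0 u v & 0 <= t1 &
   (ALL p:OC. \<bar>fst p - x0\<bar> <= X' --> m <= u p t1) &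
   (ALL p:EC. \<bar>fst p - x0\<bar> <= X' & nr p <= R3 --> m <= v p t1) -->
   (ALL t>=t1 + L. (ALL p:OC. fst p = x0 --> U (nr p) - e/2 <= u p t) &
   (ALL p:EC. fst p = x0 & nr p <= max R b --> ?V (nr p) - e/2 <= v p t))" using st[OF m(1)] by blast
  have low: "(ALL p:OC. fst p = x0 --> U (nr p) - e/2 <= u p t) &
   (ALL p:EC. fst p = x0 & nr p <= max R b --> ?V (nr p) - e/2 <= v p t)"
   if "t >= (1 + \<bar>x0\<bar>/c') + L" for x0 t using adm S c'0 lev[of x0] that by (intro L'[THEN spec, THEN spec, THEN spec, THEN spec, THEN spec, THEN spec, THEN mp, THEN spec, THEN mp, of u0 v0 u v "1 + \<bar>x0\<bar>/c'" x0 t]) auto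
  have up: "\<forall>\<^sub>F t in at_top. (ALL p:OC. u p t <= U (nr p) + e/2) & (ALL p:EC. v p t <= ?V (nr p) + e/2)" by (rule upper_steady[OF U01 P adm S]) (use e in auto)
  \<comment> \<open>From this time on \<open>1 + c * t / c' + L \<le> t\<close>.\<close>
  define T where "T = (1 + L)/(1 - c/c')"
  have cc: "1 - c/c' > 0" using ca(1) c'0 by simp
  from up eventually_ge_at_top[of T] eventually_ge_at_top[of 0] show ?thesis
  proof eventually_elim
   case (elim t)
   have T: "t >= (1 + \<bar>x\<bar>/c') + L" if "\<bar>x\<bar> <= c*t" for x
   proof -
   have "1 + L <= t*(1 - c/c')" using elim(2) cc by (simp add: T_def pos_divide_le_eq)
   moreover have "\<bar>x\<bar>/c' <= c*t/c'" using that c'0 by (intro divide_right_mono) auto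
   ultimately show ?thesis by (simp add: right_diff_distrib mult.commute)
   qed
   show ?case
   proof (intro conjI ballI impI)
   fix p :: "'m pt" assume p: "p:OC" "\<bar>fst p\<bar> <= c*t"
   have "U (nr p) - e/2 <= u p t" using low[OF T[OF p(2)]] p(1) by blast
   moreover have "u p t <= U (nr p) + e/2" using elim(1) p by blast
   ultimately show "\<bar>u p t - U (nr p)\<bar> < e" using e unfolding abs_less_iff by linarith
   next
   fix p :: "'m pt" assume p: "p:EC" "\<bar>fst p\<bar> <= c*t & nr p <= b"
   have "nr p <= max R b" using p by auto
   hence "?V (nr p) - e/2 <= v p t" using low[OF T[OF conjunct1[OF p(2)]]] p(1) by blast
   moreover have "v p t <= ?V (nr p) + e/2" using elim(1) p by blast
   ultimately show "\<bar>v p t - ?V (nr p)\<bar> < e" using e unfolding abs_less_iff by linarith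
   qed
  qed
 qed
 thus ?thesis unfolding spread_in_def by blast
qed

lemma spread_in_conv_loc:
 fixes u v :: "'m::finite pt => real => real"
 assumes s: "spread_in R c u v U V" and c: "c > 0"
 shows "conv_loc R u v U V"
proof -
 have main: "\<forall>\<^sub>F t in at_top. (ALL p:OC \<inter> K. \<bar>u p t - U p\<bar> < e) & (ALL p:EC \<inter> K. \<bar>v p t - V p\<bar> < e)"
  if h: "compact K" "e > 0" for K and e :: real
 proof -
  obtain b where b: "ALL p:K. norm p <= b" using compact_imp_bounded[OF h(1)] unfolding bounded_iff by blast
  have "\<forall>\<^sub>F t in at_top. b <= c*t" using c by real_asymp
  moreover have "\<forall>\<^sub>F t in at_top. (ALL p:OC. \<bar>fst p\<bar> <= c*t --> \<bar>u p t - U p\<bar> < e) &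
   (ALL p:EC. \<bar>fst p\<bar> <= c*t & nr p <= b --> \<bar>v p t - V p\<bar> < e)" using s h(2) unfolding spread_in_def by blast
  ultimately show ?thesis
  proof eventually_elim
   case (elim t)
   have "\<bar>fst p\<bar> <= c*t & nr p <= b" if "p:K" for p using norm_fst_le[of "fst p" "snd p"] norm_snd_le[of "snd p" "fst p"] b that elim(1) by fastforce
   thus ?case using elim(2) by blast
  qed
 qed
 show ?thesis unfolding conv_loc_def
 proof (intro conjI allI impI; elim conjE)
  fix K :: "'m pt set" and e :: real assume "compact K" "K \<subseteq> OC" "e > 0"
  with main[of K e] show "\<forall>\<^sub>F t in at_top. ALL p:K. \<bar>u p t - U p\<bar> < e" by (auto elim!: eventually_mono)
 next
  fix K :: "'m pt set" and e :: real assume "compact K" "K \<subseteq> EC" "e > 0"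
  with main[of K e] show "\<forall>\<^sub>F t in at_top. ALL p:K. \<bar>v p t - V p\<bar> < e" by (auto elim!: eventually_mono)
 qed
qed

text \<open>Exponent 0 is allowed so that limits of admissible parameters stay in the description;
  \<open>speed_pos\<close> excludes it afterwards.\<close>

definition speeds :: "nat => real set" where
 "speeds N = {c. 0 <= c & (EX a>=0. ALL R2. admc N R2 g0 c a)}"

lemma speeds: "speeds N ~= {}" "bdd_below (speeds N)" "Inf (speeds N) >= 0"
proof -
 obtain c where "c >= 0" "ALL R2. admc N R2 g0 c 1" using admc_exists[OF less_imp_le[OF g0_pos], of N] by blast
 hence "c:speeds N" unfolding speeds_def by (auto intro!: exI[of _ 1])
 thus ne: "speeds N ~= {}" by blast
 show "bdd_below (speeds N)" by (intro bdd_belowI[of _ 0]) (simp add: speeds_def)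
 show "Inf (speeds N) >= 0" by (rule cInf_greatest[OF ne]) (simp add: speeds_def)
qed

text \<open>Otherwise there would be admissible parameters with speeds up to \<open>c\<close> for
  radii tending to infinity and slopes tending to \<open>g0\<close>. Their limit would be admissible
  for every radius at slope \<open>g0\<close>, against \<open>c < Inf (speeds N)\<close>.\<close>

lemma speed_gap:
 assumes c: "0 <= c" "c < Inf (speeds N)"
 shows "EX R2>R3. EX G. R < R2 & 0 <= G & G < g0 & (ALL c' a. 0 <= c' & c' <= c & 0 <= a --> ~ admc N R2 G c' a)"
proof (rule ccontr)
 assume n: "~ ?thesis"
 define Rk where "Rk = (%k. max R3 R + 1 + real k)"
 define Gk where "Gk = (%k. g0 - g0/(real k + 2))"
 have Rk: "R3 < Rk k" "R < Rk k" for k by (auto simp: Rk_def)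
 have Gk: "0 <= Gk k" "Gk k < g0" for k
 proof -
  have "g0/(real k + 2) <= g0/1" using g0_pos by (intro divide_left_mono) auto
  thus "0 <= Gk k" by (simp add: Gk_def)
  show "Gk k < g0" using g0_pos by (simp add: Gk_def)
 qed
 have "EX c' a. 0 <= c' & c' <= c & 0 <= a & admc N (Rk k) (Gk k) c' a" for k using n Rk[of k] Gk[of k] by blast
 then obtain cs as where ca: "!!k. 0 <= cs k & cs k <= c" "!!k. 0 <= as k" "!!k. admc N (Rk k) (Gk k) (cs k) (as k)" by metis
 have Gl: "Gk \<longlonglongrightarrow> g0" unfolding Gk_def by real_asymp
 obtain c0 a r where r: "strict_mono (r::nat => nat)" "(cs \<circ> r) \<longlonglongrightarrow> c0" "0 <= c0" "c0 <= c" "0 <= a" "!!R2. R2:UNIV ==> admc N R2 g0 c0 a"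
 proof (rule admc_compact[of cs c as Gk g0 UNIV N])
  fix R2
  have "\<forall>\<^sub>F k in sequentially. R2 <= Rk k" unfolding Rk_def by real_asymp
  thus "\<forall>\<^sub>F k in sequentially. admc N R2 (Gk k) (cs k) (as k)" by eventually_elim (rule admc_mono[OF ca(3)])
  show "admc N R (Gk k) (cs k) (as k)" for k by (rule admc_mono[OF ca(3)]) (use Rk[of k] in simp)
 qed (use ca Gk Gl in auto)
 hence "c0:speeds N" by (auto simp: speeds_def)
 hence "Inf (speeds N) <= c0" by (rule cInf_lower[OF _ speeds(2)])
 thus False using r(4) c by simp
qed

text \<open>Speeds tending to 0 would produce in the limit an admissible mode of speed 0, which
  \<open>admc_pos_speed\<close> forbids. Exponent 0 is excluded in the same way, because its
  parameters do not involve the speed.\<close>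

lemma speed_pos:
 assumes l: "ALL r:{0..R}. ph N l r > 0" "D*ph' N l R + k*ph N l R = 0" and lg: "D*l < g0"
  and k: "k = mq*(- d*psi' N gam R)/(nq*psi N gam R + (- d*psi' N gam R))"
 shows "Inf (speeds N) > 0"
  and "c > Inf (speeds N) ==> EX c1 a. c1 < c & 0 < a & (ALL R2. admc N R2 g0 c1 a)"
proof -
 have no: "~ (ALL R2. admc N R2 g0 0 a)" for a using admc_pos_speed[OF _ l lg k] by blast
 show "EX c1 a. c1 < c & 0 < a & (ALL R2. admc N R2 g0 c1 a)" if h: "c > Inf (speeds N)"
 proof -
  obtain c1 where "c1:speeds N" "c1 < c" using cInf_lessD[OF speeds(1) h] by blast
  then obtain a where a: "0 <= a" "ALL R2. admc N R2 g0 c1 a" by (auto simp: speeds_def)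
  have "a ~= 0"
  proof
   assume "a = 0"
   hence "ALL R2. admc N R2 g0 0 0" using a(2) by (simp add: admc_def zc_def mc_def)
   thus False using no by blast
  qed
  hence "0 < a" using a(1) by simp
  thus ?thesis using a(2) \<open>c1 < c\<close> by blast
 qed
 show "Inf (speeds N) > 0"
 proof (rule ccontr)
  assume "~ ?thesis"
  moreover have "0 < 1/real (Suc k)" for k by simp
  ultimately have i: "Inf (speeds N) < 1/real (Suc k)" for k by (meson le_less_trans not_less)
  have "EX c a. 0 <= c & c < 1/real (Suc k) & 0 <= a & (ALL R2. admc N R2 g0 c a)" for k using cInf_lessD[OF speeds(1) i[of k]] by (auto simp: speeds_def)
  then obtain cs as where ca: "!!k. 0 <= cs k" "!!k. cs k < 1/real (Suc k)" "!!k. 0 <= as k" "!!k R2. admc N R2 g0 (cs k) (as k)" by metis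
  have c1: "cs k <= 1" for k
  proof -
   have "1/real (Suc k) <= 1" by simp
   thus ?thesis using ca(2)[of k] by linarith
  qed
  obtain c0 a r where r: "strict_mono (r::nat => nat)" "(cs \<circ> r) \<longlonglongrightarrow> c0" "0 <= c0" "c0 <= 1" "0 <= a" "!!R2. R2:UNIV ==> admc N R2 g0 c0 a"
   by (rule admc_compact[of cs 1 as "%k. g0" g0 UNIV N]) (use ca c1 g0_pos in \<open>auto intro: less_imp_le\<close>)
  have "cs \<longlonglongrightarrow> 0"
  proof (rule tendsto_sandwich[OF _ _ tendsto_const])
   show "(%k. 1/real (Suc k)) \<longlonglongrightarrow> 0" using LIMSEQ_inverse_real_of_nat by (simp add: inverse_eq_divide)
   show "\<forall>\<^sub>F k in sequentially. 0 <= cs k" using ca(1) by simp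
   show "\<forall>\<^sub>F k in sequentially. cs k <= 1/real (Suc k)" using less_imp_le[OF ca(2)] by (intro always_eventually allI)
  qed
  hence "c0 = 0" using LIMSEQ_subseq_LIMSEQ[OF _ r(1)] r(2) LIMSEQ_unique by blast
  thus False using r(6) no by blast
 qed
qed

lemma conv_loc_pointwise:
 assumes "conv_loc R u v U V"
 shows "p:OC ==> (u p \<longlongrightarrow> U p) at_top" "p:EC ==> (v p \<longlongrightarrow> V p) at_top"
proof -
 show "(u p \<longlongrightarrow> U p) at_top" if "p:OC"
 proof (rule tendstoI)
  fix e :: real assume "e > 0"
  hence "\<forall>\<^sub>F t in at_top. ALL q:{p}. \<bar>u q t - U q\<bar> < e" using assms that unfolding conv_loc_def by (meson compact_sing empty_subsetI insert_subset)
  thus "\<forall>\<^sub>F t in at_top. dist (u p t) (U p) < e" by (simp add: dist_real_def)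
 qed
 show "(v p \<longlongrightarrow> V p) at_top" if "p:EC"
 proof (rule tendstoI)
  fix e :: real assume "e > 0"
  hence "\<forall>\<^sub>F t in at_top. ALL q:{p}. \<bar>v q t - V q\<bar> < e" using assms that unfolding conv_loc_def by (meson compact_sing empty_subsetI insert_subset)
  thus "\<forall>\<^sub>F t in at_top. dist (v p t) (V p) < e" by (simp add: dist_real_def)
 qed
qed

text \<open>Pointwise limits are unique, so whatever limit a solution has agrees on the closed
  domains with the one constructed here.\<close>

lemma spread_in_unique:
 assumes s: "spread_in R c u v U V" and c: "conv_loc R u v U V" "conv_loc R u v U' V'"
 shows "spread_in R c u v U' V'"
proof -
 have "U' p = U p" if "p:OC" for p using tendsto_unique[OF _ conv_loc_pointwise(1)[OF c(2) that] conv_loc_pointwise(1)[OF c(1) that]] by simp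
 moreover have "V' p = V p" if "p:EC" for p using tendsto_unique[OF _ conv_loc_pointwise(2)[OF c(2) that] conv_loc_pointwise(2)[OF c(1) that]] by simp
 ultimately show ?thesis using s unfolding spread_in_def by simp
qed

lemma conv_zero_not_steady:
 fixes u v :: "'m::finite pt => real => real"
 assumes z: "conv_zero R u v" and P: "pos_steady D d R mq nq ro g U V" and c: "conv_loc R u v U V"
 shows False
proof -
 have p: "(0::'m pt):OI" "(0::'m pt):OC" using pos by (auto simp: OmegaI_def OmegaC_def)
 have "(u 0 \<longlongrightarrow> 0) at_top"
 proof (rule tendstoI)
  fix e :: real assume "e > 0"
  hence "\<forall>\<^sub>F t in at_top. (ALL p:OC. \<bar>u p t\<bar> < e) & (ALL p:EC. \<bar>v p t\<bar> < e)" using z unfolding conv_zero_def by blast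
  thus "\<forall>\<^sub>F t in at_top. dist (u 0 t) 0 < e" by eventually_elim (use p in auto)
 qed
 hence "U 0 = 0" using tendsto_unique[OF _ conv_loc_pointwise(1)[OF c p(2)]] by simp
 moreover have "U 0 > 0" using P p(1) unfolding pos_steady_def by blast
 ultimately show False by simp
qed

end
theorem theorem1p3:
  fixes D d R \<mu> \<nu> \<rho> g0 :: real and g :: "real \<Rightarrow> real"
    and M :: "'m::finite itself"
  assumes pos: "D > 0" "d > 0" "R > 0" "\<mu> > 0" "\<nu> > 0" "\<rho> > 0"
    and g_lip: "\<forall>z. \<exists>e>0. \<exists>L. \<forall>a\<in>ball z e. \<forall>b\<in>ball z e. \<bar>g a - g b\<bar> \<le> L * \<bar>a - b\<bar>"
    and g_diff: "(g has_real_derivative g0) (at 0)"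
    and g_0: "g 0 = 0" and g_1: "g 1 = 0"
    and g_kpp: "\<forall>s. 0 < s \<and> s < 1 \<longrightarrow> 0 < g s \<and> g s \<le> g0 * s"
    and g_neg: "\<forall>s>1. g s < 0"
    and g_skpp: "\<forall>s t. 0 < s \<and> s < t \<longrightarrow> g t / t < g s / s"
  shows
   "(\<forall>(u0 :: 'm pt \<Rightarrow> real) v0 u v.
       admissible_data R u0 v0 \<and> is_solution D d R \<mu> \<nu> \<rho> g u0 v0 u v \<longrightarrow>
       (((\<exists>U V. pos_steady D d R \<mu> \<nu> \<rho> g U V \<and> conv_loc R u v U V)
            \<longleftrightarrow> g0 / D > beta0sq M D d R \<mu> \<nu> \<rho>) \<and>
        (\<not> (g0 / D > beta0sq M D d R \<mu> \<nu> \<rho>) \<longrightarrow> conv_zero R u v))) \<and>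
    (g0 / D > beta0sq M D d R \<mu> \<nu> \<rho> \<and> (D < d \<longrightarrow> CARD('m) + 1 \<le> 5) \<longrightarrow>
      (\<exists>cs>0. \<forall>(u0 :: 'm pt \<Rightarrow> real) v0 u v.
          admissible_data R u0 v0 \<and> compact_support R u0 v0 \<and>
          is_solution D d R \<mu> \<nu> \<rho> g u0 v0 u v \<longrightarrow>
          (\<forall>c>cs. spread_out R c u v) \<and>
          (\<forall>U V. pos_steady D d R \<mu> \<nu> \<rho> g U V \<and> conv_loc R u v U V \<longrightarrow>
              (\<forall>c. 0 < c \<and> c < cs \<longrightarrow> spread_in R c u v U V))))"
  proof -
  interpret kpp D d R \<mu> \<nu> \<rho> g g0
    by unfold_locales (fact pos g_lip g_diff g_0 g_1 g_kpp g_neg g_skpp)+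
  define N where "N = CARD('m) - 1"
  have N: "N + 1 = CARD('m)" by (simp add: N_def Suc_leI)
  let ?k = "kappa TYPE('m) d R \<mu> \<nu> \<rho>"
  obtain l where l: "l > 0" "\<forall>r\<in>{0..R}. ph N l r > 0" "D * ph' N l R + kappa M d R \<mu> \<nu> \<rho> * ph N l R = 0"
    and b: "beta0sq M D d R \<mu> \<nu> \<rho> = l" using beta0_char[OF N, of M] .
  \<comment> \<open>\<open>kappa\<close> depends on its first argument through the type only, so
    \<open>M\<close> and \<open>TYPE('m)\<close> give the same number.\<close>
  have l3: "D * ph' N l R + ?k * ph N l R = 0" using l(3) by (simp add: kappa_def)
  have thr: "g0 / D > l \<longleftrightarrow> D * l < g0" using pos by (simp add: field_simps)
  have zero: "conv_zero R u v" if "\<not> D * l < g0" "admissible_data R u0 v0" "sol u0 v0 u v" for u0 v0 and u v :: "'m pt \<Rightarrow> real \<Rightarrow> real"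
    using conv_zero_I[OF N l(1,2) l3 _ that(2,3)] that(1) by simp
  show ?thesis
  proof (cases "D * l < g0")
    case False
    then show ?thesis unfolding b thr using zero conv_zero_not_steady by blast
  next
    case lg: True
    obtain U U1 :: "real \<Rightarrow> real" where Uc: "continuous_on {0..R} U" and U01: "\<And>r. r \<in> {0..R} \<Longrightarrow> 0 < U r \<and> U r < 1"
      and dU: "(U has_real_derivative U1 R) (at_left R)"
      and lU: "\<And>y::real^'m. norm y < R \<Longrightarrow> has_lap (\<lambda>y. U (norm y)) y (- g (U (norm y)) / D)"
      and bU: "D * U1 R + ?k * U R = 0"
      and P: "profile TYPE('m) U (U1 R) (\<lambda>r. g (U r)) (\<lambda>r. bpsi N (U R) * psi N gam r) (bpsi N (U R) * psi' N gam R) (bpsi N (U R) * psi N gam R)"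
      and st: "pos_steady D d R \<mu> \<nu> \<rho> g (\<lambda>p::'m pt. U (norm (snd p))) (\<lambda>p. bpsi N (U R) * psi N gam (norm (snd p)))"
      by (rule exists_steady[OF N l(1,2) l3 lg]) (rule that)
    have bU': "D * U1 R = \<nu> * (bpsi N (U R) * psi N gam R) - \<mu> * U R" using P unfolding profile_def by blast
    note sp = speed_pos[OF l(2) l3 lg kappa_psi(1)[OF N]]
    have si: "spread_in R c u v (\<lambda>p. U (norm (snd p))) (\<lambda>p. bpsi N (U R) * psi N gam (norm (snd p)))"
      if "admissible_data R u0 v0" "sol u0 v0 u v" "0 < c" "c < Inf (speeds N)" for u0 v0 c and u v :: "'m pt \<Rightarrow> real \<Rightarrow> real"
      by (rule spread_in_I[OF N Uc U01 dU lU bU' P that(3) speed_gap[OF less_imp_le[OF that(3)] that(4)] that(1,2)])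
    \<comment> \<open>Local convergence is read off from invasion at one positive speed below the
      threshold, here half of it.\<close>
    have cl: "conv_loc R u v (\<lambda>p. U (norm (snd p))) (\<lambda>p. bpsi N (U R) * psi N gam (norm (snd p)))"
      if "admissible_data R u0 v0" "sol u0 v0 u v" for u0 v0 and u v :: "'m pt \<Rightarrow> real \<Rightarrow> real"
      by (rule spread_in_conv_loc[OF si[OF that, of "Inf (speeds N) / 2"]]) (use sp(1) in auto)
    have so: "spread_out R c u v" if h: "admissible_data R u0 v0" "compact_support R u0 v0" "sol u0 v0 u v" "c > Inf (speeds N)"
      for u0 v0 c and u v :: "'m pt \<Rightarrow> real \<Rightarrow> real"
    proof -
      obtain c1 a where "c1 < c" "0 < a" "\<forall>R2. admc N R2 g0 c1 a" using sp(2)[OF h(4)] by blast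
      then show ?thesis using spread_out_I[OF N _ _ _ h(1-3)] by blast
    qed
    have 1: "(\<exists>U V. pos_steady D d R \<mu> \<nu> \<rho> g U V \<and> conv_loc R u v U V)"
      if "admissible_data R u0 v0" "sol u0 v0 u v" for u0 v0 and u v :: "'m pt \<Rightarrow> real \<Rightarrow> real"
      using st cl[OF that] by blast
    have 2: "spread_in R c u v U' V'" if "admissible_data R u0 v0" "sol u0 v0 u v" "0 < c" "c < Inf (speeds N)" "conv_loc R u v U' V'"
      for u0 v0 c U' V' and u v :: "'m pt \<Rightarrow> real \<Rightarrow> real"
      by (rule spread_in_unique[OF si[OF that(1-4)] cl[OF that(1,2)] that(5)])
    show ?thesis unfolding b thr
    proof (intro conjI allI impI)
      \<comment> \<open>The witness is \<open>Inf (speeds N)\<close>, which depends neither on the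
        initial data nor on the solution.\<close>
      show "\<exists>cs>0. \<forall>(u0 :: 'm pt \<Rightarrow> real) v0 u v.
          admissible_data R u0 v0 \<and> compact_support R u0 v0 \<and> sol u0 v0 u v \<longrightarrow>
          (\<forall>c>cs. spread_out R c u v) \<and>
          (\<forall>U V. pos_steady D d R \<mu> \<nu> \<rho> g U V \<and> conv_loc R u v U V \<longrightarrow>
              (\<forall>c. 0 < c \<and> c < cs \<longrightarrow> spread_in R c u v U V))"
        using sp(1) so 2 by (intro exI[of _ "Inf (speeds N)"]) blast
    qed (use 1 lg in blast)+
  qed
qed

end
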